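(* Let $\mu\le\lambda$ be regular cardinals, let $\mathcal{V}$ be locally $\lambda$-presentable as a symmetric monoidal closed category, with unit $I$, such that $\mathcal{V}_0(I,-):\mathcal{V}_0\to\mathbf{Set}$ preserves $\lambda$-presentable objects. Let $\mathcal{T}$ be a discrete $\lambda$-ary $\mathcal{V}$-theory, and assume that $(\mathit{Surj},\mathit{Inj})$ is a proper $\mu$-convenient factorization system in $\mathcal{V}_0$. Assume moreover that $\mathcal{V}_0$ is $\mathit{Inj}$-locally $\mu$-generated. Let $\mathcal{L}$ be a full replete subcategory of $\mathbf{Alg}(\mathcal{T})$. Then $\mathcal{L}$ is a $\mu$-Birkhoff subcategory of $\mathbf{Alg}(\mathcal{T})$ if and only if $\mathcal{L}=\mathbf{Alg}(E)$ for some $\mathcal{T}$-equational theory $E$ all of whose equations are $\mu$-clustered.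
   Context: $\mathcal{V}_0$ is the underlying category of $\mathcal{V}$. "Locally $\lambda$-presentable as a symmetric monoidal closed category" means: $\mathcal{V}_0$ is locally $\lambda$-presentable, $I$ is $\lambda$-presentable, and $X\otimes Y$ is $\lambda$-presentable whenever $X,Y$ are. $\mathcal{V}_\lambda$ is the (representative) small full subcategory of $\lambda$-presentable objects, with inclusion $K:\mathcal{V}_\lambda\to\mathcal{V}$. Surjections and injections: a morphism $f$ of $\mathcal{V}_0$ is a surjection if $\mathcal{V}_0(I,f)$ is surjective; $\mathit{Surj}$ is the class of surjections, and $\mathit{Inj}$ (injections) is the class of morphisms of $\mathcal{V}_0$ having the unique right lifting property with respect to every surjection. The factorization system $(\mathit{Surj},\mathit{Inj})$ is proper if surjections are epimorphisms and injections are monomorphisms. It is $\mu$-convenient if (1) every object of $\mathcal{V}_0$ has only a set of surjective quotients, and (2) $\mathit{Inj}$ is closed under $\mu$-directed colimits: for every $\mu$-directed diagram of injections, the colimit cocone consists of injections, and for every cocone of injections the factorizing morphism from the colimit is an injection. Generated objects: an object $V$ is $\mu$-generated (with respect to $\mathit{Inj}$) if $\mathcal{V}_0(V,-):\mathcal{V}_0\to\mathbf{Set}$ preserves $\mu$-directed colimits of injections (colimits of $\mu$-directed diagrams whose connecting morphisms are injections). $\mathcal{V}_0$ is $\mathit{Inj}$-locally $\mu$-generated if it has a set $\mathcal{X}$ of $\mu$-generated objects such that every object of $\mathcal{V}_0$ is a $\mu$-directed colimit of objects from $\mathcal{X}$ and injections. A morphism $f:A\to B$ in $\mathcal{V}_0$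 is a $\mu$-pure epimorphism if for every $\mu$-generated object $X$, every morphism $X\to B$ factors through $f$. Theories: a $\mathcal{V}_\lambda$-pretheory is an identity-on-objects $\mathcal{V}$-functor $J:\mathcal{V}_\lambda\to\mathcal{T}$. A $\mathcal{T}$-algebra is an object $A$ of $\mathcal{V}$ with a $\mathcal{V}$-functor $\hat A:\mathcal{T}^{\mathrm{op}}\to\mathcal{V}$ such that $\hat A J^{\mathrm{op}}=\mathcal{V}(K-,A)$; these form a $\mathcal{V}$-category $\mathbf{Alg}(\mathcal{T})$ (the pullback of $[\mathcal{T}^{\mathrm{op}},\mathcal{V}]\to[\mathcal{V}_\lambda^{\mathrm{op}},\mathcal{V}]$ along $A\mapsto\mathcal{V}(K-,A)$), with monadic forgetful $\mathcal{V}$-functor $U:\mathbf{Alg}(\mathcal{T})\to\mathcal{V}$ with left $\mathcal{V}$-adjoint $F$ and induced $\mathcal{V}$-monad $T=UF$. A $\mathcal{V}$-monad induces a pretheory given by the full subcategory of its algebras on free algebras on objects of $\mathcal{V}_\lambda$ together with the restricted free algebra functor. A pretheory is a $\lambda$-ary $\mathcal{V}$-theory if it is (up to isomorphism) the one induced by its induced monad. For an object $X$ let $X_0=\mathcal{V}_0(I,X)\cdot I$ (coproduct of $\mathcal{V}_0(I,X)$ copies of $I$) and let $\delta_X:X_0\to X$ be the canonical morphism. The theory is discrete if for each $X$ in $\mathcal{V}_\lambda$ every morphism $JI\to JX$ of $\mathcal{T}$ is a composite $J(\delta_X)f$ for some $f:JI\to JX_0$. Let $\mathbf{Alg}(\mathcal{T})_0$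 be the underlying category and $U_0:\mathbf{Alg}(\mathcal{T})_0\to\mathcal{V}_0$ the underlying functor of $U$. A Birkhoff subcategory of $\mathbf{Alg}(\mathcal{T})$ is a full replete subcategory of $\mathbf{Alg}(\mathcal{T})_0$ closed under products, subalgebras (if $A\to B$ is a monomorphism in $\mathbf{Alg}(\mathcal{T})_0$ and $B$ is in the subcategory then so is $A$) and $U_0$-split quotients (if $g:A\to B$ is such that $U_0(g)$ is a split epimorphism and $A$ is in the subcategory then so is $B$). It is a $\mu$-Birkhoff subcategory if moreover it is closed under quotients $f:A\to B$ such that $Uf$ is a $\mu$-pure epimorphism. Equations: a $\mathcal{T}$-equation $p=q$ is a pair of morphisms $p,q:FY\to FX$ in $\mathbf{Alg}(\mathcal{T})$, with $X,Y$ objects of $\mathcal{V}$. A $\mathcal{T}$-equational theory $E$ is a set of $\mathcal{T}$-equations. A $\mathcal{T}$-algebra $A$ satisfies $p=q$ if $hp=hq$ for every morphism $h:FX\to A$; $\mathbf{Alg}(E)$ is the full subcategory of $\mathbf{Alg}(\mathcal{T})_0$ of the algebras satisfying all equations of $E$. The equation $p=q$ with $p,q:FY\to FX$ is $\mu$-clustered if $X$ is a coproduct of $\mu$-generated objects. *)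

theory Defs
  imports Main "HOL-Library.FuncSet"
begin

unbundle cardinal_syntax

section \<open>Size\<close>

text \<open>
  The distinction between sets and classes is rendered by a universe: a type \<open>'u\<close> whose
  cardinality is strongly inaccessible and uncountable.  A set (of elements of any type) is small
  if it has fewer elements than \<open>'u\<close>; a class is an arbitrary set.  The arrows of the base
  category are elements of \<open>'u\<close>, so its hom-sets are small subsets of \<open>'u\<close>, and every
  small set is in bijection with a subset of \<open>'u\<close>.  Index sets of small families and diagrams
  are therefore taken inside \<open>'u\<close>.
\<close>

definition universe :: "'u itself \<Rightarrow> bool" where
  "universe _ \<longleftrightarrow>
     natLeq <o |UNIV :: 'u set| \<and> regularCard |UNIV :: 'u set| \<and>
     (\<forall>A :: 'u set. |A| <o |UNIV :: 'u set| \<longrightarrow> |Pow A| <o |UNIV :: 'u set| )"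

definition small :: "'u itself \<Rightarrow> 'a set \<Rightarrow> bool" where
  "small _ A \<longleftrightarrow> |A| <o |UNIV :: 'u set|"

definition small_regular_cardinal :: "'u rel \<Rightarrow> bool" where
  "small_regular_cardinal \<mu> \<longleftrightarrow>
     Card_order \<mu> \<and> cinfinite \<mu> \<and> regularCard \<mu> \<and> \<mu> <o |UNIV :: 'u set|"


section \<open>Ordinary categories\<close>

record ('o, 'a) cat =
  Obj :: "'o set"
  Arr :: "'a set"
  Dom :: "'a \<Rightarrow> 'o"
  Cod :: "'a \<Rightarrow> 'o"
  Ide :: "'o \<Rightarrow> 'a"
  Comp :: "'a \<Rightarrow> 'a \<Rightarrow> 'a"  (infixl \<open>\<cdot>\<index>\<close> 55)

definition hom :: "('o, 'a, 'm) cat_scheme \<Rightarrow> 'o \<Rightarrow> 'o \<Rightarrow> 'a set" where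
  "hom C X Y = {f \<in> Arr C. Dom C f = X \<and> Cod C f = Y}"

definition category :: "('o, 'a, 'm) cat_scheme \<Rightarrow> bool" where
  "category C \<longleftrightarrow>
     (\<forall>f \<in> Arr C. Dom C f \<in> Obj C \<and> Cod C f \<in> Obj C) \<and>
     (\<forall>X \<in> Obj C. Ide C X \<in> hom C X X) \<and>
     (\<forall>X Y Z. \<forall>f \<in> hom C X Y. \<forall>g \<in> hom C Y Z. g \<cdot>\<^bsub>C\<^esub> f \<in> hom C X Z) \<and>
     (\<forall>X Y. \<forall>f \<in> hom C X Y. f \<cdot>\<^bsub>C\<^esub> Ide C X = f \<and> Ide C Y \<cdot>\<^bsub>C\<^esub> f = f) \<and>
     (\<forall>W X Y Z. \<forall>f \<in> hom C W X. \<forall>g \<in> hom C X Y. \<forall>h \<in> hom C Y Z.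
        h \<cdot>\<^bsub>C\<^esub> (g \<cdot>\<^bsub>C\<^esub> f) = (h \<cdot>\<^bsub>C\<^esub> g) \<cdot>\<^bsub>C\<^esub> f)"

definition locally_small :: "'u itself \<Rightarrow> ('o, 'a, 'm) cat_scheme \<Rightarrow> bool" where
  "locally_small U C \<longleftrightarrow> (\<forall>X \<in> Obj C. \<forall>Y \<in> Obj C. small U (hom C X Y))"

definition inverse_arr :: "('o, 'a, 'm) cat_scheme \<Rightarrow> 'a \<Rightarrow> 'a \<Rightarrow> bool" where
  "inverse_arr C f g \<longleftrightarrow>
     f \<in> Arr C \<and> g \<in> hom C (Cod C f) (Dom C f) \<and>
     g \<cdot>\<^bsub>C\<^esub> f = Ide C (Dom C f) \<and> f \<cdot>\<^bsub>C\<^esub> g = Ide C (Cod C f)"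

definition iso :: "('o, 'a, 'm) cat_scheme \<Rightarrow> 'a \<Rightarrow> bool" where
  "iso C f \<longleftrightarrow> (\<exists>g. inverse_arr C f g)"

definition inv_arr :: "('o, 'a, 'm) cat_scheme \<Rightarrow> 'a \<Rightarrow> 'a" where
  "inv_arr C f = (THE g. inverse_arr C f g)"

definition isomorphic :: "('o, 'a, 'm) cat_scheme \<Rightarrow> 'o \<Rightarrow> 'o \<Rightarrow> bool" where
  "isomorphic C X Y \<longleftrightarrow> (\<exists>f \<in> hom C X Y. iso C f)"

definition mono_arr :: "('o, 'a, 'm) cat_scheme \<Rightarrow> 'a \<Rightarrow> bool" where
  "mono_arr C f \<longleftrightarrow> f \<in> Arr C \<and>
     (\<forall>W. \<forall>g \<in> hom C W (Dom C f). \<forall>h \<in> hom C W (Dom C f). f \<cdot>\<^bsub>C\<^esub> g = f \<cdot>\<^bsub>C\<^esub> h \<longrightarrow> g = h)"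

definition epi_arr :: "('o, 'a, 'm) cat_scheme \<Rightarrow> 'a \<Rightarrow> bool" where
  "epi_arr C f \<longleftrightarrow> f \<in> Arr C \<and>
     (\<forall>W. \<forall>g \<in> hom C (Cod C f) W. \<forall>h \<in> hom C (Cod C f) W. g \<cdot>\<^bsub>C\<^esub> f = h \<cdot>\<^bsub>C\<^esub> f \<longrightarrow> g = h)"

definition split_epi :: "('o, 'a, 'm) cat_scheme \<Rightarrow> 'a \<Rightarrow> bool" where
  "split_epi C f \<longleftrightarrow> f \<in> Arr C \<and>
     (\<exists>s \<in> hom C (Cod C f) (Dom C f). f \<cdot>\<^bsub>C\<^esub> s = Ide C (Cod C f))"

text \<open>An ordinary functor is given by its action on objects and its action on arrows.\<close>

definition is_functor ::
  "('j, 'k, 'm) cat_scheme \<Rightarrow> ('o, 'a, 'n) cat_scheme \<Rightarrow> ('j \<Rightarrow> 'o) \<Rightarrow> ('k \<Rightarrow> 'a) \<Rightarrow> bool" where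
  "is_functor J C D d \<longleftrightarrow>
     category J \<and> category C \<and>
     (\<forall>i \<in> Obj J. D i \<in> Obj C \<and> d (Ide J i) = Ide C (D i)) \<and>
     (\<forall>i j. \<forall>a \<in> hom J i j. d a \<in> hom C (D i) (D j)) \<and>
     (\<forall>i j k. \<forall>a \<in> hom J i j. \<forall>b \<in> hom J j k. d (b \<cdot>\<^bsub>J\<^esub> a) = d b \<cdot>\<^bsub>C\<^esub> d a)"

definition is_cocone ::
  "('j, 'k, 'm) cat_scheme \<Rightarrow> ('o, 'a, 'n) cat_scheme \<Rightarrow> ('j \<Rightarrow> 'o) \<Rightarrow> ('k \<Rightarrow> 'a) \<Rightarrow>
   'o \<Rightarrow> ('j \<Rightarrow> 'a) \<Rightarrow> bool" where
  "is_cocone J C D d Q c \<longleftrightarrow>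
     Q \<in> Obj C \<and> (\<forall>i \<in> Obj J. c i \<in> hom C (D i) Q) \<and>
     (\<forall>i j. \<forall>a \<in> hom J i j. c j \<cdot>\<^bsub>C\<^esub> d a = c i)"

definition is_colimit ::
  "('j, 'k, 'm) cat_scheme \<Rightarrow> ('o, 'a, 'n) cat_scheme \<Rightarrow> ('j \<Rightarrow> 'o) \<Rightarrow> ('k \<Rightarrow> 'a) \<Rightarrow>
   'o \<Rightarrow> ('j \<Rightarrow> 'a) \<Rightarrow> bool" where
  "is_colimit J C D d Q c \<longleftrightarrow>
     is_cocone J C D d Q c \<and>
     (\<forall>R r. is_cocone J C D d R r \<longrightarrow>
        (\<exists>!u. u \<in> hom C Q R \<and> (\<forall>i \<in> Obj J. u \<cdot>\<^bsub>C\<^esub> c i = r i)))"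

definition cocomplete :: "'u itself \<Rightarrow> ('o, 'a, 'm) cat_scheme \<Rightarrow> bool" where
  "cocomplete U C \<longleftrightarrow>
     (\<forall>(J :: ('u, 'u) cat) D d. small U (Obj J) \<and> small U (Arr J) \<and> is_functor J C D d \<longrightarrow>
        (\<exists>Q c. is_colimit J C D d Q c))"

definition is_product ::
  "('o, 'a, 'm) cat_scheme \<Rightarrow> 'j set \<Rightarrow> ('j \<Rightarrow> 'o) \<Rightarrow> 'o \<Rightarrow> ('j \<Rightarrow> 'a) \<Rightarrow> bool" where
  "is_product C K D Q p \<longleftrightarrow>
     Q \<in> Obj C \<and> (\<forall>i \<in> K. p i \<in> hom C Q (D i)) \<and>
     (\<forall>R \<in> Obj C. \<forall>r. (\<forall>i \<in> K. r i \<in> hom C R (D i)) \<longrightarrow>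
        (\<exists>!u. u \<in> hom C R Q \<and> (\<forall>i \<in> K. p i \<cdot>\<^bsub>C\<^esub> u = r i)))"

definition is_coproduct ::
  "('o, 'a, 'm) cat_scheme \<Rightarrow> 'j set \<Rightarrow> ('j \<Rightarrow> 'o) \<Rightarrow> 'o \<Rightarrow> ('j \<Rightarrow> 'a) \<Rightarrow> bool" where
  "is_coproduct C K D Q c \<longleftrightarrow>
     Q \<in> Obj C \<and> (\<forall>i \<in> K. c i \<in> hom C (D i) Q) \<and>
     (\<forall>R \<in> Obj C. \<forall>r. (\<forall>i \<in> K. r i \<in> hom C (D i) R) \<longrightarrow>
        (\<exists>!u. u \<in> hom C Q R \<and> (\<forall>i \<in> K. u \<cdot>\<^bsub>C\<^esub> c i = r i)))"

definition is_equalizer ::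
  "('o, 'a, 'm) cat_scheme \<Rightarrow> 'a \<Rightarrow> 'a \<Rightarrow> 'o \<Rightarrow> 'a \<Rightarrow> bool" where
  "is_equalizer C f g H e \<longleftrightarrow>
     e \<in> hom C H (Dom C f) \<and> f \<cdot>\<^bsub>C\<^esub> e = g \<cdot>\<^bsub>C\<^esub> e \<and>
     (\<forall>W. \<forall>w \<in> hom C W (Dom C f). f \<cdot>\<^bsub>C\<^esub> w = g \<cdot>\<^bsub>C\<^esub> w \<longrightarrow>
        (\<exists>!u. u \<in> hom C W H \<and> e \<cdot>\<^bsub>C\<^esub> u = w))"

definition is_pullback ::
  "('o, 'a, 'm) cat_scheme \<Rightarrow> 'a \<Rightarrow> 'a \<Rightarrow> 'o \<Rightarrow> 'a \<Rightarrow> 'a \<Rightarrow> bool" where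
  "is_pullback C f g H p q \<longleftrightarrow>
     p \<in> hom C H (Dom C f) \<and> q \<in> hom C H (Dom C g) \<and> f \<cdot>\<^bsub>C\<^esub> p = g \<cdot>\<^bsub>C\<^esub> q \<and>
     (\<forall>W. \<forall>v \<in> hom C W (Dom C f). \<forall>w \<in> hom C W (Dom C g). f \<cdot>\<^bsub>C\<^esub> v = g \<cdot>\<^bsub>C\<^esub> w \<longrightarrow>
        (\<exists>!u. u \<in> hom C W H \<and> p \<cdot>\<^bsub>C\<^esub> u = v \<and> q \<cdot>\<^bsub>C\<^esub> u = w))"

text \<open>The category of small sets (of elements of a type \<open>'b\<close>) and functions.\<close>

definition set_cat :: "'u itself \<Rightarrow> ('b set, 'b set \<times> ('b \<Rightarrow> 'b) \<times> 'b set) cat" where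
  "set_cat U = \<lparr>
     Obj = {A. small U A},
     Arr = {(A, f, B). small U A \<and> small U B \<and> f \<in> A \<rightarrow>\<^sub>E B},
     Dom = (\<lambda>(A, f, B). A),
     Cod = (\<lambda>(A, f, B). B),
     Ide = (\<lambda>A. (A, restrict (\<lambda>x. x) A, A)),
     Comp = (\<lambda>(B, g, D) (A, f, B'). (A, compose A g f, D)) \<rparr>"

text \<open>The action on arrows of the functor \<open>C(X,-)\<close> to sets.\<close>

definition hom_map :: "('o, 'a, 'm) cat_scheme \<Rightarrow> 'o \<Rightarrow> 'a \<Rightarrow> 'a set \<times> ('a \<Rightarrow> 'a) \<times> 'a set" where
  "hom_map C X f =
     (hom C X (Dom C f), restrict (\<lambda>g. f \<cdot>\<^bsub>C\<^esub> g) (hom C X (Dom C f)), hom C X (Cod C f))"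


section \<open>Directed colimits, presentable and generated objects\<close>

definition poset_cat :: "'i set \<Rightarrow> 'i rel \<Rightarrow> ('i, 'i \<times> 'i) cat" where
  "poset_cat S r =
     \<lparr> Obj = S, Arr = r, Dom = fst, Cod = snd, Ide = (\<lambda>i. (i, i)),
       Comp = (\<lambda>b a. (fst a, snd b)) \<rparr>"

text \<open>A small \<open>\<mu>\<close>-directed poset; it is nonempty, as the empty subset has an upper bound.\<close>

definition directed_poset :: "'u rel \<Rightarrow> 'u set \<Rightarrow> 'u rel \<Rightarrow> bool" where
  "directed_poset \<mu> S r \<longleftrightarrow>
     small TYPE('u) S \<and> r \<subseteq> S \<times> S \<and> partial_order_on S r \<and>
     (\<forall>A \<subseteq> S. |A| <o \<mu> \<longrightarrow> (\<exists>u \<in> S. \<forall>a \<in> A. (a, u) \<in> r))"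

text \<open>A \<open>\<mu>\<close>-directed diagram all of whose connecting morphisms lie in the class \<open>M\<close>.\<close>

definition directed_diagram ::
  "'u rel \<Rightarrow> ('o, 'a, 'm) cat_scheme \<Rightarrow> 'a set \<Rightarrow> 'u set \<Rightarrow> 'u rel \<Rightarrow>
   ('u \<Rightarrow> 'o) \<Rightarrow> ('u \<times> 'u \<Rightarrow> 'a) \<Rightarrow> bool" where
  "directed_diagram \<mu> C M S r D d \<longleftrightarrow>
     directed_poset \<mu> S r \<and> is_functor (poset_cat S r) C D d \<and> d ` r \<subseteq> M"

definition hom_preserves_directed_colimits ::
  "'u rel \<Rightarrow> ('o, 'a, 'm) cat_scheme \<Rightarrow> 'a set \<Rightarrow> 'o \<Rightarrow> bool" where
  "hom_preserves_directed_colimits \<mu> C M X \<longleftrightarrow>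
     (\<forall>S r D d Q c. directed_diagram \<mu> C M S r D d \<and> is_colimit (poset_cat S r) C D d Q c \<longrightarrow>
        is_colimit (poset_cat S r) (set_cat TYPE('u))
          (\<lambda>i. hom C X (D i)) (\<lambda>a. hom_map C X (d a)) (hom C X Q) (\<lambda>i. hom_map C X (c i)))"

definition directed_colimit_of ::
  "'u rel \<Rightarrow> ('o, 'a, 'm) cat_scheme \<Rightarrow> 'a set \<Rightarrow> 'o set \<Rightarrow> 'o \<Rightarrow> bool" where
  "directed_colimit_of \<mu> C M G Q \<longleftrightarrow>
     (\<exists>S r D d c. directed_diagram \<mu> C M S r D d \<and> D ` S \<subseteq> G \<and>
        is_colimit (poset_cat S r) C D d Q c)"

definition presentable :: "'u rel \<Rightarrow> ('o, 'a, 'm) cat_scheme \<Rightarrow> 'o \<Rightarrow> bool" where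
  "presentable lam C X \<longleftrightarrow> X \<in> Obj C \<and> hom_preserves_directed_colimits lam C (Arr C) X"

definition locally_presentable :: "'u rel \<Rightarrow> ('o, 'a, 'm) cat_scheme \<Rightarrow> bool" where
  "locally_presentable lam C \<longleftrightarrow>
     category C \<and> locally_small TYPE('u) C \<and> cocomplete TYPE('u) C \<and>
     (\<exists>G. small TYPE('u) G \<and> (\<forall>X \<in> G. presentable lam C X) \<and>
          (\<forall>Q \<in> Obj C. directed_colimit_of lam C (Arr C) G Q))"


section \<open>Symmetric monoidal closed categories\<close>

text \<open>
  The evaluation \<open>evl X Y : [X,Y] \<otimes> X \<rightarrow> Y\<close> exhibits \<open>[X,-]\<close> as a right adjoint of
  \<open>- \<otimes> X\<close>.
\<close>

record ('o, 'u) smcc = "('o, 'u) cat" +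
  Unt :: "'o"  (\<open>\<I>\<index>\<close>)
  TensO :: "'o \<Rightarrow> 'o \<Rightarrow> 'o"  (infixr \<open>\<odot>\<index>\<close> 60)
  TensA :: "'u \<Rightarrow> 'u \<Rightarrow> 'u"  (infixr \<open>\<otimes>\<index>\<close> 60)
  assoc :: "'o \<Rightarrow> 'o \<Rightarrow> 'o \<Rightarrow> 'u"
  lunit :: "'o \<Rightarrow> 'u"
  runit :: "'o \<Rightarrow> 'u"
  symm :: "'o \<Rightarrow> 'o \<Rightarrow> 'u"
  ihom :: "'o \<Rightarrow> 'o \<Rightarrow> 'o"
  evl :: "'o \<Rightarrow> 'o \<Rightarrow> 'u"

definition sm_closed_category :: "('o, 'u) smcc \<Rightarrow> bool" where
  "sm_closed_category V \<longleftrightarrow>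
     category V \<and>
     \<I>\<^bsub>V\<^esub> \<in> Obj V \<and>
     (\<forall>X \<in> Obj V. \<forall>Y \<in> Obj V. X \<odot>\<^bsub>V\<^esub> Y \<in> Obj V \<and>
        Ide V X \<otimes>\<^bsub>V\<^esub> Ide V Y = Ide V (X \<odot>\<^bsub>V\<^esub> Y)) \<and>
     (\<forall>X X' Y Y'. \<forall>f \<in> hom V X X'. \<forall>g \<in> hom V Y Y'.
        f \<otimes>\<^bsub>V\<^esub> g \<in> hom V (X \<odot>\<^bsub>V\<^esub> Y) (X' \<odot>\<^bsub>V\<^esub> Y')) \<and>
     (\<forall>X X' X'' Y Y' Y''.
        \<forall>f \<in> hom V X X'. \<forall>f' \<in> hom V X' X''. \<forall>g \<in> hom V Y Y'. \<forall>g' \<in> hom V Y' Y''.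
        (f' \<cdot>\<^bsub>V\<^esub> f) \<otimes>\<^bsub>V\<^esub> (g' \<cdot>\<^bsub>V\<^esub> g) = (f' \<otimes>\<^bsub>V\<^esub> g') \<cdot>\<^bsub>V\<^esub> (f \<otimes>\<^bsub>V\<^esub> g)) \<and>
     (\<forall>X \<in> Obj V. \<forall>Y \<in> Obj V. \<forall>Z \<in> Obj V.
        assoc V X Y Z \<in> hom V ((X \<odot>\<^bsub>V\<^esub> Y) \<odot>\<^bsub>V\<^esub> Z) (X \<odot>\<^bsub>V\<^esub> (Y \<odot>\<^bsub>V\<^esub> Z)) \<and>
        iso V (assoc V X Y Z)) \<and>
     (\<forall>X \<in> Obj V. lunit V X \<in> hom V (\<I>\<^bsub>V\<^esub> \<odot>\<^bsub>V\<^esub> X) X \<and> iso V (lunit V X)) \<and>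
     (\<forall>X \<in> Obj V. runit V X \<in> hom V (X \<odot>\<^bsub>V\<^esub> \<I>\<^bsub>V\<^esub>) X \<and> iso V (runit V X)) \<and>
     (\<forall>X \<in> Obj V. \<forall>Y \<in> Obj V. symm V X Y \<in> hom V (X \<odot>\<^bsub>V\<^esub> Y) (Y \<odot>\<^bsub>V\<^esub> X) \<and>
        symm V Y X \<cdot>\<^bsub>V\<^esub> symm V X Y = Ide V (X \<odot>\<^bsub>V\<^esub> Y)) \<and>
     (\<forall>X X' Y Y' Z Z'. \<forall>f \<in> hom V X X'. \<forall>g \<in> hom V Y Y'. \<forall>h \<in> hom V Z Z'.
        assoc V X' Y' Z' \<cdot>\<^bsub>V\<^esub> ((f \<otimes>\<^bsub>V\<^esub> g) \<otimes>\<^bsub>V\<^esub> h) =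
        (f \<otimes>\<^bsub>V\<^esub> (g \<otimes>\<^bsub>V\<^esub> h)) \<cdot>\<^bsub>V\<^esub> assoc V X Y Z) \<and>
     (\<forall>X X'. \<forall>f \<in> hom V X X'.
        lunit V X' \<cdot>\<^bsub>V\<^esub> (Ide V \<I>\<^bsub>V\<^esub> \<otimes>\<^bsub>V\<^esub> f) = f \<cdot>\<^bsub>V\<^esub> lunit V X \<and>
        runit V X' \<cdot>\<^bsub>V\<^esub> (f \<otimes>\<^bsub>V\<^esub> Ide V \<I>\<^bsub>V\<^esub>) = f \<cdot>\<^bsub>V\<^esub> runit V X) \<and>
     (\<forall>X X' Y Y'. \<forall>f \<in> hom V X X'. \<forall>g \<in> hom V Y Y'.
        symm V X' Y' \<cdot>\<^bsub>V\<^esub> (f \<otimes>\<^bsub>V\<^esub> g) = (g \<otimes>\<^bsub>V\<^esub> f) \<cdot>\<^bsub>V\<^esub> symm V X Y) \<and>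
     \<comment> \<open>pentagon\<close>
     (\<forall>W \<in> Obj V. \<forall>X \<in> Obj V. \<forall>Y \<in> Obj V. \<forall>Z \<in> Obj V.
        assoc V W X (Y \<odot>\<^bsub>V\<^esub> Z) \<cdot>\<^bsub>V\<^esub> assoc V (W \<odot>\<^bsub>V\<^esub> X) Y Z =
        (Ide V W \<otimes>\<^bsub>V\<^esub> assoc V X Y Z) \<cdot>\<^bsub>V\<^esub> assoc V W (X \<odot>\<^bsub>V\<^esub> Y) Z \<cdot>\<^bsub>V\<^esub>
          (assoc V W X Y \<otimes>\<^bsub>V\<^esub> Ide V Z)) \<and>
     \<comment> \<open>triangle\<close>
     (\<forall>X \<in> Obj V. \<forall>Y \<in> Obj V.
        (Ide V X \<otimes>\<^bsub>V\<^esub> lunit V Y) \<cdot>\<^bsub>V\<^esub> assoc V X \<I>\<^bsub>V\<^esub> Y = runit V X \<otimes>\<^bsub>V\<^esub> Ide V Y) \<and>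
     \<comment> \<open>hexagon\<close>
     (\<forall>X \<in> Obj V. \<forall>Y \<in> Obj V. \<forall>Z \<in> Obj V.
        assoc V Y Z X \<cdot>\<^bsub>V\<^esub> symm V X (Y \<odot>\<^bsub>V\<^esub> Z) \<cdot>\<^bsub>V\<^esub> assoc V X Y Z =
        (Ide V Y \<otimes>\<^bsub>V\<^esub> symm V X Z) \<cdot>\<^bsub>V\<^esub> assoc V Y X Z \<cdot>\<^bsub>V\<^esub>
          (symm V X Y \<otimes>\<^bsub>V\<^esub> Ide V Z)) \<and>
     \<comment> \<open>closedness\<close>
     (\<forall>X \<in> Obj V. \<forall>Y \<in> Obj V.
        ihom V X Y \<in> Obj V \<and> evl V X Y \<in> hom V (ihom V X Y \<odot>\<^bsub>V\<^esub> X) Y \<and>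
        (\<forall>Z \<in> Obj V. \<forall>f \<in> hom V (Z \<odot>\<^bsub>V\<^esub> X) Y.
           \<exists>!g. g \<in> hom V Z (ihom V X Y) \<and> evl V X Y \<cdot>\<^bsub>V\<^esub> (g \<otimes>\<^bsub>V\<^esub> Ide V X) = f))"

definition vcurry :: "('o, 'u) smcc \<Rightarrow> 'o \<Rightarrow> 'o \<Rightarrow> 'o \<Rightarrow> 'u \<Rightarrow> 'u" where
  "vcurry V Z X Y f =
     (THE g. g \<in> hom V Z (ihom V X Y) \<and> evl V X Y \<cdot>\<^bsub>V\<^esub> (g \<otimes>\<^bsub>V\<^esub> Ide V X) = f)"

text \<open>The passage between arrows \<open>X \<rightarrow> Y\<close> and elements \<open>I \<rightarrow> [X,Y]\<close>.\<close>

definition name_of :: "('o, 'u) smcc \<Rightarrow> 'u \<Rightarrow> 'u" where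
  "name_of V f = vcurry V \<I>\<^bsub>V\<^esub> (Dom V f) (Cod V f) (f \<cdot>\<^bsub>V\<^esub> lunit V (Dom V f))"

definition arrow_of :: "('o, 'u) smcc \<Rightarrow> 'o \<Rightarrow> 'o \<Rightarrow> 'u \<Rightarrow> 'u" where
  "arrow_of V X Y x = evl V X Y \<cdot>\<^bsub>V\<^esub> (x \<otimes>\<^bsub>V\<^esub> Ide V X) \<cdot>\<^bsub>V\<^esub> inv_arr V (lunit V X)"

definition locally_presentable_smcc :: "'u rel \<Rightarrow> ('o, 'u) smcc \<Rightarrow> bool" where
  "locally_presentable_smcc lam V \<longleftrightarrow>
     sm_closed_category V \<and> locally_presentable lam V \<and> presentable lam V \<I>\<^bsub>V\<^esub> \<and>
     (\<forall>X Y. presentable lam V X \<and> presentable lam V Y \<longrightarrow> presentable lam V (X \<odot>\<^bsub>V\<^esub> Y))"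

text \<open>
  A choice of (the object set of) the small full subcategory of \<open>lam\<close>-presentable objects:
  it contains an isomorphic copy of each of them, and the unit itself.
\<close>

definition representative_presentables :: "'u rel \<Rightarrow> ('o, 'u) smcc \<Rightarrow> 'o set \<Rightarrow> bool" where
  "representative_presentables lam V P \<longleftrightarrow>
     small TYPE('u) P \<and> (\<forall>X \<in> P. presentable lam V X) \<and>
     (\<forall>X. presentable lam V X \<longrightarrow> (\<exists>X' \<in> P. isomorphic V X X')) \<and> \<I>\<^bsub>V\<^esub> \<in> P"


section \<open>Enriched categories\<close>

text \<open>\<open>VComp C X Y Z\<close> is the composition \<open>C(Y,Z) \<otimes> C(X,Y) \<rightarrow> C(X,Z)\<close>.\<close>

record ('x, 'o, 'u) vcat =
  VObj :: "'x set"
  VHom :: "'x \<Rightarrow> 'x \<Rightarrow> 'o"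
  VComp :: "'x \<Rightarrow> 'x \<Rightarrow> 'x \<Rightarrow> 'u"
  VIde :: "'x \<Rightarrow> 'u"

definition vcategory :: "('o, 'u) smcc \<Rightarrow> ('x, 'o, 'u) vcat \<Rightarrow> bool" where
  "vcategory V C \<longleftrightarrow>
     (\<forall>X \<in> VObj C. \<forall>Y \<in> VObj C. VHom C X Y \<in> Obj V) \<and>
     (\<forall>X \<in> VObj C. VIde C X \<in> hom V \<I>\<^bsub>V\<^esub> (VHom C X X)) \<and>
     (\<forall>X \<in> VObj C. \<forall>Y \<in> VObj C. \<forall>Z \<in> VObj C.
        VComp C X Y Z \<in> hom V (VHom C Y Z \<odot>\<^bsub>V\<^esub> VHom C X Y) (VHom C X Z)) \<and>
     (\<forall>W \<in> VObj C. \<forall>X \<in> VObj C. \<forall>Y \<in> VObj C. \<forall>Z \<in> VObj C.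
        VComp C W Y Z \<cdot>\<^bsub>V\<^esub> (Ide V (VHom C Y Z) \<otimes>\<^bsub>V\<^esub> VComp C W X Y) \<cdot>\<^bsub>V\<^esub>
          assoc V (VHom C Y Z) (VHom C X Y) (VHom C W X) =
        VComp C W X Z \<cdot>\<^bsub>V\<^esub> (VComp C X Y Z \<otimes>\<^bsub>V\<^esub> Ide V (VHom C W X))) \<and>
     (\<forall>X \<in> VObj C. \<forall>Y \<in> VObj C.
        VComp C X Y Y \<cdot>\<^bsub>V\<^esub> (VIde C Y \<otimes>\<^bsub>V\<^esub> Ide V (VHom C X Y)) = lunit V (VHom C X Y) \<and>
        VComp C X X Y \<cdot>\<^bsub>V\<^esub> (Ide V (VHom C X Y) \<otimes>\<^bsub>V\<^esub> VIde C X) = runit V (VHom C X Y))"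

text \<open>
  A \<open>\<V>\<close>-functor is required to be undefined outside its domain, so that two \<open>\<V>\<close>-functors
  are equal precisely if they agree on the objects and hom-objects of their domain.
\<close>

record ('x, 'y, 'u) vfun =
  FOb :: "'x \<Rightarrow> 'y"
  FHom :: "'x \<Rightarrow> 'x \<Rightarrow> 'u"

definition mk_vfun ::
  "('x, 'o, 'u) vcat \<Rightarrow> ('x \<Rightarrow> 'y) \<Rightarrow> ('x \<Rightarrow> 'x \<Rightarrow> 'u) \<Rightarrow> ('x, 'y, 'u) vfun" where
  "mk_vfun C F h = \<lparr>
     FOb = restrict F (VObj C),
     FHom = (\<lambda>X Y. if X \<in> VObj C \<and> Y \<in> VObj C then h X Y else undefined) \<rparr>"

definition vfunctor ::
  "('o, 'u) smcc \<Rightarrow> ('x, 'o, 'u) vcat \<Rightarrow> ('y, 'o, 'u) vcat \<Rightarrow> ('x, 'y, 'u) vfun \<Rightarrow> bool" where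
  "vfunctor V C D F \<longleftrightarrow>
     vcategory V C \<and> vcategory V D \<and> F = mk_vfun C (FOb F) (FHom F) \<and>
     (\<forall>X \<in> VObj C. FOb F X \<in> VObj D) \<and>
     (\<forall>X \<in> VObj C. \<forall>Y \<in> VObj C.
        FHom F X Y \<in> hom V (VHom C X Y) (VHom D (FOb F X) (FOb F Y))) \<and>
     (\<forall>X \<in> VObj C. FHom F X X \<cdot>\<^bsub>V\<^esub> VIde C X = VIde D (FOb F X)) \<and>
     (\<forall>X \<in> VObj C. \<forall>Y \<in> VObj C. \<forall>Z \<in> VObj C.
        FHom F X Z \<cdot>\<^bsub>V\<^esub> VComp C X Y Z =
        VComp D (FOb F X) (FOb F Y) (FOb F Z) \<cdot>\<^bsub>V\<^esub> (FHom F Y Z \<otimes>\<^bsub>V\<^esub> FHom F X Y))"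

definition vid :: "('o, 'u) smcc \<Rightarrow> ('x, 'o, 'u) vcat \<Rightarrow> ('x, 'x, 'u) vfun" where
  "vid V C = mk_vfun C (\<lambda>X. X) (\<lambda>X Y. Ide V (VHom C X Y))"

definition vfun_comp ::
  "('o, 'u) smcc \<Rightarrow> ('x, 'o, 'u) vcat \<Rightarrow> ('y, 'z, 'u) vfun \<Rightarrow> ('x, 'y, 'u) vfun \<Rightarrow>
   ('x, 'z, 'u) vfun" where
  "vfun_comp V C G F = mk_vfun C (\<lambda>X. FOb G (FOb F X))
     (\<lambda>X Y. FHom G (FOb F X) (FOb F Y) \<cdot>\<^bsub>V\<^esub> FHom F X Y)"

definition vop :: "('o, 'u) smcc \<Rightarrow> ('x, 'o, 'u) vcat \<Rightarrow> ('x, 'o, 'u) vcat" where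
  "vop V C = \<lparr>
     VObj = VObj C,
     VHom = (\<lambda>X Y. VHom C Y X),
     VComp = (\<lambda>X Y Z. VComp C Z Y X \<cdot>\<^bsub>V\<^esub> symm V (VHom C Z Y) (VHom C Y X)),
     VIde = VIde C \<rparr>"

definition vop_fun :: "('x, 'y, 'u) vfun \<Rightarrow> ('x, 'y, 'u) vfun" where
  "vop_fun F = \<lparr> FOb = FOb F, FHom = (\<lambda>X Y. FHom F Y X) \<rparr>"

definition vfull :: "('x, 'o, 'u) vcat \<Rightarrow> 'x set \<Rightarrow> ('x, 'o, 'u) vcat" where
  "vfull C S = C\<lparr> VObj := S \<rparr>"

text \<open>\<open>\<V>\<close> as a \<open>\<V>\<close>-category.\<close>

definition self :: "('o, 'u) smcc \<Rightarrow> ('o, 'o, 'u) vcat" where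
  "self V = \<lparr>
     VObj = Obj V,
     VHom = ihom V,
     VComp = (\<lambda>X Y Z. vcurry V (ihom V Y Z \<odot>\<^bsub>V\<^esub> ihom V X Y) X Z
       (evl V Y Z \<cdot>\<^bsub>V\<^esub> (Ide V (ihom V Y Z) \<otimes>\<^bsub>V\<^esub> evl V X Y) \<cdot>\<^bsub>V\<^esub>
          assoc V (ihom V Y Z) (ihom V X Y) X)),
     VIde = (\<lambda>X. vcurry V \<I>\<^bsub>V\<^esub> X X (lunit V X)) \<rparr>"

text \<open>Composition of elements \<open>f : I \<rightarrow> C(X,Y)\<close> and \<open>g : I \<rightarrow> C(Y,Z)\<close>.\<close>

definition el_comp ::
  "('o, 'u) smcc \<Rightarrow> ('x, 'o, 'u) vcat \<Rightarrow> 'x \<Rightarrow> 'x \<Rightarrow> 'x \<Rightarrow> 'u \<Rightarrow> 'u \<Rightarrow> 'u" where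
  "el_comp V C X Y Z g f = VComp C X Y Z \<cdot>\<^bsub>V\<^esub> (g \<otimes>\<^bsub>V\<^esub> f) \<cdot>\<^bsub>V\<^esub> inv_arr V (lunit V \<I>\<^bsub>V\<^esub>)"

text \<open>The underlying ordinary category; the arrow \<open>(X, f, Y)\<close> stands for \<open>f : I \<rightarrow> C(X,Y)\<close>.\<close>

definition underlying ::
  "('o, 'u) smcc \<Rightarrow> ('x, 'o, 'u) vcat \<Rightarrow> ('x, 'x \<times> 'u \<times> 'x) cat" where
  "underlying V C = \<lparr>
     Obj = VObj C,
     Arr = {(X, f, Y). X \<in> VObj C \<and> Y \<in> VObj C \<and> f \<in> hom V \<I>\<^bsub>V\<^esub> (VHom C X Y)},
     Dom = (\<lambda>(X, f, Y). X),
     Cod = (\<lambda>(X, f, Y). Y),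
     Ide = (\<lambda>X. (X, VIde C X, X)),
     Comp = (\<lambda>(Y', g, Z) (X, f, Y). (X, el_comp V C X Y Z g f, Z)) \<rparr>"

text \<open>
  For \<open>g : I \<rightarrow> C(X,Y)\<close> and \<open>f : I \<rightarrow> C(X,Y)\<close>, the induced arrows
  \<open>C(W,g) : C(W,X) \<rightarrow> C(W,Y)\<close> and \<open>C(f,Z) : C(Y,Z) \<rightarrow> C(X,Z)\<close>.
\<close>

definition vpost ::
  "('o, 'u) smcc \<Rightarrow> ('x, 'o, 'u) vcat \<Rightarrow> 'x \<Rightarrow> 'x \<Rightarrow> 'x \<Rightarrow> 'u \<Rightarrow> 'u" where
  "vpost V C W X Y g =
     VComp C W X Y \<cdot>\<^bsub>V\<^esub> (g \<otimes>\<^bsub>V\<^esub> Ide V (VHom C W X)) \<cdot>\<^bsub>V\<^esub> inv_arr V (lunit V (VHom C W X))"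

definition vpre ::
  "('o, 'u) smcc \<Rightarrow> ('x, 'o, 'u) vcat \<Rightarrow> 'x \<Rightarrow> 'x \<Rightarrow> 'x \<Rightarrow> 'u \<Rightarrow> 'u" where
  "vpre V C X Y Z f =
     VComp C X Y Z \<cdot>\<^bsub>V\<^esub> (Ide V (VHom C Y Z) \<otimes>\<^bsub>V\<^esub> f) \<cdot>\<^bsub>V\<^esub> inv_arr V (runit V (VHom C Y Z))"

definition vnat_trans ::
  "('o, 'u) smcc \<Rightarrow> ('x, 'o, 'u) vcat \<Rightarrow> ('y, 'o, 'u) vcat \<Rightarrow>
   ('x, 'y, 'u) vfun \<Rightarrow> ('x, 'y, 'u) vfun \<Rightarrow> ('x \<Rightarrow> 'u) \<Rightarrow> bool" where
  "vnat_trans V C D F G \<alpha> \<longleftrightarrow>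
     vfunctor V C D F \<and> vfunctor V C D G \<and>
     (\<forall>X \<in> VObj C. \<alpha> X \<in> hom V \<I>\<^bsub>V\<^esub> (VHom D (FOb F X) (FOb G X))) \<and>
     (\<forall>X \<in> VObj C. \<forall>Y \<in> VObj C.
        vpost V D (FOb F X) (FOb F Y) (FOb G Y) (\<alpha> Y) \<cdot>\<^bsub>V\<^esub> FHom F X Y =
        vpre V D (FOb F X) (FOb G X) (FOb G Y) (\<alpha> X) \<cdot>\<^bsub>V\<^esub> FHom G X Y)"

text \<open>An adjunction in the 2-category of \<open>\<V>\<close>-categories, given by unit and counit.\<close>

definition vadjunction ::
  "('o, 'u) smcc \<Rightarrow> ('x, 'o, 'u) vcat \<Rightarrow> ('y, 'o, 'u) vcat \<Rightarrow>
   ('x, 'y, 'u) vfun \<Rightarrow> ('y, 'x, 'u) vfun \<Rightarrow> ('x \<Rightarrow> 'u) \<Rightarrow> ('y \<Rightarrow> 'u) \<Rightarrow> bool" where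
  "vadjunction V C D F U \<eta> \<epsilon> \<longleftrightarrow>
     vfunctor V C D F \<and> vfunctor V D C U \<and>
     vnat_trans V C C (vid V C) (vfun_comp V C U F) \<eta> \<and>
     vnat_trans V D D (vfun_comp V D F U) (vid V D) \<epsilon> \<and>
     (\<forall>X \<in> VObj C.
        el_comp V D (FOb F X) (FOb F (FOb U (FOb F X))) (FOb F X)
          (\<epsilon> (FOb F X)) (FHom F X (FOb U (FOb F X)) \<cdot>\<^bsub>V\<^esub> \<eta> X) = VIde D (FOb F X)) \<and>
     (\<forall>A \<in> VObj D.
        el_comp V C (FOb U A) (FOb U (FOb F (FOb U A))) (FOb U A)
          (FHom U (FOb F (FOb U A)) A \<cdot>\<^bsub>V\<^esub> \<epsilon> A) (\<eta> (FOb U A)) = VIde C (FOb U A))"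


section \<open>Functor categories and pullbacks of enriched categories\<close>

text \<open>
  A family \<open>w X : W \<rightarrow> D(FX,GX)\<close> is natural if the two arrows
  \<open>W \<otimes> C(X,Y) \<rightarrow> D(FX,GY)\<close> it induces agree.  The hom-object \<open>[C,D](F,G)\<close>, that is, the
  end of \<open>D(F-,G-)\<close>, is the universal such family.
\<close>

definition vnat_family ::
  "('o, 'u) smcc \<Rightarrow> ('x, 'o, 'u) vcat \<Rightarrow> ('y, 'o, 'u) vcat \<Rightarrow>
   ('x, 'y, 'u) vfun \<Rightarrow> ('x, 'y, 'u) vfun \<Rightarrow> 'o \<Rightarrow> ('x \<Rightarrow> 'u) \<Rightarrow> bool" where
  "vnat_family V C D F G W w \<longleftrightarrow>
     W \<in> Obj V \<and>
     (\<forall>X \<in> VObj C. w X \<in> hom V W (VHom D (FOb F X) (FOb G X))) \<and>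
     (\<forall>X \<in> VObj C. \<forall>Y \<in> VObj C.
        VComp D (FOb F X) (FOb F Y) (FOb G Y) \<cdot>\<^bsub>V\<^esub> (w Y \<otimes>\<^bsub>V\<^esub> FHom F X Y) =
        VComp D (FOb F X) (FOb G X) (FOb G Y) \<cdot>\<^bsub>V\<^esub> (FHom G X Y \<otimes>\<^bsub>V\<^esub> w X) \<cdot>\<^bsub>V\<^esub>
          symm V W (VHom C X Y))"

definition is_nat_object ::
  "('o, 'u) smcc \<Rightarrow> ('x, 'o, 'u) vcat \<Rightarrow> ('y, 'o, 'u) vcat \<Rightarrow>
   ('x, 'y, 'u) vfun \<Rightarrow> ('x, 'y, 'u) vfun \<Rightarrow> 'o \<Rightarrow> ('x \<Rightarrow> 'u) \<Rightarrow> bool" where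
  "is_nat_object V C D F G N p \<longleftrightarrow>
     vnat_family V C D F G N p \<and>
     (\<forall>W w. vnat_family V C D F G W w \<longrightarrow>
        (\<exists>!u. u \<in> hom V W N \<and> (\<forall>X \<in> VObj C. p X \<cdot>\<^bsub>V\<^esub> u = w X)))"

definition nat_object ::
  "('o, 'u) smcc \<Rightarrow> ('x, 'o, 'u) vcat \<Rightarrow> ('y, 'o, 'u) vcat \<Rightarrow>
   ('x, 'y, 'u) vfun \<Rightarrow> ('x, 'y, 'u) vfun \<Rightarrow> 'o \<times> ('x \<Rightarrow> 'u)" where
  "nat_object V C D F G = (SOME (N, p). is_nat_object V C D F G N p)"

abbreviation nat_ob where
  "nat_ob V C D F G \<equiv> fst (nat_object V C D F G)"

abbreviation nat_proj where
  "nat_proj V C D F G \<equiv> snd (nat_object V C D F G)"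

text \<open>The \<open>\<V>\<close>-category \<open>[C,D]\<close>, for \<open>C\<close> with a small set of objects.\<close>

definition vfunctor_cat ::
  "('o, 'u) smcc \<Rightarrow> ('x, 'o, 'u) vcat \<Rightarrow> ('y, 'o, 'u) vcat \<Rightarrow>
   (('x, 'y, 'u) vfun, 'o, 'u) vcat" where
  "vfunctor_cat V C D = \<lparr>
     VObj = {F. vfunctor V C D F},
     VHom = (\<lambda>F G. nat_ob V C D F G),
     VComp = (\<lambda>F G H. THE c.
       c \<in> hom V (nat_ob V C D G H \<odot>\<^bsub>V\<^esub> nat_ob V C D F G) (nat_ob V C D F H) \<and>
       (\<forall>X \<in> VObj C. nat_proj V C D F H X \<cdot>\<^bsub>V\<^esub> c =
          VComp D (FOb F X) (FOb G X) (FOb H X) \<cdot>\<^bsub>V\<^esub>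
            (nat_proj V C D G H X \<otimes>\<^bsub>V\<^esub> nat_proj V C D F G X))),
     VIde = (\<lambda>F. THE e.
       e \<in> hom V \<I>\<^bsub>V\<^esub> (nat_ob V C D F F) \<and>
       (\<forall>X \<in> VObj C. nat_proj V C D F F X \<cdot>\<^bsub>V\<^esub> e = VIde D (FOb F X))) \<rparr>"

text \<open>Precomposition with \<open>K : B \<rightarrow> C\<close>, as a \<open>\<V>\<close>-functor \<open>[C,D] \<rightarrow> [B,D]\<close>.\<close>

definition vprecomp ::
  "('o, 'u) smcc \<Rightarrow> ('w, 'o, 'u) vcat \<Rightarrow> ('x, 'o, 'u) vcat \<Rightarrow> ('y, 'o, 'u) vcat \<Rightarrow>
   ('w, 'x, 'u) vfun \<Rightarrow> (('x, 'y, 'u) vfun, ('w, 'y, 'u) vfun, 'u) vfun" where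
  "vprecomp V B C D K = mk_vfun (vfunctor_cat V C D)
     (\<lambda>F. vfun_comp V B F K)
     (\<lambda>F G. THE h.
        h \<in> hom V (nat_ob V C D F G) (nat_ob V B D (vfun_comp V B F K) (vfun_comp V B G K)) \<and>
        (\<forall>X \<in> VObj B. nat_proj V B D (vfun_comp V B F K) (vfun_comp V B G K) X \<cdot>\<^bsub>V\<^esub> h =
           nat_proj V C D F G (FOb K X)))"

text \<open>
  For a set \<open>S\<close> of objects of \<open>C\<close> with inclusion \<open>K\<close>, the \<open>\<V>\<close>-functor
  \<open>C(K-,A) : S\<^sup>o\<^sup>p \<rightarrow> \<V>\<close>, and the \<open>\<V>\<close>-functor \<open>C \<rightarrow> [S\<^sup>o\<^sup>p,\<V>]\<close> sending \<open>A\<close> to it.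
\<close>

definition restricted_rep ::
  "('o, 'u) smcc \<Rightarrow> ('x, 'o, 'u) vcat \<Rightarrow> 'x set \<Rightarrow> 'x \<Rightarrow> ('x, 'o, 'u) vfun" where
  "restricted_rep V C S A = mk_vfun (vop V (vfull C S))
     (\<lambda>X. VHom C X A)
     (\<lambda>X Y. vcurry V (VHom C Y X) (VHom C X A) (VHom C Y A)
        (VComp C Y X A \<cdot>\<^bsub>V\<^esub> symm V (VHom C Y X) (VHom C X A)))"

definition restricted_yoneda ::
  "('o, 'u) smcc \<Rightarrow> ('x, 'o, 'u) vcat \<Rightarrow> 'x set \<Rightarrow> ('x, ('x, 'o, 'u) vfun, 'u) vfun" where
  "restricted_yoneda V C S =
     (let N = nat_object V (vop V (vfull C S)) (self V) in
      mk_vfun C (restricted_rep V C S)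
        (\<lambda>A B. THE h.
           h \<in> hom V (VHom C A B) (fst (N (restricted_rep V C S A) (restricted_rep V C S B))) \<and>
           (\<forall>X \<in> S. snd (N (restricted_rep V C S A) (restricted_rep V C S B)) X \<cdot>\<^bsub>V\<^esub> h =
              vcurry V (VHom C A B) (VHom C X A) (VHom C X B) (VComp C X A B))))"

text \<open>The pullback of \<open>F : A \<rightarrow> C\<close> and \<open>G : B \<rightarrow> C\<close> in \<open>\<V>\<close>-categories.\<close>

definition pb_object ::
  "('o, 'u) smcc \<Rightarrow> ('x, 'z, 'u) vfun \<Rightarrow> ('y, 'z, 'u) vfun \<Rightarrow> 'x \<times> 'y \<Rightarrow> 'x \<times> 'y \<Rightarrow>
   'o \<times> 'u \<times> 'u" where
  "pb_object V F G a b = (SOME (H, p, q).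
     is_pullback V (FHom F (fst a) (fst b)) (FHom G (snd a) (snd b)) H p q)"

abbreviation pb_ob where
  "pb_ob V F G a b \<equiv> fst (pb_object V F G a b)"

abbreviation pb_fst where
  "pb_fst V F G a b \<equiv> fst (snd (pb_object V F G a b))"

abbreviation pb_snd where
  "pb_snd V F G a b \<equiv> snd (snd (pb_object V F G a b))"

definition vpullback ::
  "('o, 'u) smcc \<Rightarrow> ('x, 'o, 'u) vcat \<Rightarrow> ('y, 'o, 'u) vcat \<Rightarrow>
   ('x, 'z, 'u) vfun \<Rightarrow> ('y, 'z, 'u) vfun \<Rightarrow> ('x \<times> 'y, 'o, 'u) vcat" where
  "vpullback V A B F G = \<lparr>
     VObj = {(x, y). x \<in> VObj A \<and> y \<in> VObj B \<and> FOb F x = FOb G y},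
     VHom = (\<lambda>a b. pb_ob V F G a b),
     VComp = (\<lambda>a b c. THE k.
       k \<in> hom V (pb_ob V F G b c \<odot>\<^bsub>V\<^esub> pb_ob V F G a b) (pb_ob V F G a c) \<and>
       pb_fst V F G a c \<cdot>\<^bsub>V\<^esub> k =
         VComp A (fst a) (fst b) (fst c) \<cdot>\<^bsub>V\<^esub> (pb_fst V F G b c \<otimes>\<^bsub>V\<^esub> pb_fst V F G a b) \<and>
       pb_snd V F G a c \<cdot>\<^bsub>V\<^esub> k =
         VComp B (snd a) (snd b) (snd c) \<cdot>\<^bsub>V\<^esub> (pb_snd V F G b c \<otimes>\<^bsub>V\<^esub> pb_snd V F G a b)),
     VIde = (\<lambda>a. THE k.
       k \<in> hom V \<I>\<^bsub>V\<^esub> (pb_ob V F G a a) \<and>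
       pb_fst V F G a a \<cdot>\<^bsub>V\<^esub> k = VIde A (fst a) \<and>
       pb_snd V F G a a \<cdot>\<^bsub>V\<^esub> k = VIde B (snd a)) \<rparr>"


section \<open>Pretheories, theories and their algebras\<close>

text \<open>
  \<open>P\<close> is the set of objects of the small category of \<open>lam\<close>-presentable objects, and \<open>J\<close> a
  \<open>\<V>\<close>-functor to \<open>T\<close>.
\<close>

definition pretheory ::
  "('o, 'u) smcc \<Rightarrow> 'o set \<Rightarrow> ('o, 'o, 'u) vcat \<Rightarrow> ('o, 'o, 'u) vfun \<Rightarrow> bool" where
  "pretheory V P T J \<longleftrightarrow>
     VObj T = P \<and> vfunctor V (vfull (self V) P) T J \<and> (\<forall>X \<in> P. FOb J X = X)"

text \<open>
  A \<open>T\<close>-algebra is a pair \<open>(\<hat>A, A)\<close> where \<open>\<hat>A : T\<^sup>o\<^sup>p \<rightarrow> \<V>\<close> composed with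
  \<open>J\<^sup>o\<^sup>p\<close> is \<open>\<V>(K-,A)\<close>.
\<close>

type_synonym ('o, 'u) alg = "('o, 'o, 'u) vfun \<times> 'o"

definition alg_restr ::
  "('o, 'u) smcc \<Rightarrow> 'o set \<Rightarrow> ('o, 'o, 'u) vcat \<Rightarrow> ('o, 'o, 'u) vfun \<Rightarrow>
   (('o, 'o, 'u) vfun, ('o, 'o, 'u) vfun, 'u) vfun" where
  "alg_restr V P T J =
     vprecomp V (vop V (vfull (self V) P)) (vop V T) (self V) (vop_fun J)"

definition Alg ::
  "('o, 'u) smcc \<Rightarrow> 'o set \<Rightarrow> ('o, 'o, 'u) vcat \<Rightarrow> ('o, 'o, 'u) vfun \<Rightarrow>
   (('o, 'u) alg, 'o, 'u) vcat" where
  "Alg V P T J = vpullback V (vfunctor_cat V (vop V T) (self V)) (self V)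
     (alg_restr V P T J) (restricted_yoneda V (self V) P)"

definition forget ::
  "('o, 'u) smcc \<Rightarrow> 'o set \<Rightarrow> ('o, 'o, 'u) vcat \<Rightarrow> ('o, 'o, 'u) vfun \<Rightarrow>
   (('o, 'u) alg, 'o, 'u) vfun" where
  "forget V P T J = mk_vfun (Alg V P T J) snd
     (pb_snd V (alg_restr V P T J) (restricted_yoneda V (self V) P))"

abbreviation Alg0 where
  "Alg0 V P T J \<equiv> underlying V (Alg V P T J)"

text \<open>
  The action on arrows of the underlying functor of the forgetful \<open>\<V>\<close>-functor; an element
  \<open>I \<rightarrow> [A,B]\<close> is identified with the corresponding arrow \<open>A \<rightarrow> B\<close> of \<open>\<V>\<close>.
\<close>

definition forget0 ::
  "('o, 'u) smcc \<Rightarrow> 'o set \<Rightarrow> ('o, 'o, 'u) vcat \<Rightarrow> ('o, 'o, 'u) vfun \<Rightarrow>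
   ('o, 'u) alg \<times> 'u \<times> ('o, 'u) alg \<Rightarrow> 'u" where
  "forget0 V P T J = (\<lambda>(A, f, B).
     arrow_of V (FOb (forget V P T J) A) (FOb (forget V P T J) B)
       (FHom (forget V P T J) A B \<cdot>\<^bsub>V\<^esub> f))"

definition free_adjunction ::
  "('o, 'u) smcc \<Rightarrow> 'o set \<Rightarrow> ('o, 'o, 'u) vcat \<Rightarrow> ('o, 'o, 'u) vfun \<Rightarrow>
   ('o, ('o, 'u) alg, 'u) vfun \<Rightarrow> ('o \<Rightarrow> 'u) \<Rightarrow> (('o, 'u) alg \<Rightarrow> 'u) \<Rightarrow> bool" where
  "free_adjunction V P T J F \<eta> \<epsilon> \<longleftrightarrow>
     vadjunction V (self V) (Alg V P T J) F (forget V P T J) \<eta> \<epsilon>"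

text \<open>
  The Eilenberg-Moore \<open>\<V>\<close>-category of a monad \<open>(M, \<eta>, m)\<close> on a \<open>\<V>\<close>-category \<open>C\<close>.  Algebras
  are pairs \<open>(A, a)\<close> with \<open>a : I \<rightarrow> C(MA,A)\<close>, and the hom-object from \<open>(A, a)\<close> to \<open>(B, b)\<close>
  is the equalizer of \<open>C(a,B)\<close> and \<open>C(MA,b) \<circ> M : C(A,B) \<rightarrow> C(MA,B)\<close>.
\<close>

definition em_object ::
  "('o, 'u) smcc \<Rightarrow> ('x, 'o, 'u) vcat \<Rightarrow> ('x, 'x, 'u) vfun \<Rightarrow> 'x \<times> 'u \<Rightarrow> 'x \<times> 'u \<Rightarrow> 'o \<times> 'u" where
  "em_object V C M = (\<lambda>(A, a) (B, b). SOME (H, e).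
     is_equalizer V
       (vpre V C (FOb M A) A B a)
       (vpost V C (FOb M A) (FOb M B) B b \<cdot>\<^bsub>V\<^esub> FHom M A B) H e)"

abbreviation em_ob where
  "em_ob V C M x y \<equiv> fst (em_object V C M x y)"

abbreviation em_incl where
  "em_incl V C M x y \<equiv> snd (em_object V C M x y)"

definition em_cat ::
  "('o, 'u) smcc \<Rightarrow> ('x, 'o, 'u) vcat \<Rightarrow> ('x, 'x, 'u) vfun \<Rightarrow> ('x \<Rightarrow> 'u) \<Rightarrow> ('x \<Rightarrow> 'u) \<Rightarrow>
   ('x \<times> 'u, 'o, 'u) vcat" where
  "em_cat V C M \<eta> m = \<lparr>
     VObj = {(A, a). A \<in> VObj C \<and> a \<in> hom V \<I>\<^bsub>V\<^esub> (VHom C (FOb M A) A) \<and>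
       el_comp V C A (FOb M A) A a (\<eta> A) = VIde C A \<and>
       el_comp V C (FOb M (FOb M A)) (FOb M A) A a (m A) =
       el_comp V C (FOb M (FOb M A)) (FOb M A) A a (FHom M (FOb M A) A \<cdot>\<^bsub>V\<^esub> a)},
     VHom = (\<lambda>x y. em_ob V C M x y),
     VComp = (\<lambda>x y z. THE k.
       k \<in> hom V (em_ob V C M y z \<odot>\<^bsub>V\<^esub> em_ob V C M x y) (em_ob V C M x z) \<and>
       em_incl V C M x z \<cdot>\<^bsub>V\<^esub> k =
         VComp C (fst x) (fst y) (fst z) \<cdot>\<^bsub>V\<^esub> (em_incl V C M y z \<otimes>\<^bsub>V\<^esub> em_incl V C M x y)),
     VIde = (\<lambda>x. THE k.
       k \<in> hom V \<I>\<^bsub>V\<^esub> (em_ob V C M x x) \<and> em_incl V C M x x \<cdot>\<^bsub>V\<^esub> k = VIde C (fst x)) \<rparr>"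

definition em_free ::
  "('o, 'u) smcc \<Rightarrow> ('x, 'o, 'u) vcat \<Rightarrow> ('x, 'x, 'u) vfun \<Rightarrow> ('x \<Rightarrow> 'u) \<Rightarrow>
   ('x, 'x \<times> 'u, 'u) vfun" where
  "em_free V C M m = mk_vfun C (\<lambda>X. (FOb M X, m X))
     (\<lambda>X Y. THE h.
        h \<in> hom V (VHom C X Y) (em_ob V C M (FOb M X, m X) (FOb M Y, m Y)) \<and>
        em_incl V C M (FOb M X, m X) (FOb M Y, m Y) \<cdot>\<^bsub>V\<^esub> h = FHom M X Y)"

text \<open>
  The pretheory induced by a monad on \<open>\<V>\<close>: the full subcategory of its algebras on the free
  algebras over objects of \<open>P\<close>, with objects named by the elements of \<open>P\<close>, together with the
  restriction of the free algebra functor.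
\<close>

definition monad_pretheory_cat ::
  "('o, 'u) smcc \<Rightarrow> 'o set \<Rightarrow> ('o, 'o, 'u) vfun \<Rightarrow> ('o \<Rightarrow> 'u) \<Rightarrow> ('o \<Rightarrow> 'u) \<Rightarrow>
   ('o, 'o, 'u) vcat" where
  "monad_pretheory_cat V P M \<eta> m =
     (let E = em_cat V (self V) M \<eta> m; F = FOb (em_free V (self V) M m) in \<lparr>
     VObj = P,
     VHom = (\<lambda>X Y. VHom E (F X) (F Y)),
     VComp = (\<lambda>X Y Z. VComp E (F X) (F Y) (F Z)),
     VIde = (\<lambda>X. VIde E (F X)) \<rparr>)"

definition monad_pretheory_fun ::
  "('o, 'u) smcc \<Rightarrow> 'o set \<Rightarrow> ('o, 'o, 'u) vfun \<Rightarrow> ('o \<Rightarrow> 'u) \<Rightarrow> ('o, 'o, 'u) vfun" where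
  "monad_pretheory_fun V P M m =
     mk_vfun (vfull (self V) P) (\<lambda>X. X) (FHom (em_free V (self V) M m))"

definition pretheory_iso ::
  "('o, 'u) smcc \<Rightarrow> 'o set \<Rightarrow> ('o, 'o, 'u) vcat \<Rightarrow> ('o, 'o, 'u) vfun \<Rightarrow>
   ('o, 'o, 'u) vcat \<Rightarrow> ('o, 'o, 'u) vfun \<Rightarrow> bool" where
  "pretheory_iso V P T J T' J' \<longleftrightarrow>
     (\<exists>\<Phi>. vfunctor V T T' \<Phi> \<and> (\<forall>X \<in> P. FOb \<Phi> X = X) \<and>
        (\<forall>X \<in> P. \<forall>Y \<in> P. iso V (FHom \<Phi> X Y)) \<and>
        vfun_comp V (vfull (self V) P) \<Phi> J = J')"

text \<open>The monad induced by an adjunction has multiplication \<open>U\<epsilon>F\<close>.\<close>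

definition induced_monad_fun ::
  "('o, 'u) smcc \<Rightarrow> 'o set \<Rightarrow> ('o, 'o, 'u) vcat \<Rightarrow> ('o, 'o, 'u) vfun \<Rightarrow>
   ('o, ('o, 'u) alg, 'u) vfun \<Rightarrow> ('o, 'o, 'u) vfun" where
  "induced_monad_fun V P T J F = vfun_comp V (self V) (forget V P T J) F"

definition induced_monad_mult ::
  "('o, 'u) smcc \<Rightarrow> 'o set \<Rightarrow> ('o, 'o, 'u) vcat \<Rightarrow> ('o, 'o, 'u) vfun \<Rightarrow>
   ('o, ('o, 'u) alg, 'u) vfun \<Rightarrow> (('o, 'u) alg \<Rightarrow> 'u) \<Rightarrow> 'o \<Rightarrow> 'u" where
  "induced_monad_mult V P T J F \<epsilon> X =
     FHom (forget V P T J) (FOb F (FOb (forget V P T J) (FOb F X))) (FOb F X)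
       \<cdot>\<^bsub>V\<^esub> \<epsilon> (FOb F X)"

text \<open>
  A theory is a pretheory isomorphic to the one induced by its induced monad; the left adjoint
  is unique up to isomorphism, so any choice of it may be used.
\<close>

definition lambda_ary_theory ::
  "('o, 'u) smcc \<Rightarrow> 'o set \<Rightarrow> ('o, 'o, 'u) vcat \<Rightarrow> ('o, 'o, 'u) vfun \<Rightarrow> bool" where
  "lambda_ary_theory V P T J \<longleftrightarrow>
     pretheory V P T J \<and>
     (\<exists>F \<eta> \<epsilon>. free_adjunction V P T J F \<eta> \<epsilon> \<and>
        pretheory_iso V P T J
          (monad_pretheory_cat V P (induced_monad_fun V P T J F) \<eta> (induced_monad_mult V P T J F \<epsilon>))
          (monad_pretheory_fun V P (induced_monad_fun V P T J F) (induced_monad_mult V P T J F \<epsilon>)))"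

text \<open>
  \<open>X\<^sub>0\<close> with coprojections \<open>c x\<close> is a coproduct of \<open>\<V>\<^sub>0(I,X)\<close> copies of the unit, and \<open>\<delta>\<close>
  is the canonical arrow, with \<open>\<delta> \<circ> c x = x\<close>.
\<close>

definition is_discrete_cover ::
  "('o, 'u) smcc \<Rightarrow> 'o \<Rightarrow> 'o \<Rightarrow> 'u \<Rightarrow> bool" where
  "is_discrete_cover V X X\<^sub>0 \<delta> \<longleftrightarrow>
     (\<exists>c. is_coproduct V (hom V \<I>\<^bsub>V\<^esub> X) (\<lambda>x. \<I>\<^bsub>V\<^esub>) X\<^sub>0 c \<and>
        \<delta> \<in> hom V X\<^sub>0 X \<and> (\<forall>x \<in> hom V \<I>\<^bsub>V\<^esub> X. \<delta> \<cdot>\<^bsub>V\<^esub> c x = x))"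

text \<open>
  Arrows \<open>JI \<rightarrow> JX\<close> of \<open>T\<close> are elements \<open>I \<rightarrow> T(I,X)\<close>.  The coproduct \<open>X\<^sub>0\<close> is only
  determined up to isomorphism; it is taken in \<open>P\<close>.
\<close>

definition discrete_theory ::
  "('o, 'u) smcc \<Rightarrow> 'o set \<Rightarrow> ('o, 'o, 'u) vcat \<Rightarrow> ('o, 'o, 'u) vfun \<Rightarrow> bool" where
  "discrete_theory V P T J \<longleftrightarrow>
     (\<forall>X \<in> P. \<exists>X\<^sub>0 \<in> P. \<exists>\<delta>. is_discrete_cover V X X\<^sub>0 \<delta> \<and>
        (\<forall>g \<in> hom V \<I>\<^bsub>V\<^esub> (VHom T \<I>\<^bsub>V\<^esub> X). \<exists>f \<in> hom V \<I>\<^bsub>V\<^esub> (VHom T \<I>\<^bsub>V\<^esub> X\<^sub>0).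
           g = el_comp V T \<I>\<^bsub>V\<^esub> X\<^sub>0 X (FHom J X\<^sub>0 X \<cdot>\<^bsub>V\<^esub> name_of V \<delta>) f))"


section \<open>Surjections and injections\<close>

definition Surj :: "('o, 'u) smcc \<Rightarrow> 'u set" where
  "Surj V = {f \<in> Arr V.
     (\<lambda>x. f \<cdot>\<^bsub>V\<^esub> x) ` hom V \<I>\<^bsub>V\<^esub> (Dom V f) = hom V \<I>\<^bsub>V\<^esub> (Cod V f)}"

definition unique_lifting :: "('o, 'a, 'm) cat_scheme \<Rightarrow> 'a \<Rightarrow> 'a \<Rightarrow> bool" where
  "unique_lifting C e m \<longleftrightarrow>
     (\<forall>u \<in> hom C (Dom C e) (Dom C m). \<forall>v \<in> hom C (Cod C e) (Cod C m).
        m \<cdot>\<^bsub>C\<^esub> u = v \<cdot>\<^bsub>C\<^esub> e \<longrightarrow>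
        (\<exists>!d. d \<in> hom C (Cod C e) (Dom C m) \<and> d \<cdot>\<^bsub>C\<^esub> e = u \<and> m \<cdot>\<^bsub>C\<^esub> d = v))"

definition Inj :: "('o, 'u) smcc \<Rightarrow> 'u set" where
  "Inj V = {m \<in> Arr V. \<forall>e \<in> Surj V. unique_lifting V e m}"

definition factorization_system :: "('o, 'a, 'm) cat_scheme \<Rightarrow> 'a set \<Rightarrow> 'a set \<Rightarrow> bool" where
  "factorization_system C E M \<longleftrightarrow>
     E \<subseteq> Arr C \<and> M \<subseteq> Arr C \<and> Collect (iso C) \<subseteq> E \<inter> M \<and>
     (\<forall>f \<in> E. \<forall>g \<in> E. Dom C g = Cod C f \<longrightarrow> g \<cdot>\<^bsub>C\<^esub> f \<in> E) \<and>
     (\<forall>f \<in> M. \<forall>g \<in> M. Dom C g = Cod C f \<longrightarrow> g \<cdot>\<^bsub>C\<^esub> f \<in> M) \<and>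
     (\<forall>e \<in> E. \<forall>m \<in> M. unique_lifting C e m) \<and>
     (\<forall>f \<in> Arr C. \<exists>e \<in> E. \<exists>m \<in> M. Cod C e = Dom C m \<and> f = m \<cdot>\<^bsub>C\<^esub> e)"

definition proper_factorization :: "('o, 'a, 'm) cat_scheme \<Rightarrow> 'a set \<Rightarrow> 'a set \<Rightarrow> bool" where
  "proper_factorization C E M \<longleftrightarrow> (\<forall>e \<in> E. epi_arr C e) \<and> (\<forall>m \<in> M. mono_arr C m)"

definition small_quotients :: "'u itself \<Rightarrow> ('o, 'a, 'm) cat_scheme \<Rightarrow> 'a set \<Rightarrow> bool" where
  "small_quotients U C E \<longleftrightarrow>
     (\<forall>X \<in> Obj C. \<exists>R \<subseteq> {e \<in> E. Dom C e = X}. small U R \<and>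
        (\<forall>e \<in> E. Dom C e = X \<longrightarrow>
           (\<exists>q \<in> R. \<exists>i \<in> hom C (Cod C q) (Cod C e). iso C i \<and> i \<cdot>\<^bsub>C\<^esub> q = e)))"

definition closed_under_directed_colimits ::
  "'u rel \<Rightarrow> ('o, 'a, 'm) cat_scheme \<Rightarrow> 'a set \<Rightarrow> bool" where
  "closed_under_directed_colimits \<mu> C M \<longleftrightarrow>
     (\<forall>S r D d Q c. directed_diagram \<mu> C M S r D d \<and> is_colimit (poset_cat S r) C D d Q c \<longrightarrow>
        (\<forall>i \<in> S. c i \<in> M) \<and>
        (\<forall>R b u. is_cocone (poset_cat S r) C D d R b \<and> (\<forall>i \<in> S. b i \<in> M) \<and>
           u \<in> hom C Q R \<and> (\<forall>i \<in> S. u \<cdot>\<^bsub>C\<^esub> c i = b i) \<longrightarrow> u \<in> M))"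

definition convenient :: "'u rel \<Rightarrow> ('o, 'u) smcc \<Rightarrow> bool" where
  "convenient \<mu> V \<longleftrightarrow>
     small_quotients TYPE('u) V (Surj V) \<and> closed_under_directed_colimits \<mu> V (Inj V)"

definition generated :: "'u rel \<Rightarrow> ('o, 'u) smcc \<Rightarrow> 'o \<Rightarrow> bool" where
  "generated \<mu> V X \<longleftrightarrow> X \<in> Obj V \<and> hom_preserves_directed_colimits \<mu> V (Inj V) X"

definition Inj_locally_generated :: "'u rel \<Rightarrow> ('o, 'u) smcc \<Rightarrow> bool" where
  "Inj_locally_generated \<mu> V \<longleftrightarrow>
     (\<exists>G. small TYPE('u) G \<and> (\<forall>X \<in> G. generated \<mu> V X) \<and>
          (\<forall>Q \<in> Obj V. directed_colimit_of \<mu> V (Inj V) G Q))"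

definition pure_epi :: "'u rel \<Rightarrow> ('o, 'u) smcc \<Rightarrow> 'u \<Rightarrow> bool" where
  "pure_epi \<mu> V f \<longleftrightarrow> f \<in> Arr V \<and>
     (\<forall>X. generated \<mu> V X \<longrightarrow>
        (\<forall>b \<in> hom V X (Cod V f). \<exists>a \<in> hom V X (Dom V f). f \<cdot>\<^bsub>V\<^esub> a = b))"


section \<open>Birkhoff subcategories and equational theories\<close>

text \<open>A full subcategory is identified with its class of objects.\<close>

definition full_replete :: "('o, 'a, 'm) cat_scheme \<Rightarrow> 'o set \<Rightarrow> bool" where
  "full_replete C L \<longleftrightarrow>
     L \<subseteq> Obj C \<and> (\<forall>A \<in> L. \<forall>B \<in> Obj C. isomorphic C A B \<longrightarrow> B \<in> L)"

definition Birkhoff ::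
  "('o, 'u) smcc \<Rightarrow> 'o set \<Rightarrow> ('o, 'o, 'u) vcat \<Rightarrow> ('o, 'o, 'u) vfun \<Rightarrow>
   ('o, 'u) alg set \<Rightarrow> bool" where
  "Birkhoff V P T J L \<longleftrightarrow>
     full_replete (Alg0 V P T J) L \<and>
     (\<forall>(K :: 'u set) D Q p. small TYPE('u) K \<and> D ` K \<subseteq> L \<and>
        is_product (Alg0 V P T J) K D Q p \<longrightarrow> Q \<in> L) \<and>
     (\<forall>A B. \<forall>f \<in> hom (Alg0 V P T J) A B.
        mono_arr (Alg0 V P T J) f \<and> B \<in> L \<longrightarrow> A \<in> L) \<and>
     (\<forall>A B. \<forall>g \<in> hom (Alg0 V P T J) A B.
        split_epi V (forget0 V P T J g) \<and> A \<in> L \<longrightarrow> B \<in> L)"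

definition mu_Birkhoff ::
  "'u rel \<Rightarrow> ('o, 'u) smcc \<Rightarrow> 'o set \<Rightarrow> ('o, 'o, 'u) vcat \<Rightarrow> ('o, 'o, 'u) vfun \<Rightarrow>
   ('o, 'u) alg set \<Rightarrow> bool" where
  "mu_Birkhoff \<mu> V P T J L \<longleftrightarrow>
     Birkhoff V P T J L \<and>
     (\<forall>A B. \<forall>f \<in> hom (Alg0 V P T J) A B.
        pure_epi \<mu> V (forget0 V P T J f) \<and> A \<in> L \<longrightarrow> B \<in> L)"

text \<open>An equation \<open>p = q\<close> with \<open>p, q : FY \<rightarrow> FX\<close> is recorded together with \<open>Y\<close> and \<open>X\<close>.\<close>

record ('o, 'u) equation =
  eq_dom :: 'o
  eq_cod :: 'o
  eq_lhs :: "('o, 'u) alg \<times> 'u \<times> ('o, 'u) alg"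
  eq_rhs :: "('o, 'u) alg \<times> 'u \<times> ('o, 'u) alg"

definition is_equation ::
  "('o, 'u) smcc \<Rightarrow> 'o set \<Rightarrow> ('o, 'o, 'u) vcat \<Rightarrow> ('o, 'o, 'u) vfun \<Rightarrow>
   ('o, ('o, 'u) alg, 'u) vfun \<Rightarrow> ('o, 'u) equation \<Rightarrow> bool" where
  "is_equation V P T J F e \<longleftrightarrow>
     eq_dom e \<in> Obj V \<and> eq_cod e \<in> Obj V \<and>
     eq_lhs e \<in> hom (Alg0 V P T J) (FOb F (eq_dom e)) (FOb F (eq_cod e)) \<and>
     eq_rhs e \<in> hom (Alg0 V P T J) (FOb F (eq_dom e)) (FOb F (eq_cod e))"

definition equational_theory ::
  "('o, 'u) smcc \<Rightarrow> 'o set \<Rightarrow> ('o, 'o, 'u) vcat \<Rightarrow> ('o, 'o, 'u) vfun \<Rightarrow>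
   ('o, ('o, 'u) alg, 'u) vfun \<Rightarrow> ('o, 'u) equation set \<Rightarrow> bool" where
  "equational_theory V P T J F E \<longleftrightarrow>
     small TYPE('u) E \<and> (\<forall>e \<in> E. is_equation V P T J F e)"

definition satisfies ::
  "('o, 'u) smcc \<Rightarrow> 'o set \<Rightarrow> ('o, 'o, 'u) vcat \<Rightarrow> ('o, 'o, 'u) vfun \<Rightarrow>
   ('o, ('o, 'u) alg, 'u) vfun \<Rightarrow> ('o, 'u) alg \<Rightarrow> ('o, 'u) equation \<Rightarrow> bool" where
  "satisfies V P T J F A e \<longleftrightarrow>
     (\<forall>h \<in> hom (Alg0 V P T J) (FOb F (eq_cod e)) A.
        h \<cdot>\<^bsub>Alg0 V P T J\<^esub> eq_lhs e = h \<cdot>\<^bsub>Alg0 V P T J\<^esub> eq_rhs e)"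

definition equational_class ::
  "('o, 'u) smcc \<Rightarrow> 'o set \<Rightarrow> ('o, 'o, 'u) vcat \<Rightarrow> ('o, 'o, 'u) vfun \<Rightarrow>
   ('o, ('o, 'u) alg, 'u) vfun \<Rightarrow> ('o, 'u) equation set \<Rightarrow> ('o, 'u) alg set" where
  "equational_class V P T J F E =
     {A \<in> Obj (Alg0 V P T J). \<forall>e \<in> E. satisfies V P T J F A e}"

definition clustered :: "'u rel \<Rightarrow> ('o, 'u) smcc \<Rightarrow> ('o, 'u) equation \<Rightarrow> bool" where
  "clustered \<mu> V e \<longleftrightarrow>
     (\<exists>(K :: 'u set) D c. small TYPE('u) K \<and> (\<forall>i \<in> K. generated \<mu> V (D i)) \<and>
        is_coproduct V K D (eq_cod e) c)"

end

theory Submission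
  imports Defs
begin

text \<open>
  An algebra is an object \<open>A\<close> with an action of \<open>\<T>\<close> on the powers \<open>[X, A]\<close>, \<open>X \<in> \<V>\<^sub>\<lambda>\<close>, and the
  homomorphisms are the arrows compatible with the actions.  Discreteness makes \<open>UF\<close> preserve
  surjections, so homomorphisms have (surjective, jointly monic) image factorizations.

  Let \<open>\<L>\<close> be a \<open>\<mu>\<close>-Birkhoff subcategory and let \<open>A\<close> satisfy every \<open>\<mu>\<close>-clustered equation valid in \<open>\<L>\<close>.
  Let \<open>X\<close> be the coproduct of all arrows into \<open>A\<close> from the \<open>\<mu>\<close>-generated generators, \<open>g : FX \<rightarrow> A\<close> the
  induced homomorphism, and \<open>R \<in> \<L>\<close> a product through which \<open>FX\<close> is mapped so that only those points
  of \<open>FX\<close> are identified which are identified by every homomorphism into \<open>\<L>\<close>.  The image \<open>S\<close> of \<open>FX\<close> in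
  \<open>R \<times> A\<close> projects to \<open>R\<close> by an arrow injective on points, because the identified pairs are equations
  valid in \<open>\<L>\<close> and hence in \<open>A\<close>; surjections being epimorphisms, this projection is monic and \<open>S \<in> \<L>\<close>.
  The projection of \<open>S\<close> to \<open>A\<close> is a \<open>\<mu>\<close>-pure epimorphism, hence \<open>A \<in> \<L>\<close>.

  A set of equations suffices because \<open>UF\<close> preserves \<open>\<lambda>\<close>-directed colimits: every point of \<open>FX\<close> comes
  from a subcoproduct of \<open>X\<close> of bounded size that contains each generator and is therefore a retract of \<open>X\<close>.
\<close>

section \<open>Categories and symmetric monoidal closed categories\<close>

text \<open>Three obstacles shape the proof. \<open>Alg\<close> is a pullback of enriched functor
  categories whose hom-objects are picked by \<open>SOME\<close>, so nothing can be said about them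
  before the ends and pullbacks are known to exist. Local presentability speaks of colimits only,
  and \<open>representable\<close> converts these into the limits required. Next, discreteness
  concerns points of the hom-objects of \<T>, whereas the argument needs points of
  \<open>TO X\<close>; the isomorphism with the pretheory of the induced monad carries one to the
  other, through the Eilenberg-Moore category and a change of left adjoint. Finally, the equations
  have to form a set fixed before the algebra \<open>A\<close> is known, although the coproduct
  \<open>X\<close> grows with \<open>A\<close>. The retraction onto a subcoproduct folds each
  omitted summand onto the kept copy of the same generator; so validity in \<L> of an equation
  between points of \<open>FX\<close> passes to the subcoproduct, and the number of summands is
  bounded by the generators and \<open>lam\<close> alone. Points are enough throughout, because the
  canonical arrow from a copower of the unit is a surjection and hence epic.\<close>

locale cat =
  fixes C :: "('o, 'a, 'm) cat_scheme" (structure)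
  assumes category: "category C"
begin

lemma homD: "f \<in> hom C X Y \<Longrightarrow> f \<in> Arr C \<and> Dom C f = X \<and> Cod C f = Y"
  by (simp add: hom_def)

lemma homI: "f \<in> Arr C \<Longrightarrow> Dom C f = X \<Longrightarrow> Cod C f = Y \<Longrightarrow> f \<in> hom C X Y"
  by (simp add: hom_def)

lemma Dom_Obj [simp]: "f \<in> Arr C \<Longrightarrow> Dom C f \<in> Obj C"
  and Cod_Obj [simp]: "f \<in> Arr C \<Longrightarrow> Cod C f \<in> Obj C"
  using category unfolding category_def by blast+

lemma hom_Obj: "f \<in> hom C X Y \<Longrightarrow> X \<in> Obj C \<and> Y \<in> Obj C"
  using Dom_Obj Cod_Obj homD by metis

lemma Ide_hom: "X \<in> Obj C \<Longrightarrow> Ide C X \<in> hom C X X"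
  using category unfolding category_def by blast

lemma Ide_Arr [simp]: "X \<in> Obj C \<Longrightarrow> Ide C X \<in> Arr C"
  and Dom_Ide [simp]: "X \<in> Obj C \<Longrightarrow> Dom C (Ide C X) = X"
  and Cod_Ide [simp]: "X \<in> Obj C \<Longrightarrow> Cod C (Ide C X) = X"
  using Ide_hom homD by metis+

lemma comp_hom: "f \<in> hom C X Y \<Longrightarrow> g \<in> hom C Y Z \<Longrightarrow> g \<cdot> f \<in> hom C X Z"
  using category unfolding category_def by blast

lemma comp_Arr [simp]:
  assumes "f \<in> Arr C" "g \<in> Arr C" "Dom C g = Cod C f"
  shows "g \<cdot> f \<in> Arr C" "Dom C (g \<cdot> f) = Dom C f" "Cod C (g \<cdot> f) = Cod C g"
  using comp_hom[of f "Dom C f" "Cod C f" g "Cod C g"] assms by (auto simp: hom_def)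

lemma comp_Ide [simp]:
  "f \<in> Arr C \<Longrightarrow> Dom C f = X \<Longrightarrow> f \<cdot> Ide C X = f"
  "f \<in> Arr C \<Longrightarrow> Cod C f = Y \<Longrightarrow> Ide C Y \<cdot> f = f"
  using category unfolding category_def hom_def by blast+

lemma comp_assoc [simp]:
  assumes "f \<in> Arr C" "g \<in> Arr C" "h \<in> Arr C" "Dom C g = Cod C f" "Dom C h = Cod C g"
  shows "(h \<cdot> g) \<cdot> f = h \<cdot> (g \<cdot> f)"
proof -
  have "\<forall>W X Y Z. \<forall>f \<in> hom C W X. \<forall>g \<in> hom C X Y. \<forall>h \<in> hom C Y Z. h \<cdot> (g \<cdot> f) = (h \<cdot> g) \<cdot> f"
    using category unfolding category_def by (elim conjE)
  from this[rule_format, OF homI[OF assms(1) refl refl] homI[OF assms(2) _ refl] homI[OF assms(3) _ refl]]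
  show ?thesis using assms by simp
qed

text \<open>Simplification associates composites to the right, so an equation
  \<open>g \<cdot> f = h\<close> no longer matches once some \<open>k\<close> is composed on the
  right. This lemma and the next apply it under such a tail.\<close>

lemma comp_reduce:
  assumes "g \<cdot> f = h" "f \<in> Arr C" "g \<in> Arr C" "Dom C g = Cod C f" "k \<in> Arr C" "Cod C k = Dom C f"
  shows "g \<cdot> (f \<cdot> k) = h \<cdot> k"
  using assms comp_assoc[of k f g] by simp

lemma comp_permute:
  assumes "g \<cdot> f = g' \<cdot> f'" "f \<in> Arr C" "g \<in> Arr C" "Dom C g = Cod C f"
    "f' \<in> Arr C" "g' \<in> Arr C" "Dom C g' = Cod C f'" "k \<in> Arr C" "Cod C k = Dom C f"
  shows "g \<cdot> (f \<cdot> k) = g' \<cdot> (f' \<cdot> k)"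
proof -
  have "Dom C f = Dom C f'" using assms by (metis comp_Arr(2))
  then show ?thesis using assms comp_assoc[of k f g] comp_assoc[of k f' g'] by simp
qed

lemma inverse_unique:
  assumes "inverse_arr C f g" "inverse_arr C f h" shows "g = h"
proof -
  have "g \<cdot> (f \<cdot> h) = (g \<cdot> f) \<cdot> h"
    using assms by (subst comp_assoc) (auto simp: inverse_arr_def hom_def)
  then show ?thesis using assms by (auto simp: inverse_arr_def hom_def)
qed

lemma inv_arr_inverse: "iso C f \<Longrightarrow> inverse_arr C f (inv_arr C f)"
  unfolding iso_def inv_arr_def by (rule theI') (blast intro: inverse_unique)

lemma iso_Arr [simp]: "iso C f \<Longrightarrow> f \<in> Arr C"
  by (auto simp: iso_def inverse_arr_def)

lemma inv_Arr [simp]: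
  assumes "iso C f"
  shows "inv_arr C f \<in> Arr C" "Dom C (inv_arr C f) = Cod C f" "Cod C (inv_arr C f) = Dom C f"
    "inv_arr C f \<cdot> f = Ide C (Dom C f)" "f \<cdot> inv_arr C f = Ide C (Cod C f)"
  using inv_arr_inverse[OF assms] by (auto simp: inverse_arr_def hom_def)

lemma inv_comp [simp]:
  "iso C f \<Longrightarrow> k \<in> Arr C \<Longrightarrow> Cod C k = Dom C f \<Longrightarrow> inv_arr C f \<cdot> (f \<cdot> k) = k"
  "iso C f \<Longrightarrow> k \<in> Arr C \<Longrightarrow> Cod C k = Cod C f \<Longrightarrow> f \<cdot> (inv_arr C f \<cdot> k) = k"
  using comp_reduce[OF inv_Arr(4), of f k] comp_reduce[OF inv_Arr(5), of f k] by simp_all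

lemma iso_inv [simp]: "iso C f \<Longrightarrow> iso C (inv_arr C f)"
  unfolding iso_def[of C "inv_arr C f"] by (rule exI[of _ f]) (simp add: inverse_arr_def hom_def)

lemma iso_comp:
  assumes "iso C f" "iso C g" "Dom C g = Cod C f" shows "iso C (g \<cdot> f)"
  unfolding iso_def
  by (rule exI[of _ "inv_arr C f \<cdot> inv_arr C g"]) (use assms in \<open>simp add: inverse_arr_def hom_def\<close>)

lemma iso_Ide [simp]: "X \<in> Obj C \<Longrightarrow> iso C (Ide C X)"
  unfolding iso_def by (rule exI[of _ "Ide C X"]) (simp add: inverse_arr_def hom_def)

lemma iso_cancel_right:
  assumes "f \<cdot> z = g \<cdot> z" "iso C z" "f \<in> Arr C" "g \<in> Arr C" "Dom C f = Cod C z" "Dom C g = Cod C z"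
  shows "f = g"
proof -
  have "(f \<cdot> z) \<cdot> inv_arr C z = (g \<cdot> z) \<cdot> inv_arr C z" using assms(1) by simp
  then show ?thesis using assms(2-) by simp
qed

lemma iso_cancel_left:
  assumes "z \<cdot> f = z \<cdot> g" "iso C z" "f \<in> Arr C" "g \<in> Arr C" "Cod C f = Dom C z" "Cod C g = Dom C z"
  shows "f = g"
  using assms inv_comp(1) by metis

end

locale smc =
  fixes V :: "('o, 'u) smcc" (structure)
  assumes smc: "sm_closed_category V"
begin

sublocale cat V
  by standard (use smc in \<open>simp add: sm_closed_category_def\<close>)

abbreviation one (\<open>\<one>\<close>) where "\<one> X \<equiv> Ide V X"

lemma unit_Obj [simp]: "\<I> \<in> Obj V"
  using smc by (simp add: sm_closed_category_def)

lemma tens_Obj [simp]: "X \<in> Obj V \<Longrightarrow> Y \<in> Obj V \<Longrightarrow> X \<odot> Y \<in> Obj V"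
  and tens_Ide [simp]: "X \<in> Obj V \<Longrightarrow> Y \<in> Obj V \<Longrightarrow> \<one> X \<otimes> \<one> Y = \<one> (X \<odot> Y)"
  using smc by (simp_all add: sm_closed_category_def)

lemma tens_hom: "f \<in> hom V X X' \<Longrightarrow> g \<in> hom V Y Y' \<Longrightarrow> f \<otimes> g \<in> hom V (X \<odot> Y) (X' \<odot> Y')"
  using smc by (simp only: sm_closed_category_def)

lemma tens_Arr [simp]:
  assumes "f \<in> Arr V" "g \<in> Arr V"
  shows "f \<otimes> g \<in> Arr V" "Dom V (f \<otimes> g) = Dom V f \<odot> Dom V g" "Cod V (f \<otimes> g) = Cod V f \<odot> Cod V g"
  using tens_hom[of f "Dom V f" "Cod V f" g "Dom V g" "Cod V g"] assms by (auto simp: hom_def)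

lemma interchange:
  assumes "f \<in> Arr V" "f' \<in> Arr V" "g \<in> Arr V" "g' \<in> Arr V" "Dom V f' = Cod V f" "Dom V g' = Cod V g"
  shows "(f' \<otimes> g') \<cdot> (f \<otimes> g) = (f' \<cdot> f) \<otimes> (g' \<cdot> g)"
proof -
  have "\<forall>X X' X'' Y Y' Y''.
        \<forall>f \<in> hom V X X'. \<forall>f' \<in> hom V X' X''. \<forall>g \<in> hom V Y Y'. \<forall>g' \<in> hom V Y' Y''.
        (f' \<cdot> f) \<otimes> (g' \<cdot> g) = (f' \<otimes> g') \<cdot> (f \<otimes> g)"
    using smc unfolding sm_closed_category_def by (elim conjE)
  from this[rule_format, OF homI[OF assms(1) refl refl] homI[OF assms(2) _ refl]
      homI[OF assms(3) refl refl] homI[OF assms(4) _ refl]]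
  show ?thesis using assms by simp
qed

text \<open>Right association hides the two tensors in front of the tail \<open>h\<close>; this is
  interchange in the form that simplification meets.\<close>

lemma interchange' [simp]:
  assumes "f \<in> Arr V" "f' \<in> Arr V" "g \<in> Arr V" "g' \<in> Arr V" "Dom V f' = Cod V f" "Dom V g' = Cod V g"
    "h \<in> Arr V" "Cod V h = Dom V f \<odot> Dom V g"
  shows "(f' \<otimes> g') \<cdot> ((f \<otimes> g) \<cdot> h) = ((f' \<cdot> f) \<otimes> (g' \<cdot> g)) \<cdot> h"
  using comp_reduce[OF interchange, of f f' g g' h] assms by simp

declare interchange [simp]

lemma assoc_hom: "X \<in> Obj V \<Longrightarrow> Y \<in> Obj V \<Longrightarrow> Z \<in> Obj V \<Longrightarrow>
    assoc V X Y Z \<in> hom V ((X \<odot> Y) \<odot> Z) (X \<odot> (Y \<odot> Z))"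
  and assoc_iso [simp]: "X \<in> Obj V \<Longrightarrow> Y \<in> Obj V \<Longrightarrow> Z \<in> Obj V \<Longrightarrow> iso V (assoc V X Y Z)"
  using smc by (simp_all add: sm_closed_category_def)

lemma assoc_Arr [simp]:
  assumes "X \<in> Obj V" "Y \<in> Obj V" "Z \<in> Obj V"
  shows "assoc V X Y Z \<in> Arr V" "Dom V (assoc V X Y Z) = (X \<odot> Y) \<odot> Z" "Cod V (assoc V X Y Z) = X \<odot> (Y \<odot> Z)"
  using assoc_hom[OF assms] by (auto simp: hom_def)

lemma lunit_Arr [simp]:
  assumes "X \<in> Obj V"
  shows "lunit V X \<in> Arr V" "Dom V (lunit V X) = \<I> \<odot> X" "Cod V (lunit V X) = X" "iso V (lunit V X)"
  using smc assms by (auto simp: sm_closed_category_def hom_def)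

lemma runit_Arr [simp]:
  assumes "X \<in> Obj V"
  shows "runit V X \<in> Arr V" "Dom V (runit V X) = X \<odot> \<I>" "Cod V (runit V X) = X" "iso V (runit V X)"
  using smc assms by (auto simp: sm_closed_category_def hom_def)

lemma symm_Arr [simp]:
  assumes "X \<in> Obj V" "Y \<in> Obj V"
  shows "symm V X Y \<in> Arr V" "Dom V (symm V X Y) = X \<odot> Y" "Cod V (symm V X Y) = Y \<odot> X"
    "symm V Y X \<cdot> symm V X Y = \<one> (X \<odot> Y)"
  using smc assms by (auto simp: sm_closed_category_def hom_def)

lemma symm_iso [simp]: "X \<in> Obj V \<Longrightarrow> Y \<in> Obj V \<Longrightarrow> iso V (symm V X Y)"
  unfolding iso_def by (rule exI[of _ "symm V Y X"]) (simp add: inverse_arr_def hom_def)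

lemma assoc_nat:
  assumes "f \<in> hom V X X'" "g \<in> hom V Y Y'" "h \<in> hom V Z Z'"
  shows "assoc V X' Y' Z' \<cdot> ((f \<otimes> g) \<otimes> h) = (f \<otimes> (g \<otimes> h)) \<cdot> assoc V X Y Z"
  using smc assms by (simp only: sm_closed_category_def)

lemma lunit_nat: "f \<in> hom V X X' \<Longrightarrow> lunit V X' \<cdot> (\<one> \<I> \<otimes> f) = f \<cdot> lunit V X"
  and runit_nat: "f \<in> hom V X X' \<Longrightarrow> runit V X' \<cdot> (f \<otimes> \<one> \<I>) = f \<cdot> runit V X"
  using smc by (simp_all only: sm_closed_category_def)

lemma symm_nat:
  assumes "f \<in> hom V X X'" "g \<in> hom V Y Y'"
  shows "symm V X' Y' \<cdot> (f \<otimes> g) = (g \<otimes> f) \<cdot> symm V X Y"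
  using smc assms by (simp only: sm_closed_category_def)

lemma pentagon:
  assumes "W \<in> Obj V" "X \<in> Obj V" "Y \<in> Obj V" "Z \<in> Obj V"
  shows "assoc V W X (Y \<odot> Z) \<cdot> assoc V (W \<odot> X) Y Z =
        (\<one> W \<otimes> assoc V X Y Z) \<cdot> (assoc V W (X \<odot> Y) Z \<cdot> (assoc V W X Y \<otimes> \<one> Z))"
proof -
  have "assoc V W X (Y \<odot> Z) \<cdot> assoc V (W \<odot> X) Y Z =
        (\<one> W \<otimes> assoc V X Y Z) \<cdot> assoc V W (X \<odot> Y) Z \<cdot> (assoc V W X Y \<otimes> \<one> Z)"
    using smc assms by (simp only: sm_closed_category_def)
  then show ?thesis using assms by simp
qed

lemma triangle:
  assumes "X \<in> Obj V" "Y \<in> Obj V"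
  shows "(\<one> X \<otimes> lunit V Y) \<cdot> assoc V X \<I> Y = runit V X \<otimes> \<one> Y"
  using smc assms by (simp only: sm_closed_category_def)

lemma hexagon:
  assumes "X \<in> Obj V" "Y \<in> Obj V" "Z \<in> Obj V"
  shows "assoc V Y Z X \<cdot> (symm V X (Y \<odot> Z) \<cdot> assoc V X Y Z) =
        (\<one> Y \<otimes> symm V X Z) \<cdot> (assoc V Y X Z \<cdot> (symm V X Y \<otimes> \<one> Z))"
proof -
  have "assoc V Y Z X \<cdot> symm V X (Y \<odot> Z) \<cdot> assoc V X Y Z =
        (\<one> Y \<otimes> symm V X Z) \<cdot> assoc V Y X Z \<cdot> (symm V X Y \<otimes> \<one> Z)"
    using smc assms by (simp only: sm_closed_category_def)
  then show ?thesis using assms by simp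
qed

section \<open>Coherence of the unit constraints, derived from pentagon, triangle and
  hexagon\<close>

lemma iso_tens:
  assumes "iso V f" "iso V g" shows "iso V (f \<otimes> g)"
  unfolding iso_def
  by (rule exI[of _ "inv_arr V f \<otimes> inv_arr V g"]) (use assms in \<open>simp add: inverse_arr_def hom_def\<close>)

text \<open>Naturality of \<open>lunit\<close> makes tensoring with the unit isomorphic to the
  identity functor, hence faithful. This and its mirror image are the cancellations behind the
  coherence laws below.\<close>

lemma tens_unit_cancel:
  assumes "\<one> \<I> \<otimes> f = \<one> \<I> \<otimes> g" "f \<in> hom V X Y" "g \<in> hom V X Y" shows "f = g"
  using lunit_nat[OF assms(2)] lunit_nat[OF assms(3)] assms
  by (intro iso_cancel_right[of f "lunit V X" g]) (auto simp: hom_def)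

lemma unit_tens_cancel:
  assumes "f \<otimes> \<one> \<I> = g \<otimes> \<one> \<I>" "f \<in> hom V X Y" "g \<in> hom V X Y" shows "f = g"
  using runit_nat[OF assms(2)] runit_nat[OF assms(3)] assms
  by (intro iso_cancel_right[of f "runit V X" g]) (auto simp: hom_def)

text \<open>Kelly's consequence of pentagon and triangle. Tensored with \<I> on the left and
  composed with the isomorphism \<open>?z\<close>, the left side contains one side of the pentagon
  for \<I>, \<I>, X, Y; two triangles and naturality of the associator do the rest.\<close>

lemma lunit_tens:
  assumes X: "X \<in> Obj V" and Y: "Y \<in> Obj V"
  shows "lunit V (X \<odot> Y) \<cdot> assoc V \<I> X Y = lunit V X \<otimes> \<one> Y"
proof (rule tens_unit_cancel)
  let ?a = "assoc V"
  let ?z = "?a \<I> (\<I> \<odot> X) Y \<cdot> (?a \<I> \<I> X \<otimes> \<one> Y)"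
  have z: "iso V ?z" using X Y by (intro iso_comp iso_tens) auto
  have "(\<one> \<I> \<otimes> (lunit V (X \<odot> Y) \<cdot> ?a \<I> X Y)) \<cdot> ?z
      = (\<one> \<I> \<otimes> lunit V (X \<odot> Y)) \<cdot> ((\<one> \<I> \<otimes> ?a \<I> X Y) \<cdot> ?z)"
    using X Y by simp
  also have "\<dots> = (\<one> \<I> \<otimes> lunit V (X \<odot> Y)) \<cdot> (?a \<I> \<I> (X \<odot> Y) \<cdot> ?a (\<I> \<odot> \<I>) X Y)"
    using X Y by (simp only: pentagon unit_Obj)
  also have "\<dots> = (runit V \<I> \<otimes> \<one> (X \<odot> Y)) \<cdot> ?a (\<I> \<odot> \<I>) X Y"
    using X Y comp_reduce[OF triangle[of \<I> "X \<odot> Y"], of "?a (\<I> \<odot> \<I>) X Y"] by simp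
  also have "\<dots> = ?a \<I> X Y \<cdot> ((runit V \<I> \<otimes> \<one> X) \<otimes> \<one> Y)"
    using X Y assoc_nat[of "runit V \<I>" "\<I> \<odot> \<I>" \<I> "\<one> X" X X "\<one> Y" Y Y] by (simp add: hom_def)
  also have "\<dots> = ?a \<I> X Y \<cdot> (((\<one> \<I> \<otimes> lunit V X) \<otimes> \<one> Y) \<cdot> (?a \<I> \<I> X \<otimes> \<one> Y))"
    using X Y triangle[of \<I> X] by simp
  also have "\<dots> = (\<one> \<I> \<otimes> (lunit V X \<otimes> \<one> Y)) \<cdot> ?z"
    using X Y comp_permute[OF assoc_nat[of "\<one> \<I>" \<I> \<I> "lunit V X" "\<I> \<odot> X" X "\<one> Y" Y Y], of "?a \<I> \<I> X \<otimes> \<one> Y"]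
    by (simp add: hom_def)
  finally show "\<one> \<I> \<otimes> (lunit V (X \<odot> Y) \<cdot> ?a \<I> X Y) = \<one> \<I> \<otimes> (lunit V X \<otimes> \<one> Y)"
    using X Y z by (elim iso_cancel_right) auto
qed (use X Y in \<open>auto simp: hom_def\<close>)

text \<open>Naturality of \<open>lunit\<close> at itself identifies
  \<open>\<one> \<I> \<otimes> lunit V \<I>\<close> with the left unit at
  \<open>\<I> \<odot> \<I>\<close>; then \<open>lunit_tens\<close> and the triangle evaluate the
  same composite in two ways.\<close>

lemma lunit_eq_runit: "lunit V \<I> = runit V \<I>"
proof (rule unit_tens_cancel)
  have "lunit V \<I> \<cdot> (\<one> \<I> \<otimes> lunit V \<I>) = lunit V \<I> \<cdot> lunit V (\<I> \<odot> \<I>)"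
    by (rule lunit_nat) (simp add: hom_def)
  then have "\<one> \<I> \<otimes> lunit V \<I> = lunit V (\<I> \<odot> \<I>)"
    by (rule iso_cancel_left) auto
  then show "lunit V \<I> \<otimes> \<one> \<I> = runit V \<I> \<otimes> \<one> \<I>"
    using lunit_tens[of \<I> \<I>] triangle[of \<I> \<I>] by simp
qed (auto simp: hom_def)

text \<open>The hexagon at X, \<I>, \<I> relates the two unit constraints. Everything is composed
  with the isomorphism \<open>symm V X \<I>\<close>, cancelled at the end, so that the symmetries
  can be moved by naturality.\<close>

lemma runit_eq:
  assumes X: "X \<in> Obj V" shows "runit V X = lunit V X \<cdot> symm V X \<I>"
proof (rule unit_tens_cancel)
  let ?a = "assoc V" and ?s = "symm V"
  have "?s X \<I> \<cdot> (runit V X \<otimes> \<one> \<I>) = ?s X \<I> \<cdot> ((\<one> X \<otimes> lunit V \<I>) \<cdot> ?a X \<I> \<I>)"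
    using X by (simp only: triangle unit_Obj)
  also have "\<dots> = (lunit V \<I> \<otimes> \<one> X) \<cdot> (?s X (\<I> \<odot> \<I>) \<cdot> ?a X \<I> \<I>)"
    using X by (intro comp_permute symm_nat) (auto simp: hom_def)
  also have "\<dots> = lunit V (\<I> \<odot> X) \<cdot> (?a \<I> \<I> X \<cdot> (?s X (\<I> \<odot> \<I>) \<cdot> ?a X \<I> \<I>))"
    using X by (intro comp_reduce[symmetric] lunit_tens) auto
  also have "\<dots> = lunit V (\<I> \<odot> X) \<cdot> ((\<one> \<I> \<otimes> ?s X \<I>) \<cdot> (?a \<I> X \<I> \<cdot> (?s X \<I> \<otimes> \<one> \<I>)))"
    using X by (simp only: hexagon unit_Obj)
  also have "\<dots> = ?s X \<I> \<cdot> (lunit V (X \<odot> \<I>) \<cdot> (?a \<I> X \<I> \<cdot> (?s X \<I> \<otimes> \<one> \<I>)))"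
    using X by (intro comp_permute lunit_nat) (auto simp: hom_def)
  also have "\<dots> = ?s X \<I> \<cdot> ((lunit V X \<otimes> \<one> \<I>) \<cdot> (?s X \<I> \<otimes> \<one> \<I>))"
    using X by (subst comp_reduce[OF lunit_tens]) auto
  finally have "?s X \<I> \<cdot> (runit V X \<otimes> \<one> \<I>) = ?s X \<I> \<cdot> ((lunit V X \<cdot> ?s X \<I>) \<otimes> \<one> \<I>)"
    using X by simp
  then show "runit V X \<otimes> \<one> \<I> = (lunit V X \<cdot> ?s X \<I>) \<otimes> \<one> \<I>"
    by (rule iso_cancel_left) (use X in auto)
qed (use X in \<open>auto simp: hom_def\<close>)

end

section \<open>Internal homs and the self-enrichment\<close>

context smc
begin

lemma ihom_Obj [simp]: "X \<in> Obj V \<Longrightarrow> Y \<in> Obj V \<Longrightarrow> ihom V X Y \<in> Obj V"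
  and evl_hom: "X \<in> Obj V \<Longrightarrow> Y \<in> Obj V \<Longrightarrow> evl V X Y \<in> hom V (ihom V X Y \<odot> X) Y"
  using smc by (simp_all add: sm_closed_category_def)

lemma evl_Arr [simp]:
  assumes "X \<in> Obj V" "Y \<in> Obj V"
  shows "evl V X Y \<in> Arr V" "Dom V (evl V X Y) = ihom V X Y \<odot> X" "Cod V (evl V X Y) = Y"
  using evl_hom[OF assms] by (auto simp: hom_def)

lemma curry_ex1:
  assumes "X \<in> Obj V" "Y \<in> Obj V" "Z \<in> Obj V" "f \<in> hom V (Z \<odot> X) Y"
  shows "\<exists>!g. g \<in> hom V Z (ihom V X Y) \<and> evl V X Y \<cdot> (g \<otimes> \<one> X) = f"
proof -
  have "\<forall>X \<in> Obj V. \<forall>Y \<in> Obj V.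
        ihom V X Y \<in> Obj V \<and> evl V X Y \<in> hom V (ihom V X Y \<odot>\<^bsub>V\<^esub> X) Y \<and>
        (\<forall>Z \<in> Obj V. \<forall>f \<in> hom V (Z \<odot>\<^bsub>V\<^esub> X) Y.
           \<exists>!g. g \<in> hom V Z (ihom V X Y) \<and> evl V X Y \<cdot>\<^bsub>V\<^esub> (g \<otimes>\<^bsub>V\<^esub> Ide V X) = f)"
    using smc unfolding sm_closed_category_def by (elim conjE)
  then show ?thesis using assms by blast
qed

lemma vcurry_hom:
  assumes "X \<in> Obj V" "Y \<in> Obj V" "Z \<in> Obj V" "f \<in> hom V (Z \<odot> X) Y"
  shows "vcurry V Z X Y f \<in> hom V Z (ihom V X Y)" "evl V X Y \<cdot> (vcurry V Z X Y f \<otimes> \<one> X) = f"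
  using theI'[OF curry_ex1[OF assms]] by (simp_all add: vcurry_def)

lemma vcurry_Arr [simp]:
  assumes "X \<in> Obj V" "Y \<in> Obj V" "Z \<in> Obj V" "f \<in> Arr V" "Dom V f = Z \<odot> X" "Cod V f = Y"
  shows "vcurry V Z X Y f \<in> Arr V" "Dom V (vcurry V Z X Y f) = Z" "Cod V (vcurry V Z X Y f) = ihom V X Y"
    "evl V X Y \<cdot> (vcurry V Z X Y f \<otimes> \<one> X) = f"
  using vcurry_hom[of X Y Z f] assms by (auto simp: hom_def)

text \<open>Uniqueness of currying as a proof principle: most identities between arrows into an
  internal hom are established below by evaluating both sides.\<close>

lemma curry_inj:
  assumes "evl V X Y \<cdot> (g \<otimes> \<one> X) = evl V X Y \<cdot> (h \<otimes> \<one> X)"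
    "g \<in> hom V Z (ihom V X Y)" "h \<in> hom V Z (ihom V X Y)" "X \<in> Obj V" "Y \<in> Obj V"
  shows "g = h"
proof -
  have Z: "Z \<in> Obj V" using assms(2) hom_Obj by blast
  have "evl V X Y \<cdot> (g \<otimes> \<one> X) \<in> hom V (Z \<odot> X) Y" using assms(2,4,5) by (auto simp: hom_def)
  from curry_ex1[OF assms(4,5) Z this] show ?thesis using assms by metis
qed

lemma vcurry_eqI:
  assumes "evl V X Y \<cdot> (g \<otimes> \<one> X) = f" "g \<in> hom V Z (ihom V X Y)" "X \<in> Obj V" "Y \<in> Obj V"
  shows "vcurry V Z X Y f = g"
proof -
  have Z: "Z \<in> Obj V" using assms(2) hom_Obj by blast
  have "f \<in> hom V (Z \<odot> X) Y" using assms by (auto simp: hom_def)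
  from curry_inj[of X Y "vcurry V Z X Y f" g] vcurry_hom[OF assms(3,4) Z this] assms show ?thesis by simp
qed

text \<open>\<open>ipost X f\<close> is [X, f], the action on arrows of the right adjoint
  [X, -].\<close>

definition ipost where
  "ipost X f = vcurry V (ihom V X (Dom V f)) X (Cod V f) (f \<cdot> evl V X (Dom V f))"

lemma ipost_Arr [simp]:
  assumes "X \<in> Obj V" "f \<in> Arr V"
  shows "ipost X f \<in> Arr V" "Dom V (ipost X f) = ihom V X (Dom V f)" "Cod V (ipost X f) = ihom V X (Cod V f)"
  using assms by (simp_all add: ipost_def)

lemma evl_ipost:
  assumes "X \<in> Obj V" "f \<in> hom V A B"
  shows "evl V X B \<cdot> (ipost X f \<otimes> \<one> X) = f \<cdot> evl V X A"
  using assms by (auto simp: hom_def ipost_def)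

text \<open>Naturality of the tensor-hom adjunction in the codomain.\<close>

lemma evl_tens:
  assumes "X \<in> Obj V" "g \<in> hom V Z (ihom V X A)" "f \<in> hom V A B"
  shows "evl V X B \<cdot> ((ipost X f \<cdot> g) \<otimes> \<one> X) = f \<cdot> (evl V X A \<cdot> (g \<otimes> \<one> X))"
proof -
  have "evl V X B \<cdot> ((ipost X f \<cdot> g) \<otimes> \<one> X) = evl V X B \<cdot> ((ipost X f \<otimes> \<one> X) \<cdot> (g \<otimes> \<one> X))"
    using assms by (auto simp: hom_def)
  also have "\<dots> = f \<cdot> (evl V X A \<cdot> (g \<otimes> \<one> X))"
    using assms by (intro comp_permute[OF evl_ipost]) (auto simp: hom_def)
  finally show ?thesis .
qed

lemma ipost_comp:
  assumes "X \<in> Obj V" "f \<in> hom V A B" "g \<in> hom V B C"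
  shows "ipost X (g \<cdot> f) = ipost X g \<cdot> ipost X f"
proof (rule curry_inj)
  have O: "A \<in> Obj V" "B \<in> Obj V" "C \<in> Obj V" using assms hom_Obj by blast+
  note t = O assms(1) homD[OF assms(2)] homD[OF assms(3)]
  have "evl V X C \<cdot> ((ipost X g \<cdot> ipost X f) \<otimes> \<one> X) = g \<cdot> (evl V X B \<cdot> (ipost X f \<otimes> \<one> X))"
    using t by (intro evl_tens) (simp_all add: hom_def)
  also have "\<dots> = g \<cdot> (f \<cdot> evl V X A)" by (simp only: evl_ipost[OF assms(1,2)])
  also have "\<dots> = evl V X C \<cdot> (ipost X (g \<cdot> f) \<otimes> \<one> X)"
    using t by (subst evl_ipost[of X "g \<cdot> f" A C]) (simp_all add: hom_def)
  finally show "evl V X C \<cdot> (ipost X (g \<cdot> f) \<otimes> \<one> X) = evl V X C \<cdot> ((ipost X g \<cdot> ipost X f) \<otimes> \<one> X)" ..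
  show "C \<in> Obj V" by fact
qed (use assms in \<open>auto simp: hom_def\<close>)

lemma ipost_Ide:
  assumes "X \<in> Obj V" "A \<in> Obj V" shows "ipost X (\<one> A) = \<one> (ihom V X A)"
proof (rule curry_inj)
  show "evl V X A \<cdot> (ipost X (\<one> A) \<otimes> \<one> X) = evl V X A \<cdot> (\<one> (ihom V X A) \<otimes> \<one> X)"
    using assms by (subst evl_ipost[of X "\<one> A" A A]) (simp_all add: hom_def)
qed (use assms in \<open>simp_all add: hom_def\<close>)

section \<open>Names of arrows and the enrichment of \<V> in itself\<close>

lemma name_of_hom:
  assumes "f \<in> hom V X Y" shows "name_of V f \<in> hom V \<I> (ihom V X Y)"
    "evl V X Y \<cdot> (name_of V f \<otimes> \<one> X) = f \<cdot> lunit V X"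
  using assms by (auto simp: hom_def name_of_def)

lemma arrow_of_hom:
  assumes "x \<in> hom V \<I> (ihom V X Y)" "X \<in> Obj V" "Y \<in> Obj V" shows "arrow_of V X Y x \<in> hom V X Y"
    "arrow_of V X Y x \<cdot> lunit V X = evl V X Y \<cdot> (x \<otimes> \<one> X)"
  using assms by (auto simp: hom_def arrow_of_def)

lemma arrow_of_name:
  assumes "f \<in> hom V X Y" shows "arrow_of V X Y (name_of V f) = f"
proof -
  note t = homD[OF assms] hom_Obj[OF assms] homD[OF name_of_hom(1)[OF assms]]
  have "arrow_of V X Y (name_of V f) = (evl V X Y \<cdot> (name_of V f \<otimes> \<one> X)) \<cdot> inv_arr V (lunit V X)"
    using t by (simp add: arrow_of_def)
  also have "\<dots> = (f \<cdot> lunit V X) \<cdot> inv_arr V (lunit V X)" by (simp only: name_of_hom[OF assms])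
  finally show ?thesis using t by simp
qed

lemma name_of_arrow:
  assumes "x \<in> hom V \<I> (ihom V X Y)" "X \<in> Obj V" "Y \<in> Obj V"
  shows "name_of V (arrow_of V X Y x) = x"
proof (rule curry_inj)
  show "evl V X Y \<cdot> (name_of V (arrow_of V X Y x) \<otimes> \<one> X) = evl V X Y \<cdot> (x \<otimes> \<one> X)"
    by (simp only: name_of_hom(2)[OF arrow_of_hom(1)[OF assms]] arrow_of_hom(2)[OF assms])
qed (use name_of_hom(1)[OF arrow_of_hom(1)[OF assms]] assms in simp_all)

lemma arrow_of_inj:
  assumes "arrow_of V X Y x = arrow_of V X Y y" "x \<in> hom V \<I> (ihom V X Y)" "y \<in> hom V \<I> (ihom V X Y)"
    "X \<in> Obj V" "Y \<in> Obj V"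
  shows "x = y"
  using name_of_arrow assms by metis

lemma self_simps [simp]: "VObj (self V) = Obj V" "VHom (self V) = ihom V"
  by (simp_all add: self_def)

lemma self_comp [simp]:
  assumes "X \<in> Obj V" "Y \<in> Obj V" "Z \<in> Obj V"
  shows "VComp (self V) X Y Z \<in> Arr V" "Dom V (VComp (self V) X Y Z) = ihom V Y Z \<odot> ihom V X Y"
    "Cod V (VComp (self V) X Y Z) = ihom V X Z"
  using assms by (simp_all add: self_def)

lemma evl_self_comp:
  assumes "X \<in> Obj V" "Y \<in> Obj V" "Z \<in> Obj V"
  shows "evl V X Z \<cdot> (VComp (self V) X Y Z \<otimes> \<one> X) =
    evl V Y Z \<cdot> ((\<one> (ihom V Y Z) \<otimes> evl V X Y) \<cdot> assoc V (ihom V Y Z) (ihom V X Y) X)"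
  using assms by (simp add: self_def)

text \<open>The defining property of composition in \<open>self V\<close>, taken at generalized
  elements \<open>g\<close> and \<open>f\<close>. This is the rule by which composites in
  \<open>self V\<close> are computed.\<close>

lemma evl_self_comp_tens:
  assumes "X \<in> Obj V" "Y \<in> Obj V" "Z \<in> Obj V" "g \<in> hom V W (ihom V Y Z)" "f \<in> hom V W' (ihom V X Y)"
  shows "evl V X Z \<cdot> ((VComp (self V) X Y Z \<cdot> (g \<otimes> f)) \<otimes> \<one> X) =
    evl V Y Z \<cdot> ((g \<otimes> (evl V X Y \<cdot> (f \<otimes> \<one> X))) \<cdot> assoc V W W' X)"
proof -
  have O: "W \<in> Obj V" "W' \<in> Obj V" using assms hom_Obj by blast+
  note t = assms(1-3) O homD[OF assms(4)] homD[OF assms(5)]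
  have "evl V X Z \<cdot> ((VComp (self V) X Y Z \<cdot> (g \<otimes> f)) \<otimes> \<one> X) =
     evl V X Z \<cdot> ((VComp (self V) X Y Z \<otimes> \<one> X) \<cdot> ((g \<otimes> f) \<otimes> \<one> X))"
    using t by simp
  also have "\<dots> = (evl V Y Z \<cdot> ((\<one> (ihom V Y Z) \<otimes> evl V X Y) \<cdot> assoc V (ihom V Y Z) (ihom V X Y) X)) \<cdot> ((g \<otimes> f) \<otimes> \<one> X)"
    using t by (intro comp_reduce[OF evl_self_comp]) auto
  also have "\<dots> = evl V Y Z \<cdot> ((\<one> (ihom V Y Z) \<otimes> evl V X Y) \<cdot> (assoc V (ihom V Y Z) (ihom V X Y) X \<cdot> ((g \<otimes> f) \<otimes> \<one> X)))"
    using t by simp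
  also have "\<dots> = evl V Y Z \<cdot> ((\<one> (ihom V Y Z) \<otimes> evl V X Y) \<cdot> ((g \<otimes> (f \<otimes> \<one> X)) \<cdot> assoc V W W' X))"
    using t assoc_nat[OF assms(4,5), of "\<one> X" X X] by (simp add: hom_def)
  also have "\<dots> = evl V Y Z \<cdot> ((g \<otimes> (evl V X Y \<cdot> (f \<otimes> \<one> X))) \<cdot> assoc V W W' X)"
    using t by simp
  finally show ?thesis .
qed

lemma self_ide [simp]:
  assumes "X \<in> Obj V"
  shows "VIde (self V) X \<in> Arr V" "Dom V (VIde (self V) X) = \<I>" "Cod V (VIde (self V) X) = ihom V X X"
    "evl V X X \<cdot> (VIde (self V) X \<otimes> \<one> X) = lunit V X"
  using assms by (simp_all add: self_def)

lemma arrow_of_ide: "X \<in> Obj V \<Longrightarrow> arrow_of V X X (VIde (self V) X) = \<one> X"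
  by (simp add: arrow_of_def)

lemma assoc_inv_lunit:
  assumes "X \<in> Obj V"
  shows "assoc V \<I> \<I> X \<cdot> (inv_arr V (lunit V \<I>) \<otimes> \<one> X) = \<one> \<I> \<otimes> inv_arr V (lunit V X)"
proof (rule iso_cancel_left)
  show "iso V (\<one> \<I> \<otimes> lunit V X)" using assms by (intro iso_tens) auto
  show "(\<one> \<I> \<otimes> lunit V X) \<cdot> (assoc V \<I> \<I> X \<cdot> (inv_arr V (lunit V \<I>) \<otimes> \<one> X)) =
    (\<one> \<I> \<otimes> lunit V X) \<cdot> (\<one> \<I> \<otimes> inv_arr V (lunit V X))"
    using assms comp_reduce[OF triangle[of \<I> X], of "inv_arr V (lunit V \<I>) \<otimes> \<one> X"]
    by (simp add: lunit_eq_runit)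
qed (use assms in auto)

lemma lunit_inv_nat:
  assumes "f \<in> hom V X Y"
  shows "inv_arr V (lunit V Y) \<cdot> f = (\<one> \<I> \<otimes> f) \<cdot> inv_arr V (lunit V X)"
proof (rule iso_cancel_left[of "lunit V Y"])
  have O: "X \<in> Obj V" "Y \<in> Obj V" using assms hom_Obj by blast+
  show "lunit V Y \<cdot> (inv_arr V (lunit V Y) \<cdot> f) = lunit V Y \<cdot> ((\<one> \<I> \<otimes> f) \<cdot> inv_arr V (lunit V X))"
    using O homD[OF assms] comp_permute[OF lunit_nat[OF assms], of "inv_arr V (lunit V X)"] by simp
qed (use assms hom_Obj[OF assms] in \<open>auto simp: hom_def\<close>)

lemma runit_inv_nat:
  assumes "f \<in> hom V X Y"
  shows "inv_arr V (runit V Y) \<cdot> f = (f \<otimes> \<one> \<I>) \<cdot> inv_arr V (runit V X)"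
proof (rule iso_cancel_left[of "runit V Y"])
  have O: "X \<in> Obj V" "Y \<in> Obj V" using assms hom_Obj by blast+
  show "runit V Y \<cdot> (inv_arr V (runit V Y) \<cdot> f) = runit V Y \<cdot> ((f \<otimes> \<one> \<I>) \<cdot> inv_arr V (runit V X))"
    using O homD[OF assms] comp_permute[OF runit_nat[OF assms], of "inv_arr V (runit V X)"] by simp
qed (use assms hom_Obj[OF assms] in \<open>auto simp: hom_def\<close>)

text \<open>Together with \<open>arrow_of_ide\<close> and the bijection between arrows and names,
  this identifies the underlying category of \<open>self V\<close> with \<V> itself.\<close>

lemma arrow_of_el_comp:
  assumes "X \<in> Obj V" "Y \<in> Obj V" "Z \<in> Obj V" and g: "g \<in> hom V \<I> (ihom V Y Z)" and f: "f \<in> hom V \<I> (ihom V X Y)"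
  shows "arrow_of V X Z (el_comp V (self V) X Y Z g f) = arrow_of V Y Z g \<cdot> arrow_of V X Y f"
proof -
  let ?l = "inv_arr V (lunit V \<I>)" and ?lX = "inv_arr V (lunit V X)"
  note t = assms(1-3) homD[OF g] homD[OF f]
  have a: "arrow_of V X Y f \<in> hom V X Y" using arrow_of_hom f assms by simp
  have "arrow_of V X Z (el_comp V (self V) X Y Z g f) =
     (evl V X Z \<cdot> ((VComp (self V) X Y Z \<cdot> (g \<otimes> f)) \<otimes> \<one> X)) \<cdot> ((?l \<otimes> \<one> X) \<cdot> ?lX)"
    using t by (simp add: arrow_of_def el_comp_def)
  also have "\<dots> = evl V Y Z \<cdot> ((g \<otimes> (evl V X Y \<cdot> (f \<otimes> \<one> X))) \<cdot> ((assoc V \<I> \<I> X \<cdot> (?l \<otimes> \<one> X)) \<cdot> ?lX))"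
    using t by (subst evl_self_comp_tens[OF assms]) simp
  also have "\<dots> = evl V Y Z \<cdot> ((g \<otimes> (evl V X Y \<cdot> (f \<otimes> \<one> X))) \<cdot> ((\<one> \<I> \<otimes> ?lX) \<cdot> ?lX))"
    using t by (simp only: assoc_inv_lunit)
  also have "\<dots> = evl V Y Z \<cdot> ((g \<otimes> \<one> Y) \<cdot> ((\<one> \<I> \<otimes> arrow_of V X Y f) \<cdot> ?lX))"
    using t by (simp add: arrow_of_def)
  also have "\<dots> = evl V Y Z \<cdot> ((g \<otimes> \<one> Y) \<cdot> (inv_arr V (lunit V Y) \<cdot> arrow_of V X Y f))"
    by (simp only: lunit_inv_nat[OF a])
  also have "\<dots> = arrow_of V Y Z g \<cdot> arrow_of V X Y f"
    using t homD[OF a] by (simp add: arrow_of_def)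
  finally show ?thesis .
qed

section \<open>Enriched categories, their points, and functors to \<V>\<close>

lemma vcatD:
  assumes "vcategory V C"
  shows "X \<in> VObj C \<Longrightarrow> Y \<in> VObj C \<Longrightarrow> VHom C X Y \<in> Obj V"
    and "X \<in> VObj C \<Longrightarrow> VIde C X \<in> hom V \<I> (VHom C X X)"
    and "X \<in> VObj C \<Longrightarrow> Y \<in> VObj C \<Longrightarrow> Z \<in> VObj C \<Longrightarrow>
        VComp C X Y Z \<in> hom V (VHom C Y Z \<odot> VHom C X Y) (VHom C X Z)"
  using assms unfolding vcategory_def by blast+

lemma vcat_Arr [simp]:
  assumes "vcategory V C" "X \<in> VObj C" "Y \<in> VObj C"
  shows "VHom C X Y \<in> Obj V" "VIde C X \<in> Arr V" "Dom V (VIde C X) = \<I>" "Cod V (VIde C X) = VHom C X X"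
    "Z \<in> VObj C \<Longrightarrow> VComp C X Y Z \<in> Arr V"
    "Z \<in> VObj C \<Longrightarrow> Dom V (VComp C X Y Z) = VHom C Y Z \<odot> VHom C X Y"
    "Z \<in> VObj C \<Longrightarrow> Cod V (VComp C X Y Z) = VHom C X Z"
  using vcatD[OF assms(1)] assms by (auto simp: hom_def)

lemma vcat_assoc:
  assumes "vcategory V C" "W \<in> VObj C" "X \<in> VObj C" "Y \<in> VObj C" "Z \<in> VObj C"
  shows "VComp C W Y Z \<cdot> ((\<one> (VHom C Y Z) \<otimes> VComp C W X Y) \<cdot>
          assoc V (VHom C Y Z) (VHom C X Y) (VHom C W X)) =
        VComp C W X Z \<cdot> (VComp C X Y Z \<otimes> \<one> (VHom C W X))"
proof -
  have "VComp C W Y Z \<cdot> (\<one> (VHom C Y Z) \<otimes> VComp C W X Y) \<cdot>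
          assoc V (VHom C Y Z) (VHom C X Y) (VHom C W X) =
        VComp C W X Z \<cdot> (VComp C X Y Z \<otimes> \<one> (VHom C W X))"
    using assms unfolding vcategory_def by blast
  then show ?thesis using assms by simp
qed

lemma el_comp_hom:
  assumes "vcategory V C" "X \<in> VObj C" "Y \<in> VObj C" "Z \<in> VObj C"
    "g \<in> hom V \<I> (VHom C Y Z)" "f \<in> hom V \<I> (VHom C X Y)"
  shows "el_comp V C X Y Z g f \<in> hom V \<I> (VHom C X Z)"
  using assms by (auto simp: hom_def el_comp_def)

lemma vpost_point:
  assumes "vcategory V C" "W \<in> VObj C" "X \<in> VObj C" "Y \<in> VObj C"
    "g \<in> hom V \<I> (VHom C X Y)" "f \<in> hom V \<I> (VHom C W X)"
  shows "vpost V C W X Y g \<cdot> f = el_comp V C W X Y g f"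
proof -
  note t = assms(1-4) homD[OF assms(5)] homD[OF assms(6)]
  have "vpost V C W X Y g \<cdot> f =
    VComp C W X Y \<cdot> ((g \<otimes> \<one> (VHom C W X)) \<cdot> (inv_arr V (lunit V (VHom C W X)) \<cdot> f))"
    using t by (simp add: vpost_def)
  also have "\<dots> = VComp C W X Y \<cdot> ((g \<otimes> \<one> (VHom C W X)) \<cdot> ((\<one> \<I> \<otimes> f) \<cdot> inv_arr V (lunit V \<I>)))"
    by (simp only: lunit_inv_nat[OF assms(6)])
  finally show ?thesis using t by (simp add: el_comp_def)
qed

lemma vpre_point:
  assumes "vcategory V C" "X \<in> VObj C" "Y \<in> VObj C" "Z \<in> VObj C"
    "g \<in> hom V \<I> (VHom C Y Z)" "f \<in> hom V \<I> (VHom C X Y)"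
  shows "vpre V C X Y Z f \<cdot> g = el_comp V C X Y Z g f"
proof -
  note t = assms(1-4) homD[OF assms(5)] homD[OF assms(6)]
  have "vpre V C X Y Z f \<cdot> g =
    VComp C X Y Z \<cdot> ((\<one> (VHom C Y Z) \<otimes> f) \<cdot> (inv_arr V (runit V (VHom C Y Z)) \<cdot> g))"
    using t by (simp add: vpre_def)
  also have "\<dots> = VComp C X Y Z \<cdot> ((\<one> (VHom C Y Z) \<otimes> f) \<cdot> ((g \<otimes> \<one> \<I>) \<cdot> inv_arr V (runit V \<I>)))"
    by (simp only: runit_inv_nat[OF assms(5)])
  \<comment> \<open>\<open>el_comp\<close> is normalised with the left unit, \<open>vpre\<close>
    with the right one; they agree at \<I>.\<close>
  finally show ?thesis using t by (simp add: el_comp_def lunit_eq_runit)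
qed

lemma vfunctorD:
  assumes "vfunctor V C D G"
  shows "vcategory V C" "vcategory V D" "G = mk_vfun C (FOb G) (FHom G)"
    "X \<in> VObj C \<Longrightarrow> FOb G X \<in> VObj D"
    "X \<in> VObj C \<Longrightarrow> Y \<in> VObj C \<Longrightarrow> FHom G X Y \<in> hom V (VHom C X Y) (VHom D (FOb G X) (FOb G Y))"
    "X \<in> VObj C \<Longrightarrow> FHom G X X \<cdot> VIde C X = VIde D (FOb G X)"
    "X \<in> VObj C \<Longrightarrow> Y \<in> VObj C \<Longrightarrow> Z \<in> VObj C \<Longrightarrow>
        FHom G X Z \<cdot> VComp C X Y Z = VComp D (FOb G X) (FOb G Y) (FOb G Z) \<cdot> (FHom G Y Z \<otimes> FHom G X Y)"
  using assms unfolding vfunctor_def by blast+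

lemma vfunctor_Arr [simp]:
  assumes "vfunctor V C D G" "X \<in> VObj C" "Y \<in> VObj C"
  shows "FOb G X \<in> VObj D" "FHom G X Y \<in> Arr V" "Dom V (FHom G X Y) = VHom C X Y"
    "Cod V (FHom G X Y) = VHom D (FOb G X) (FOb G Y)"
  using vfunctorD[OF assms(1)] assms by (auto simp: hom_def)

lemma vfunctor_el_comp:
  assumes G: "vfunctor V C D G" and "X \<in> VObj C" "Y \<in> VObj C" "Z \<in> VObj C"
    "g \<in> hom V \<I> (VHom C Y Z)" "f \<in> hom V \<I> (VHom C X Y)"
  shows "FHom G X Z \<cdot> el_comp V C X Y Z g f =
    el_comp V D (FOb G X) (FOb G Y) (FOb G Z) (FHom G Y Z \<cdot> g) (FHom G X Y \<cdot> f)"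
proof -
  note t = vfunctorD(1,2)[OF G] assms(1-4) homD[OF assms(5)] homD[OF assms(6)]
  have "FHom G X Z \<cdot> el_comp V C X Y Z g f =
      FHom G X Z \<cdot> (VComp C X Y Z \<cdot> ((g \<otimes> f) \<cdot> inv_arr V (lunit V \<I>)))"
    using t by (simp add: el_comp_def)
  also have "\<dots> = (VComp D (FOb G X) (FOb G Y) (FOb G Z) \<cdot> (FHom G Y Z \<otimes> FHom G X Y)) \<cdot> ((g \<otimes> f) \<cdot> inv_arr V (lunit V \<I>))"
    using t by (intro comp_reduce[OF vfunctorD(7)[OF G]]) auto
  also have "\<dots> = el_comp V D (FOb G X) (FOb G Y) (FOb G Z) (FHom G Y Z \<cdot> g) (FHom G X Y \<cdot> f)"
    using t by (simp add: el_comp_def)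
  finally show ?thesis .
qed

text \<open>Uncurried form of a \<V>-functor to \<V>: the action C(X,Y) \<otimes> GX \<rightarrow>
  GY. The functor laws become the unit and associativity laws of an action.\<close>

definition vact where
  "vact G X Y = evl V (FOb G X) (FOb G Y) \<cdot> (FHom G X Y \<otimes> \<one> (FOb G X))"

lemma vact_hom:
  assumes "vfunctor V C (self V) G" "X \<in> VObj C" "Y \<in> VObj C"
  shows "vact G X Y \<in> hom V (VHom C X Y \<odot> FOb G X) (FOb G Y)"
  using vfunctor_Arr[OF assms] vfunctor_Arr(1)[OF assms(1,3,2)] by (auto simp: hom_def vact_def)

lemma vact_Arr [simp]:
  assumes "vfunctor V C (self V) G" "X \<in> VObj C" "Y \<in> VObj C"
  shows "FOb G X \<in> Obj V" "vact G X Y \<in> Arr V" "Dom V (vact G X Y) = VHom C X Y \<odot> FOb G X" "Cod V (vact G X Y) = FOb G Y"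
  using vact_hom[OF assms] vfunctor_Arr(1)[OF assms] by (auto simp: hom_def)

lemma vact_unit:
  assumes "vfunctor V C (self V) G" "X \<in> VObj C"
  shows "vact G X X \<cdot> (VIde C X \<otimes> \<one> (FOb G X)) = lunit V (FOb G X)"
  using assms vfunctor_Arr[OF assms assms(2)] vfunctorD(1,6)[OF assms(1)]
  by (simp add: vact_def)

lemma vact_comp:
  assumes G: "vfunctor V C (self V) G" and "X \<in> VObj C" "Y \<in> VObj C" "Z \<in> VObj C"
  shows "vact G X Z \<cdot> (VComp C X Y Z \<otimes> \<one> (FOb G X)) =
     vact G Y Z \<cdot> ((\<one> (VHom C Y Z) \<otimes> vact G X Y) \<cdot> assoc V (VHom C Y Z) (VHom C X Y) (FOb G X))"
proof -
  have O: "FOb G X \<in> Obj V" "FOb G Y \<in> Obj V" "FOb G Z \<in> Obj V"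
    using vfunctor_Arr(1)[OF G] assms by auto
  note t = O assms vfunctorD(1)[OF G]
  have "vact G X Z \<cdot> (VComp C X Y Z \<otimes> \<one> (FOb G X))
      = evl V (FOb G X) (FOb G Z) \<cdot> ((FHom G X Z \<cdot> VComp C X Y Z) \<otimes> \<one> (FOb G X))"
    using t by (simp add: vact_def)
  also have "\<dots> = evl V (FOb G X) (FOb G Z) \<cdot>
      ((VComp (self V) (FOb G X) (FOb G Y) (FOb G Z) \<cdot> (FHom G Y Z \<otimes> FHom G X Y)) \<otimes> \<one> (FOb G X))"
    by (simp only: vfunctorD(7)[OF assms])
  also have "\<dots> = evl V (FOb G Y) (FOb G Z) \<cdot> ((FHom G Y Z \<otimes> vact G X Y) \<cdot> assoc V (VHom C Y Z) (VHom C X Y) (FOb G X))"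
    unfolding vact_def using t by (intro evl_self_comp_tens) (auto simp: hom_def)
  also have "\<dots> = vact G Y Z \<cdot> ((\<one> (VHom C Y Z) \<otimes> vact G X Y) \<cdot> assoc V (VHom C Y Z) (VHom C X Y) (FOb G X))"
    using t by (simp add: vact_def)
  finally show ?thesis .
qed

text \<open>Converse of \<open>vact_unit\<close> and \<open>vact_comp\<close>: a unital and
  associative action is curried to a \<V>-functor. The hypothesis on \<open>self V\<close> is what
  \<open>vfunctor\<close> demands of the codomain.\<close>

lemma vfunctor_of_act:
  fixes G
  assumes C: "vcategory V C" and S: "vcategory V (self V)"
    and G: "\<And>X. X \<in> VObj C \<Longrightarrow> G X \<in> Obj V"
    and h: "\<And>X Y. X \<in> VObj C \<Longrightarrow> Y \<in> VObj C \<Longrightarrow> \<alpha> X Y \<in> hom V (VHom C X Y \<odot> G X) (G Y)"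
    and u: "\<And>X. X \<in> VObj C \<Longrightarrow> \<alpha> X X \<cdot> (VIde C X \<otimes> \<one> (G X)) = lunit V (G X)"
    and c: "\<And>X Y Z. X \<in> VObj C \<Longrightarrow> Y \<in> VObj C \<Longrightarrow> Z \<in> VObj C \<Longrightarrow>
      \<alpha> X Z \<cdot> (VComp C X Y Z \<otimes> \<one> (G X)) =
     \<alpha> Y Z \<cdot> ((\<one> (VHom C Y Z) \<otimes> \<alpha> X Y) \<cdot> assoc V (VHom C Y Z) (VHom C X Y) (G X))"
  defines "H \<equiv> mk_vfun C G (\<lambda>X Y. vcurry V (VHom C X Y) (G X) (G Y) (\<alpha> X Y))"
  shows "vfunctor V C (self V) H" "\<And>X. X \<in> VObj C \<Longrightarrow> FOb H X = G X"
    "\<And>X Y. X \<in> VObj C \<Longrightarrow> Y \<in> VObj C \<Longrightarrow> vact H X Y = \<alpha> X Y"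
proof -
  have a [simp]: "\<alpha> X Y \<in> Arr V" "Dom V (\<alpha> X Y) = VHom C X Y \<odot> G X" "Cod V (\<alpha> X Y) = G Y"
    if "X \<in> VObj C" "Y \<in> VObj C" for X Y using h[OF that] by (auto simp: hom_def)
  note [simp] = G C
  have F [simp]: "FOb H X = G X" if "X \<in> VObj C" for X using that by (simp add: H_def mk_vfun_def)
  have FH: "FHom H X Y = vcurry V (VHom C X Y) (G X) (G Y) (\<alpha> X Y)" if "X \<in> VObj C" "Y \<in> VObj C" for X Y
    using that by (simp add: H_def mk_vfun_def)
  have ht [simp]: "FHom H X Y \<in> Arr V" "Dom V (FHom H X Y) = VHom C X Y" "Cod V (FHom H X Y) = ihom V (G X) (G Y)"
     "evl V (G X) (G Y) \<cdot> (FHom H X Y \<otimes> \<one> (G X)) = \<alpha> X Y" if "X \<in> VObj C" "Y \<in> VObj C" for X Y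
    using that by (simp_all add: FH)
  show act: "vact H X Y = \<alpha> X Y" if "X \<in> VObj C" "Y \<in> VObj C" for X Y
    using that by (simp add: vact_def)
  show "FOb H X = G X" if "X \<in> VObj C" for X using that by simp
  show "vfunctor V C (self V) H"
    unfolding vfunctor_def
  proof (intro conjI ballI)
    fix X Y Z assume O: "X \<in> VObj C" "Y \<in> VObj C" "Z \<in> VObj C"
    show "FHom H X Z \<cdot> VComp C X Y Z = VComp (self V) (FOb H X) (FOb H Y) (FOb H Z) \<cdot> (FHom H Y Z \<otimes> FHom H X Y)"
    proof (rule curry_inj)
      have "evl V (G X) (G Z) \<cdot> ((FHom H X Z \<cdot> VComp C X Y Z) \<otimes> \<one> (G X)) =
          evl V (G X) (G Z) \<cdot> ((FHom H X Z \<otimes> \<one> (G X)) \<cdot> (VComp C X Y Z \<otimes> \<one> (G X)))"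
        using O by simp
      also have "\<dots> = \<alpha> X Z \<cdot> (VComp C X Y Z \<otimes> \<one> (G X))"
        using O by (intro comp_reduce ht) auto
      also have "\<dots> = \<alpha> Y Z \<cdot> ((\<one> (VHom C Y Z) \<otimes> \<alpha> X Y) \<cdot> assoc V (VHom C Y Z) (VHom C X Y) (G X))"
        by (rule c[OF O])
      also have "\<dots> = evl V (G Y) (G Z) \<cdot> ((FHom H Y Z \<otimes> \<one> (G Y)) \<cdot> ((\<one> (VHom C Y Z) \<otimes> \<alpha> X Y) \<cdot> assoc V (VHom C Y Z) (VHom C X Y) (G X)))"
        using O by (intro comp_reduce[symmetric] ht) auto
      also have "\<dots> = evl V (G Y) (G Z) \<cdot> ((FHom H Y Z \<otimes> (evl V (G X) (G Y) \<cdot> (FHom H X Y \<otimes> \<one> (G X)))) \<cdot> assoc V (VHom C Y Z) (VHom C X Y) (G X))"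
        using O by simp
      also have "\<dots> = evl V (G X) (G Z) \<cdot> ((VComp (self V) (G X) (G Y) (G Z) \<cdot> (FHom H Y Z \<otimes> FHom H X Y)) \<otimes> \<one> (G X))"
        using O by (intro evl_self_comp_tens[symmetric]) (auto simp: hom_def)
      finally show "evl V (G X) (G Z) \<cdot> ((FHom H X Z \<cdot> VComp C X Y Z) \<otimes> \<one> (G X)) =
          evl V (G X) (G Z) \<cdot> ((VComp (self V) (FOb H X) (FOb H Y) (FOb H Z) \<cdot> (FHom H Y Z \<otimes> FHom H X Y)) \<otimes> \<one> (G X))"
        using O by simp
    qed (use O in \<open>auto simp: hom_def\<close>)
  next
    fix X assume O: "X \<in> VObj C"
    show "FHom H X X \<cdot> VIde C X = VIde (self V) (FOb H X)"
    proof (rule curry_inj)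
      have "evl V (G X) (G X) \<cdot> ((FHom H X X \<cdot> VIde C X) \<otimes> \<one> (G X)) =
          evl V (G X) (G X) \<cdot> ((FHom H X X \<otimes> \<one> (G X)) \<cdot> (VIde C X \<otimes> \<one> (G X)))"
        using O by simp
      also have "\<dots> = \<alpha> X X \<cdot> (VIde C X \<otimes> \<one> (G X))"
        using O by (intro comp_reduce ht) auto
      finally show "evl V (G X) (G X) \<cdot> ((FHom H X X \<cdot> VIde C X) \<otimes> \<one> (G X)) =
          evl V (G X) (G X) \<cdot> (VIde (self V) (FOb H X) \<otimes> \<one> (G X))"
        using O u by simp
    qed (use O in \<open>auto simp: hom_def\<close>)
  qed (use C S in \<open>auto simp: hom_def H_def mk_vfun_def restrict_def fun_eq_iff\<close>)
qed

end

section \<open>Small sets\<close>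

lemma small_mono: "small U B \<Longrightarrow> A \<subseteq> B \<Longrightarrow> small U A"
  unfolding small_def using card_of_mono1 ordLeq_ordLess_trans by blast

lemma small_image: "small U A \<Longrightarrow> small U (f ` A)"
  unfolding small_def using card_of_image ordLeq_ordLess_trans by blast

lemma small_inj_on:
  assumes "small U B" "inj_on f A" "f ` A \<subseteq> B" shows "small U A"
proof -
  have "|A| \<le>o |B|" using assms card_of_ordLeq by blast
  with assms(1) show ?thesis unfolding small_def using ordLeq_ordLess_trans by blast
qed

text \<open>Shapes of diagrams and indices of products and coproducts are sets of elements of
  \<open>'u\<close>; small sets of other types enter through such a code.\<close>

lemma small_code:
  assumes "small TYPE('u) A" obtains e :: "'a \<Rightarrow> 'u" where "inj_on e A"
proof -
  have "|A| \<le>o |UNIV :: 'u set|" using assms ordLess_imp_ordLeq unfolding small_def by blast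
  then obtain e :: "'a \<Rightarrow> 'u" where "inj_on e A" using card_of_ordLeq[of A "UNIV :: 'u set"] by auto
  then show ?thesis by (rule that)
qed

lemma universe_infinite: "universe TYPE('u) \<Longrightarrow> infinite (UNIV :: 'u set)"
  unfolding universe_def using infinite_iff_natLeq_ordLeq ordLess_imp_ordLeq by blast

text \<open>Regularity of the universe in the form that is used: smallness is preserved by sums over
  small index sets.\<close>

lemma universe_stable: "universe TYPE('u) \<Longrightarrow> stable |UNIV :: 'u set|"
  using universe_infinite[where 'u = 'u]
  by (intro regularCard_stable) (simp_all add: Field_card_of card_of_card_order_on universe_def)

lemma small_Sigma:
  assumes "universe TYPE('u)" "small TYPE('u) A" "\<And>x. x \<in> A \<Longrightarrow> small TYPE('u) (B x)"
  shows "small TYPE('u) (SIGMA x:A. B x)"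
  using stable_elim[OF universe_stable[OF assms(1)]] assms(2,3) unfolding small_def by blast

lemma small_UN:
  assumes "universe TYPE('u)" "small TYPE('u) A" "\<And>x. x \<in> A \<Longrightarrow> small TYPE('u) (B x)"
  shows "small TYPE('u) (\<Union>x\<in>A. B x)"
  using stable_UNION[OF universe_stable[OF assms(1)]] assms(2,3) unfolding small_def by blast

lemma small_finite:
  assumes "universe TYPE('u)" "finite A" shows "small TYPE('u) A"
proof -
  have "|A| <o |UNIV :: 'u set|"
    using assms universe_infinite[where 'u = 'u]
    by (intro finite_ordLess_infinite) (simp_all add: Field_card_of card_of_well_order_on)
  then show ?thesis by (simp add: small_def)
qed

lemma small_Un:
  assumes "universe TYPE('u)" "small TYPE('u) A" "small TYPE('u) B"
  shows "small TYPE('u) (A \<union> B)"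
  using assms card_of_Un_ordLess_infinite[OF universe_infinite] unfolding small_def by blast

lemma small_Pow:
  assumes "universe TYPE('u)" "small TYPE('u) A" shows "small TYPE('u) (Pow A)"
proof -
  obtain e :: "'a \<Rightarrow> 'u" where e: "inj_on e A" using small_code[OF assms(2)] by blast
  have "|e ` A| <o |UNIV :: 'u set|" using small_image[OF assms(2)] unfolding small_def .
  then have "small TYPE('u) (Pow (e ` A))" using assms(1) unfolding universe_def small_def by blast
  moreover have "inj_on (image e) (Pow A)" using e by (rule inj_on_image_Pow)
  ultimately show ?thesis by (rule small_inj_on) auto
qed

text \<open>A function is coded by its graph, an element of the power set of the small set
  \<open>A \<times> B\<close>.\<close>

lemma small_PiE:
  assumes "universe TYPE('u)" "small TYPE('u) A" "small TYPE('u) B"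
  shows "small TYPE('u) (A \<rightarrow>\<^sub>E B)"
proof (rule small_inj_on)
  show "small TYPE('u) (Pow (A \<times> B))" using assms by (intro small_Pow small_Sigma)
  show "inj_on (\<lambda>f. {(x, f x) |x. x \<in> A}) (A \<rightarrow>\<^sub>E B)"
  proof (rule inj_onI)
    fix f g assume fg: "f \<in> A \<rightarrow>\<^sub>E B" "g \<in> A \<rightarrow>\<^sub>E B" "{(x, f x) |x. x \<in> A} = {(x, g x) |x. x \<in> A}"
    show "f = g"
    proof (rule PiE_ext[OF fg(1,2)])
      fix x assume "x \<in> A"
      then have "(x, f x) \<in> {(x, g x) |x. x \<in> A}" using fg(3) by blast
      then show "f x = g x" by blast
    qed
  qed
qed auto


lemma poset_cat_simps [simp]: "Obj (poset_cat S r) = S" "Arr (poset_cat S r) = r"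
    "Dom (poset_cat S r) = fst" "Cod (poset_cat S r) = snd" "Ide (poset_cat S r) i = (i, i)"
    "b \<cdot>\<^bsub>poset_cat S r\<^esub> a = (fst a, snd b)"
  by (simp_all add: poset_cat_def)

section \<open>Limits in locally presentable categories\<close>

context cat
begin

lemma colimit_arrows_eq:
  assumes "is_colimit J C D d Q c" "f \<in> hom C Q R" "g \<in> hom C Q R" "\<And>i. i \<in> Obj J \<Longrightarrow> f \<cdot> c i = g \<cdot> c i"
    and J: "category J" "\<And>i j a. a \<in> hom J i j \<Longrightarrow> d a \<in> hom C (D i) (D j)"
  shows "f = g"
proof -
  have cc: "is_cocone J C D d Q c" using assms(1) by (simp add: is_colimit_def)
  have "is_cocone J C D d R (\<lambda>i. f \<cdot> c i)"
    unfolding is_cocone_def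
  proof (intro conjI ballI allI)
    show "R \<in> Obj C" using assms(2) hom_Obj by blast
    show "f \<cdot> c i \<in> hom C (D i) R" if "i \<in> Obj J" for i
      using cc that assms(2) comp_hom unfolding is_cocone_def by blast
    fix i j a assume a: "a \<in> hom J i j"
    have j: "i \<in> Obj J" "j \<in> Obj J" using cat.hom_Obj[OF cat.intro[OF J(1)] a] by blast+
    have "c j \<cdot> d a = c i" "c j \<in> hom C (D j) Q" using cc a j unfolding is_cocone_def by blast+
    then show "(f \<cdot> c j) \<cdot> d a = f \<cdot> c i"
      using J(2)[OF a] homD assms(2) by (metis comp_assoc)
  qed
  then have "\<exists>!u. u \<in> hom C Q R \<and> (\<forall>i \<in> Obj J. u \<cdot> c i = f \<cdot> c i)"
    using assms(1) unfolding is_colimit_def by blast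
  then show ?thesis using assms(2,3,4) by metis
qed

lemma colimit_factor:
  assumes "is_colimit J C D d Q c" "is_cocone J C D d R r"
  obtains u where "u \<in> hom C Q R" "\<And>i. i \<in> Obj J \<Longrightarrow> u \<cdot> c i = r i"
  using assms unfolding is_colimit_def by blast

text \<open>Transporting a diagram along codes for objects and arrows of its shape.\<close>

lemma cocomplete_small:
  fixes J :: "('j, 'k, 'n) cat_scheme"
  assumes co: "cocomplete TYPE('u) C" and sm: "small TYPE('u) (Obj J)" "small TYPE('u) (Arr J)"
    and F: "is_functor J C D d"
  shows "\<exists>Q c. is_colimit J C D d Q c"
proof -
  have J: "category J" using F by (simp add: is_functor_def)
  interpret J: cat J by (rule cat.intro[OF J])
  obtain eo :: "'j \<Rightarrow> 'u" where eo: "inj_on eo (Obj J)" using small_code[OF sm(1)] by blast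
  obtain ea :: "'k \<Rightarrow> 'u" where ea: "inj_on ea (Arr J)" using small_code[OF sm(2)] by blast
  define po where "po = inv_into (Obj J) eo"
  define pa where "pa = inv_into (Arr J) ea"
  have po [simp]: "po (eo x) = x" if "x \<in> Obj J" for x using that eo by (simp add: po_def)
  have pa [simp]: "pa (ea x) = x" if "x \<in> Arr J" for x using that ea by (simp add: pa_def)
  define J' :: "('u, 'u) cat" where "J' = \<lparr> Obj = eo ` Obj J, Arr = ea ` Arr J,
    Dom = (\<lambda>a. eo (Dom J (pa a))), Cod = (\<lambda>a. eo (Cod J (pa a))), Ide = (\<lambda>x. ea (Ide J (po x))),
    Comp = (\<lambda>b a. ea (Comp J (pa b) (pa a))) \<rparr>"
  have hom': "hom J' (eo i) (eo j) = ea ` hom J i j" if "i \<in> Obj J" "j \<in> Obj J" for i j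
    using that eo by (auto simp: hom_def J'_def inj_on_eq_iff)
  have homE: "\<exists>i j b. i \<in> Obj J \<and> j \<in> Obj J \<and> x = eo i \<and> y = eo j \<and> a = ea b \<and> b \<in> hom J i j"
    if ab: "a \<in> hom J' x y" for x y a
  proof -
    obtain b where b: "b \<in> Arr J" "a = ea b" using ab by (auto simp: hom_def J'_def)
    moreover have "x = eo (Dom J b)" "y = eo (Cod J b)" using ab b by (auto simp: hom_def J'_def)
    ultimately show ?thesis by (intro exI[of _ "Dom J b"] exI[of _ "Cod J b"] exI[of _ b]) (simp add: hom_def)
  qed
  have s: "Obj J' = eo ` Obj J" "Ide J' x = ea (Ide J (po x))"
    "b \<cdot>\<^bsub>J'\<^esub> a = ea (pa b \<cdot>\<^bsub>J\<^esub> pa a)" for x a b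
    by (simp_all add: J'_def)
  have cJ': "category J'"
    unfolding category_def
  proof (intro conjI allI ballI)
    fix f assume "f \<in> Arr J'"
    then show "Dom J' f \<in> Obj J'" "Cod J' f \<in> Obj J'" by (auto simp: J'_def)
  next
    fix X assume "X \<in> Obj J'"
    then show "Ide J' X \<in> hom J' X X" by (auto simp: J'_def hom_def)
  next
    fix X Y Z f g assume "f \<in> hom J' X Y" "g \<in> hom J' Y Z"
    then show "g \<cdot>\<^bsub>J'\<^esub> f \<in> hom J' X Z" using eo by (auto simp: J'_def hom_def inj_on_eq_iff)
  next
    fix X Y f assume "f \<in> hom J' X Y"
    then show "f \<cdot>\<^bsub>J'\<^esub> Ide J' X = f" "Ide J' Y \<cdot>\<^bsub>J'\<^esub> f = f" by (auto simp: J'_def hom_def)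
  next
    fix W X Y Z f g h assume "f \<in> hom J' W X" "g \<in> hom J' X Y" "h \<in> hom J' Y Z"
    then show "h \<cdot>\<^bsub>J'\<^esub> (g \<cdot>\<^bsub>J'\<^esub> f) = h \<cdot>\<^bsub>J'\<^esub> g \<cdot>\<^bsub>J'\<^esub> f"
      using eo by (auto simp: J'_def hom_def inj_on_eq_iff)
  qed
  have F': "is_functor J' C (D \<circ> po) (d \<circ> pa)"
    unfolding is_functor_def
  proof (intro conjI allI ballI)
    show "category J'" by (rule cJ')
    show "category C" by (rule category)
    fix x assume "x \<in> Obj J'"
    then show "(D \<circ> po) x \<in> Obj C" "(d \<circ> pa) (Ide J' x) = Ide C ((D \<circ> po) x)"
      using F by (auto simp: s is_functor_def)
  next
    fix x y a assume "a \<in> hom J' x y"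
    then obtain i j b where "i \<in> Obj J" "j \<in> Obj J" "x = eo i" "y = eo j" "a = ea b" "b \<in> hom J i j"
      using homE by blast
    moreover from this have "d b \<in> hom C (D i) (D j)" using F by (simp add: is_functor_def)
    ultimately show "(d \<circ> pa) a \<in> hom C ((D \<circ> po) x) ((D \<circ> po) y)"
      using J.homD by simp
  next
    fix x y z a b assume a: "a \<in> hom J' x y" and b: "b \<in> hom J' y z"
    obtain i j a' where 1: "i \<in> Obj J" "j \<in> Obj J" "x = eo i" "y = eo j" "a = ea a'" "a' \<in> hom J i j"
      using homE[OF a] by blast
    obtain j' k b' where 2: "j' \<in> Obj J" "k \<in> Obj J" "y = eo j'" "z = eo k" "b = ea b'" "b' \<in> hom J j' k"
      using homE[OF b] by blast
    have jj: "j' = j" using 1 2 eo by (auto simp: inj_on_eq_iff)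
    have ba: "b' \<cdot>\<^bsub>J\<^esub> a' \<in> hom J i k" using 1(6) 2(6) jj J.comp_hom by blast
    have "d (b' \<cdot>\<^bsub>J\<^esub> a') = d b' \<cdot> d a'" using F 1(6) 2(6) jj by (simp add: is_functor_def)
    then show "(d \<circ> pa) (b \<cdot>\<^bsub>J'\<^esub> a) = (d \<circ> pa) b \<cdot> (d \<circ> pa) a"
      using 1 2 J.homD[OF 1(6)] J.homD[OF 2(6)] J.homD[OF ba] by (simp add: s)
  qed
  have sm': "small TYPE('u) (Obj J')" "small TYPE('u) (Arr J')"
    using sm by (simp_all add: J'_def small_image)
  obtain Q c where Q: "is_colimit J' C (D \<circ> po) (d \<circ> pa) Q c"
    using co F' sm' unfolding cocomplete_def by blast
  \<comment> \<open>Decoding the indices matches cocones over \<open>J\<close> with cocones over its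
    coded copy, so a colimit over the copy is one over \<open>J\<close>.\<close>
  have cone: "is_cocone J C D d R r \<longleftrightarrow> is_cocone J' C (D \<circ> po) (d \<circ> pa) R (r \<circ> po)" for R r
  proof
    assume L: "is_cocone J C D d R r"
    show "is_cocone J' C (D \<circ> po) (d \<circ> pa) R (r \<circ> po)"
      unfolding is_cocone_def
    proof (intro conjI ballI allI)
      show "R \<in> Obj C" using L by (simp add: is_cocone_def)
      fix x assume "x \<in> Obj J'" then show "(r \<circ> po) x \<in> hom C ((D \<circ> po) x) R"
        using L by (auto simp: s is_cocone_def)
    next
      fix x y a assume "a \<in> hom J' x y"
      then obtain i j b where "i \<in> Obj J" "j \<in> Obj J" "x = eo i" "y = eo j" "a = ea b" "b \<in> hom J i j"
        using homE by blast
      then show "(r \<circ> po) y \<cdot> (d \<circ> pa) a = (r \<circ> po) x"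
        using L J.homD by (simp add: is_cocone_def)
    qed
  next
    assume L: "is_cocone J' C (D \<circ> po) (d \<circ> pa) R (r \<circ> po)"
    show "is_cocone J C D d R r"
      unfolding is_cocone_def
    proof (intro conjI ballI allI)
      show "R \<in> Obj C" using L by (simp add: is_cocone_def)
      fix i assume i: "i \<in> Obj J"
      then have "eo i \<in> Obj J'" by (simp add: s)
      then have "(r \<circ> po) (eo i) \<in> hom C ((D \<circ> po) (eo i)) R" using L by (simp add: is_cocone_def)
      then show "r i \<in> hom C (D i) R" using i by simp
    next
      fix i j a assume a: "a \<in> hom J i j"
      then have ij: "i \<in> Obj J" "j \<in> Obj J" using J.hom_Obj by blast+
      then have "ea a \<in> hom J' (eo i) (eo j)" using a hom' by blast
      then have "(r \<circ> po) (eo j) \<cdot> (d \<circ> pa) (ea a) = (r \<circ> po) (eo i)" using L unfolding is_cocone_def by blast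
      then show "r j \<cdot> d a = r i" using ij J.homD[OF a] by simp
    qed
  qed
  have "is_colimit J C D d Q (c \<circ> eo)"
    unfolding is_colimit_def
  proof (intro conjI allI impI)
    have "is_cocone J' C (D \<circ> po) (d \<circ> pa) Q c" using Q by (simp add: is_colimit_def)
    then have "is_cocone J' C (D \<circ> po) (d \<circ> pa) Q ((c \<circ> eo) \<circ> po)"
      unfolding is_cocone_def
    proof (elim conjE, intro conjI ballI allI)
      assume h: "\<forall>i\<in>Obj J'. c i \<in> hom C ((D \<circ> po) i) Q"
      fix x assume "x \<in> Obj J'" then show "((c \<circ> eo) \<circ> po) x \<in> hom C ((D \<circ> po) x) Q"
        using h by (auto simp: s)
    next
      assume h: "\<forall>i j. \<forall>a\<in>hom J' i j. c j \<cdot> (d \<circ> pa) a = c i"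
      fix x y a assume a: "a \<in> hom J' x y"
      then obtain i j b where "i \<in> Obj J" "j \<in> Obj J" "x = eo i" "y = eo j" "a = ea b" "b \<in> hom J i j"
        using homE by blast
      then show "((c \<circ> eo) \<circ> po) y \<cdot> (d \<circ> pa) a = ((c \<circ> eo) \<circ> po) x"
        using h a by auto
    qed
    then show "is_cocone J C D d Q (c \<circ> eo)" by (simp add: cone)
    fix R r assume "is_cocone J C D d R r"
    then have "is_cocone J' C (D \<circ> po) (d \<circ> pa) R (r \<circ> po)" by (simp add: cone)
    then have "\<exists>!u. u \<in> hom C Q R \<and> (\<forall>i \<in> Obj J'. u \<cdot> c i = (r \<circ> po) i)"
      using Q unfolding is_colimit_def by blast
    then show "\<exists>!u. u \<in> hom C Q R \<and> (\<forall>i \<in> Obj J. u \<cdot> (c \<circ> eo) i = r i)" by (simp add: s)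
  qed
  then show ?thesis by blast
qed


lemma is_colimit_hom: "is_colimit J C D d Q c \<Longrightarrow> i \<in> Obj J \<Longrightarrow> c i \<in> hom C (D i) Q"
  by (simp add: is_cocone_def is_colimit_def)

lemma is_colimit_nat: "is_colimit J C D d Q c \<Longrightarrow> a \<in> hom J i j \<Longrightarrow> c j \<cdot> d a = c i"
  by (simp add: is_cocone_def is_colimit_def)

text \<open>The shape, the diagram and its cocones are exposed along with the arrow
  \<open>q\<close>, because \<open>representable\<close> glues families along colimit cocones and
  has to treat the coequalizer as one.\<close>

lemma coequalizer_exists:
  assumes co: "cocomplete TYPE('u) C" and U: "universe TYPE('u)"
    and f: "f \<in> hom C X Y" and g: "g \<in> hom C X Y"
  obtains Q q J D d and c :: "nat \<Rightarrow> 'a" where "q \<in> hom C Y Q" "q \<cdot> f = q \<cdot> g"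
    "is_colimit (J :: (nat, nat) cat) C D d Q c" "Obj J = {0, 1}" "c 0 = q \<cdot> f" "c 1 = q" "D 0 = X" "D 1 = Y"
    "is_functor J C D d"
    "\<And>R h. h \<in> hom C Y R \<Longrightarrow> h \<cdot> f = h \<cdot> g \<Longrightarrow> is_cocone J C D d R (\<lambda>i. if i = 0 then h \<cdot> f else h)"
proof -
  \<comment> \<open>Arrows 0 and 1 are the identities, 2 and 3 the parallel pair. If
    \<open>b < 2\<close>, the second factor of a composite is an identity; otherwise the first one
    is.\<close>
  define J :: "(nat, nat) cat" where "J = \<lparr> Obj = {0, 1}, Arr = {0, 1, 2, 3}, Dom = (\<lambda>a. if a = 1 then 1 else 0),
    Cod = (\<lambda>a. if a = 0 then 0 else 1), Ide = (\<lambda>x. x), Comp = (\<lambda>b a. if b < 2 then a else b) \<rparr>"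
  define D where "D = (\<lambda>i::nat. if i = 0 then X else Y)"
  define d where "d = (\<lambda>a::nat. if a = 0 then Ide C X else if a = 1 then Ide C Y else if a = 2 then f else g)"
  have O: "X \<in> Obj C" "Y \<in> Obj C" using f hom_Obj by blast+
  have homJ: "hom J i j = (if i = 0 \<and> j = 0 then {0} else if i = 1 \<and> j = 1 then {1} else if i = 0 \<and> j = 1 then {2,3} else {})"
    for i j by (auto simp: hom_def J_def split: if_splits)
  have cJ: "category J"
    unfolding category_def by (auto simp: homJ, auto simp: J_def split: if_splits)
  have F: "is_functor J C D d"
    unfolding is_functor_def
  proof (intro conjI ballI allI)
    note t = O homD[OF f] homD[OF g]
    show "category J" by (rule cJ)
    show "category C" by (rule category)
    fix i assume "i \<in> Obj J"
    then show "D i \<in> Obj C" "d (Ide J i) = Ide C (D i)" using O by (auto simp: J_def D_def d_def)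
  next
    fix i j a assume "a \<in> hom J i j"
    then show "d a \<in> hom C (D i) (D j)"
      using f g Ide_hom[OF O(1)] Ide_hom[OF O(2)] by (auto simp: homJ D_def d_def split: if_splits)
  next
    fix i j k a b assume ab: "a \<in> hom J i j" "b \<in> hom J j k"
    consider "a = 0" "b = 0" | "a = 0" "b = 2" | "a = 0" "b = 3" | "b = 1" "a \<in> {1,2,3}"
      using ab by (auto simp: homJ split: if_splits)
    then show "d (b \<cdot>\<^bsub>J\<^esub> a) = d b \<cdot> d a"
      by cases (use O homD[OF f] homD[OF g] in \<open>simp_all add: J_def d_def\<close>, auto)
  qed
  have "small TYPE('u) (Obj J)" "small TYPE('u) (Arr J)" by (rule small_finite[OF U], simp add: J_def)+
  with cocomplete_small[OF co _ _ F] obtain Q c where Q: "is_colimit J C D d Q c" by blast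
  have c: "c 0 \<in> hom C X Q" "c 1 \<in> hom C Y Q"
    using is_colimit_hom[OF Q, of 0] is_colimit_hom[OF Q, of 1] by (auto simp: J_def D_def)
  have cf: "c 1 \<cdot> f = c 0" "c 1 \<cdot> g = c 0"
    using is_colimit_nat[OF Q, of 2 0 1] is_colimit_nat[OF Q, of 3 0 1] by (auto simp: homJ d_def)
  have cone: "is_cocone J C D d R (\<lambda>i. if i = 0 then h \<cdot> f else h)" if h: "h \<in> hom C Y R" "h \<cdot> f = h \<cdot> g" for R h
    unfolding is_cocone_def
  proof (intro conjI ballI allI)
    show "R \<in> Obj C" using hom_Obj[OF h(1)] by simp
    show "(if i = 0 then h \<cdot> f else h) \<in> hom C (D i) R" if "i \<in> Obj J" for i
      using h(1) comp_hom[OF f h(1)] by (simp add: D_def)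
    fix i j a assume "a \<in> hom J i j"
    then consider "a = 0" "i = 0" "j = 0" | "a = 1" "i = 1" "j = 1" | "a = 2" "i = 0" "j = 1" | "a = 3" "i = 0" "j = 1"
      by (auto simp: homJ split: if_splits)
    then show "(if j = 0 then h \<cdot> f else h) \<cdot> d a = (if i = 0 then h \<cdot> f else h)"
      by cases (use O homD[OF f] homD[OF g] homD[OF h(1)] in \<open>simp_all add: d_def h(2)\<close>)
  qed
  show thesis
  proof (rule that[OF c(2) _ Q _ _ _ _ _ F])
    show "c 1 \<cdot> f = c 1 \<cdot> g" "c 0 = c 1 \<cdot> f" using cf by simp_all
    show "Obj J = {0, 1}" "D 0 = X" "D 1 = Y" by (simp_all add: J_def D_def)
    show "\<And>R h. h \<in> hom C Y R \<Longrightarrow> h \<cdot> f = h \<cdot> g \<Longrightarrow> is_cocone J C D d R (\<lambda>i. if i = 0 then h \<cdot> f else h)" by (rule cone)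
  qed simp
qed

text \<open>
  A contravariant functor of small families of arrows into fixed objects that turns colimits into
  limits is representable.  The colimit of its category of elements over the generators is weakly
  terminal, and the joint coequalizer of the endomorphisms of the latter is terminal.
\<close>

lemma representable:
  fixes K :: "'k set" and lam :: "'u rel" and D :: "'k \<Rightarrow> 'o"
  assumes U: "universe TYPE('u)" and lp: "locally_presentable lam C" and K: "small TYPE('u) K"
    and DO: "\<And>k. k \<in> K \<Longrightarrow> D k \<in> Obj C"
    and ext: "\<And>W v w. W \<in> Obj C \<Longrightarrow> cond W w \<Longrightarrow> (\<And>k. k \<in> K \<Longrightarrow> w k = v k) \<Longrightarrow> cond W v"
    and pre: "\<And>W w X f. \<lbrakk>W \<in> Obj C; \<And>k. k \<in> K \<Longrightarrow> w k \<in> hom C W (D k); cond W w; f \<in> hom C X W\<rbrakk> \<Longrightarrow> cond X (\<lambda>k. w k \<cdot> f)"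
    and loc: "\<And>W w X I. \<lbrakk>W \<in> Obj C; \<And>k. k \<in> K \<Longrightarrow> w k \<in> hom C W (D k);
        \<And>c. c \<in> I \<Longrightarrow> c \<in> hom C (Dom C c) W \<and> cond (Dom C c) (\<lambda>k. w k \<cdot> c);
        \<And>R f g. f \<in> hom C W R \<Longrightarrow> g \<in> hom C W R \<Longrightarrow> (\<And>c. c \<in> I \<Longrightarrow> f \<cdot> c = g \<cdot> c) \<Longrightarrow> f = g\<rbrakk> \<Longrightarrow> cond W w"
  obtains L l where "L \<in> Obj C" "\<And>k. k \<in> K \<Longrightarrow> l k \<in> hom C L (D k)" "cond L l"
    "\<And>W w. \<lbrakk>W \<in> Obj C; \<And>k. k \<in> K \<Longrightarrow> w k \<in> hom C W (D k); cond W w\<rbrakk> \<Longrightarrow>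
       \<exists>!u. u \<in> hom C W L \<and> (\<forall>k \<in> K. l k \<cdot> u = w k)"
proof -
  define fam where "fam W w \<longleftrightarrow> W \<in> Obj C \<and> (\<forall>k \<in> K. w k \<in> hom C W (D k)) \<and> cond W w" for W w
  have famI: "fam W w" if "W \<in> Obj C" "\<And>k. k \<in> K \<Longrightarrow> w k \<in> hom C W (D k)" "cond W w" for W w
    using that by (simp add: fam_def)
  \<comment> \<open>Only the values on \<open>K\<close> matter, so the families may be taken
    extensional; over a fixed object these form a small set.\<close>
  have famR: "fam W (restrict w K) \<longleftrightarrow> fam W w" for W w
    unfolding fam_def using ext[of W w "restrict w K"] ext[of W "restrict w K" w] by auto
  have fampre: "fam X (\<lambda>k. w k \<cdot> f)" if "fam W w" "f \<in> hom C X W" for W w f X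
    using that pre[of W w f X] hom_Obj[OF that(2)] comp_hom unfolding fam_def by blast
  have ls: "small TYPE('u) (hom C X Y)" if "X \<in> Obj C" "Y \<in> Obj C" for X Y
    using lp that by (simp add: locally_presentable_def locally_small_def)
  have co: "cocomplete TYPE('u) C" using lp by (simp add: locally_presentable_def)
  obtain G where G: "small TYPE('u) G" "\<And>X. X \<in> G \<Longrightarrow> presentable lam C X"
      "\<And>Q. Q \<in> Obj C \<Longrightarrow> directed_colimit_of lam C (Arr C) G Q"
    using lp unfolding locally_presentable_def by blast
  have GO: "X \<in> Obj C" if "X \<in> G" for X using G(2)[OF that] by (simp add: presentable_def)
  \<comment> \<open>The cocone of a colimit is jointly epic, hence an instance of
    \<open>loc\<close>: a family on the colimit is admissible as soon as its restrictions to all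
    stages are.\<close>
  have famloc: "fam W w" if J: "is_colimit J C E e W c" "is_functor J C E e" and w: "\<And>k. k \<in> K \<Longrightarrow> w k \<in> hom C W (D k)"
    and cw: "\<And>j. j \<in> Obj J \<Longrightarrow> fam (E j) (\<lambda>k. w k \<cdot> c j)"
    for J :: "('j, 'l) cat" and E e W c w
  proof (rule famI)
    show W: "W \<in> Obj C" using J(1) by (simp add: is_colimit_def is_cocone_def)
    show "cond W w"
    proof (rule loc[of W w "c ` Obj J", OF W w])
      show "x \<in> hom C (Dom C x) W \<and> cond (Dom C x) (\<lambda>k. w k \<cdot> x)" if "x \<in> c ` Obj J" for x
      proof -
        obtain j where j: "j \<in> Obj J" "x = c j" using \<open>x \<in> c ` Obj J\<close> by blast
        have "c j \<in> hom C (E j) W" by (rule is_colimit_hom[OF J(1) j(1)])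
        then show ?thesis using cw[OF j(1)] homD[of "c j" "E j" W] by (simp add: j(2) fam_def)
      qed
      fix R f g assume fg: "f \<in> hom C W R" "g \<in> hom C W R" "\<And>x. x \<in> c ` Obj J \<Longrightarrow> f \<cdot> x = g \<cdot> x"
      show "f = g"
        by (rule colimit_arrows_eq[OF J(1) fg(1,2)]) (use fg(3) J(2) in \<open>simp_all add: is_functor_def\<close>)
    qed
  qed (fact w)
  define J where "J = \<lparr> Obj = {(g, w). g \<in> G \<and> w \<in> K \<rightarrow>\<^sub>E Arr C \<and> fam g w},
    Arr = {((g, w), f, (g', w')). g \<in> G \<and> w \<in> K \<rightarrow>\<^sub>E Arr C \<and> fam g w \<and> g' \<in> G \<and> w' \<in> K \<rightarrow>\<^sub>E Arr C \<and> fam g' w' \<and>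
      f \<in> hom C g g' \<and> (\<forall>k \<in> K. w' k \<cdot> f = w k)},
    Dom = fst, Cod = (\<lambda>a. snd (snd a)), Ide = (\<lambda>x. (x, Ide C (fst x), x)),
    Comp = (\<lambda>b a. (fst a, fst (snd b) \<cdot> fst (snd a), snd (snd b))) \<rparr>"
  define A where "A = (\<Union>g\<in>G. \<Union>k\<in>K. hom C g (D k))"
  define B where "B = (\<Union>g\<in>G. \<Union>g'\<in>G. hom C g g')"
  have smA: "small TYPE('u) A" unfolding A_def
    using U G(1) K ls GO DO by (intro small_UN) auto
  have smB: "small TYPE('u) B" unfolding B_def
    using U G(1) ls GO by (intro small_UN) auto
  have "Obj J \<subseteq> G \<times> (K \<rightarrow>\<^sub>E A)"
    by (auto simp: J_def fam_def A_def PiE_iff extensional_def, blast)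
  then have smO: "small TYPE('u) (Obj J)"
    by (rule small_mono[OF small_Sigma[OF U G(1) small_PiE[OF U K smA]]])
  have "Arr J \<subseteq> Obj J \<times> (B \<times> Obj J)" by (auto simp: J_def B_def)
  then have smAr: "small TYPE('u) (Arr J)"
    by (rule small_mono[OF small_Sigma[OF U smO small_Sigma[OF U smB smO]]])
  have cJ: "category J"
    unfolding category_def
  proof (intro conjI allI ballI)
    fix W X Y Z f g h assume h: "f \<in> hom J W X" "g \<in> hom J X Y" "h \<in> hom J Y Z"
    then show "h \<cdot>\<^bsub>J\<^esub> (g \<cdot>\<^bsub>J\<^esub> f) = h \<cdot>\<^bsub>J\<^esub> g \<cdot>\<^bsub>J\<^esub> f"
      by (auto simp: J_def hom_def)
  next
    fix X assume "X \<in> Obj J"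
    then show "Ide J X \<in> hom J X X"
      using GO by (auto simp: J_def hom_def fam_def)
  next
    fix X Y Z f g assume h: "f \<in> hom J X Y" "g \<in> hom J Y Z"
    then show "g \<cdot>\<^bsub>J\<^esub> f \<in> hom J X Z"
    proof (clarsimp simp: J_def hom_def)
      fix k a w1 a' w2 a'' w3
      assume k: "k \<in> K" and f: "a \<in> Arr C" "a' \<in> Arr C" "Dom C a' = Cod C a"
        and e: "\<forall>k\<in>K. w3 k \<cdot> a' = w2 k" "\<forall>k\<in>K. w2 k \<cdot> a = w1 k" and "fam (Cod C a') w3"
      then have "w3 k \<in> hom C (Cod C a') (D k)" by (simp add: fam_def)
      then show "w3 k \<cdot> (a' \<cdot> a) = w1 k"
        using comp_reduce[of "w3 k" a' "w2 k" a] k f e by (simp add: hom_def)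
    qed
  next
    fix X Y f assume "f \<in> hom J X Y"
    then show "f \<cdot>\<^bsub>J\<^esub> Ide J X = f" "Ide J Y \<cdot>\<^bsub>J\<^esub> f = f" by (auto simp: J_def hom_def)
  qed (auto simp: J_def)
  have FJ: "is_functor J C fst (\<lambda>a. fst (snd a))"
    unfolding is_functor_def using GO by (auto simp: cJ category) (auto simp: J_def hom_def)
  obtain L0 \<iota> where L0: "is_colimit J C fst (\<lambda>a. fst (snd a)) L0 \<iota>"
    using cocomplete_small[OF co smO smAr FJ] by blast
  have L0O: "L0 \<in> Obj C" using L0 by (simp add: is_colimit_def is_cocone_def)
  have "\<exists>u. u \<in> hom C L0 (D k) \<and> (\<forall>x \<in> Obj J. u \<cdot> \<iota> x = snd x k)" if k: "k \<in> K" for k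
  proof -
    have "is_cocone J C fst (\<lambda>a. fst (snd a)) (D k) (\<lambda>x. snd x k)"
      unfolding is_cocone_def using k DO by (auto simp: J_def hom_def fam_def)
    then show ?thesis using L0 unfolding is_colimit_def by blast
  qed
  then obtain l0 where l0: "\<And>k. k \<in> K \<Longrightarrow> l0 k \<in> hom C L0 (D k)"
      "\<And>k x. k \<in> K \<Longrightarrow> x \<in> Obj J \<Longrightarrow> l0 k \<cdot> \<iota> x = snd x k"
    by metis
  have fam0: "fam L0 l0"
  proof (rule famloc[OF L0 FJ l0(1)])
    fix x assume x: "x \<in> Obj J"
    then have "fam (fst x) (snd x)" by (auto simp: J_def)
    then show "fam (fst x) (\<lambda>k. l0 k \<cdot> \<iota> x)"
      using ext[of "fst x" "snd x"] l0(2)[OF _ x] by (simp add: fam_def)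
  qed
  \<comment> \<open>\<open>W\<close> is a directed colimit of generators. Restricting
    \<open>w\<close> to the stages gives objects of \<open>J\<close>, and the coprojections of
    \<open>L0\<close> at these objects form a cocone that induces the arrow.\<close>
  have weak: "\<exists>u \<in> hom C W L0. \<forall>k \<in> K. l0 k \<cdot> u = w k" if W: "fam W w" for W w
  proof -
    have WO: "W \<in> Obj C" using W by (simp add: fam_def)
    obtain S r E e c where S: "directed_diagram lam C (Arr C) S r E e" "E ` S \<subseteq> G" "is_colimit (poset_cat S r) C E e W c"
      using G(3)[OF WO] unfolding directed_colimit_of_def by blast
    have FS: "is_functor (poset_cat S r) C E e" using S(1) by (simp add: directed_diagram_def)
    have c: "c i \<in> hom C (E i) W" if "i \<in> S" for i using is_colimit_hom[OF S(3)] that by (simp add: poset_cat_def)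
    define x where "x i = (E i, restrict (\<lambda>k. w k \<cdot> c i) K)" for i
    have w: "w k \<in> hom C W (D k)" if "k \<in> K" for k using W that by (simp add: fam_def)
    have xO: "x i \<in> Obj J" if "i \<in> S" for i
    proof -
      have "w k \<cdot> c i \<in> Arr C" if k: "k \<in> K" for k using homD[OF comp_hom[OF c[OF \<open>i \<in> S\<close>] w[OF k]]] by simp
      then show ?thesis using that S(2) fampre[OF W c[OF that]] famR by (auto simp: x_def J_def)
    qed
    have "is_cocone (poset_cat S r) C E e L0 (\<lambda>i. \<iota> (x i))"
      unfolding is_cocone_def
    proof (intro conjI ballI allI)
      fix i assume "i \<in> Obj (poset_cat S r)"
      then have "x i \<in> Obj J" using xO by (simp add: poset_cat_def)
      then show "\<iota> (x i) \<in> hom C (E i) L0" using is_colimit_hom[OF L0, of "x i"] by (simp add: x_def)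
    next
      fix i j a assume a: "a \<in> hom (poset_cat S r) i j"
      have ij: "i \<in> S" "j \<in> S" using cat.hom_Obj[OF cat.intro a] FS by (auto simp: is_functor_def poset_cat_def)
      have ea: "e a \<in> hom C (E i) (E j)" using FS a by (simp add: is_functor_def)
      have "c j \<cdot> e a = c i" using is_colimit_nat[OF S(3) a] .
      then have "w k \<cdot> (c j \<cdot> e a) = w k \<cdot> c i" for k by simp
      moreover have "(w k \<cdot> c j) \<cdot> e a = w k \<cdot> (c j \<cdot> e a)" if "k \<in> K" for k
        using homD[OF w[OF that]] homD[OF c[OF ij(2)]] homD[OF ea] by simp
      ultimately have "(x i, e a, x j) \<in> hom J (x i) (x j)"
        using xO[OF ij(1)] xO[OF ij(2)] ea by (auto simp: J_def hom_def[of "\<lparr>Obj = _, Arr = _, Dom = _, Cod = _, Ide = _, Comp = _\<rparr>"] x_def)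
      from is_colimit_nat[OF L0 this] show "\<iota> (x j) \<cdot> e a = \<iota> (x i)" by simp
    qed (fact L0O)
    from colimit_factor[OF S(3) this] obtain u where
      u: "u \<in> hom C W L0" "\<And>i. i \<in> S \<Longrightarrow> u \<cdot> c i = \<iota> (x i)"
      unfolding poset_cat_simps by blast
    have "l0 k \<cdot> u = w k" if k: "k \<in> K" for k
    proof (rule colimit_arrows_eq[OF S(3)])
      show "l0 k \<cdot> u \<in> hom C W (D k)" using comp_hom[OF u(1) l0(1)[OF k]] .
      show "w k \<in> hom C W (D k)" by (rule w[OF k])
      fix i assume "i \<in> Obj (poset_cat S r)"
      then have i: "i \<in> S" by (simp add: poset_cat_def)
      have "(l0 k \<cdot> u) \<cdot> c i = l0 k \<cdot> \<iota> (x i)"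
        using homD[OF l0(1)[OF k]] homD[OF u(1)] homD[OF c[OF i]] u(2)[OF i] by simp
      also have "\<dots> = w k \<cdot> c i" using l0(2)[OF k xO[OF i]] k by (simp add: x_def)
      finally show "(l0 k \<cdot> u) \<cdot> c i = w k \<cdot> c i" .
    qed (use FS in \<open>auto simp: is_functor_def\<close>)
    with u(1) show ?thesis by blast
  qed
  \<comment> \<open>Endomorphisms of \<open>L0\<close> that fix the family obstruct uniqueness.
    \<open>JM\<close> is their monoid regarded as a category with one object, so that a colimit over
    it coequalizes all of them with the identity.\<close>
  define M where "M = {e \<in> hom C L0 L0. \<forall>k \<in> K. l0 k \<cdot> e = l0 k}"
  have Mc: "b \<cdot> a \<in> M" if "a \<in> M" "b \<in> M" for a b
  proof -
    have ab: "a \<in> hom C L0 L0" "b \<in> hom C L0 L0" using that by (auto simp: M_def)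
    have "l0 k \<cdot> (b \<cdot> a) = l0 k" if k: "k \<in> K" for k
      using comp_reduce[of "l0 k" b "l0 k" a] \<open>a \<in> M\<close> \<open>b \<in> M\<close> homD[OF l0(1)[OF k]] homD[OF ab(1)] homD[OF ab(2)] k
      by (simp add: M_def)
    then show ?thesis using comp_hom[OF ab] by (simp add: M_def)
  qed
  have "l0 k \<cdot> Ide C L0 = l0 k" if "k \<in> K" for k using homD[OF l0(1)[OF that]] by simp
  then have MI: "Ide C L0 \<in> M" using Ide_hom[OF L0O] by (simp add: M_def)
  have MA: "a \<in> Arr C" "Dom C a = L0" "Cod C a = L0" if "a \<in> M" for a using that by (auto simp: M_def hom_def)
  define JM where "JM = \<lparr> Obj = {()}, Arr = M, Dom = (\<lambda>a. ()), Cod = (\<lambda>a. ()), Ide = (\<lambda>a. Ide C L0), Comp = Comp C \<rparr>"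
  have cJM: "category JM"
    unfolding category_def by (auto simp: JM_def hom_def MI Mc MA)
  have FM: "is_functor JM C (\<lambda>_. L0) (\<lambda>a. a)"
  proof -
    have "hom JM i j = M" for i j by (auto simp: JM_def hom_def)
    then show ?thesis unfolding is_functor_def using MA L0O by (simp add: cJM category homI) (simp add: JM_def)
  qed
  have "small TYPE('u) (Obj JM)" by (rule small_finite[OF U]) (simp add: JM_def)
  moreover have "small TYPE('u) (Arr JM)" by (rule small_mono[OF ls[OF L0O L0O]]) (auto simp: JM_def M_def)
  ultimately obtain L c where L: "is_colimit JM C (\<lambda>_. L0) (\<lambda>a. a) L c"
    using cocomplete_small[OF co _ _ FM] by blast
  define q where "q = c ()"
  have q: "q \<in> hom C L0 L" using is_colimit_hom[OF L, of "()"] by (simp add: q_def JM_def)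
  have qM: "q \<cdot> e = q" if "e \<in> M" for e
    using is_colimit_nat[OF L, of e "()" "()"] that by (simp add: q_def JM_def hom_def)
  have LO: "L \<in> Obj C" using q hom_Obj by blast
  have qepi: "f = g" if "f \<in> hom C L R" "g \<in> hom C L R" "f \<cdot> q = g \<cdot> q" for f g R
    by (rule colimit_arrows_eq[OF L that(1,2)]) (use that FM in \<open>auto simp: is_functor_def JM_def q_def\<close>)
  have "\<exists>u. u \<in> hom C L (D k) \<and> u \<cdot> q = l0 k" if k: "k \<in> K" for k
  proof -
    have "is_cocone JM C (\<lambda>_. L0) (\<lambda>a. a) (D k) (\<lambda>_. l0 k)"
      unfolding is_cocone_def using k DO l0(1)[OF k] by (auto simp: JM_def hom_def M_def)
    from colimit_factor[OF L this] obtain u where "u \<in> hom C L (D k)" "\<And>i. i \<in> Obj JM \<Longrightarrow> u \<cdot> c i = l0 k" by blast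
    then show ?thesis by (auto simp: JM_def q_def)
  qed
  then obtain l where l: "\<And>k. k \<in> K \<Longrightarrow> l k \<in> hom C L (D k)" "\<And>k. k \<in> K \<Longrightarrow> l k \<cdot> q = l0 k"
    by metis
  have famL: "fam L l"
  proof (rule famloc[OF L FM l(1)])
    fix x assume "x \<in> Obj JM"
    then have "c x = q" by (simp add: q_def)
    then show "fam L0 (\<lambda>k. l k \<cdot> c x)" using fam0 ext[OF L0O, of l0 "\<lambda>k. l k \<cdot> q"] l(2)
      by (simp add: fam_def)
  qed
  have "\<exists>!u. u \<in> hom C W L \<and> (\<forall>k \<in> K. l k \<cdot> u = w k)" if W: "fam W w" for W w
  proof (rule ex_ex1I)
    obtain u where u: "u \<in> hom C W L0" "\<And>k. k \<in> K \<Longrightarrow> l0 k \<cdot> u = w k" using weak[OF W] by blast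
    have "l k \<cdot> (q \<cdot> u) = w k" if k: "k \<in> K" for k
      using comp_reduce[OF l(2)[OF k], of u] homD[OF l(1)[OF k]] homD[OF q] homD[OF u(1)] u(2)[OF k] by simp
    then show "\<exists>u. u \<in> hom C W L \<and> (\<forall>k \<in> K. l k \<cdot> u = w k)" using comp_hom[OF u(1) q] by blast
    fix f g assume f: "f \<in> hom C W L \<and> (\<forall>k \<in> K. l k \<cdot> f = w k)" and g: "g \<in> hom C W L \<and> (\<forall>k \<in> K. l k \<cdot> g = w k)"
    then have fg: "f \<in> hom C W L" "g \<in> hom C W L" by simp_all
    \<comment> \<open>The coequalizer \<open>p\<close> of two solutions still carries the family, so
      weak terminality gives \<open>v : Q \<rightarrow> L0\<close>. Then
      \<open>v \<cdot> (p \<cdot> q)\<close> lies in \<open>M\<close>, hence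
      \<open>q \<cdot> (v \<cdot> (p \<cdot> q)) = q\<close>. As \<open>q\<close> is epic,
      \<open>q \<cdot> v\<close> is a left inverse of \<open>p\<close>, and
      \<open>p \<cdot> f = p \<cdot> g\<close> can be cancelled.\<close>
    obtain Q p J' D' d' and c' :: "nat \<Rightarrow> 'a" where p: "p \<in> hom C L Q" "p \<cdot> f = p \<cdot> g"
      and Q: "is_colimit (J' :: (nat, nat) cat) C D' d' Q c'" "Obj J' = {0, 1}" "c' 0 = p \<cdot> f" "c' 1 = p" "D' 0 = W" "D' 1 = L"
       "is_functor J' C D' d'"
       "\<And>R h. h \<in> hom C L R \<Longrightarrow> h \<cdot> f = h \<cdot> g \<Longrightarrow> is_cocone J' C D' d' R (\<lambda>i. if i = 0 then h \<cdot> f else h)"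
      by (rule coequalizer_exists[OF co U fg]) (rule that)
    have "\<exists>u. u \<in> hom C Q (D k) \<and> u \<cdot> p = l k" if k: "k \<in> K" for k
    proof -
      have "l k \<cdot> f = l k \<cdot> g" using f g k by simp
      from Q(8)[OF l(1)[OF k] this] obtain u where "u \<in> hom C Q (D k)" "\<And>i. i \<in> Obj J' \<Longrightarrow> u \<cdot> c' i = (if i = 0 then l k \<cdot> f else l k)"
        using colimit_factor[OF Q(1)] by blast
      then show ?thesis using Q(2,4) by force
    qed
    then obtain l' where l': "\<And>k. k \<in> K \<Longrightarrow> l' k \<in> hom C Q (D k)" "\<And>k. k \<in> K \<Longrightarrow> l' k \<cdot> p = l k"
      by metis
    have "fam Q l'"
    proof (rule famloc[OF Q(1,7) l'(1)])
      fix i assume "i \<in> Obj J'"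
      then consider "i = 0" | "i = 1" using Q(2) by auto
      then show "fam (D' i) (\<lambda>k. l' k \<cdot> c' i)"
      proof cases
        case 1
        have "w k = l' k \<cdot> (p \<cdot> f)" if "k \<in> K" for k
          using comp_reduce[OF l'(2)[OF that], of f] f homD[OF l'(1)[OF that]] homD[OF p(1)] homD[OF fg(1)] that by simp
        then show ?thesis using W ext[of W w "\<lambda>k. l' k \<cdot> (p \<cdot> f)"] 1 Q(3,5) by (simp add: fam_def)
      next
        case 2
        then show ?thesis using famL ext[OF LO, of l "\<lambda>k. l' k \<cdot> p"] l'(2) Q(4,6) by (simp add: fam_def)
      qed
    qed
    then obtain v where v: "v \<in> hom C Q L0" "\<And>k. k \<in> K \<Longrightarrow> l0 k \<cdot> v = l' k" using weak by blast
    note t = homD[OF v(1)] homD[OF p(1)] homD[OF q] homD[OF fg(1)] homD[OF fg(2)]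
    have "l0 k \<cdot> (v \<cdot> (p \<cdot> q)) = l0 k" if k: "k \<in> K" for k
      using comp_reduce[OF v(2)[OF k], of "p \<cdot> q"] comp_reduce[OF l'(2)[OF k], of q] l(2)[OF k] t
        homD[OF l0(1)[OF k]] homD[OF l'(1)[OF k]] by simp
    then have "v \<cdot> (p \<cdot> q) \<in> M" using t by (simp add: M_def hom_def)
    then have qv: "q \<cdot> (v \<cdot> (p \<cdot> q)) = q" by (rule qM)
    have s: "q \<cdot> (v \<cdot> p) = Ide C L"
      by (rule qepi[of _ L]) (use t LO qv in \<open>simp_all add: hom_def\<close>)
    have "f = (q \<cdot> (v \<cdot> p)) \<cdot> f" using homD[OF fg(1)] by (simp add: s)
    also have "\<dots> = q \<cdot> (v \<cdot> (p \<cdot> f))" using t by simp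
    also have "\<dots> = (q \<cdot> (v \<cdot> p)) \<cdot> g" using t p(2) by simp
    also have "\<dots> = g" using homD[OF fg(2)] by (simp add: s)
    finally show "f = g" .
  qed
  then show thesis using that[of L l] famL unfolding fam_def by blast
qed

end

section \<open>Directed diagrams\<close>

lemma regular_two:
  assumes "small_regular_cardinal m" shows "|{a, b}| <o m"
proof -
  have m: "Card_order m" "\<not> finite (Field m)" using assms by (auto simp: small_regular_cardinal_def cinfinite_def)
  have "|{a, b}| <o |Field m|"
    using m(2) by (intro finite_ordLess_infinite) (simp_all add: Field_card_of card_of_well_order_on)
  moreover have "|Field m| =o m" using m(1) card_of_Field_ordIso by blast
  ultimately show ?thesis using ordLess_ordIso_trans by blast
qed

lemma directed_posetD:
  assumes "directed_poset m S r"
  shows "i \<in> S \<Longrightarrow> (i, i) \<in> r" "(i, j) \<in> r \<Longrightarrow> (j, k) \<in> r \<Longrightarrow> (i, k) \<in> r"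
    "(i, j) \<in> r \<Longrightarrow> i \<in> S" "(i, j) \<in> r \<Longrightarrow> j \<in> S"
  using assms unfolding directed_poset_def partial_order_on_def preorder_on_def refl_on_def trans_def by blast+

lemma directed_poset_ub:
  assumes "directed_poset m S r" "small_regular_cardinal m" "i \<in> S" "j \<in> S"
  obtains k where "(i, k) \<in> r" "(j, k) \<in> r"
proof -
  have "{i, j} \<subseteq> S" "|{i, j}| <o m" using assms regular_two by auto
  then obtain u where "u \<in> S" "\<forall>a \<in> {i, j}. (a, u) \<in> r" using assms(1) unfolding directed_poset_def by blast
  then show ?thesis using that by blast
qed

lemma poset_hom: "hom (poset_cat S r) i j = (if (i, j) \<in> r then {(i, j)} else {})"
  by (auto simp: hom_def)

lemma preorder_category:
  assumes "\<And>i. i \<in> S \<Longrightarrow> (i, i) \<in> r" "\<And>i j. (i, j) \<in> r \<Longrightarrow> i \<in> S \<and> j \<in> S"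
    "\<And>i j k. (i, j) \<in> r \<Longrightarrow> (j, k) \<in> r \<Longrightarrow> (i, k) \<in> r"
  shows "category (poset_cat S r)"
  unfolding category_def
proof (intro conjI allI ballI)
  fix f assume "f \<in> Arr (poset_cat S r)"
  then show "Dom (poset_cat S r) f \<in> Obj (poset_cat S r)" "Cod (poset_cat S r) f \<in> Obj (poset_cat S r)"
    using assms(2)[of "fst f" "snd f"] by auto
next
  fix X Y Z f g assume "f \<in> hom (poset_cat S r) X Y" "g \<in> hom (poset_cat S r) Y Z"
  then show "g \<cdot>\<^bsub>poset_cat S r\<^esub> f \<in> hom (poset_cat S r) X Z"
    using assms(3) by (auto simp: poset_hom split: if_splits)
qed (auto simp: poset_hom assms(1) split: if_splits)

lemma poset_category: "directed_poset m S r \<Longrightarrow> category (poset_cat S r)"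
  by (rule preorder_category) (blast dest: directed_posetD)+

lemma directed_diagramD:
  assumes "directed_diagram m C M S r D d"
  shows "directed_poset m S r" "is_functor (poset_cat S r) C D d"
    "(i, j) \<in> r \<Longrightarrow> d (i, j) \<in> hom C (D i) (D j)" "(i, j) \<in> r \<Longrightarrow> d (i, j) \<in> M"
    "i \<in> S \<Longrightarrow> d (i, i) = Ide C (D i)" "i \<in> S \<Longrightarrow> D i \<in> Obj C"
    "(i, j) \<in> r \<Longrightarrow> (j, k) \<in> r \<Longrightarrow> d (j, k) \<cdot>\<^bsub>C\<^esub> d (i, j) = d (i, k)"
proof -
  show p: "directed_poset m S r" and f: "is_functor (poset_cat S r) C D d"
    using assms by (simp_all add: directed_diagram_def)
  show "(i, j) \<in> r \<Longrightarrow> d (i, j) \<in> hom C (D i) (D j)"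
    using f unfolding is_functor_def poset_hom by (metis singletonI)
  show "(i, j) \<in> r \<Longrightarrow> d (i, j) \<in> M" using assms by (auto simp: directed_diagram_def)
  show "i \<in> S \<Longrightarrow> d (i, i) = Ide C (D i)" "i \<in> S \<Longrightarrow> D i \<in> Obj C" using f by (auto simp: is_functor_def)
  assume "(i, j) \<in> r" "(j, k) \<in> r"
  then have "(i, j) \<in> hom (poset_cat S r) i j" "(j, k) \<in> hom (poset_cat S r) j k" by (simp_all add: poset_hom)
  then have "d ((j, k) \<cdot>\<^bsub>poset_cat S r\<^esub> (i, j)) = d (j, k) \<cdot>\<^bsub>C\<^esub> d (i, j)" using f unfolding is_functor_def by blast
  then show "d (j, k) \<cdot>\<^bsub>C\<^esub> d (i, j) = d (i, k)" by simp
qed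

lemma poset_coconeI:
  assumes "R \<in> Obj C" "\<And>i. i \<in> S \<Longrightarrow> b i \<in> hom C (D i) R" "\<And>i j. (i, j) \<in> r \<Longrightarrow> b j \<cdot>\<^bsub>C\<^esub> d (i, j) = b i"
  shows "is_cocone (poset_cat S r) C D d R b"
  using assms by (auto simp: is_cocone_def poset_hom)

lemma poset_colimitD:
  assumes "is_colimit (poset_cat S r) C D d Q c"
  shows "Q \<in> Obj C" "i \<in> S \<Longrightarrow> c i \<in> hom C (D i) Q" "(i, j) \<in> r \<Longrightarrow> c j \<cdot>\<^bsub>C\<^esub> d (i, j) = c i"
  using assms by (auto simp: is_cocone_def is_colimit_def poset_hom)

lemma poset_colimit_factor:
  assumes "is_colimit (poset_cat S r) C D d Q c"
    "R \<in> Obj C" "\<And>i. i \<in> S \<Longrightarrow> b i \<in> hom C (D i) R" "\<And>i j. (i, j) \<in> r \<Longrightarrow> b j \<cdot>\<^bsub>C\<^esub> d (i, j) = b i"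
  obtains u where "u \<in> hom C Q R" "\<And>i. i \<in> S \<Longrightarrow> u \<cdot>\<^bsub>C\<^esub> c i = b i"
proof -
  have "is_cocone (poset_cat S r) C D d R b" by (rule poset_coconeI) (fact assms)+
  then have "\<exists>!u. u \<in> hom C Q R \<and> (\<forall>i \<in> Obj (poset_cat S r). u \<cdot>\<^bsub>C\<^esub> c i = b i)"
    using assms(1) unfolding is_colimit_def by blast
  then show ?thesis using that by auto
qed

lemma set_cat_hom:
  "(A, f, B) \<in> hom (set_cat U) A' B' \<longleftrightarrow> A' = A \<and> B' = B \<and> small U A \<and> small U B \<and> f \<in> A \<rightarrow>\<^sub>E B"
  by (auto simp: hom_def set_cat_def)

lemma ex1_implies_unique: "\<exists>!x. P x \<Longrightarrow> P a \<Longrightarrow> P b \<Longrightarrow> a = b"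
  by blast

text \<open>The universal property in \<open>set_cat\<close>, freed of triples and tested against a
  finite set \<open>B\<close>. The elements of \<open>B\<close> have type \<open>'u\<close> because
  those of the hom-sets do; a two-element \<open>B\<close> serves both applications.\<close>

lemma set_colimit_arrows:
  fixes C :: "('o, 'u, 'm) cat_scheme" (structure) and m :: "'u rel" and B :: "'u set"
  assumes C: "category C" and ls: "locally_small TYPE('u) C" and U: "universe TYPE('u)"
    and dd: "directed_diagram m C M S r D d" and X: "X \<in> Obj C" and Q: "Q \<in> Obj C"
    and co: "is_colimit (poset_cat S r) (set_cat TYPE('u))
          (\<lambda>i. hom C X (D i)) (\<lambda>a. hom_map C X (d a)) (hom C X Q) (\<lambda>i. hom_map C X (c i))"
    and c: "\<And>i. i \<in> S \<Longrightarrow> c i \<in> hom C (D i) Q"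
    and t: "\<And>i f. i \<in> S \<Longrightarrow> f \<in> hom C X (D i) \<Longrightarrow> t i f \<in> B"
    and tc: "\<And>i j f. (i, j) \<in> r \<Longrightarrow> f \<in> hom C X (D i) \<Longrightarrow> t j (d (i, j) \<cdot> f) = t i f"
    and B: "finite B"
  shows "\<exists>u. u \<in> hom C X Q \<rightarrow>\<^sub>E B \<and> (\<forall>i \<in> S. \<forall>f \<in> hom C X (D i). u (c i \<cdot> f) = t i f)"
    and "\<And>u v. u \<in> hom C X Q \<rightarrow>\<^sub>E B \<Longrightarrow> v \<in> hom C X Q \<rightarrow>\<^sub>E B \<Longrightarrow>
       (\<And>i f. i \<in> S \<Longrightarrow> f \<in> hom C X (D i) \<Longrightarrow> u (c i \<cdot> f) = t i f) \<Longrightarrow>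
       (\<And>i f. i \<in> S \<Longrightarrow> f \<in> hom C X (D i) \<Longrightarrow> v (c i \<cdot> f) = t i f) \<Longrightarrow> u = v"
proof -
  interpret cat C by (rule cat.intro[OF C])
  let ?S = "set_cat TYPE('u)"
  note dD = directed_diagramD[OF dd]
  have sB: "small TYPE('u) B" by (rule small_finite[OF U B])
  have sh: "small TYPE('u) (hom C X Y)" if "Y \<in> Obj C" for Y using ls X that by (simp add: locally_small_def)
  let ?b = "\<lambda>i. (hom C X (D i), restrict (t i) (hom C X (D i)), B)"
  have "is_cocone (poset_cat S r) ?S (\<lambda>i. hom C X (D i)) (\<lambda>a. hom_map C X (d a)) B ?b"
  proof (rule poset_coconeI)
    show "B \<in> Obj ?S" using sB by (simp add: set_cat_def)
    show "?b i \<in> hom ?S (hom C X (D i)) B" if "i \<in> S" for i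
      using that sB sh[OF dD(6)] t by (simp add: set_cat_hom)
    fix i j assume ij: "(i, j) \<in> r"
    note h = homD[OF dD(3)[OF ij]]
    have "compose (hom C X (D i)) (restrict (t j) (hom C X (D j))) (restrict (\<lambda>g. d (i, j) \<cdot> g) (hom C X (D i)))
      = restrict (t i) (hom C X (D i))"
      using tc[OF ij] comp_hom[OF _ dD(3)[OF ij]] by (auto simp: compose_def fun_eq_iff)
    then show "?b j \<cdot>\<^bsub>?S\<^esub> hom_map C X (d (i, j)) = ?b i"
      using h by (simp add: set_cat_def hom_map_def)
  qed
  then have ex1: "\<exists>!u. u \<in> hom ?S (hom C X Q) B \<and> (\<forall>i \<in> S. u \<cdot>\<^bsub>?S\<^esub> hom_map C X (c i) = ?b i)"
    using co unfolding is_colimit_def by simp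
  have comp: "(hom C X Q, u, B) \<cdot>\<^bsub>?S\<^esub> hom_map C X (c i) = ?b i \<longleftrightarrow> (\<forall>f \<in> hom C X (D i). u (c i \<cdot> f) = t i f)"
    if i: "i \<in> S" for u i
    using homD[OF c[OF i]] by (auto simp: set_cat_def hom_map_def compose_def fun_eq_iff restrict_def)
  have hu: "(hom C X Q, u, B) \<in> hom ?S (hom C X Q) B \<longleftrightarrow> u \<in> hom C X Q \<rightarrow>\<^sub>E B" for u
    using sB sh[OF Q] by (simp add: set_cat_hom)
  have sh: "\<exists>v. u = (hom C X Q, v, B)" if "u \<in> hom ?S (hom C X Q) B" for u
    using that by (cases u) (auto simp: set_cat_hom)
  from ex1 obtain u where u: "u \<in> hom ?S (hom C X Q) B" "\<forall>i \<in> S. u \<cdot>\<^bsub>?S\<^esub> hom_map C X (c i) = ?b i" by blast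
  obtain v where v: "u = (hom C X Q, v, B)" using sh[OF u(1)] by blast
  have "v \<in> hom C X Q \<rightarrow>\<^sub>E B" using u(1) hu unfolding v by simp
  moreover have "\<forall>i \<in> S. \<forall>f \<in> hom C X (D i). v (c i \<cdot> f) = t i f"
    using u(2) comp unfolding v by simp
  ultimately show "\<exists>u. u \<in> hom C X Q \<rightarrow>\<^sub>E B \<and> (\<forall>i \<in> S. \<forall>f \<in> hom C X (D i). u (c i \<cdot> f) = t i f)"
    by blast
  fix u v assume uv: "u \<in> hom C X Q \<rightarrow>\<^sub>E B" "v \<in> hom C X Q \<rightarrow>\<^sub>E B"
    "\<And>i f. i \<in> S \<Longrightarrow> f \<in> hom C X (D i) \<Longrightarrow> u (c i \<cdot> f) = t i f"
    "\<And>i f. i \<in> S \<Longrightarrow> f \<in> hom C X (D i) \<Longrightarrow> v (c i \<cdot> f) = t i f"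
  have "(hom C X Q, u, B) = (hom C X Q, v, B)"
  proof (rule ex1_implies_unique[OF ex1])
    show "(hom C X Q, u, B) \<in> hom ?S (hom C X Q) B \<and> (\<forall>i \<in> S. (hom C X Q, u, B) \<cdot>\<^bsub>?S\<^esub> hom_map C X (c i) = ?b i)"
      using uv comp hu by simp
    show "(hom C X Q, v, B) \<in> hom ?S (hom C X Q) B \<and> (\<forall>i \<in> S. (hom C X Q, v, B) \<cdot>\<^bsub>?S\<^esub> hom_map C X (c i) = ?b i)"
      using uv comp hu by simp
  qed
  then show "u = v" by simp
qed

text \<open>If \<open>f\<close> came from no stage, two different maps to a two-element set would
  agree on all stages: the constant one, and the one that singles out the arrows that do
  factor.\<close>

lemma hom_preserves_factor:
  fixes C :: "('o, 'u, 'm) cat_scheme" (structure) and m :: "'u rel"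
  assumes C: "category C" and ls: "locally_small TYPE('u) C" and U: "universe TYPE('u)"
    and hp: "hom_preserves_directed_colimits m C M X" and X: "X \<in> Obj C"
    and dd: "directed_diagram m C M S r D d" and co: "is_colimit (poset_cat S r) C D d Q c"
    and f: "f \<in> hom C X Q"
  shows "\<exists>i \<in> S. \<exists>g \<in> hom C X (D i). c i \<cdot> g = f"
proof (rule ccontr)
  assume no: "\<not> ?thesis"
  interpret cat C by (rule cat.intro[OF C])
  obtain a b :: 'u where ab: "a \<noteq> b"
    using universe_infinite[OF U] by (metis (full_types) ex_new_if_finite finite.emptyI finite.insertI insertCI)
  have co': "is_colimit (poset_cat S r) (set_cat TYPE('u))
          (\<lambda>i. hom C X (D i)) (\<lambda>a. hom_map C X (d a)) (hom C X Q) (\<lambda>i. hom_map C X (c i))"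
    using hp dd co unfolding hom_preserves_directed_colimits_def by blast
  note cD = poset_colimitD[OF co]
  let ?u = "\<lambda>x. restrict (\<lambda>q. if \<exists>i \<in> S. \<exists>g \<in> hom C X (D i). c i \<cdot> g = q then a else x) (hom C X Q)"
  have "?u a = ?u b"
  proof (rule set_colimit_arrows(2)[OF C ls U dd X cD(1) co' cD(2), where t = "\<lambda>_ _. a" and B = "{a, b}"])
    fix i f assume "i \<in> S" "f \<in> hom C X (D i)"
    then show "?u a (c i \<cdot> f) = a" "?u b (c i \<cdot> f) = a" using comp_hom[OF _ cD(2)] by auto
  qed auto
  from fun_cong[OF this, of f] show False using no f ab by auto
qed

text \<open>The test map sends an arrow at stage \<open>j\<close> to \<open>a\<close> if it becomes
  equal to \<open>f\<close> at some common later stage, and to \<open>b\<close> otherwise. Its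
  values at \<open>c i \<cdot> f\<close> and \<open>c i \<cdot> g\<close> coincide, and the first
  one is \<open>a\<close>.\<close>

lemma hom_preserves_eq:
  fixes C :: "('o, 'u, 'm) cat_scheme" (structure) and m :: "'u rel"
  assumes C: "category C" and ls: "locally_small TYPE('u) C" and U: "universe TYPE('u)"
    and m: "small_regular_cardinal m"
    and hp: "hom_preserves_directed_colimits m C M X" and X: "X \<in> Obj C"
    and dd: "directed_diagram m C M S r D d" and co: "is_colimit (poset_cat S r) C D d Q c"
    and f: "i \<in> S" "f \<in> hom C X (D i)" "g \<in> hom C X (D i)" "c i \<cdot> f = c i \<cdot> g"
  shows "\<exists>j. (i, j) \<in> r \<and> d (i, j) \<cdot> f = d (i, j) \<cdot> g"
proof -
  interpret cat C by (rule cat.intro[OF C])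
  obtain a b :: 'u where ab: "a \<noteq> b"
    using universe_infinite[OF U] by (metis (full_types) ex_new_if_finite finite.emptyI finite.insertI insertCI)
  have co': "is_colimit (poset_cat S r) (set_cat TYPE('u))
          (\<lambda>i. hom C X (D i)) (\<lambda>a. hom_map C X (d a)) (hom C X Q) (\<lambda>i. hom_map C X (c i))"
    using hp dd co unfolding hom_preserves_directed_colimits_def by blast
  note cD = poset_colimitD[OF co]
  note dD = directed_diagramD[OF dd]
  note pD = directed_posetD[OF dD(1)]
  let ?P = "\<lambda>j h. \<exists>k. (i, k) \<in> r \<and> (j, k) \<in> r \<and> d (i, k) \<cdot> f = d (j, k) \<cdot> h"
  \<comment> \<open>The test is compatible with the diagram: in one direction the same later stage
    works, in the other a common upper bound is taken.\<close>
  have P: "?P k (d (j, k) \<cdot> h) = ?P j h" if jk: "(j, k) \<in> r" and h: "h \<in> hom C X (D j)" for j k h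
  proof
    assume "?P k (d (j, k) \<cdot> h)"
    then obtain l where l: "(i, l) \<in> r" "(k, l) \<in> r" "d (i, l) \<cdot> f = d (k, l) \<cdot> (d (j, k) \<cdot> h)" by blast
    have "d (k, l) \<cdot> (d (j, k) \<cdot> h) = d (j, l) \<cdot> h"
      using comp_reduce[OF dD(7)[OF jk l(2)], of h] homD[OF dD(3)[OF jk]] homD[OF dD(3)[OF l(2)]] homD[OF h] by simp
    then show "?P j h" using l pD(2)[OF jk l(2)] by auto
  next
    assume "?P j h"
    then obtain l where l: "(i, l) \<in> r" "(j, l) \<in> r" "d (i, l) \<cdot> f = d (j, l) \<cdot> h" by blast
    obtain l' where l': "(l, l') \<in> r" "(k, l') \<in> r" using directed_poset_ub[OF dD(1) m] pD(4) l(1) jk by metis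
    have "d (i, l') \<cdot> f = d (l, l') \<cdot> (d (i, l) \<cdot> f)"
      using comp_reduce[OF dD(7)[OF l(1) l'(1)], of f] homD[OF dD(3)[OF l(1)]] homD[OF dD(3)[OF l'(1)]] homD[OF f(2)] by simp
    also have "\<dots> = d (j, l') \<cdot> h"
      using comp_reduce[OF dD(7)[OF l(2) l'(1)], of h] homD[OF dD(3)[OF l(2)]] homD[OF dD(3)[OF l'(1)]] homD[OF h] l(3) by simp
    also have "\<dots> = d (k, l') \<cdot> (d (j, k) \<cdot> h)"
      using comp_reduce[OF dD(7)[OF jk l'(2)], of h] homD[OF dD(3)[OF jk]] homD[OF dD(3)[OF l'(2)]] homD[OF h] by simp
    finally show "?P k (d (j, k) \<cdot> h)" using l'(2) pD(2)[OF l(1) l'(1)] by blast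
  qed
  have "\<exists>u. u \<in> hom C X Q \<rightarrow>\<^sub>E {a, b} \<and> (\<forall>j \<in> S. \<forall>h \<in> hom C X (D j). u (c j \<cdot> h) = (if ?P j h then a else b))"
    by (rule set_colimit_arrows(1)[OF C ls U dd X cD(1) co' cD(2)]) (use P in auto)
  then obtain u where u: "\<forall>j \<in> S. \<forall>h \<in> hom C X (D j). u (c j \<cdot> h) = (if ?P j h then a else b)" by blast
  have P: "?P i f" using pD(1)[OF f(1)] by blast
  have "u (c i \<cdot> f) = (if ?P i f then a else b)" using u f by blast
  then have "u (c i \<cdot> f) = a" by (simp only: if_P[OF P])
  moreover have "u (c i \<cdot> g) = (if ?P i g then a else b)" using u f by blast
  ultimately have "?P i g" using f(4) ab by (auto split: if_splits)
  then show ?thesis by blast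
qed


section \<open>Limits and colimits in the base\<close>

locale lps =
  fixes V :: "('o, 'u) smcc" (structure) and lam :: "'u rel"
  assumes univ: "universe TYPE('u)" and lam: "small_regular_cardinal lam"
    and lpV: "locally_presentable_smcc lam V"
begin

sublocale smc V
  by standard (use lpV in \<open>simp add: locally_presentable_smcc_def\<close>)

lemma lp: "locally_presentable lam V"
  using lpV by (simp add: locally_presentable_smcc_def)

lemma co: "cocomplete TYPE('u) V"
  using lp by (simp add: locally_presentable_def)

lemma ls: "locally_small TYPE('u) V"
  using lp by (simp add: locally_presentable_def)

lemma small_hom: "X \<in> Obj V \<Longrightarrow> Y \<in> Obj V \<Longrightarrow> small TYPE('u) (hom V X Y)"
  using ls by (simp add: locally_small_def)

lemma presentable_unit: "presentable lam V \<I>"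
  using lpV by (simp add: locally_presentable_smcc_def)

lemma presentable_tens: "presentable lam V X \<Longrightarrow> presentable lam V Y \<Longrightarrow> presentable lam V (X \<odot> Y)"
  using lpV by (simp add: locally_presentable_smcc_def)

text \<open>The definition of local presentability supplies colimits; limits arise as representing
  objects, here of families subject to no condition.\<close>

lemma product_exists:
  fixes K :: "'k set"
  assumes K: "small TYPE('u) K" and D: "\<And>i. i \<in> K \<Longrightarrow> D i \<in> Obj V"
  obtains Q p where "is_product V K D Q p"
proof (rule representable[OF univ lp K D, where cond = "\<lambda>_ _. True"])
  fix L l assume "L \<in> Obj V" "\<And>k. k \<in> K \<Longrightarrow> l k \<in> hom V L (D k)"
    "\<And>W w. \<lbrakk>W \<in> Obj V; \<And>k. k \<in> K \<Longrightarrow> w k \<in> hom V W (D k); True\<rbrakk> \<Longrightarrow>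
       \<exists>!u. u \<in> hom V W L \<and> (\<forall>k \<in> K. l k \<cdot> u = w k)"
  then have "is_product V K D L l" unfolding is_product_def by simp
  then show thesis by (rule that)
qed auto

lemma equalizer_exists:
  assumes f: "f \<in> hom V X Y" and g: "g \<in> hom V X Y"
  obtains H e where "is_equalizer V f g H e"
proof (rule representable[OF univ lp, where K = "{()}" and D = "\<lambda>_. X" and cond = "\<lambda>_ w. f \<cdot> w () = g \<cdot> w ()"])
  note t = homD[OF f] homD[OF g]
  show "small TYPE('u) {()}" by (rule small_finite[OF univ]) simp
  show "X \<in> Obj V" using f hom_Obj by blast
  fix L l assume L: "L \<in> Obj V" "\<And>k. k \<in> {()} \<Longrightarrow> l k \<in> hom V L X" "f \<cdot> l () = g \<cdot> l ()"
    "\<And>W w. \<lbrakk>W \<in> Obj V; \<And>k. k \<in> {()} \<Longrightarrow> w k \<in> hom V W X; f \<cdot> w () = g \<cdot> w ()\<rbrakk> \<Longrightarrow>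
       \<exists>!u. u \<in> hom V W L \<and> (\<forall>k \<in> {()}. l k \<cdot> u = w k)"
  have "is_equalizer V f g L (l ())"
    unfolding is_equalizer_def
  proof (intro conjI allI ballI impI)
    show "l () \<in> hom V L (Dom V f)" "f \<cdot> l () = g \<cdot> l ()" using L t by auto
    fix W w assume w: "w \<in> hom V W (Dom V f)" "f \<cdot> w = g \<cdot> w"
    then show "\<exists>!u. u \<in> hom V W L \<and> l () \<cdot> u = w"
      using L(4)[of W "\<lambda>_. w"] hom_Obj[OF w(1)] t by simp
  qed
  then show thesis by (rule that)
next
  fix W :: 'o and w :: "unit \<Rightarrow> 'u" and X' c
  assume w: "\<And>k. k \<in> {()} \<Longrightarrow> w k \<in> hom V W X" "f \<cdot> w () = g \<cdot> w ()" "c \<in> hom V X' W"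
  then have "w () \<in> hom V W X" by blast
  then show "f \<cdot> (w () \<cdot> c) = g \<cdot> (w () \<cdot> c)"
    using comp_permute[OF w(2), of c] homD[OF f] homD[OF g] homD[OF w(3)] homD[of "w ()"] by simp
next
  fix W :: 'o and w :: "unit \<Rightarrow> 'u" and X' :: 'o and I
  assume W: "\<And>k. k \<in> {()} \<Longrightarrow> w k \<in> hom V W X"
    and c: "\<And>c. c \<in> I \<Longrightarrow> c \<in> hom V (Dom V c) W \<and> f \<cdot> (w () \<cdot> c) = g \<cdot> (w () \<cdot> c)"
    and e: "\<And>R f g. f \<in> hom V W R \<Longrightarrow> g \<in> hom V W R \<Longrightarrow> (\<And>c. c \<in> I \<Longrightarrow> f \<cdot> c = g \<cdot> c) \<Longrightarrow> f = g"
  have w: "w () \<in> hom V W X" using W by blast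
  show "f \<cdot> w () = g \<cdot> w ()"
  proof (rule e)
    show "f \<cdot> w () \<in> hom V W Y" "g \<cdot> w () \<in> hom V W Y" using comp_hom w f g by blast+
    fix c assume "c \<in> I"
    with c have "c \<in> hom V (Dom V c) W" "f \<cdot> (w () \<cdot> c) = g \<cdot> (w () \<cdot> c)" by auto
    then show "(f \<cdot> w ()) \<cdot> c = (g \<cdot> w ()) \<cdot> c"
      using homD[OF f] homD[OF g] homD[OF w] homD[of c] by simp
  qed
qed (auto simp: category)

lemma pullback_exists:
  assumes f: "f \<in> hom V X Z" and g: "g \<in> hom V Y Z"
  obtains H p q where "is_pullback V f g H p q"
proof -
  have O: "X \<in> Obj V" "Y \<in> Obj V" using f g hom_Obj by blast+
  obtain Q p where P: "is_product V {True, False} (\<lambda>b. if b then X else Y) Q p"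
    by (rule product_exists[of "{True, False}" "\<lambda>b. if b then X else Y"]) (use O small_finite[OF univ, of "{True, False}"] in auto)
  have p: "p True \<in> hom V Q X" "p False \<in> hom V Q Y"
    using P unfolding is_product_def by (metis (full_types) insertCI)+
  have pu: "\<exists>!u. u \<in> hom V R Q \<and> p True \<cdot> u = x \<and> p False \<cdot> u = y" if "x \<in> hom V R X" "y \<in> hom V R Y" for R x y
  proof -
    have "R \<in> Obj V" using that hom_Obj by blast
    then have "\<exists>!u. u \<in> hom V R Q \<and> (\<forall>i \<in> {True, False}. p i \<cdot> u = (if i then x else y))"
      using P that unfolding is_product_def by (elim conjE allE[of _ "\<lambda>i. if i then x else y"] ballE[of _ _ R]) auto
    then show ?thesis by simp
  qed
  have fp: "f \<cdot> p True \<in> hom V Q Z" "g \<cdot> p False \<in> hom V Q Z" using comp_hom p f g by blast+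
  obtain H e where E: "is_equalizer V (f \<cdot> p True) (g \<cdot> p False) H e" using equalizer_exists[OF fp] by blast
  have e: "e \<in> hom V H Q" "(f \<cdot> p True) \<cdot> e = (g \<cdot> p False) \<cdot> e" using E homD[OF fp(1)] by (auto simp: is_equalizer_def)
  note t = homD[OF f] homD[OF g] homD[OF p(1)] homD[OF p(2)] homD[OF e(1)]
  have "is_pullback V f g H (p True \<cdot> e) (p False \<cdot> e)"
    unfolding is_pullback_def
  proof (intro conjI allI ballI impI)
    show "p True \<cdot> e \<in> hom V H (Dom V f)" "p False \<cdot> e \<in> hom V H (Dom V g)" using t by (simp_all add: hom_def)
    show "f \<cdot> (p True \<cdot> e) = g \<cdot> (p False \<cdot> e)" using e(2) t by simp
    fix W v w assume "v \<in> hom V W (Dom V f)" "w \<in> hom V W (Dom V g)" and eq: "f \<cdot> v = g \<cdot> w"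
    then have vw: "v \<in> hom V W X" "w \<in> hom V W Y" using t by auto
    show "\<exists>!u. u \<in> hom V W H \<and> (p True \<cdot> e) \<cdot> u = v \<and> (p False \<cdot> e) \<cdot> u = w"
    proof (rule ex_ex1I)
      obtain u where u: "u \<in> hom V W Q" "p True \<cdot> u = v" "p False \<cdot> u = w" using pu[OF vw] by blast
      have "(f \<cdot> p True) \<cdot> u = (g \<cdot> p False) \<cdot> u" using u eq t homD[OF u(1)] by simp
      then obtain x where x: "x \<in> hom V W H" "e \<cdot> x = u" using E u(1) homD[OF fp(1)] unfolding is_equalizer_def by metis
      then have "x \<in> hom V W H \<and> (p True \<cdot> e) \<cdot> x = v \<and> (p False \<cdot> e) \<cdot> x = w" using u t homD[OF x(1)] by simp
      then show "\<exists>u. u \<in> hom V W H \<and> (p True \<cdot> e) \<cdot> u = v \<and> (p False \<cdot> e) \<cdot> u = w" by blast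
      fix x y assume xy: "x \<in> hom V W H \<and> (p True \<cdot> e) \<cdot> x = v \<and> (p False \<cdot> e) \<cdot> x = w"
        "y \<in> hom V W H \<and> (p True \<cdot> e) \<cdot> y = v \<and> (p False \<cdot> e) \<cdot> y = w"
      note tx = homD[of x W H] homD[of y W H]
      have "e \<cdot> x \<in> hom V W Q" "e \<cdot> y \<in> hom V W Q" using xy comp_hom e(1) by blast+
      moreover have "p True \<cdot> (e \<cdot> x) = v" "p False \<cdot> (e \<cdot> x) = w" "p True \<cdot> (e \<cdot> y) = v" "p False \<cdot> (e \<cdot> y) = w"
        using xy tx t by auto
      ultimately have ex: "e \<cdot> x = e \<cdot> y" using pu[OF vw] by blast
      have "(f \<cdot> p True) \<cdot> (e \<cdot> x) = (g \<cdot> p False) \<cdot> (e \<cdot> x)"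
        using xy eq t tx by auto
      then show "x = y"
        using E \<open>e \<cdot> x \<in> hom V W Q\<close> homD[OF fp(1)] ex xy unfolding is_equalizer_def by metis
    qed
  qed
  then show thesis by (rule that)
qed

text \<open>Tensoring with \<open>X\<close> is a left adjoint and therefore keeps a family jointly
  epic; concretely, both arrows are curried first.\<close>

lemma tens_epi:
  assumes "f \<in> hom V (W \<odot> X) Z" "g \<in> hom V (W \<odot> X) Z" and O: "W \<in> Obj V" "X \<in> Obj V"
    and c: "\<And>c. c \<in> I \<Longrightarrow> c \<in> hom V (Dom V c) W" and eq: "\<And>c. c \<in> I \<Longrightarrow> f \<cdot> (c \<otimes> \<one> X) = g \<cdot> (c \<otimes> \<one> X)"
    and e: "\<And>R f g. f \<in> hom V W R \<Longrightarrow> g \<in> hom V W R \<Longrightarrow> (\<And>c. c \<in> I \<Longrightarrow> f \<cdot> c = g \<cdot> c) \<Longrightarrow> f = g"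
  shows "f = g"
proof -
  have Z: "Z \<in> Obj V" using assms(1) hom_Obj by blast
  note cf = vcurry_hom[OF O(2) Z O(1) assms(1)] vcurry_hom[OF O(2) Z O(1) assms(2)]
  have "vcurry V W X Z f = vcurry V W X Z g"
  proof (rule e[OF cf(1,3)])
    fix c assume ci: "c \<in> I"
    note t = homD[OF c[OF ci]] homD[OF cf(1)] homD[OF cf(3)] Z O
    show "vcurry V W X Z f \<cdot> c = vcurry V W X Z g \<cdot> c"
    proof (rule curry_inj)
      have "evl V X Z \<cdot> ((vcurry V W X Z f \<cdot> c) \<otimes> \<one> X) = evl V X Z \<cdot> ((vcurry V W X Z f \<otimes> \<one> X) \<cdot> (c \<otimes> \<one> X))"
        using t by simp
      also have "\<dots> = f \<cdot> (c \<otimes> \<one> X)" using t by (intro comp_reduce cf) auto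
      also have "\<dots> = g \<cdot> (c \<otimes> \<one> X)" by (rule eq[OF ci])
      also have "\<dots> = evl V X Z \<cdot> ((vcurry V W X Z g \<otimes> \<one> X) \<cdot> (c \<otimes> \<one> X))"
        using t by (intro comp_reduce[symmetric] cf) auto
      finally show "evl V X Z \<cdot> ((vcurry V W X Z f \<cdot> c) \<otimes> \<one> X) = evl V X Z \<cdot> ((vcurry V W X Z g \<cdot> c) \<otimes> \<one> X)"
        using t by simp
    qed (use t c[OF ci] comp_hom cf in auto)
  qed
  then show ?thesis using cf by metis
qed

text \<open>The end of \<open>D(F-,G-)\<close> represents natural families. Naturality is a system
  of equations, stable under precomposition and detected by jointly epic families thanks to
  \<open>tens_epi\<close>. The statement works from the typing of the hom components, so that it
  covers \<open>restricted_rep\<close> as well as the functor part of an algebra.\<close>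

lemma nat_object_exists:
  assumes C: "small TYPE('u) (VObj C)" and D: "vcategory V D"
    and CO: "\<And>X Y. X \<in> VObj C \<Longrightarrow> Y \<in> VObj C \<Longrightarrow> VHom C X Y \<in> Obj V"
    and FO: "\<And>X. X \<in> VObj C \<Longrightarrow> FOb F X \<in> VObj D" and GO: "\<And>X. X \<in> VObj C \<Longrightarrow> FOb G X \<in> VObj D"
    and F: "\<And>X Y. X \<in> VObj C \<Longrightarrow> Y \<in> VObj C \<Longrightarrow> FHom F X Y \<in> hom V (VHom C X Y) (VHom D (FOb F X) (FOb F Y))"
    and G: "\<And>X Y. X \<in> VObj C \<Longrightarrow> Y \<in> VObj C \<Longrightarrow> FHom G X Y \<in> hom V (VHom C X Y) (VHom D (FOb G X) (FOb G Y))"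
  shows "is_nat_object V C D F G (nat_ob V C D F G) (nat_proj V C D F G)"
proof -
  let ?l = "\<lambda>w X Y. VComp D (FOb F X) (FOb F Y) (FOb G Y) \<cdot> (w Y \<otimes> FHom F X Y)"
  let ?r = "\<lambda>W w X Y. VComp D (FOb F X) (FOb G X) (FOb G Y) \<cdot> ((FHom G X Y \<otimes> w X) \<cdot> symm V W (VHom C X Y))"
  \<comment> \<open>Both sides of naturality are restricted along \<open>f\<close> by composing with
    \<open>f \<otimes> \<one> (VHom C X Y)\<close>; this yields the restriction condition and the
    locality condition of \<open>representable\<close>.\<close>
  have pre: "?l (\<lambda>X. w X \<cdot> f) X Y = ?l w X Y \<cdot> (f \<otimes> \<one> (VHom C X Y))"
    "?r W' (\<lambda>X. w X \<cdot> f) X Y = ?r W w X Y \<cdot> (f \<otimes> \<one> (VHom C X Y))"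
    "?l w X Y \<in> hom V (W \<odot> VHom C X Y) (VHom D (FOb F X) (FOb G Y))"
    "?r W w X Y \<in> hom V (W \<odot> VHom C X Y) (VHom D (FOb F X) (FOb G Y))"
    if W: "W \<in> Obj V" and w: "\<And>X. X \<in> VObj C \<Longrightarrow> w X \<in> hom V W (VHom D (FOb F X) (FOb G X))"
      and f: "f \<in> hom V W' W" and XY: "X \<in> VObj C" "Y \<in> VObj C" for W W' w f X Y
  proof -
    have W': "W' \<in> Obj V" using f hom_Obj by blast
    note t = W W' D CO FO GO homD[OF w[OF XY(1)]] homD[OF w[OF XY(2)]] homD[OF f] homD[OF F[OF XY]] homD[OF G[OF XY]] XY
    show "?l (\<lambda>X. w X \<cdot> f) X Y = ?l w X Y \<cdot> (f \<otimes> \<one> (VHom C X Y))" using t by simp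
    have "symm V W (VHom C X Y) \<cdot> (f \<otimes> \<one> (VHom C X Y)) = (\<one> (VHom C X Y) \<otimes> f) \<cdot> symm V W' (VHom C X Y)"
      using t by (intro symm_nat) (auto simp: hom_def)
    then show "?r W' (\<lambda>X. w X \<cdot> f) X Y = ?r W w X Y \<cdot> (f \<otimes> \<one> (VHom C X Y))" using t by simp
    show "?l w X Y \<in> hom V (W \<odot> VHom C X Y) (VHom D (FOb F X) (FOb G Y))"
      "?r W w X Y \<in> hom V (W \<odot> VHom C X Y) (VHom D (FOb F X) (FOb G Y))" using t by (simp_all add: hom_def)
  qed
  let ?cond = "\<lambda>W w. \<forall>X \<in> VObj C. \<forall>Y \<in> VObj C. ?l w X Y = ?r W w X Y"
  have fam: "vnat_family V C D F G W w \<longleftrightarrow> W \<in> Obj V \<and>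
     (\<forall>X \<in> VObj C. w X \<in> hom V W (VHom D (FOb F X) (FOb G X))) \<and> ?cond W w" for W w
  proof -
    have "VComp D (FOb F X) (FOb G X) (FOb G Y) \<cdot> (FHom G X Y \<otimes> w X) \<cdot> symm V W (VHom C X Y) = ?r W w X Y"
      if "W \<in> Obj V" "\<forall>X \<in> VObj C. w X \<in> hom V W (VHom D (FOb F X) (FOb G X))" and XY: "X \<in> VObj C" "Y \<in> VObj C" for X Y
    proof -
      have "w X \<in> hom V W (VHom D (FOb F X) (FOb G X))" using that by blast
      from homD[OF this] show ?thesis using that D CO FO GO homD[OF F[OF XY]] homD[OF G[OF XY]] by simp
    qed
    then show ?thesis unfolding vnat_family_def by auto
  qed
  have "\<exists>N p. is_nat_object V C D F G N p"
  proof (rule representable[OF univ lp C, where D = "\<lambda>X. VHom D (FOb F X) (FOb G X)" and cond = ?cond])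
    show "VHom D (FOb F X) (FOb G X) \<in> Obj V" if "X \<in> VObj C" for X using that FO GO D by simp
    fix L l assume L: "L \<in> Obj V" "\<And>k. k \<in> VObj C \<Longrightarrow> l k \<in> hom V L (VHom D (FOb F k) (FOb G k))" "?cond L l"
      "\<And>W w. \<lbrakk>W \<in> Obj V; \<And>k. k \<in> VObj C \<Longrightarrow> w k \<in> hom V W (VHom D (FOb F k) (FOb G k)); ?cond W w\<rbrakk> \<Longrightarrow>
       \<exists>!u. u \<in> hom V W L \<and> (\<forall>k \<in> VObj C. l k \<cdot> u = w k)"
    have "is_nat_object V C D F G L l" unfolding is_nat_object_def fam using L by blast
    then show "\<exists>N p. is_nat_object V C D F G N p" by blast
  next
    fix W w X f assume W: "W \<in> Obj V" "\<And>k. k \<in> VObj C \<Longrightarrow> w k \<in> hom V W (VHom D (FOb F k) (FOb G k))" "?cond W w" "f \<in> hom V X W"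
    show "?cond X (\<lambda>k. w k \<cdot> f)"
      using pre(1,2)[of W w, OF W(1,2,4)] W(3) by simp
  next
    fix W w X I assume W: "W \<in> Obj V" "\<And>k. k \<in> VObj C \<Longrightarrow> w k \<in> hom V W (VHom D (FOb F k) (FOb G k))"
      and c: "\<And>c. c \<in> I \<Longrightarrow> c \<in> hom V (Dom V c) W \<and> ?cond (Dom V c) (\<lambda>k. w k \<cdot> c)"
      and e: "\<And>R f g. f \<in> hom V W R \<Longrightarrow> g \<in> hom V W R \<Longrightarrow> (\<And>c. c \<in> I \<Longrightarrow> f \<cdot> c = g \<cdot> c) \<Longrightarrow> f = g"
    show "?cond W w"
    proof (intro ballI)
      fix X Y assume XY: "X \<in> VObj C" "Y \<in> VObj C"
      show "?l w X Y = ?r W w X Y"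
      proof (rule tens_epi[OF pre(3,4)[OF W(1,2) Ide_hom[OF W(1)] XY] W(1) CO[OF XY] _ _ e])
        fix c assume ci: "c \<in> I"
        then show "c \<in> hom V (Dom V c) W" using c by blast
        have "?l (\<lambda>k. w k \<cdot> c) X Y = ?r (Dom V c) (\<lambda>k. w k \<cdot> c) X Y" using c ci XY by blast
        then show "?l w X Y \<cdot> (c \<otimes> \<one> (VHom C X Y)) = ?r W w X Y \<cdot> (c \<otimes> \<one> (VHom C X Y))"
          using pre(1,2)[of W w, OF W(1,2) _ XY, of c "Dom V c"] c[OF ci] by simp
      qed (use W in auto)
    qed
  qed auto
  then have "\<exists>x. case x of (N, p) \<Rightarrow> is_nat_object V C D F G N p" by simp
  from someI_ex[OF this] have "case nat_object V C D F G of (N, p) \<Rightarrow> is_nat_object V C D F G N p"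
    unfolding nat_object_def .
  then show ?thesis by (cases "nat_object V C D F G") simp
qed

lemma coproduct_exists:
  fixes K :: "'k set"
  assumes K: "small TYPE('u) K" and D: "\<And>i. i \<in> K \<Longrightarrow> D i \<in> Obj V"
  obtains Q c where "is_coproduct V K D Q c"
proof -
  \<comment> \<open>The discrete shape: its order is equality on \<open>K\<close>.\<close>
  let ?J = "poset_cat K (Id_on K)"
  have J: "category ?J" by (rule preorder_category) auto
  have F: "is_functor ?J V D (\<lambda>a. \<one> (D (fst a)))"
    unfolding is_functor_def
  proof (intro conjI allI ballI)
    show "category ?J" "category V" by (fact J category)+
  next
    fix i j a assume "a \<in> hom ?J i j"
    then have "a = (i, i)" "j = i" "i \<in> K" by (auto simp: poset_hom split: if_splits)
    then show "\<one> (D (fst a)) \<in> hom V (D i) (D j)" using Ide_hom[OF D] by simp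
  next
    fix i j k a b assume "a \<in> hom ?J i j" "b \<in> hom ?J j k"
    then have "a = (i, i)" "b = (i, i)" "i \<in> K" by (auto simp: poset_hom split: if_splits)
    then show "\<one> (D (fst (b \<cdot>\<^bsub>?J\<^esub> a))) = \<one> (D (fst b)) \<cdot> \<one> (D (fst a))" using D by simp
  qed (use D in auto)
  have "small TYPE('u) (Id_on K)" unfolding Id_on_def
    by (rule small_UN[OF univ K], rule small_finite[OF univ]) simp
  then obtain Q c where Q: "is_colimit ?J V D (\<lambda>a. \<one> (D (fst a))) Q c"
    using cocomplete_small[OF co _ _ F] K by auto
  have "is_coproduct V K D Q c"
    unfolding is_coproduct_def
  proof (intro conjI ballI allI impI)
    fix R r assume "R \<in> Obj V" and r: "\<forall>i\<in>K. r i \<in> hom V (D i) R"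
    then have "is_cocone ?J V D (\<lambda>a. \<one> (D (fst a))) R r"
      by (intro poset_coconeI) (auto simp: hom_def)
    then show "\<exists>!u. u \<in> hom V Q R \<and> (\<forall>i\<in>K. u \<cdot> c i = r i)" using Q unfolding is_colimit_def by simp
  qed (use poset_colimitD[OF Q] in auto)
  then show thesis by (rule that)
qed

lemma directed_colimit_exists:
  fixes m :: "'u rel"
  assumes "directed_diagram m V M S r D d"
  obtains Q c where "is_colimit (poset_cat S r) V D d Q c"
proof -
  have S: "small TYPE('u) S" "r \<subseteq> S \<times> S" using directed_diagramD(1)[OF assms] by (auto simp: directed_poset_def)
  have "small TYPE('u) r" by (rule small_mono[OF small_Sigma[OF univ S(1) S(1)] S(2)])
  then show thesis using cocomplete_small[OF co _ _ directed_diagramD(2)[OF assms]] S that by auto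
qed

lemma presentable_factor:
  assumes "presentable lam V X" "directed_diagram lam V M S r D d" "is_colimit (poset_cat S r) V D d Q c"
    "f \<in> hom V X Q"
  shows "\<exists>i \<in> S. \<exists>g \<in> hom V X (D i). c i \<cdot> g = f"
proof -
  have "directed_diagram lam V (Arr V) S r D d"
    using assms(2) directed_diagramD(3)[OF assms(2)] unfolding directed_diagram_def by (auto simp: hom_def)
  then show ?thesis using hom_preserves_factor[OF category ls univ] assms unfolding presentable_def by blast
qed

lemma presentable_eq:
  assumes "presentable lam V X" "directed_diagram lam V M S r D d" "is_colimit (poset_cat S r) V D d Q c"
    "i \<in> S" "f \<in> hom V X (D i)" "g \<in> hom V X (D i)" "c i \<cdot> f = c i \<cdot> g"
  shows "\<exists>j. (i, j) \<in> r \<and> d (i, j) \<cdot> f = d (i, j) \<cdot> g"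
proof -
  have "directed_diagram lam V (Arr V) S r D d"
    using assms(2) directed_diagramD(3)[OF assms(2)] unfolding directed_diagram_def by (auto simp: hom_def)
  then show ?thesis using hom_preserves_eq[OF category ls univ lam] assms unfolding presentable_def by blast
qed

end

section \<open>Algebras and their homomorphisms\<close>

text \<open>That \<open>self V\<close> and the opposite of \<open>T\<close> are \<V>-categories is
  contained in what an enriched adjunction asserts. The final proof reads both facts off the free
  algebra functor instead of verifying the axioms.\<close>

locale thy_alg = lps V lam for V :: "('o, 'u) smcc" (structure) and lam :: "'u rel" +
  fixes P :: "'o set" and T :: "('o, 'o, 'u) vcat" and J :: "('o, 'o, 'u) vfun"
  assumes PS: "small TYPE('u) P" and PP: "\<And>X. X \<in> P \<Longrightarrow> presentable lam V X"
    and pre: "pretheory V P T J"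
    and slf: "vcategory V (self V)" and opT: "vcategory V (vop V T)"
begin

abbreviation To where "To \<equiv> vop V T"
abbreviation AT where "AT \<equiv> Alg V P T J"

lemma PO: "X \<in> P \<Longrightarrow> X \<in> Obj V"
  using PP by (simp add: presentable_def)

lemma To_Obj [simp]: "VObj To = P"
  using pre by (simp add: vop_def pretheory_def)

lemma Pop_simps [simp]: "VObj (vop V (vfull (self V) P)) = P" "VHom (vop V (vfull (self V) P)) X Y = ihom V Y X"
  by (simp_all add: vop_def vfull_def self_def)

lemma To_hom [simp]: "X \<in> P \<Longrightarrow> Y \<in> P \<Longrightarrow> VHom To X Y \<in> Obj V"
  using vcatD(1)[OF opT] by simp

lemma J_obj: "X \<in> P \<Longrightarrow> FOb J X = X"
  using pre by (simp add: pretheory_def)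

lemma J_hom: "X \<in> P \<Longrightarrow> Y \<in> P \<Longrightarrow> FHom J Y X \<in> hom V (ihom V Y X) (VHom To X Y)"
proof -
  assume XY: "X \<in> P" "Y \<in> P"
  have "vfunctor V (vfull (self V) P) T J" using pre by (simp add: pretheory_def)
  from vfunctorD(5)[OF this, of Y X] show ?thesis using XY by (simp add: vfull_def J_obj vop_def)
qed

lemma J_Arr [simp]:
  assumes "X \<in> P" "Y \<in> P"
  shows "FHom J Y X \<in> Arr V" "Dom V (FHom J Y X) = ihom V Y X" "Cod V (FHom J Y X) = VHom To X Y"
  using J_hom[OF assms] by (auto simp: hom_def)

text \<open>Precomposition [Y,X] \<otimes> [X,A] \<rightarrow> [Y,A] as an action on the powers of
  \<open>A\<close>. An algebra structure extends it along \<open>J\<close>.\<close>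

definition jact where
  "jact A X Y = VComp (self V) Y X A \<cdot> symm V (ihom V Y X) (ihom V X A)"

lemma jact_Arr [simp]:
  assumes "X \<in> Obj V" "Y \<in> Obj V" "A \<in> Obj V"
  shows "jact A X Y \<in> Arr V" "Dom V (jact A X Y) = ihom V Y X \<odot> ihom V X A" "Cod V (jact A X Y) = ihom V Y A"
  using assms by (simp_all add: jact_def)

lemma restricted_rep_simps:
  assumes "A \<in> Obj V"
  shows "X \<in> P \<Longrightarrow> FOb (restricted_rep V (self V) P A) X = ihom V X A"
    "X \<in> P \<Longrightarrow> Y \<in> P \<Longrightarrow> FHom (restricted_rep V (self V) P A) X Y =
       vcurry V (ihom V Y X) (ihom V X A) (ihom V Y A) (jact A X Y)"
  using assms by (simp_all add: restricted_rep_def mk_vfun_def jact_def)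

lemma J_restr:
  assumes "X \<in> P"
  shows "FOb (vfun_comp V (vop V (vfull (self V) P)) G (vop_fun J)) X = FOb G X"
    "Y \<in> P \<Longrightarrow> FHom (vfun_comp V (vop V (vfull (self V) P)) G (vop_fun J)) X Y = FHom G X Y \<cdot> FHom J Y X"
  using assms by (simp_all add: vfun_comp_def mk_vfun_def vop_fun_def J_obj)

text \<open>\<V>-functors are undefined outside their domain, so the equation that defines an
  algebra is equality of values on \<open>P\<close>; uncurrying turns it into an equation between
  actions.\<close>

lemma Alg_Obj_iff:
  "A \<in> VObj AT \<longleftrightarrow> snd A \<in> Obj V \<and> vfunctor V To (self V) (fst A) \<and> (\<forall>X \<in> P. FOb (fst A) X = ihom V X (snd A)) \<and>
     (\<forall>X \<in> P. \<forall>Y \<in> P. vact (fst A) X Y \<cdot> (FHom J Y X \<otimes> \<one> (ihom V X (snd A))) = jact (snd A) X Y)"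
proof -
  obtain G B where A: "A = (G, B)" by (cases A)
  let ?R = "vop V (vfull (self V) P)"
  have "A \<in> VObj AT \<longleftrightarrow> vfunctor V To (self V) G \<and> B \<in> Obj V \<and> vfun_comp V ?R G (vop_fun J) = restricted_rep V (self V) P B"
    by (auto simp: A Alg_def vpullback_def vfunctor_cat_def alg_restr_def vprecomp_def restricted_yoneda_def Let_def mk_vfun_def)
  moreover have "vfun_comp V ?R G (vop_fun J) = restricted_rep V (self V) P B \<longleftrightarrow>
      (\<forall>X \<in> P. FOb G X = ihom V X B) \<and>
      (\<forall>X \<in> P. \<forall>Y \<in> P. vact G X Y \<cdot> (FHom J Y X \<otimes> \<one> (ihom V X B)) = jact B X Y)" (is "?l \<longleftrightarrow> ?r")
    if G: "vfunctor V To (self V) G" and B: "B \<in> Obj V"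
  proof -
    have key: "FHom G X Y \<cdot> FHom J Y X = vcurry V (ihom V Y X) (ihom V X B) (ihom V Y B) (jact B X Y) \<longleftrightarrow>
      vact G X Y \<cdot> (FHom J Y X \<otimes> \<one> (ihom V X B)) = jact B X Y"
      if XY: "X \<in> P" "Y \<in> P" and F: "FOb G X = ihom V X B" "FOb G Y = ihom V Y B" for X Y
    proof -
      note t = XY B PO[OF XY(1)] PO[OF XY(2)] vfunctor_Arr[OF G, of X Y]
      have 1: "vact G X Y \<cdot> (FHom J Y X \<otimes> \<one> (ihom V X B)) =
          evl V (ihom V X B) (ihom V Y B) \<cdot> ((FHom G X Y \<cdot> FHom J Y X) \<otimes> \<one> (ihom V X B))"
        using t F by (simp add: vact_def)
      have h: "FHom G X Y \<cdot> FHom J Y X \<in> hom V (ihom V Y X) (ihom V (ihom V X B) (ihom V Y B))"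
        using t F by (simp add: hom_def)
      show ?thesis
      proof
        assume "FHom G X Y \<cdot> FHom J Y X = vcurry V (ihom V Y X) (ihom V X B) (ihom V Y B) (jact B X Y)"
        then show "vact G X Y \<cdot> (FHom J Y X \<otimes> \<one> (ihom V X B)) = jact B X Y"
          unfolding 1 using t by simp
      next
        assume "vact G X Y \<cdot> (FHom J Y X \<otimes> \<one> (ihom V X B)) = jact B X Y"
        then show "FHom G X Y \<cdot> FHom J Y X = vcurry V (ihom V Y X) (ihom V X B) (ihom V Y B) (jact B X Y)"
          unfolding 1 using t h vcurry_eqI[OF _ h] by simp
      qed
    qed
    show ?thesis
    proof
      assume l: ?l
      have o: "FOb G X = ihom V X B" if "X \<in> P" for X
        using J_restr(1)[OF that, of G] restricted_rep_simps(1)[OF B that] l by simp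
      have "FHom G X Y \<cdot> FHom J Y X = vcurry V (ihom V Y X) (ihom V X B) (ihom V Y B) (jact B X Y)"
        if "X \<in> P" "Y \<in> P" for X Y
        using J_restr(2)[OF that, of G] restricted_rep_simps(2)[OF B that] l by simp
      then show ?r using o key by blast
    next
      assume r: ?r
      have "FHom G X Y \<cdot> FHom J Y X = vcurry V (ihom V Y X) (ihom V X B) (ihom V Y B) (jact B X Y)"
        if "X \<in> P" "Y \<in> P" for X Y
        using that r key by blast
      then show ?l using r
        unfolding vfun_comp_def restricted_rep_def mk_vfun_def
        by (auto simp: fun_eq_iff restrict_def vop_fun_def J_obj jact_def)
    qed
  qed
  ultimately show ?thesis by (auto simp: A)
qed

lemma AlgD:
  assumes "A \<in> VObj AT"
  shows "snd A \<in> Obj V" "vfunctor V To (self V) (fst A)" "X \<in> P \<Longrightarrow> FOb (fst A) X = ihom V X (snd A)"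
    "X \<in> P \<Longrightarrow> Y \<in> P \<Longrightarrow> vact (fst A) X Y \<cdot> (FHom J Y X \<otimes> \<one> (ihom V X (snd A))) = jact (snd A) X Y"
  using assms unfolding Alg_Obj_iff by auto

lemma alg_act [simp]:
  assumes "A \<in> VObj AT" "X \<in> P" "Y \<in> P"
  shows "vact (fst A) X Y \<in> Arr V" "Dom V (vact (fst A) X Y) = VHom To X Y \<odot> ihom V X (snd A)"
    "Cod V (vact (fst A) X Y) = ihom V Y (snd A)"
  using vact_Arr[OF AlgD(2)[OF assms(1)], of X Y] AlgD(3)[OF assms(1)] assms by auto

text \<open>By \<open>hom_point_bij\<close> these are exactly the arrows underlying the points of
  the hom-objects of \<open>AT\<close>; all later work with algebras goes through this
  predicate.\<close>

definition Hm where
  "Hm A B f \<longleftrightarrow> f \<in> hom V (snd A) (snd B) \<and>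
     (\<forall>X \<in> P. \<forall>Y \<in> P. ipost Y f \<cdot> vact (fst A) X Y = vact (fst B) X Y \<cdot> (\<one> (VHom To X Y) \<otimes> ipost X f))"

text \<open>Serves to evaluate the restricted Yoneda functor on points. The unit constraint appears
  because a point has the unit as its domain, and \<open>lunit_tens\<close> moves it into
  place.\<close>

lemma comp_point:
  assumes O: "X \<in> Obj V" "A \<in> Obj V" "B \<in> Obj V" and z: "z \<in> hom V \<I> (ihom V A B)"
  shows "VComp (self V) X A B \<cdot> (z \<otimes> \<one> (ihom V X A)) = ipost X (arrow_of V A B z) \<cdot> lunit V (ihom V X A)"
proof (rule curry_inj)
  let ?XA = "ihom V X A"
  note az = arrow_of_hom[OF z O(2,3)]
  note t = O homD[OF z] homD[OF az(1)]
  have "evl V X B \<cdot> ((VComp (self V) X A B \<cdot> (z \<otimes> \<one> ?XA)) \<otimes> \<one> X) =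
      evl V A B \<cdot> ((z \<otimes> (evl V X A \<cdot> (\<one> ?XA \<otimes> \<one> X))) \<cdot> assoc V \<I> ?XA X)"
    using O z by (intro evl_self_comp_tens) (simp_all add: Ide_hom)
  also have "\<dots> = evl V A B \<cdot> ((z \<otimes> \<one> A) \<cdot> ((\<one> \<I> \<otimes> evl V X A) \<cdot> assoc V \<I> ?XA X))"
    using t by simp
  also have "\<dots> = (arrow_of V A B z \<cdot> lunit V A) \<cdot> ((\<one> \<I> \<otimes> evl V X A) \<cdot> assoc V \<I> ?XA X)"
    using t by (intro comp_reduce[OF az(2)[symmetric]]) auto
  also have "\<dots> = arrow_of V A B z \<cdot> (evl V X A \<cdot> (lunit V (?XA \<odot> X) \<cdot> assoc V \<I> ?XA X))"
    using t comp_permute[OF lunit_nat[OF evl_hom[OF O(1,2)]], of "assoc V \<I> ?XA X"] by simp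
  also have "\<dots> = arrow_of V A B z \<cdot> (evl V X A \<cdot> (lunit V ?XA \<otimes> \<one> X))"
    using O by (simp add: lunit_tens)
  also have "\<dots> = evl V X B \<cdot> ((ipost X (arrow_of V A B z) \<cdot> lunit V ?XA) \<otimes> \<one> X)"
    using t az(1) by (intro evl_tens[symmetric]) (simp_all add: hom_def)
  finally show "evl V X B \<cdot> ((VComp (self V) X A B \<cdot> (z \<otimes> \<one> ?XA)) \<otimes> \<one> X) =
    evl V X B \<cdot> ((ipost X (arrow_of V A B z) \<cdot> lunit V ?XA) \<otimes> \<one> X)" .
  show "X \<in> Obj V" "B \<in> Obj V" by fact+
qed (use O arrow_of_hom[OF z O(2,3)] z in \<open>simp_all add: hom_def\<close>)

text \<open>The component [A,B] \<rightarrow> [[X,A],[X,B]] of the restricted Yoneda functor on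
  hom-objects.\<close>

definition yfam where
  "yfam A B X = vcurry V (ihom V A B) (ihom V X A) (ihom V X B) (VComp (self V) X A B)"

lemma yfam_Arr [simp]:
  assumes "X \<in> Obj V" "A \<in> Obj V" "B \<in> Obj V"
  shows "yfam A B X \<in> Arr V" "Dom V (yfam A B X) = ihom V A B"
    "Cod V (yfam A B X) = ihom V (ihom V X A) (ihom V X B)"
    "evl V (ihom V X A) (ihom V X B) \<cdot> (yfam A B X \<otimes> \<one> (ihom V X A)) = VComp (self V) X A B"
  using assms by (simp_all add: yfam_def)

lemma yfam_point:
  assumes "X \<in> Obj V" "A \<in> Obj V" "B \<in> Obj V" "z \<in> hom V \<I> (ihom V A B)"
  shows "yfam A B X \<cdot> z = name_of V (ipost X (arrow_of V A B z))"
proof (rule curry_inj)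
  note az = arrow_of_hom[OF assms(4,2,3)]
  note t = assms(1-3) homD[OF assms(4)] homD[OF az(1)]
  have ip: "ipost X (arrow_of V A B z) \<in> hom V (ihom V X A) (ihom V X B)" using t by (simp add: hom_def)
  have "evl V (ihom V X A) (ihom V X B) \<cdot> ((yfam A B X \<cdot> z) \<otimes> \<one> (ihom V X A)) =
    evl V (ihom V X A) (ihom V X B) \<cdot> ((yfam A B X \<otimes> \<one> (ihom V X A)) \<cdot> (z \<otimes> \<one> (ihom V X A)))"
    using t by simp
  also have "\<dots> = VComp (self V) X A B \<cdot> (z \<otimes> \<one> (ihom V X A))"
    using t by (intro comp_reduce yfam_Arr) auto
  also have "\<dots> = evl V (ihom V X A) (ihom V X B) \<cdot> (name_of V (ipost X (arrow_of V A B z)) \<otimes> \<one> (ihom V X A))"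
    by (simp only: comp_point[OF assms] name_of_hom(2)[OF ip])
  finally show "evl V (ihom V X A) (ihom V X B) \<cdot> ((yfam A B X \<cdot> z) \<otimes> \<one> (ihom V X A)) =
    evl V (ihom V X A) (ihom V X B) \<cdot> (name_of V (ipost X (arrow_of V A B z)) \<otimes> \<one> (ihom V X A))" .
  show "name_of V (ipost X (arrow_of V A B z)) \<in> hom V \<I> (ihom V (ihom V X A) (ihom V X B))"
    by (rule name_of_hom[OF ip])
  show "yfam A B X \<cdot> z \<in> hom V \<I> (ihom V (ihom V X A) (ihom V X B))" using t by (simp add: hom_def)
qed (use assms in simp_all)

text \<open>After uncurrying this is associativity of composition in \<open>self V\<close>; the
  symmetries brought in by the opposite category are collected with the hexagon.\<close>

lemma yfam_nat:
  assumes O: "X \<in> Obj V" "Y \<in> Obj V" "A \<in> Obj V" "B \<in> Obj V"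
  shows "VComp (self V) (ihom V X A) (ihom V Y A) (ihom V Y B) \<cdot>
      (yfam A B Y \<otimes> vcurry V (ihom V Y X) (ihom V X A) (ihom V Y A) (jact A X Y)) =
    VComp (self V) (ihom V X A) (ihom V X B) (ihom V Y B) \<cdot>
      ((vcurry V (ihom V Y X) (ihom V X B) (ihom V Y B) (jact B X Y) \<otimes> yfam A B X) \<cdot> symm V (ihom V A B) (ihom V Y X))"
    (is "?L = ?R")
proof (rule curry_inj)
  let ?U = "ihom V Y X" and ?W = "ihom V A B" and ?Z = "ihom V X A" and ?YA = "ihom V Y A" and ?YB = "ihom V Y B"
    and ?XB = "ihom V X B" and ?s = "symm V" and ?a = "assoc V"
  let ?jA = "vcurry V ?U ?Z ?YA (jact A X Y)" and ?jB = "vcurry V ?U ?XB ?YB (jact B X Y)"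
  have "evl V ?Z ?YB \<cdot> (?L \<otimes> \<one> ?Z) = evl V ?YA ?YB \<cdot> ((yfam A B Y \<otimes> (evl V ?Z ?YA \<cdot> (?jA \<otimes> \<one> ?Z))) \<cdot> ?a ?W ?U ?Z)"
    using O by (intro evl_self_comp_tens) (simp_all add: hom_def)
  also have "\<dots> = evl V ?YA ?YB \<cdot> ((yfam A B Y \<otimes> \<one> ?YA) \<cdot> ((\<one> ?W \<otimes> jact A X Y) \<cdot> ?a ?W ?U ?Z))"
    using O by simp
  also have "\<dots> = VComp (self V) Y A B \<cdot> ((\<one> ?W \<otimes> jact A X Y) \<cdot> ?a ?W ?U ?Z)"
    using O by (intro comp_reduce yfam_Arr) auto
  finally have L: "evl V ?Z ?YB \<cdot> (?L \<otimes> \<one> ?Z) = VComp (self V) Y A B \<cdot> ((\<one> ?W \<otimes> VComp (self V) Y X A) \<cdot> ((\<one> ?W \<otimes> ?s ?U ?Z) \<cdot> ?a ?W ?U ?Z))"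
    using O by (simp add: jact_def)
  have "evl V ?Z ?YB \<cdot> (?R \<otimes> \<one> ?Z) =
     (evl V ?Z ?YB \<cdot> ((VComp (self V) ?Z ?XB ?YB \<cdot> (?jB \<otimes> yfam A B X)) \<otimes> \<one> ?Z)) \<cdot> (?s ?W ?U \<otimes> \<one> ?Z)"
    using O by simp
  also have "\<dots> = (evl V ?XB ?YB \<cdot> ((?jB \<otimes> (evl V ?Z ?XB \<cdot> (yfam A B X \<otimes> \<one> ?Z))) \<cdot> ?a ?U ?W ?Z)) \<cdot> (?s ?W ?U \<otimes> \<one> ?Z)"
    using O by (subst evl_self_comp_tens[where W = ?U and W' = ?W]) (simp_all add: hom_def)
  also have "\<dots> = evl V ?XB ?YB \<cdot> ((?jB \<otimes> \<one> ?XB) \<cdot> ((\<one> ?U \<otimes> VComp (self V) X A B) \<cdot> (?a ?U ?W ?Z \<cdot> (?s ?W ?U \<otimes> \<one> ?Z))))"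
    using O by simp
  also have "\<dots> = jact B X Y \<cdot> ((\<one> ?U \<otimes> VComp (self V) X A B) \<cdot> (?a ?U ?W ?Z \<cdot> (?s ?W ?U \<otimes> \<one> ?Z)))"
    using O by (intro comp_reduce vcurry_Arr) auto
  also have "\<dots> = VComp (self V) Y X B \<cdot> (?s ?U ?XB \<cdot> ((\<one> ?U \<otimes> VComp (self V) X A B) \<cdot> (?a ?U ?W ?Z \<cdot> (?s ?W ?U \<otimes> \<one> ?Z))))"
    using O by (simp add: jact_def)
  also have "?s ?U ?XB \<cdot> ((\<one> ?U \<otimes> VComp (self V) X A B) \<cdot> (?a ?U ?W ?Z \<cdot> (?s ?W ?U \<otimes> \<one> ?Z))) =
      (VComp (self V) X A B \<otimes> \<one> ?U) \<cdot> (?s ?U (?W \<odot> ?Z) \<cdot> (?a ?U ?W ?Z \<cdot> (?s ?W ?U \<otimes> \<one> ?Z)))"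
    using O by (intro comp_permute symm_nat) (simp_all add: hom_def)
  also have "VComp (self V) Y X B \<cdot> ((VComp (self V) X A B \<otimes> \<one> ?U) \<cdot> (?s ?U (?W \<odot> ?Z) \<cdot> (?a ?U ?W ?Z \<cdot> (?s ?W ?U \<otimes> \<one> ?Z)))) =
     (VComp (self V) Y A B \<cdot> ((\<one> ?W \<otimes> VComp (self V) Y X A) \<cdot> ?a ?W ?Z ?U)) \<cdot> (?s ?U (?W \<odot> ?Z) \<cdot> (?a ?U ?W ?Z \<cdot> (?s ?W ?U \<otimes> \<one> ?Z)))"
    using O vcat_assoc[OF slf, of Y X A B] by (intro comp_reduce) simp_all
  also have "\<dots> = VComp (self V) Y A B \<cdot> ((\<one> ?W \<otimes> VComp (self V) Y X A) \<cdot>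
      ((?a ?W ?Z ?U \<cdot> (?s ?U (?W \<odot> ?Z) \<cdot> ?a ?U ?W ?Z)) \<cdot> (?s ?W ?U \<otimes> \<one> ?Z)))"
    using O by simp
  \<comment> \<open>The hexagon at \<open>?U\<close>, \<open>?W\<close>, \<open>?Z\<close> leaves
    the factor \<open>?s ?U ?W \<otimes> \<one> ?Z\<close>, which cancels against
    \<open>?s ?W ?U \<otimes> \<one> ?Z\<close>.\<close>
  also have "\<dots> = VComp (self V) Y A B \<cdot> ((\<one> ?W \<otimes> VComp (self V) Y X A) \<cdot> ((\<one> ?W \<otimes> ?s ?U ?Z) \<cdot> ?a ?W ?U ?Z))"
    using O by (subst hexagon) simp_all
  finally show "evl V ?Z ?YB \<cdot> (?L \<otimes> \<one> ?Z) = evl V ?Z ?YB \<cdot> (?R \<otimes> \<one> ?Z)"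
    using L by simp
qed (use O in \<open>simp_all add: hom_def\<close>)

text \<open>Naturality of a family of points is compatibility of the corresponding arrows with the actions.\<close>

lemma point_nat_iff:
  assumes AB: "A \<in> VObj AT" "B \<in> VObj AT" and XY: "X \<in> P" "Y \<in> P"
    and g: "g \<in> hom V (ihom V X (snd A)) (ihom V X (snd B))" and h: "h \<in> hom V (ihom V Y (snd A)) (ihom V Y (snd B))"
  shows "VComp (self V) (FOb (fst A) X) (FOb (fst A) Y) (FOb (fst B) Y) \<cdot> (name_of V h \<otimes> FHom (fst A) X Y) =
      VComp (self V) (FOb (fst A) X) (FOb (fst B) X) (FOb (fst B) Y) \<cdot> (FHom (fst B) X Y \<otimes> name_of V g) \<cdot>
          symm V \<I> (VHom To X Y) \<longleftrightarrow>
    h \<cdot> vact (fst A) X Y = vact (fst B) X Y \<cdot> (\<one> (VHom To X Y) \<otimes> g)"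
    (is "?L = ?R \<longleftrightarrow> _")
proof -
  let ?XA = "ihom V X (snd A)" and ?YA = "ihom V Y (snd A)" and ?XB = "ihom V X (snd B)" and ?YB = "ihom V Y (snd B)"
  let ?T = "VHom To X Y" and ?a = "assoc V" and ?s = "symm V"
  note F = AlgD(3)[OF AB(1) XY(1)] AlgD(3)[OF AB(1) XY(2)] AlgD(3)[OF AB(2) XY(1)] AlgD(3)[OF AB(2) XY(2)]
  note ng = name_of_hom[OF g] and nh = name_of_hom[OF h]
  note fA = vfunctor_Arr[OF AlgD(2)[OF AB(1)], of X Y, unfolded F To_Obj self_simps, OF XY]
  note fB = vfunctor_Arr[OF AlgD(2)[OF AB(2)], of X Y, unfolded F To_Obj self_simps, OF XY]
  have aA: "evl V ?XA ?YA \<cdot> (FHom (fst A) X Y \<otimes> \<one> ?XA) = vact (fst A) X Y"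
    and aB: "evl V ?XB ?YB \<cdot> (FHom (fst B) X Y \<otimes> \<one> ?XB) = vact (fst B) X Y" by (simp_all add: vact_def F)
  note t = PO[OF XY(1)] PO[OF XY(2)] XY AlgD(1)[OF AB(1)] AlgD(1)[OF AB(2)] fA fB homD[OF g] homD[OF h] homD[OF ng(1)] homD[OF nh(1)]
    alg_act[OF AB(1) XY] alg_act[OF AB(2) XY] To_hom[OF XY]
  have hL: "?L \<in> hom V (\<I> \<odot> ?T) (ihom V ?XA ?YB)" and hR: "?R \<in> hom V (\<I> \<odot> ?T) (ihom V ?XA ?YB)"
    using t by (simp_all add: F hom_def)
  have "evl V ?XA ?YB \<cdot> (?L \<otimes> \<one> ?XA) = evl V ?YA ?YB \<cdot> ((name_of V h \<otimes> (evl V ?XA ?YA \<cdot> (FHom (fst A) X Y \<otimes> \<one> ?XA))) \<cdot> ?a \<I> ?T ?XA)"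
    unfolding F using t by (intro evl_self_comp_tens) (simp_all add: hom_def)
  also have "\<dots> = evl V ?YA ?YB \<cdot> ((name_of V h \<otimes> \<one> ?YA) \<cdot> ((\<one> \<I> \<otimes> vact (fst A) X Y) \<cdot> ?a \<I> ?T ?XA))"
    unfolding aA using t by simp
  also have "\<dots> = (h \<cdot> lunit V ?YA) \<cdot> ((\<one> \<I> \<otimes> vact (fst A) X Y) \<cdot> ?a \<I> ?T ?XA)"
    using t by (intro comp_reduce nh(2)) auto
  also have "\<dots> = h \<cdot> (lunit V ?YA \<cdot> ((\<one> \<I> \<otimes> vact (fst A) X Y) \<cdot> ?a \<I> ?T ?XA))"
    using t by simp
  also have "\<dots> = h \<cdot> (vact (fst A) X Y \<cdot> (lunit V (?T \<odot> ?XA) \<cdot> ?a \<I> ?T ?XA))"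
    using t comp_permute[OF lunit_nat, of "vact (fst A) X Y" "?T \<odot> ?XA" ?YA "?a \<I> ?T ?XA"] by (simp add: hom_def)
  also have "\<dots> = (h \<cdot> vact (fst A) X Y) \<cdot> (lunit V ?T \<otimes> \<one> ?XA)"
    using t by (simp add: lunit_tens)
  finally have L: "evl V ?XA ?YB \<cdot> (?L \<otimes> \<one> ?XA) = (h \<cdot> vact (fst A) X Y) \<cdot> (lunit V ?T \<otimes> \<one> ?XA)" .
  \<comment> \<open>The symmetry with \<I> turns the right unit into the left one. Both sides then
    end in the isomorphism \<open>lunit V ?T \<otimes> \<one> ?XA\<close>, which is cancelled at the
    end.\<close>
  have sr: "runit V ?T \<cdot> ?s \<I> ?T = lunit V ?T" using t by (simp add: runit_eq)
  have "evl V ?XA ?YB \<cdot> (?R \<otimes> \<one> ?XA) =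
    (evl V ?XA ?YB \<cdot> ((VComp (self V) ?XA ?XB ?YB \<cdot> (FHom (fst B) X Y \<otimes> name_of V g)) \<otimes> \<one> ?XA)) \<cdot> (?s \<I> ?T \<otimes> \<one> ?XA)"
    unfolding F using t by simp
  also have "\<dots> = (evl V ?XB ?YB \<cdot> ((FHom (fst B) X Y \<otimes> (evl V ?XA ?XB \<cdot> (name_of V g \<otimes> \<one> ?XA))) \<cdot> ?a ?T \<I> ?XA)) \<cdot> (?s \<I> ?T \<otimes> \<one> ?XA)"
    using t by (subst evl_self_comp_tens[where W = ?T and W' = \<I>]) (simp_all add: hom_def)
  also have "\<dots> = evl V ?XB ?YB \<cdot> ((FHom (fst B) X Y \<otimes> \<one> ?XB) \<cdot> ((\<one> ?T \<otimes> g) \<cdot> (((\<one> ?T \<otimes> lunit V ?XA) \<cdot> ?a ?T \<I> ?XA) \<cdot> (?s \<I> ?T \<otimes> \<one> ?XA))))"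
    unfolding ng(2) using t by simp
  also have "\<dots> = vact (fst B) X Y \<cdot> ((\<one> ?T \<otimes> g) \<cdot> (((\<one> ?T \<otimes> lunit V ?XA) \<cdot> ?a ?T \<I> ?XA) \<cdot> (?s \<I> ?T \<otimes> \<one> ?XA)))"
    using t by (intro comp_reduce aB) auto
  also have "\<dots> = vact (fst B) X Y \<cdot> ((\<one> ?T \<otimes> g) \<cdot> ((runit V ?T \<cdot> ?s \<I> ?T) \<otimes> \<one> ?XA))"
    using t by (simp add: triangle)
  also have "\<dots> = (vact (fst B) X Y \<cdot> (\<one> ?T \<otimes> g)) \<cdot> (lunit V ?T \<otimes> \<one> ?XA)"
    unfolding sr using t by simp
  finally have R: "evl V ?XA ?YB \<cdot> (?R \<otimes> \<one> ?XA) = (vact (fst B) X Y \<cdot> (\<one> ?T \<otimes> g)) \<cdot> (lunit V ?T \<otimes> \<one> ?XA)" .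
  have "?L = ?R \<longleftrightarrow> evl V ?XA ?YB \<cdot> (?L \<otimes> \<one> ?XA) = evl V ?XA ?YB \<cdot> (?R \<otimes> \<one> ?XA)"
    using curry_inj[OF _ hL hR] t by auto
  also have "\<dots> \<longleftrightarrow> (h \<cdot> vact (fst A) X Y) \<cdot> (lunit V ?T \<otimes> \<one> ?XA) = (vact (fst B) X Y \<cdot> (\<one> ?T \<otimes> g)) \<cdot> (lunit V ?T \<otimes> \<one> ?XA)"
    unfolding L R ..
  also have "\<dots> \<longleftrightarrow> h \<cdot> vact (fst A) X Y = vact (fst B) X Y \<cdot> (\<one> ?T \<otimes> g)"
  proof
    assume "(h \<cdot> vact (fst A) X Y) \<cdot> (lunit V ?T \<otimes> \<one> ?XA) = (vact (fst B) X Y \<cdot> (\<one> ?T \<otimes> g)) \<cdot> (lunit V ?T \<otimes> \<one> ?XA)"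
    then show "h \<cdot> vact (fst A) X Y = vact (fst B) X Y \<cdot> (\<one> ?T \<otimes> g)"
      by (rule iso_cancel_right) (use t in \<open>simp_all add: iso_tens\<close>)
  qed simp
  finally show ?thesis .
qed

end

section \<open>Hom-objects of algebras and their points\<close>

context thy_alg
begin

abbreviation Rop where "Rop \<equiv> vop V (vfull (self V) P)"

lemma alg_restricted:
  assumes "A \<in> VObj AT"
  shows "vfun_comp V Rop (fst A) (vop_fun J) = restricted_rep V (self V) P (snd A)"
    "fst A \<in> VObj (vfunctor_cat V To (self V))"
  using assms
  by (auto simp: Alg_def vpullback_def vfunctor_cat_def alg_restr_def vprecomp_def restricted_yoneda_def Let_def mk_vfun_def)

lemma nat_familyI:
  assumes "W \<in> Obj V" "\<And>X. X \<in> VObj C \<Longrightarrow> w X \<in> hom V W (VHom D (FOb F X) (FOb G X))"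
    "\<And>X Y. X \<in> VObj C \<Longrightarrow> Y \<in> VObj C \<Longrightarrow>
        VComp D (FOb F X) (FOb F Y) (FOb G Y) \<cdot> (w Y \<otimes> FHom F X Y) =
        VComp D (FOb F X) (FOb G X) (FOb G Y) \<cdot> (FHom G X Y \<otimes> w X) \<cdot> symm V W (VHom C X Y)"
  shows "vnat_family V C D F G W w"
  using assms by (simp add: vnat_family_def)

lemma nat_ob_alg:
  assumes "A \<in> VObj AT" "B \<in> VObj AT"
  shows "is_nat_object V To (self V) (fst A) (fst B) (nat_ob V To (self V) (fst A) (fst B)) (nat_proj V To (self V) (fst A) (fst B))"
proof (rule nat_object_exists)
  fix X Y assume XY: "X \<in> VObj To" "Y \<in> VObj To"
  show "VHom To X Y \<in> Obj V" using XY by simp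
  show "FOb (fst A) X \<in> VObj (self V)" "FOb (fst B) X \<in> VObj (self V)"
    using vfunctorD(4)[OF AlgD(2)[OF assms(1)]] vfunctorD(4)[OF AlgD(2)[OF assms(2)]] XY by auto
  show "FHom (fst A) X Y \<in> hom V (VHom To X Y) (VHom (self V) (FOb (fst A) X) (FOb (fst A) Y))"
    by (rule vfunctorD(5)[OF AlgD(2)[OF assms(1)] XY])
  show "FHom (fst B) X Y \<in> hom V (VHom To X Y) (VHom (self V) (FOb (fst B) X) (FOb (fst B) Y))"
    by (rule vfunctorD(5)[OF AlgD(2)[OF assms(2)] XY])
qed (simp_all add: PS slf)

lemma restricted_rep_hom:
  assumes "A \<in> Obj V" "X \<in> P" "Y \<in> P"
  shows "FHom (restricted_rep V (self V) P A) X Y \<in> hom V (ihom V Y X) (ihom V (ihom V X A) (ihom V Y A))"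
  using assms PO by (simp add: restricted_rep_simps hom_def)

lemma nat_ob_rep:
  assumes "A \<in> Obj V" "B \<in> Obj V"
  defines "a \<equiv> restricted_rep V (self V) P A" and "b \<equiv> restricted_rep V (self V) P B"
  shows "is_nat_object V Rop (self V) a b (nat_ob V Rop (self V) a b) (nat_proj V Rop (self V) a b)"
proof (rule nat_object_exists)
  fix X Y assume XY: "X \<in> VObj Rop" "Y \<in> VObj Rop"
  then have XY: "X \<in> P" "Y \<in> P" by simp_all
  show "VHom Rop X Y \<in> Obj V" "FOb a X \<in> VObj (self V)" "FOb b X \<in> VObj (self V)"
    using XY PO assms by (simp_all add: restricted_rep_simps)
  show "FHom a X Y \<in> hom V (VHom Rop X Y) (VHom (self V) (FOb a X) (FOb a Y))"
    "FHom b X Y \<in> hom V (VHom Rop X Y) (VHom (self V) (FOb b X) (FOb b Y))"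
    using restricted_rep_hom[OF _ XY] XY assms by (simp_all add: restricted_rep_simps)
qed (simp_all add: PS slf)

lemma nat_object_family:
  assumes "is_nat_object V C D F G N p"
  shows "vnat_family V C D F G N p" "N \<in> Obj V" "X \<in> VObj C \<Longrightarrow> p X \<in> hom V N (VHom D (FOb F X) (FOb G X))"
    "X \<in> VObj C \<Longrightarrow> Y \<in> VObj C \<Longrightarrow> VComp D (FOb F X) (FOb F Y) (FOb G Y) \<cdot> (p Y \<otimes> FHom F X Y) =
        VComp D (FOb F X) (FOb G X) (FOb G Y) \<cdot> (FHom G X Y \<otimes> p X) \<cdot> symm V N (VHom C X Y)"
    "vnat_family V C D F G W w \<Longrightarrow> \<exists>!u. u \<in> hom V W N \<and> (\<forall>X \<in> VObj C. p X \<cdot> u = w X)"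
  using assms unfolding is_nat_object_def vnat_family_def by auto

text \<open>The two \<open>THE\<close> descriptions have values because the families they refer to
  are natural: the projections of the end over \<open>To\<close> restrict along \<open>J\<close>,
  and \<open>yfam\<close> is natural by \<open>yfam_nat\<close>. The pullback of the resulting
  arrows exists, so the choice made in \<open>pb_object\<close> meets its specification.\<close>

lemma hom_structure:
  assumes A: "A \<in> VObj AT" and B: "B \<in> VObj AT"
  defines "a \<equiv> restricted_rep V (self V) P (snd A)" and "b \<equiv> restricted_rep V (self V) P (snd B)"
  defines "N0 \<equiv> nat_ob V To (self V) (fst A) (fst B)" and "p0 \<equiv> nat_proj V To (self V) (fst A) (fst B)"
    and "N1 \<equiv> nat_ob V Rop (self V) a b" and "p1 \<equiv> nat_proj V Rop (self V) a b"
  defines "h1 \<equiv> FHom (alg_restr V P T J) (fst A) (fst B)" and "h2 \<equiv> FHom (restricted_yoneda V (self V) P) (snd A) (snd B)"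
    and "F \<equiv> alg_restr V P T J" and "G \<equiv> restricted_yoneda V (self V) P"
  shows "h1 \<in> hom V N0 N1" "\<And>X. X \<in> P \<Longrightarrow> p1 X \<cdot> h1 = p0 X"
    "h2 \<in> hom V (ihom V (snd A) (snd B)) N1" "\<And>X. X \<in> P \<Longrightarrow> p1 X \<cdot> h2 = yfam (snd A) (snd B) X"
    "is_pullback V h1 h2 (pb_ob V F G A B) (pb_fst V F G A B) (pb_snd V F G A B)"
proof -
  note OA = AlgD(1)[OF A] and OB = AlgD(1)[OF B]
  note n0 = nat_object_family[OF nat_ob_alg[OF A B], folded N0_def p0_def]
  note n1 = nat_object_family[OF nat_ob_rep[OF OA OB], folded a_def b_def, folded N1_def p1_def]
  have F0: "FOb (fst A) X = ihom V X (snd A)" "FOb (fst B) X = ihom V X (snd B)"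
    "FOb a X = ihom V X (snd A)" "FOb b X = ihom V X (snd B)" if "X \<in> P" for X
    using AlgD(3)[OF A that] AlgD(3)[OF B that] OA OB that by (simp_all add: a_def b_def restricted_rep_simps)
  have FH: "FHom a X Y = FHom (fst A) X Y \<cdot> FHom J Y X" "FHom b X Y = FHom (fst B) X Y \<cdot> FHom J Y X"
    if "X \<in> P" "Y \<in> P" for X Y
    using J_restr(2)[OF that, of "fst A"] J_restr(2)[OF that, of "fst B"] alg_restricted(1)[OF A] alg_restricted(1)[OF B]
    by (simp_all add: a_def b_def)
  have fam1: "vnat_family V Rop (self V) a b N0 p0"
  proof (rule nat_familyI)
    show "N0 \<in> Obj V" by (rule n0(2))
    show "p0 X \<in> hom V N0 (VHom (self V) (FOb a X) (FOb b X))" if "X \<in> VObj Rop" for X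
      using n0(3)[of X] that by (simp add: F0)
    fix X Y assume "X \<in> VObj Rop" "Y \<in> VObj Rop"
    then have XY: "X \<in> P" "Y \<in> P" by simp_all
    note fA = vfunctor_Arr[OF AlgD(2)[OF A], of X Y, unfolded To_Obj self_simps F0[OF XY(1)] F0[OF XY(2)], OF XY]
    note fB = vfunctor_Arr[OF AlgD(2)[OF B], of X Y, unfolded To_Obj self_simps F0[OF XY(1)] F0[OF XY(2)], OF XY]
    note pX = n0(3)[of X, unfolded To_Obj self_simps F0[OF XY(1)], OF XY(1)]
    note pY = n0(3)[of Y, unfolded To_Obj self_simps F0[OF XY(2)], OF XY(2)]
    note t = OA OB n0(2) PO[OF XY(1)] PO[OF XY(2)] fA fB homD[OF pX] homD[OF pY] XY To_hom[OF XY] F0[OF XY(1)] F0[OF XY(2)]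
    have eq: "VComp (self V) (FOb (fst A) X) (FOb (fst A) Y) (FOb (fst B) Y) \<cdot> (p0 Y \<otimes> FHom (fst A) X Y) =
        VComp (self V) (FOb (fst A) X) (FOb (fst B) X) (FOb (fst B) Y) \<cdot> (FHom (fst B) X Y \<otimes> p0 X) \<cdot> symm V N0 (VHom To X Y)"
      using n0(4)[of X Y] XY by simp
    have "VComp (self V) (FOb a X) (FOb a Y) (FOb b Y) \<cdot> (p0 Y \<otimes> FHom a X Y) =
      (VComp (self V) (FOb (fst A) X) (FOb (fst A) Y) (FOb (fst B) Y) \<cdot> (p0 Y \<otimes> FHom (fst A) X Y)) \<cdot> (\<one> N0 \<otimes> FHom J Y X)"
      using t by (simp add: FH)
    also have "\<dots> = VComp (self V) (FOb (fst A) X) (FOb (fst B) X) (FOb (fst B) Y) \<cdot> ((FHom (fst B) X Y \<otimes> p0 X) \<cdot> (symm V N0 (VHom To X Y) \<cdot> (\<one> N0 \<otimes> FHom J Y X)))"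
      unfolding eq using t by simp
    also have "symm V N0 (VHom To X Y) \<cdot> (\<one> N0 \<otimes> FHom J Y X) = (FHom J Y X \<otimes> \<one> N0) \<cdot> symm V N0 (ihom V Y X)"
      using t by (intro symm_nat) (simp_all add: hom_def)
    finally show "VComp (self V) (FOb a X) (FOb a Y) (FOb b Y) \<cdot> (p0 Y \<otimes> FHom a X Y) =
      VComp (self V) (FOb a X) (FOb b X) (FOb b Y) \<cdot> (FHom b X Y \<otimes> p0 X) \<cdot> symm V N0 (VHom Rop X Y)"
      using t by (simp add: FH)
  qed
  have fam2: "vnat_family V Rop (self V) a b (ihom V (snd A) (snd B)) (yfam (snd A) (snd B))"
  proof (rule nat_familyI)
    show "yfam (snd A) (snd B) X \<in> hom V (ihom V (snd A) (snd B)) (VHom (self V) (FOb a X) (FOb b X))" if "X \<in> VObj Rop" for X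
      using that OA OB PO by (simp add: F0 hom_def)
    fix X Y assume "X \<in> VObj Rop" "Y \<in> VObj Rop"
    then have XY: "X \<in> P" "Y \<in> P" by simp_all
    have c: "FHom a X Y = vcurry V (ihom V Y X) (ihom V X (snd A)) (ihom V Y (snd A)) (jact (snd A) X Y)"
      "FHom b X Y = vcurry V (ihom V Y X) (ihom V X (snd B)) (ihom V Y (snd B)) (jact (snd B) X Y)"
      using restricted_rep_simps(2)[OF OA XY] restricted_rep_simps(2)[OF OB XY] by (simp_all add: a_def b_def)
    show "VComp (self V) (FOb a X) (FOb a Y) (FOb b Y) \<cdot> (yfam (snd A) (snd B) Y \<otimes> FHom a X Y) =
      VComp (self V) (FOb a X) (FOb b X) (FOb b Y) \<cdot> (FHom b X Y \<otimes> yfam (snd A) (snd B) X) \<cdot> symm V (ihom V (snd A) (snd B)) (VHom Rop X Y)"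
      using yfam_nat[OF PO[OF XY(1)] PO[OF XY(2)] OA OB] XY PO OA OB
      by (simp add: F0 c)
  qed (use OA OB in simp)
  have "h1 = (THE h. h \<in> hom V N0 N1 \<and> (\<forall>X \<in> VObj Rop. p1 X \<cdot> h = p0 X))"
    using alg_restricted(1)[OF A] alg_restricted(1)[OF B] alg_restricted(2)[OF A] alg_restricted(2)[OF B]
    by (simp add: h1_def alg_restr_def vprecomp_def mk_vfun_def N0_def p0_def N1_def p1_def a_def b_def
       vop_fun_def J_obj cong: ball_cong)
  then have "h1 \<in> hom V N0 N1 \<and> (\<forall>X \<in> VObj Rop. p1 X \<cdot> h1 = p0 X)"
    using theI'[OF n1(5)[OF fam1]] by simp
  then show h1: "h1 \<in> hom V N0 N1" "\<And>X. X \<in> P \<Longrightarrow> p1 X \<cdot> h1 = p0 X" by simp_all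
  have "h2 = (THE h. h \<in> hom V (ihom V (snd A) (snd B)) N1 \<and> (\<forall>X \<in> VObj Rop. p1 X \<cdot> h = yfam (snd A) (snd B) X))"
    using OA OB
    by (simp add: h2_def restricted_yoneda_def Let_def mk_vfun_def N1_def p1_def a_def b_def yfam_def)
  then have "h2 \<in> hom V (ihom V (snd A) (snd B)) N1 \<and> (\<forall>X \<in> VObj Rop. p1 X \<cdot> h2 = yfam (snd A) (snd B) X)"
    using theI'[OF n1(5)[OF fam2]] by simp
  then show h2: "h2 \<in> hom V (ihom V (snd A) (snd B)) N1" "\<And>X. X \<in> P \<Longrightarrow> p1 X \<cdot> h2 = yfam (snd A) (snd B) X" by simp_all
  obtain H p q where "is_pullback V h1 h2 H p q" using pullback_exists[OF h1(1) h2(1)] by blast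
  then have "\<exists>x. case x of (H, p, q) \<Rightarrow> is_pullback V (FHom F (fst A) (fst B)) (FHom G (snd A) (snd B)) H p q"
    unfolding h1_def h2_def F_def G_def by auto
  from someI_ex[OF this] have "case pb_object V F G A B of (H, p, q) \<Rightarrow> is_pullback V (FHom F (fst A) (fst B)) (FHom G (snd A) (snd B)) H p q"
    unfolding pb_object_def .
  then show "is_pullback V h1 h2 (pb_ob V F G A B) (pb_fst V F G A B) (pb_snd V F G A B)"
    unfolding h1_def h2_def F_def G_def by (simp add: case_prod_beta)
qed

lemma AT_hom: "VHom AT A B = pb_ob V (alg_restr V P T J) (restricted_yoneda V (self V) P) A B"
  by (simp add: Alg_def vpullback_def)

definition qsnd where
  "qsnd A B = pb_snd V (alg_restr V P T J) (restricted_yoneda V (self V) P) A B"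

lemma forget_simps:
  "A \<in> VObj AT \<Longrightarrow> FOb (forget V P T J) A = snd A"
  "A \<in> VObj AT \<Longrightarrow> B \<in> VObj AT \<Longrightarrow> FHom (forget V P T J) A B = qsnd A B"
  by (simp_all add: forget_def mk_vfun_def qsnd_def)

text \<open>A point of the pullback is a natural family over \<open>To\<close> together with a point
  of [A,B] that has the same restriction to \<open>P\<close>. As \<open>J\<close> is the identity on
  objects, the second component determines the first, and naturality of the family is compatibility
  of the arrow with the actions.\<close>

lemma hom_point_bij:
  assumes A: "A \<in> VObj AT" and B: "B \<in> VObj AT"
  shows "qsnd A B \<in> hom V (VHom AT A B) (ihom V (snd A) (snd B))"
    "x \<in> hom V \<I> (VHom AT A B) \<Longrightarrow> Hm A B (arrow_of V (snd A) (snd B) (qsnd A B \<cdot> x))"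
    "Hm A B f \<Longrightarrow> \<exists>x \<in> hom V \<I> (VHom AT A B). arrow_of V (snd A) (snd B) (qsnd A B \<cdot> x) = f"
    "x \<in> hom V \<I> (VHom AT A B) \<Longrightarrow> y \<in> hom V \<I> (VHom AT A B) \<Longrightarrow>
      arrow_of V (snd A) (snd B) (qsnd A B \<cdot> x) = arrow_of V (snd A) (snd B) (qsnd A B \<cdot> y) \<Longrightarrow> x = y"
proof -
  let ?a = "restricted_rep V (self V) P (snd A)" and ?b = "restricted_rep V (self V) P (snd B)"
  let ?N0 = "nat_ob V To (self V) (fst A) (fst B)" and ?p0 = "nat_proj V To (self V) (fst A) (fst B)"
    and ?N1 = "nat_ob V Rop (self V) ?a ?b" and ?p1 = "nat_proj V Rop (self V) ?a ?b"
    and ?h1 = "FHom (alg_restr V P T J) (fst A) (fst B)" and ?h2 = "FHom (restricted_yoneda V (self V) P) (snd A) (snd B)"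
  let ?H = "VHom AT A B" and ?q = "qsnd A B" and ?AB = "ihom V (snd A) (snd B)"
  note OA = AlgD(1)[OF A] and OB = AlgD(1)[OF B]
  note n0 = nat_object_family[OF nat_ob_alg[OF A B]]
  note n1 = nat_object_family[OF nat_ob_rep[OF OA OB]]
  note hs = hom_structure[OF A B]
  define p where "p = pb_fst V (alg_restr V P T J) (restricted_yoneda V (self V) P) A B"
  have pb: "is_pullback V ?h1 ?h2 ?H p ?q"
    using hs(5) unfolding AT_hom p_def qsnd_def .
  have F0: "FOb (fst A) X = ihom V X (snd A)" "FOb (fst B) X = ihom V X (snd B)" if "X \<in> P" for X
    using AlgD(3)[OF A that] AlgD(3)[OF B that] .
  have pq: "p \<in> hom V ?H ?N0" "?q \<in> hom V ?H ?AB" "?h1 \<cdot> p = ?h2 \<cdot> ?q"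
    using pb homD[OF hs(1)] homD[OF hs(3)] unfolding is_pullback_def by simp_all
  show "?q \<in> hom V ?H ?AB" by (rule pq(2))
  have p0: "?p0 X \<in> hom V ?N0 (ihom V (ihom V X (snd A)) (ihom V X (snd B)))" if "X \<in> P" for X
    using n0(3)[of X] that by (simp add: F0)
  have p1: "?p1 X \<in> hom V ?N1 (ihom V (ihom V X (snd A)) (ihom V X (snd B)))" if "X \<in> P" for X
    using n1(3)[of X] that OA OB by (simp add: restricted_rep_simps)
  have proj: "?p0 X \<cdot> (p \<cdot> x) = name_of V (ipost X (arrow_of V (snd A) (snd B) (?q \<cdot> x)))"
    if x: "x \<in> hom V \<I> ?H" and X: "X \<in> P" for x X
  proof -
    note t = homD[OF pq(1)] homD[OF pq(2)] homD[OF hs(1)] homD[OF hs(3)] homD[OF x] homD[OF p1[OF X]]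
    have "?p0 X \<cdot> (p \<cdot> x) = ?p1 X \<cdot> ((?h1 \<cdot> p) \<cdot> x)"
      using t by (subst hs(2)[OF X, symmetric]) simp
    also have "\<dots> = (?p1 X \<cdot> ?h2) \<cdot> (?q \<cdot> x)" unfolding pq(3) using t by simp
    also have "\<dots> = name_of V (ipost X (arrow_of V (snd A) (snd B) (?q \<cdot> x)))"
      unfolding hs(4)[OF X] by (rule yfam_point[OF PO[OF X] OA OB comp_hom[OF x pq(2)]])
    finally show ?thesis .
  qed
  have ip: "ipost X f \<in> hom V (ihom V X (snd A)) (ihom V X (snd B))" if "X \<in> P" "f \<in> hom V (snd A) (snd B)" for X f
    using PO that by (simp add: hom_def)
  show "Hm A B (arrow_of V (snd A) (snd B) (?q \<cdot> x))" if x: "x \<in> hom V \<I> ?H"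
    unfolding Hm_def
  proof (intro conjI ballI)
    let ?f = "arrow_of V (snd A) (snd B) (?q \<cdot> x)"
    show f: "?f \<in> hom V (snd A) (snd B)" by (rule arrow_of_hom(1)[OF comp_hom[OF x pq(2)] OA OB])
    fix X Y assume XY: "X \<in> P" "Y \<in> P"
    have "VComp (self V) (FOb (fst A) X) (FOb (fst A) Y) (FOb (fst B) Y) \<cdot> (name_of V (ipost Y ?f) \<otimes> FHom (fst A) X Y) =
      VComp (self V) (FOb (fst A) X) (FOb (fst B) X) (FOb (fst B) Y) \<cdot> (FHom (fst B) X Y \<otimes> name_of V (ipost X ?f)) \<cdot>
          symm V \<I> (VHom To X Y)"
    proof -
      note fA = vfunctor_Arr[OF AlgD(2)[OF A], of X Y, unfolded To_Obj self_simps F0[OF XY(1)] F0[OF XY(2)], OF XY]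
      note fB = vfunctor_Arr[OF AlgD(2)[OF B], of X Y, unfolded To_Obj self_simps F0[OF XY(1)] F0[OF XY(2)], OF XY]
      have px: "p \<cdot> x \<in> hom V \<I> ?N0" by (rule comp_hom[OF x pq(1)])
      note t = homD[OF px] homD[OF p0[OF XY(1)]] homD[OF p0[OF XY(2)]] fA fB F0[OF XY(1)] F0[OF XY(2)]
        PO[OF XY(1)] PO[OF XY(2)] OA OB n0(2) To_hom[OF XY] XY
      let ?L = "VComp (self V) (FOb (fst A) X) (FOb (fst A) Y) (FOb (fst B) Y) \<cdot> (?p0 Y \<otimes> FHom (fst A) X Y)"
      let ?R = "VComp (self V) (FOb (fst A) X) (FOb (fst B) X) (FOb (fst B) Y) \<cdot> (FHom (fst B) X Y \<otimes> ?p0 X) \<cdot> symm V ?N0 (VHom To X Y)"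
      have "?L = ?R" using n0(4)[of X Y] XY by simp
      then have "?L \<cdot> ((p \<cdot> x) \<otimes> \<one> (VHom To X Y)) = ?R \<cdot> ((p \<cdot> x) \<otimes> \<one> (VHom To X Y))" by (rule arg_cong)
      moreover have "?L \<cdot> ((p \<cdot> x) \<otimes> \<one> (VHom To X Y)) =
        VComp (self V) (FOb (fst A) X) (FOb (fst A) Y) (FOb (fst B) Y) \<cdot> ((?p0 Y \<cdot> (p \<cdot> x)) \<otimes> FHom (fst A) X Y)"
        using t by simp
      moreover have "?R \<cdot> ((p \<cdot> x) \<otimes> \<one> (VHom To X Y)) = VComp (self V) (FOb (fst A) X) (FOb (fst B) X) (FOb (fst B) Y) \<cdot>
         ((FHom (fst B) X Y \<otimes> ?p0 X) \<cdot> (symm V ?N0 (VHom To X Y) \<cdot> ((p \<cdot> x) \<otimes> \<one> (VHom To X Y))))"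
        using t by simp
      moreover have "symm V ?N0 (VHom To X Y) \<cdot> ((p \<cdot> x) \<otimes> \<one> (VHom To X Y)) = (\<one> (VHom To X Y) \<otimes> (p \<cdot> x)) \<cdot> symm V \<I> (VHom To X Y)"
        using t by (intro symm_nat[OF px]) (simp add: Ide_hom)
      moreover have "(FHom (fst B) X Y \<otimes> ?p0 X) \<cdot> ((\<one> (VHom To X Y) \<otimes> (p \<cdot> x)) \<cdot> symm V \<I> (VHom To X Y)) =
         (FHom (fst B) X Y \<otimes> (?p0 X \<cdot> (p \<cdot> x))) \<cdot> symm V \<I> (VHom To X Y)"
        using t by simp
      ultimately have "VComp (self V) (FOb (fst A) X) (FOb (fst A) Y) (FOb (fst B) Y) \<cdot> (name_of V (ipost Y ?f) \<otimes> FHom (fst A) X Y) =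
        VComp (self V) (FOb (fst A) X) (FOb (fst B) X) (FOb (fst B) Y) \<cdot> ((FHom (fst B) X Y \<otimes> name_of V (ipost X ?f)) \<cdot>
          symm V \<I> (VHom To X Y))"
        by (simp only: proj[OF x XY(1)] proj[OF x XY(2)])
      then show ?thesis using t homD[OF name_of_hom(1)[OF ip[OF XY(1) f]]] by simp
    qed
    then show "ipost Y ?f \<cdot> vact (fst A) X Y = vact (fst B) X Y \<cdot> (\<one> (VHom To X Y) \<otimes> ipost X ?f)"
      using point_nat_iff[OF A B XY ip[OF XY(1) f] ip[OF XY(2) f]] by blast
  qed
  show "\<exists>x \<in> hom V \<I> ?H. arrow_of V (snd A) (snd B) (?q \<cdot> x) = f" if f: "Hm A B f"
  proof -
    have fh: "f \<in> hom V (snd A) (snd B)" using f by (simp add: Hm_def)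
    have "vnat_family V To (self V) (fst A) (fst B) \<I> (\<lambda>X. name_of V (ipost X f))"
    proof (rule nat_familyI)
      show "name_of V (ipost X f) \<in> hom V \<I> (VHom (self V) (FOb (fst A) X) (FOb (fst B) X))" if "X \<in> VObj To" for X
        using that name_of_hom(1)[OF ip[OF _ fh]] by (simp add: F0)
      fix X Y assume "X \<in> VObj To" "Y \<in> VObj To"
      then have XY: "X \<in> P" "Y \<in> P" by simp_all
      show "VComp (self V) (FOb (fst A) X) (FOb (fst A) Y) (FOb (fst B) Y) \<cdot> (name_of V (ipost Y f) \<otimes> FHom (fst A) X Y) =
        VComp (self V) (FOb (fst A) X) (FOb (fst B) X) (FOb (fst B) Y) \<cdot> (FHom (fst B) X Y \<otimes> name_of V (ipost X f)) \<cdot>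
          symm V \<I> (VHom To X Y)"
        unfolding point_nat_iff[OF A B XY ip[OF XY(1) fh] ip[OF XY(2) fh]] using f XY by (simp add: Hm_def)
    qed simp
    from n0(5)[OF this] obtain u where u: "u \<in> hom V \<I> ?N0" "\<And>X. X \<in> P \<Longrightarrow> ?p0 X \<cdot> u = name_of V (ipost X f)" by auto
    note nf = name_of_hom(1)[OF fh]
    \<comment> \<open>Both points have the same projections, so they agree by uniqueness in the end
      over \<open>Rop\<close>. To invoke it, the projections of one of them must be shown to form a
      natural family.\<close>
    have "?h1 \<cdot> u = ?h2 \<cdot> name_of V f"
    proof -
      have h: "?h1 \<cdot> u \<in> hom V \<I> ?N1" "?h2 \<cdot> name_of V f \<in> hom V \<I> ?N1"
        using comp_hom[OF u(1) hs(1)] comp_hom[OF nf hs(3)] .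
      have e1: "?p1 X \<cdot> (?h1 \<cdot> u) = name_of V (ipost X f)" if X: "X \<in> P" for X
        using comp_reduce[OF hs(2)[OF X], of u] homD[OF hs(1)] homD[OF u(1)] homD[OF p1[OF X]] u(2)[OF X] by simp
      have e2: "?p1 X \<cdot> (?h2 \<cdot> name_of V f) = name_of V (ipost X f)" if X: "X \<in> P" for X
        using comp_reduce[OF hs(4)[OF X], of "name_of V f"] homD[OF hs(3)] homD[OF nf] homD[OF p1[OF X]]
          yfam_point[OF PO[OF X] OA OB nf] arrow_of_name[OF fh] by simp
      have ps: "?p1 X \<in> Arr V" "Dom V (?p1 X) = ?N1" if "X \<in> P" for X using homD[OF p1[OF that]] by simp_all
      have fam: "vnat_family V Rop (self V) ?a ?b \<I> (\<lambda>X. ?p1 X \<cdot> (?h1 \<cdot> u))"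
      proof (rule nat_familyI)
        show "?p1 X \<cdot> (?h1 \<cdot> u) \<in> hom V \<I> (VHom (self V) (FOb ?a X) (FOb ?b X))" if "X \<in> VObj Rop" for X
          using that comp_hom[OF h(1) n1(3)] by simp
        fix X Y assume "X \<in> VObj Rop" "Y \<in> VObj Rop"
        then have XY: "X \<in> P" "Y \<in> P" by simp_all
        let ?v = "?h1 \<cdot> u"
        note ra = restricted_rep_hom[OF OA XY] and rb = restricted_rep_hom[OF OB XY]
        have Fr: "FOb ?a X = ihom V X (snd A)" "FOb ?a Y = ihom V Y (snd A)" "FOb ?b X = ihom V X (snd B)" "FOb ?b Y = ihom V Y (snd B)"
          using XY OA OB by (simp_all add: restricted_rep_simps)
        note t = homD[OF h(1)] homD[OF p1[OF XY(1)]] homD[OF p1[OF XY(2)]] homD[OF ra] homD[OF rb] Fr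
          PO[OF XY(1)] PO[OF XY(2)] OA OB n1(2) XY
        let ?L = "VComp (self V) (FOb ?a X) (FOb ?a Y) (FOb ?b Y) \<cdot> (?p1 Y \<otimes> FHom ?a X Y)"
        let ?R = "VComp (self V) (FOb ?a X) (FOb ?b X) (FOb ?b Y) \<cdot> (FHom ?b X Y \<otimes> ?p1 X) \<cdot> symm V ?N1 (ihom V Y X)"
        have "?L = ?R" using n1(4)[of X Y] XY by simp
        then have "?L \<cdot> (?v \<otimes> \<one> (ihom V Y X)) = ?R \<cdot> (?v \<otimes> \<one> (ihom V Y X))" by (rule arg_cong)
        moreover have "?L \<cdot> (?v \<otimes> \<one> (ihom V Y X)) =
          VComp (self V) (FOb ?a X) (FOb ?a Y) (FOb ?b Y) \<cdot> ((?p1 Y \<cdot> ?v) \<otimes> FHom ?a X Y)"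
          using t by simp
        moreover have "?R \<cdot> (?v \<otimes> \<one> (ihom V Y X)) = VComp (self V) (FOb ?a X) (FOb ?b X) (FOb ?b Y) \<cdot>
           ((FHom ?b X Y \<otimes> ?p1 X) \<cdot> (symm V ?N1 (ihom V Y X) \<cdot> (?v \<otimes> \<one> (ihom V Y X))))"
          using t by simp
        moreover have "symm V ?N1 (ihom V Y X) \<cdot> (?v \<otimes> \<one> (ihom V Y X)) = (\<one> (ihom V Y X) \<otimes> ?v) \<cdot> symm V \<I> (ihom V Y X)"
          using t by (intro symm_nat[OF h(1)]) (simp add: Ide_hom)
        moreover have "(FHom ?b X Y \<otimes> ?p1 X) \<cdot> ((\<one> (ihom V Y X) \<otimes> ?v) \<cdot> symm V \<I> (ihom V Y X)) =
           (FHom ?b X Y \<otimes> (?p1 X \<cdot> ?v)) \<cdot> symm V \<I> (ihom V Y X)"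
          using t by simp
        ultimately have "VComp (self V) (FOb ?a X) (FOb ?a Y) (FOb ?b Y) \<cdot> ((?p1 Y \<cdot> ?v) \<otimes> FHom ?a X Y) =
          VComp (self V) (FOb ?a X) (FOb ?b X) (FOb ?b Y) \<cdot> ((FHom ?b X Y \<otimes> (?p1 X \<cdot> ?v)) \<cdot> symm V \<I> (ihom V Y X))"
          by simp
        then show "VComp (self V) (FOb ?a X) (FOb ?a Y) (FOb ?b Y) \<cdot> ((?p1 Y \<cdot> ?v) \<otimes> FHom ?a X Y) =
          VComp (self V) (FOb ?a X) (FOb ?b X) (FOb ?b Y) \<cdot> (FHom ?b X Y \<otimes> (?p1 X \<cdot> ?v)) \<cdot> symm V \<I> (VHom Rop X Y)"
          using t by simp
      qed simp
      show ?thesis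
        by (rule ex1_implies_unique[OF n1(5)[OF fam]]) (use h e1 e2 in auto)
    qed
    then have "\<exists>!x. x \<in> hom V \<I> ?H \<and> p \<cdot> x = u \<and> ?q \<cdot> x = name_of V f"
      using pb u(1) nf homD[OF hs(1)] homD[OF hs(3)] unfolding is_pullback_def by simp
    then obtain x where "x \<in> hom V \<I> ?H" "?q \<cdot> x = name_of V f" by blast
    then show ?thesis using arrow_of_name[OF fh] by (intro bexI[of _ x]) simp_all
  qed
  assume x: "x \<in> hom V \<I> ?H" and y: "y \<in> hom V \<I> ?H"
    and eq: "arrow_of V (snd A) (snd B) (?q \<cdot> x) = arrow_of V (snd A) (snd B) (?q \<cdot> y)"
  have q: "?q \<cdot> x = ?q \<cdot> y"
    by (rule arrow_of_inj[OF eq comp_hom[OF x pq(2)] comp_hom[OF y pq(2)] OA OB])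
  have px: "p \<cdot> x \<in> hom V \<I> ?N0" "p \<cdot> y \<in> hom V \<I> ?N0" using comp_hom[OF x pq(1)] comp_hom[OF y pq(1)] .
  \<comment> \<open>By \<open>proj\<close> the projections of \<open>p \<cdot> x\<close> depend only
    on \<open>?q \<cdot> x\<close>, and projections from an end determine a point.\<close>
  have "p \<cdot> x = p \<cdot> y"
  proof -
    have "vnat_family V To (self V) (fst A) (fst B) \<I> (\<lambda>X. name_of V (ipost X (arrow_of V (snd A) (snd B) (?q \<cdot> x))))"
    proof (rule nat_familyI)
      have f: "arrow_of V (snd A) (snd B) (?q \<cdot> x) \<in> hom V (snd A) (snd B)" by (rule arrow_of_hom(1)[OF comp_hom[OF x pq(2)] OA OB])
      show "name_of V (ipost X (arrow_of V (snd A) (snd B) (?q \<cdot> x))) \<in> hom V \<I> (VHom (self V) (FOb (fst A) X) (FOb (fst B) X))" if "X \<in> VObj To" for X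
        using that name_of_hom(1)[OF ip[OF _ f]] by (simp add: F0)
      fix X Y assume "X \<in> VObj To" "Y \<in> VObj To"
      then have XY: "X \<in> P" "Y \<in> P" by simp_all
      show "VComp (self V) (FOb (fst A) X) (FOb (fst A) Y) (FOb (fst B) Y) \<cdot> (name_of V (ipost Y (arrow_of V (snd A) (snd B) (?q \<cdot> x))) \<otimes> FHom (fst A) X Y) =
        VComp (self V) (FOb (fst A) X) (FOb (fst B) X) (FOb (fst B) Y) \<cdot> (FHom (fst B) X Y \<otimes> name_of V (ipost X (arrow_of V (snd A) (snd B) (?q \<cdot> x)))) \<cdot>
          symm V \<I> (VHom To X Y)"
        unfolding point_nat_iff[OF A B XY ip[OF XY(1) f] ip[OF XY(2) f]]
        using \<open>x \<in> hom V \<I> ?H \<Longrightarrow> Hm A B (arrow_of V (snd A) (snd B) (?q \<cdot> x))\<close> x XY by (simp add: Hm_def)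
    qed simp
    from n0(5)[OF this] show ?thesis
      by (rule ex1_implies_unique) (use px proj[OF x] proj[OF y] q in auto)
  qed
  moreover have "\<exists>!z. z \<in> hom V \<I> ?H \<and> p \<cdot> z = p \<cdot> x \<and> ?q \<cdot> z = ?q \<cdot> x"
  proof -
    have "?h1 \<cdot> (p \<cdot> x) = ?h2 \<cdot> (?q \<cdot> x)"
      by (rule comp_permute[OF pq(3)]) (use homD[OF pq(1)] homD[OF pq(2)] homD[OF hs(1)] homD[OF hs(3)] homD[OF x] in simp_all)
    then show ?thesis
      using pb px(1) comp_hom[OF x pq(2)] homD[OF hs(1)] homD[OF hs(3)] unfolding is_pullback_def by simp
  qed
  ultimately show "x = y" using x y q by metis
qed

end

section \<open>The free algebra adjunction on underlying categories\<close>

context thy_alg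
begin

lemma Hm_hom: "Hm A B f \<Longrightarrow> f \<in> hom V (snd A) (snd B)"
  by (simp add: Hm_def)

lemma Hm_Ide: "A \<in> VObj AT \<Longrightarrow> Hm A A (\<one> (snd A))"
  using AlgD(1)[of A] by (simp add: Hm_def Ide_hom ipost_Ide PO)

lemma Hm_comp:
  assumes A: "A \<in> VObj AT" "B \<in> VObj AT" "C \<in> VObj AT" and f: "Hm A B f" and g: "Hm B C g"
  shows "Hm A C (g \<cdot> f)"
  unfolding Hm_def
proof (intro conjI ballI)
  note fh = Hm_hom[OF f] and gh = Hm_hom[OF g]
  show "g \<cdot> f \<in> hom V (snd A) (snd C)" by (rule comp_hom[OF fh gh])
  fix X Y assume XY: "X \<in> P" "Y \<in> P"
  note t = homD[OF fh] homD[OF gh] alg_act[OF A(1) XY] alg_act[OF A(2) XY] alg_act[OF A(3) XY] To_hom[OF XY]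
    PO[OF XY(1)] PO[OF XY(2)]
  have ef: "ipost Y f \<cdot> vact (fst A) X Y = vact (fst B) X Y \<cdot> (\<one> (VHom To X Y) \<otimes> ipost X f)"
    and eg: "ipost Y g \<cdot> vact (fst B) X Y = vact (fst C) X Y \<cdot> (\<one> (VHom To X Y) \<otimes> ipost X g)"
    using f g XY by (auto simp: Hm_def)
  have "ipost Y (g \<cdot> f) \<cdot> vact (fst A) X Y = ipost Y g \<cdot> (ipost Y f \<cdot> vact (fst A) X Y)"
    using t by (simp add: ipost_comp[OF _ fh gh])
  also have "\<dots> = (ipost Y g \<cdot> vact (fst B) X Y) \<cdot> (\<one> (VHom To X Y) \<otimes> ipost X f)"
    unfolding ef using t by simp
  also have "\<dots> = vact (fst C) X Y \<cdot> (\<one> (VHom To X Y) \<otimes> ipost X (g \<cdot> f))"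
    unfolding eg using t by (simp add: ipost_comp[OF _ fh gh])
  finally show "ipost Y (g \<cdot> f) \<cdot> vact (fst A) X Y = vact (fst C) X Y \<cdot> (\<one> (VHom To X Y) \<otimes> ipost X (g \<cdot> f))" .
qed

definition uo where
  "uo A B x = arrow_of V (snd A) (snd B) (qsnd A B \<cdot> x)"

end

locale alg_adj = thy_alg V lam P T J for V :: "('o, 'u) smcc" (structure) and lam :: "'u rel" and P T J +
  fixes F :: "('o, ('o, 'u) alg, 'u) vfun" and \<eta> :: "'o \<Rightarrow> 'u" and \<epsilon> :: "('o, 'u) alg \<Rightarrow> 'u"
  assumes adj: "free_adjunction V P T J F \<eta> \<epsilon>"
begin

abbreviation "UF \<equiv> forget V P T J"

lemma adjD:
  shows "vfunctor V (self V) AT F" "vfunctor V AT (self V) UF"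
    "vnat_trans V (self V) (self V) (vid V (self V)) (vfun_comp V (self V) UF F) \<eta>"
    "vnat_trans V AT AT (vfun_comp V AT F UF) (vid V AT) \<epsilon>"
    "X \<in> Obj V \<Longrightarrow> el_comp V AT (FOb F X) (FOb F (FOb UF (FOb F X))) (FOb F X)
          (\<epsilon> (FOb F X)) (FHom F X (FOb UF (FOb F X)) \<cdot> \<eta> X) = VIde AT (FOb F X)"
    "A \<in> VObj AT \<Longrightarrow> el_comp V (self V) (FOb UF A) (FOb UF (FOb F (FOb UF A))) (FOb UF A)
          (FHom UF (FOb F (FOb UF A)) A \<cdot> \<epsilon> A) (\<eta> (FOb UF A)) = VIde (self V) (FOb UF A)"
  using adj unfolding free_adjunction_def vadjunction_def by auto

lemma AT_cat: "vcategory V AT"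
  using vfunctorD(1)[OF adjD(2)] .

lemma F_obj [simp]: "X \<in> Obj V \<Longrightarrow> FOb F X \<in> VObj AT"
  using vfunctorD(4)[OF adjD(1)] by simp

abbreviation TO where "TO X \<equiv> snd (FOb F X)"

lemma TO_Obj [simp]: "X \<in> Obj V \<Longrightarrow> TO X \<in> Obj V"
  using AlgD(1) F_obj by blast

lemma alg_Obj [simp]: "A \<in> VObj AT \<Longrightarrow> snd A \<in> Obj V"
  using AlgD(1) .

lemma uo_comp:
  assumes "A \<in> VObj AT" "B \<in> VObj AT" "C \<in> VObj AT" "x \<in> hom V \<I> (VHom AT A B)" "y \<in> hom V \<I> (VHom AT B C)"
  shows "uo A C (el_comp V AT A B C y x) = uo B C y \<cdot> uo A B x"
  using vfunctor_el_comp[OF adjD(2) assms(1,2,3,5,4)] assms(1-3)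
    arrow_of_el_comp[OF _ _ _ comp_hom[OF assms(5) hom_point_bij(1)[OF assms(2,3)]] comp_hom[OF assms(4) hom_point_bij(1)[OF assms(1,2)]]]
  by (simp add: uo_def forget_simps)

lemma uo_Ide: "A \<in> VObj AT \<Longrightarrow> uo A A (VIde AT A) = \<one> (snd A)"
  using vfunctorD(6)[OF adjD(2), of A] arrow_of_ide[of "snd A"] by (simp add: uo_def forget_simps)

text \<open>From here on the adjunction is used through ordinary arrows of \<V>: \<open>e\<close> is
  the unit, \<open>Tm\<close> the induced monad on arrows and \<open>eps\<close> the counit, while
  \<open>F0\<close> is the point of a hom-object of algebras that the free functor assigns to an
  arrow.\<close>

definition e where "e X = arrow_of V X (TO X) (\<eta> X)"
definition F0 where "F0 f = FHom F (Dom V f) (Cod V f) \<cdot> name_of V f"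
definition Tm where "Tm f = uo (FOb F (Dom V f)) (FOb F (Cod V f)) (F0 f)"
definition eps where "eps A = uo (FOb F (snd A)) A (\<epsilon> A)"

lemma eta_hom:
  assumes "X \<in> Obj V" shows "\<eta> X \<in> hom V \<I> (ihom V X (TO X))"
  using adjD(3) assms by (simp add: vnat_trans_def vid_def vfun_comp_def mk_vfun_def forget_simps)

lemma eps_hom:
  assumes "A \<in> VObj AT" shows "\<epsilon> A \<in> hom V \<I> (VHom AT (FOb F (snd A)) A)"
  using adjD(4) assms by (simp add: vnat_trans_def vid_def vfun_comp_def mk_vfun_def forget_simps)

lemma e_hom:
  assumes "X \<in> Obj V" shows "e X \<in> hom V X (TO X)"
  unfolding e_def by (rule arrow_of_hom(1)[OF eta_hom[OF assms] assms TO_Obj[OF assms]])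

lemma F0_hom:
  assumes "f \<in> hom V X Y" shows "F0 f \<in> hom V \<I> (VHom AT (FOb F X) (FOb F Y))"
proof -
  have "FHom F X Y \<in> hom V (ihom V X Y) (VHom AT (FOb F X) (FOb F Y))"
    using vfunctorD(5)[OF adjD(1), of X Y] hom_Obj[OF assms] by simp
  then show ?thesis using comp_hom[OF name_of_hom(1)[OF assms]] homD[OF assms] by (simp add: F0_def)
qed

lemma Tm_Hm:
  assumes "f \<in> hom V X Y" shows "Hm (FOb F X) (FOb F Y) (Tm f)"
  using hom_point_bij(2)[OF _ _ F0_hom[OF assms]] hom_Obj[OF assms] homD[OF assms] by (simp add: Tm_def uo_def)

lemma eps_Hm: "A \<in> VObj AT \<Longrightarrow> Hm (FOb F (snd A)) A (eps A)"
  using hom_point_bij(2)[OF _ _ eps_hom] by (simp add: eps_def uo_def)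

lemma name_of_comp:
  assumes f: "f \<in> hom V X Y" and g: "g \<in> hom V Y Z"
  shows "name_of V (g \<cdot> f) = el_comp V (self V) X Y Z (name_of V g) (name_of V f)"
proof -
  have O: "X \<in> Obj V" "Y \<in> Obj V" "Z \<in> Obj V" using hom_Obj f g by blast+
  show ?thesis
  proof (rule arrow_of_inj)
    show "arrow_of V X Z (name_of V (g \<cdot> f)) = arrow_of V X Z (el_comp V (self V) X Y Z (name_of V g) (name_of V f))"
      using arrow_of_el_comp[OF O name_of_hom(1)[OF g] name_of_hom(1)[OF f]] arrow_of_name[OF f] arrow_of_name[OF g]
        arrow_of_name[OF comp_hom[OF f g]] by simp
    show "el_comp V (self V) X Y Z (name_of V g) (name_of V f) \<in> hom V \<I> (ihom V X Z)"
      using el_comp_hom[OF slf, of X Y Z] O name_of_hom(1)[OF g] name_of_hom(1)[OF f] by simp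
  qed (use O name_of_hom(1)[OF comp_hom[OF f g]] in auto)
qed

lemma Tm_comp:
  assumes f: "f \<in> hom V X Y" and g: "g \<in> hom V Y Z"
  shows "Tm (g \<cdot> f) = Tm g \<cdot> Tm f"
proof -
  have O: "X \<in> Obj V" "Y \<in> Obj V" "Z \<in> Obj V" using hom_Obj f g by blast+
  note t = homD[OF f] homD[OF g] homD[OF comp_hom[OF f g]]
  have "F0 (g \<cdot> f) = FHom F X Z \<cdot> el_comp V (self V) X Y Z (name_of V g) (name_of V f)"
    using t by (simp add: F0_def name_of_comp[OF f g])
  also have "\<dots> = el_comp V AT (FOb F X) (FOb F Y) (FOb F Z) (F0 g) (F0 f)"
    using vfunctor_el_comp[OF adjD(1), of X Y Z "name_of V g" "name_of V f"] O name_of_hom(1)[OF f] name_of_hom(1)[OF g] t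
    by (simp add: F0_def)
  finally show ?thesis using uo_comp[OF _ _ _ F0_hom[OF f] F0_hom[OF g]] O t by (simp add: Tm_def)
qed

text \<open>Enriched naturality compares two arrows between hom-objects; composing both with the
  name of \<open>f\<close> gives the ordinary square.\<close>

lemma e_nat:
  assumes f: "f \<in> hom V X Y" shows "e Y \<cdot> f = Tm f \<cdot> e X"
proof -
  have O: "X \<in> Obj V" "Y \<in> Obj V" using hom_Obj f by blast+
  note nf = name_of_hom(1)[OF f] and t = homD[OF f] O
  have n: "vpost V (self V) X Y (TO Y) (\<eta> Y) \<cdot> \<one> (ihom V X Y) =
        vpre V (self V) X (TO X) (TO Y) (\<eta> X) \<cdot> (qsnd (FOb F X) (FOb F Y) \<cdot> FHom F X Y)"
    using adjD(3) O by (simp add: vnat_trans_def vid_def vfun_comp_def mk_vfun_def forget_simps)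
  have FX: "FHom F X Y \<in> hom V (ihom V X Y) (VHom AT (FOb F X) (FOb F Y))"
    using vfunctorD(5)[OF adjD(1), of X Y] O by simp
  have q: "qsnd (FOb F X) (FOb F Y) \<in> hom V (VHom AT (FOb F X) (FOb F Y)) (ihom V (TO X) (TO Y))"
    using hom_point_bij(1) O by simp
  have Ff: "F0 f = FHom F X Y \<cdot> name_of V f" using t by (simp add: F0_def)
  have qf: "qsnd (FOb F X) (FOb F Y) \<cdot> F0 f \<in> hom V \<I> (ihom V (TO X) (TO Y))"
    by (rule comp_hom[OF F0_hom[OF f] q])
  have d: "vpre V (self V) X (TO X) (TO Y) (\<eta> X) \<in> hom V (ihom V (TO X) (TO Y)) (ihom V X (TO Y))"
     "vpost V (self V) X Y (TO Y) (\<eta> Y) \<in> hom V (ihom V X Y) (ihom V X (TO Y))"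
    using O homD[OF eta_hom[OF O(1)]] homD[OF eta_hom[OF O(2)]] by (simp_all add: vpre_def vpost_def hom_def)
  have "el_comp V (self V) X Y (TO Y) (\<eta> Y) (name_of V f) = (vpost V (self V) X Y (TO Y) (\<eta> Y) \<cdot> \<one> (ihom V X Y)) \<cdot> name_of V f"
    using vpost_point[OF slf, of X Y "TO Y" "\<eta> Y" "name_of V f"] O eta_hom[OF O(2)] nf homD[OF nf] homD[OF d(2)] by simp
  also have "\<dots> = vpre V (self V) X (TO X) (TO Y) (\<eta> X) \<cdot> (qsnd (FOb F X) (FOb F Y) \<cdot> F0 f)"
    unfolding n Ff using homD[OF d(1)] homD[OF q] homD[OF FX] homD[OF nf] by simp
  also have "\<dots> = el_comp V (self V) X (TO X) (TO Y) (qsnd (FOb F X) (FOb F Y) \<cdot> F0 f) (\<eta> X)"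
    using vpre_point[OF slf, of X "TO X" "TO Y" _ "\<eta> X"] O eta_hom[OF O(1)] qf by simp
  finally have "arrow_of V X (TO Y) (el_comp V (self V) X Y (TO Y) (\<eta> Y) (name_of V f)) =
     arrow_of V X (TO Y) (el_comp V (self V) X (TO X) (TO Y) (qsnd (FOb F X) (FOb F Y) \<cdot> F0 f) (\<eta> X))" by simp
  then show ?thesis
    using arrow_of_el_comp[OF _ _ _ eta_hom[OF O(2)] nf] arrow_of_el_comp[OF _ _ _ qf eta_hom[OF O(1)]]
      arrow_of_name[OF f] O t by (simp add: e_def Tm_def uo_def)
qed

text \<open>The same passage to points as for the unit, except that \<open>g\<close> is represented
  by a point \<open>x\<close> of a hom-object of algebras, whose image under \<open>qsnd\<close> is
  the name of \<open>g\<close>.\<close>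

lemma eps_nat:
  assumes A: "A \<in> VObj AT" and B: "B \<in> VObj AT" and g: "Hm A B g"
  shows "eps B \<cdot> Tm g = g \<cdot> eps A"
proof -
  obtain x where x: "x \<in> hom V \<I> (VHom AT A B)" "uo A B x = g"
    using hom_point_bij(3)[OF A B g] unfolding uo_def by blast
  note t = homD[OF Hm_hom[OF g]] alg_Obj[OF A] alg_Obj[OF B]
  let ?FA = "FOb F (snd A)" and ?FB = "FOb F (snd B)"
  have OF: "?FA \<in> VObj AT" "?FB \<in> VObj AT" using A B by auto
  have n: "vpost V AT ?FA ?FB B (\<epsilon> B) \<cdot> (FHom F (snd A) (snd B) \<cdot> qsnd A B) =
        vpre V AT ?FA A B (\<epsilon> A) \<cdot> \<one> (VHom AT A B)"
    using adjD(4) A B by (simp add: vnat_trans_def vid_def vfun_comp_def mk_vfun_def forget_simps)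
  have FX: "FHom F (snd A) (snd B) \<in> hom V (ihom V (snd A) (snd B)) (VHom AT ?FA ?FB)"
    using vfunctorD(5)[OF adjD(1), of "snd A" "snd B"] t by simp
  have q: "qsnd A B \<in> hom V (VHom AT A B) (ihom V (snd A) (snd B))"
    using hom_point_bij(1)[OF A B] .
  have nx: "name_of V g = qsnd A B \<cdot> x"
    using name_of_arrow[OF comp_hom[OF x(1) q]] t x(2) by (simp add: uo_def)
  have Fg: "F0 g = FHom F (snd A) (snd B) \<cdot> (qsnd A B \<cdot> x)" using t nx by (simp add: F0_def)
  have d: "vpre V AT ?FA A B (\<epsilon> A) \<in> hom V (VHom AT A B) (VHom AT ?FA B)"
     "vpost V AT ?FA ?FB B (\<epsilon> B) \<in> hom V (VHom AT ?FA ?FB) (VHom AT ?FA B)"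
    using A B OF AT_cat homD[OF eps_hom[OF A]] homD[OF eps_hom[OF B]] by (simp_all add: vpre_def vpost_def hom_def)
  have "el_comp V AT ?FA ?FB B (\<epsilon> B) (F0 g) = vpost V AT ?FA ?FB B (\<epsilon> B) \<cdot> F0 g"
    using vpost_point[OF AT_cat OF B eps_hom[OF B] F0_hom[OF Hm_hom[OF g]]] by simp
  also have "\<dots> = (vpost V AT ?FA ?FB B (\<epsilon> B) \<cdot> (FHom F (snd A) (snd B) \<cdot> qsnd A B)) \<cdot> x"
    unfolding Fg using homD[OF d(2)] homD[OF q] homD[OF FX] homD[OF x(1)] by simp
  also have "\<dots> = el_comp V AT ?FA A B x (\<epsilon> A)"
    unfolding n using vpre_point[OF AT_cat OF(1) A B x(1) eps_hom[OF A]] homD[OF d(1)] homD[OF x(1)] A B AT_cat by simp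
  finally have "uo ?FA B (el_comp V AT ?FA ?FB B (\<epsilon> B) (F0 g)) = uo ?FA B (el_comp V AT ?FA A B x (\<epsilon> A))" by simp
  then show ?thesis
    using uo_comp[OF OF B F0_hom[OF Hm_hom[OF g]] eps_hom[OF B]] uo_comp[OF OF(1) A B eps_hom[OF A] x(1)] x(2) t
    by (simp add: eps_def Tm_def)
qed

lemma triangle1:
  assumes X: "X \<in> Obj V" shows "eps (FOb F X) \<cdot> Tm (e X) = \<one> (TO X)"
proof -
  note eh = homD[OF e_hom[OF X]]
  have "F0 (e X) = FHom F X (TO X) \<cdot> \<eta> X"
    using name_of_arrow[OF eta_hom[OF X] X TO_Obj[OF X]] eh by (simp add: F0_def e_def)
  then have "el_comp V AT (FOb F X) (FOb F (TO X)) (FOb F X) (\<epsilon> (FOb F X)) (F0 (e X)) = VIde AT (FOb F X)"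
    using adjD(5)[OF X] X by (simp add: forget_simps)
  then have "uo (FOb F X) (FOb F X) (el_comp V AT (FOb F X) (FOb F (TO X)) (FOb F X) (\<epsilon> (FOb F X)) (F0 (e X))) = \<one> (TO X)"
    using uo_Ide[of "FOb F X"] X by simp
  then show ?thesis
    using uo_comp[OF _ _ _ F0_hom[OF e_hom[OF X]] eps_hom[of "FOb F X"]] X eh by (simp add: eps_def Tm_def)
qed

lemma triangle2:
  assumes A: "A \<in> VObj AT" shows "eps A \<cdot> e (snd A) = \<one> (snd A)"
proof -
  have FA: "FOb F (snd A) \<in> VObj AT" using A by simp
  have q: "qsnd (FOb F (snd A)) A \<cdot> \<epsilon> A \<in> hom V \<I> (ihom V (TO (snd A)) (snd A))"
    using comp_hom[OF eps_hom[OF A] hom_point_bij(1)[OF FA A]] .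
  have "el_comp V (self V) (snd A) (TO (snd A)) (snd A) (qsnd (FOb F (snd A)) A \<cdot> \<epsilon> A) (\<eta> (snd A)) = VIde (self V) (snd A)"
    using adjD(6)[OF A] A FA by (simp add: forget_simps)
  then have "arrow_of V (snd A) (snd A) (el_comp V (self V) (snd A) (TO (snd A)) (snd A) (qsnd (FOb F (snd A)) A \<cdot> \<epsilon> A) (\<eta> (snd A))) = \<one> (snd A)"
    using arrow_of_ide A by simp
  then show ?thesis
    using arrow_of_el_comp[OF _ _ _ q eta_hom] A by (simp add: eps_def uo_def e_def)
qed

text \<open>The transpose of \<open>f\<close> under the adjunction: the unique homomorphism on the
  free algebra that extends \<open>f\<close> along the unit.\<close>

definition ex where "ex A f = eps A \<cdot> Tm f"

lemma ex_Hm: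
  assumes A: "A \<in> VObj AT" and f: "f \<in> hom V X (snd A)"
  shows "Hm (FOb F X) A (ex A f)" "ex A f \<cdot> e X = f"
proof -
  have X: "X \<in> Obj V" using f hom_Obj by blast
  show "Hm (FOb F X) A (ex A f)" unfolding ex_def
    using Hm_comp[OF _ _ A Tm_Hm[OF f] eps_Hm[OF A]] X A by simp
  note t = homD[OF Hm_hom[OF eps_Hm[OF A]]] homD[OF Hm_hom[OF Tm_Hm[OF f]]] homD[OF e_hom[OF X]] homD[OF f]
    homD[OF e_hom[OF alg_Obj[OF A]]]
  have "ex A f \<cdot> e X = eps A \<cdot> (Tm f \<cdot> e X)" using t by (simp add: ex_def)
  also have "\<dots> = eps A \<cdot> (e (snd A) \<cdot> f)" by (simp only: e_nat[OF f])
  also have "\<dots> = \<one> (snd A) \<cdot> f" using t by (intro comp_reduce triangle2 A) auto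
  finally show "ex A f \<cdot> e X = f" using t by simp
qed

lemma ex_hom: "A \<in> VObj AT \<Longrightarrow> f \<in> hom V X (snd A) \<Longrightarrow> ex A f \<in> hom V (TO X) (snd A)"
  using Hm_hom ex_Hm(1) by blast

lemma ex_unique:
  assumes A: "A \<in> VObj AT" and X: "X \<in> Obj V" and g: "Hm (FOb F X) A g"
  shows "g = ex A (g \<cdot> e X)"
proof -
  note gh = Hm_hom[OF g] and eh = e_hom[OF X]
  note t = homD[OF gh] homD[OF eh] homD[OF Hm_hom[OF eps_Hm[OF A]]] homD[OF Hm_hom[OF eps_Hm[OF F_obj[OF X]]]]
    homD[OF Hm_hom[OF Tm_Hm[OF gh]]] homD[OF Hm_hom[OF Tm_Hm[OF eh]]]
  have "g = g \<cdot> (eps (FOb F X) \<cdot> Tm (e X))" using t by (simp add: triangle1[OF X])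
  also have "\<dots> = eps A \<cdot> (Tm g \<cdot> Tm (e X))"
    using t by (intro comp_permute eps_nat[symmetric, OF F_obj[OF X] A g]) auto
  finally show ?thesis by (simp add: ex_def Tm_comp[OF eh gh])
qed

lemma ex_eq:
  assumes "A \<in> VObj AT" "X \<in> Obj V" "Hm (FOb F X) A g" "Hm (FOb F X) A h" "g \<cdot> e X = h \<cdot> e X"
  shows "g = h"
  using ex_unique[OF assms(1-3)] ex_unique[OF assms(1,2,4)] assms(5) by simp

lemma Tm_hom: "f \<in> hom V X Y \<Longrightarrow> Tm f \<in> hom V (TO X) (TO Y)"
  using Hm_hom[OF Tm_Hm] .

lemma ex_Tm:
  assumes A: "A \<in> VObj AT" and f: "f \<in> hom V X (snd A)" and g: "g \<in> hom V W X"
  shows "ex A f \<cdot> Tm g = ex A (f \<cdot> g)"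
  using homD[OF Hm_hom[OF eps_Hm[OF A]]] homD[OF Tm_hom[OF f]] homD[OF Tm_hom[OF g]]
  by (simp add: ex_def Tm_comp[OF g f])

lemma Tm_Ide:
  assumes X: "X \<in> Obj V" shows "Tm (\<one> X) = \<one> (TO X)"
proof (rule ex_eq[OF F_obj[OF X] X Tm_Hm[OF Ide_hom[OF X]] Hm_Ide[OF F_obj[OF X]]])
  show "Tm (\<one> X) \<cdot> e X = \<one> (TO X) \<cdot> e X"
    using e_nat[OF Ide_hom[OF X]] homD[OF e_hom[OF X]] by simp
qed

section \<open>The underlying ordinary category of algebras\<close>

abbreviation A0 where "A0 \<equiv> Alg0 V P T J"
abbreviation fo where "fo \<equiv> forget0 V P T J"

lemma A0_Obj [simp]: "Obj A0 = VObj AT"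
  by (simp add: underlying_def)

lemma A0_hom_iff: "g \<in> hom A0 A B \<longleftrightarrow> (\<exists>x \<in> hom V \<I> (VHom AT A B). g = (A, x, B)) \<and> A \<in> VObj AT \<and> B \<in> VObj AT"
proof (cases g)
  case (fields A' x B')
  then show ?thesis unfolding hom_def[of A0] by (auto simp: underlying_def)
qed

lemma fo_uo: "A \<in> VObj AT \<Longrightarrow> B \<in> VObj AT \<Longrightarrow> fo (A, x, B) = uo A B x"
  by (simp add: forget0_def uo_def forget_simps)

lemma fo_Hm:
  assumes "g \<in> hom A0 A B" shows "A \<in> VObj AT" "B \<in> VObj AT" "Hm A B (fo g)"
proof -
  obtain x where x: "x \<in> hom V \<I> (VHom AT A B)" "g = (A, x, B)" and O: "A \<in> VObj AT" "B \<in> VObj AT"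
    using assms unfolding A0_hom_iff by blast
  show "A \<in> VObj AT" "B \<in> VObj AT" by (rule O)+
  show "Hm A B (fo g)" using hom_point_bij(2)[OF O x(1)] by (simp add: x(2) fo_uo[OF O] uo_def)
qed

lemma fo_surj:
  assumes "A \<in> VObj AT" "B \<in> VObj AT" "Hm A B f" obtains g where "g \<in> hom A0 A B" "fo g = f"
proof -
  obtain x where "x \<in> hom V \<I> (VHom AT A B)" "uo A B x = f"
    using hom_point_bij(3)[OF assms] unfolding uo_def by blast
  then show thesis using that[of "(A, x, B)"] assms by (simp add: A0_hom_iff fo_uo)
qed

lemma fo_inj:
  assumes "g \<in> hom A0 A B" "h \<in> hom A0 A B" "fo g = fo h" shows "g = h"
proof -
  obtain x y where x: "x \<in> hom V \<I> (VHom AT A B)" "g = (A, x, B)" and y: "y \<in> hom V \<I> (VHom AT A B)" "h = (A, y, B)"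
    and O: "A \<in> VObj AT" "B \<in> VObj AT"
    using assms unfolding A0_hom_iff by blast
  have "x = y" using hom_point_bij(4)[OF O x(1) y(1)] assms(3) by (simp add: x(2) y(2) fo_uo[OF O] uo_def)
  then show ?thesis by (simp add: x y)
qed

lemma fo_comp:
  assumes "g \<in> hom A0 A B" "h \<in> hom A0 B C"
  shows "h \<cdot>\<^bsub>A0\<^esub> g \<in> hom A0 A C" "fo (h \<cdot>\<^bsub>A0\<^esub> g) = fo h \<cdot> fo g"
proof -
  obtain x y where x: "x \<in> hom V \<I> (VHom AT A B)" "g = (A, x, B)" and y: "y \<in> hom V \<I> (VHom AT B C)" "h = (B, y, C)"
    and O: "A \<in> VObj AT" "B \<in> VObj AT" "C \<in> VObj AT" using assms unfolding A0_hom_iff by blast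
  have c: "h \<cdot>\<^bsub>A0\<^esub> g = (A, el_comp V AT A B C y x, C)" by (simp add: x y underlying_def)
  show "h \<cdot>\<^bsub>A0\<^esub> g \<in> hom A0 A C" unfolding c A0_hom_iff using el_comp_hom[OF AT_cat O y(1) x(1)] O by auto
  show "fo (h \<cdot>\<^bsub>A0\<^esub> g) = fo h \<cdot> fo g"
    unfolding c using uo_comp[OF O x(1) y(1)] O x(2) y(2) by (simp add: fo_uo)
qed

text \<open>Faithfulness of the forgetful functor. It lets closure under subalgebras be invoked for
  homomorphisms that are monic in \<V>.\<close>

lemma fo_mono:
  assumes g: "g \<in> hom A0 A B" and m: "mono_arr V (fo g)" shows "mono_arr A0 g"
  unfolding mono_arr_def
proof (intro conjI allI ballI impI)
  have d: "Dom A0 g = A" "g \<in> Arr A0" using g by (simp_all add: hom_def)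
  show "g \<in> Arr A0" by (rule d)
  fix W h k assume "h \<in> hom A0 W (Dom A0 g)" "k \<in> hom A0 W (Dom A0 g)" and eq: "g \<cdot>\<^bsub>A0\<^esub> h = g \<cdot>\<^bsub>A0\<^esub> k"
  then have hk: "h \<in> hom A0 W A" "k \<in> hom A0 W A" by (simp_all add: d)
  have "fo g \<cdot> fo h = fo g \<cdot> fo k" using eq fo_comp(2)[OF hk(1) g] fo_comp(2)[OF hk(2) g] by simp
  then have "fo h = fo k"
    using m Hm_hom[OF fo_Hm(3)[OF hk(1)]] Hm_hom[OF fo_Hm(3)[OF hk(2)]] homD[OF Hm_hom[OF fo_Hm(3)[OF g]]]
    unfolding mono_arr_def by metis
  then show "h = k" by (rule fo_inj[OF hk])
qed

end

section \<open>Creation of algebra structures\<close>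

context smc
begin

lemma self_comp_ipost:
  assumes O: "X \<in> Obj V" "Y \<in> Obj V" and f: "f \<in> hom V A B"
  shows "VComp (self V) Y X B \<cdot> (ipost X f \<otimes> \<one> (ihom V Y X)) = ipost Y f \<cdot> VComp (self V) Y X A"
proof (rule curry_inj)
  have AB: "A \<in> Obj V" "B \<in> Obj V" using f hom_Obj by blast+
  note t = O AB homD[OF f]
  let ?a = "assoc V (ihom V X A) (ihom V Y X) Y"
  have "evl V Y B \<cdot> ((VComp (self V) Y X B \<cdot> (ipost X f \<otimes> \<one> (ihom V Y X))) \<otimes> \<one> Y) =
    evl V X B \<cdot> ((ipost X f \<otimes> (evl V Y X \<cdot> (\<one> (ihom V Y X) \<otimes> \<one> Y))) \<cdot> ?a)"
    using t by (intro evl_self_comp_tens) (simp_all add: hom_def)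
  also have "\<dots> = evl V X B \<cdot> ((ipost X f \<otimes> \<one> X) \<cdot> ((\<one> (ihom V X A) \<otimes> evl V Y X) \<cdot> ?a))"
    using t by simp
  also have "\<dots> = f \<cdot> (evl V X A \<cdot> ((\<one> (ihom V X A) \<otimes> evl V Y X) \<cdot> ?a))"
    using t by (intro comp_permute evl_ipost O f) auto
  also have "\<dots> = f \<cdot> (evl V Y A \<cdot> (VComp (self V) Y X A \<otimes> \<one> Y))"
    using t by (simp add: evl_self_comp)
  also have "\<dots> = evl V Y B \<cdot> ((ipost Y f \<cdot> VComp (self V) Y X A) \<otimes> \<one> Y)"
    using t f by (intro evl_tens[symmetric]) (simp_all add: hom_def)
  finally show "evl V Y B \<cdot> ((VComp (self V) Y X B \<cdot> (ipost X f \<otimes> \<one> (ihom V Y X))) \<otimes> \<one> Y) =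
    evl V Y B \<cdot> ((ipost Y f \<cdot> VComp (self V) Y X A) \<otimes> \<one> Y)" .
  show "B \<in> Obj V" "VComp (self V) Y X B \<cdot> (ipost X f \<otimes> \<one> (ihom V Y X)) \<in> hom V (ihom V X A \<odot> ihom V Y X) (ihom V Y B)"
    "ipost Y f \<cdot> VComp (self V) Y X A \<in> hom V (ihom V X A \<odot> ihom V Y X) (ihom V Y B)"
    using t by (simp_all add: hom_def)
qed (rule O)

text \<open>[X, -] is a right adjoint and so preserves jointly monic families.\<close>

lemma ipost_jointly_monic:
  assumes S: "S \<in> Obj V" and X: "X \<in> Obj V" and m: "\<And>i. i \<in> K \<Longrightarrow> m i \<in> hom V S (B i)"
    and jm: "\<And>W f g. f \<in> hom V W S \<Longrightarrow> g \<in> hom V W S \<Longrightarrow> (\<And>i. i \<in> K \<Longrightarrow> m i \<cdot> f = m i \<cdot> g) \<Longrightarrow> f = g"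
    and fg: "f \<in> hom V W (ihom V X S)" "g \<in> hom V W (ihom V X S)" "\<And>i. i \<in> K \<Longrightarrow> ipost X (m i) \<cdot> f = ipost X (m i) \<cdot> g"
  shows "f = g"
proof (rule curry_inj[OF _ fg(1,2) X S])
  have W: "W \<in> Obj V" using fg(1) hom_Obj by blast
  note t = homD[OF fg(1)] homD[OF fg(2)] X S W
  show "evl V X S \<cdot> (f \<otimes> \<one> X) = evl V X S \<cdot> (g \<otimes> \<one> X)"
  proof (rule jm[of _ "W \<odot> X"])
    fix i assume i: "i \<in> K"
    show "m i \<cdot> (evl V X S \<cdot> (f \<otimes> \<one> X)) = m i \<cdot> (evl V X S \<cdot> (g \<otimes> \<one> X))"
      using evl_tens[OF X fg(1) m[OF i]] evl_tens[OF X fg(2) m[OF i]] fg(3)[OF i] by simp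
  qed (use t in \<open>simp_all add: hom_def\<close>)
qed

end

context thy_alg
begin

lemma jact_ipost:
  assumes O: "X \<in> Obj V" "Y \<in> Obj V" and f: "f \<in> hom V A B"
  shows "jact B X Y \<cdot> (\<one> (ihom V Y X) \<otimes> ipost X f) = ipost Y f \<cdot> jact A X Y"
proof -
  have AB: "A \<in> Obj V" "B \<in> Obj V" using f hom_Obj by blast+
  note t = O AB homD[OF f]
  have "jact B X Y \<cdot> (\<one> (ihom V Y X) \<otimes> ipost X f) = VComp (self V) Y X B \<cdot> (symm V (ihom V Y X) (ihom V X B) \<cdot> (\<one> (ihom V Y X) \<otimes> ipost X f))"
    using t by (simp add: jact_def)
  also have "symm V (ihom V Y X) (ihom V X B) \<cdot> (\<one> (ihom V Y X) \<otimes> ipost X f) = (ipost X f \<otimes> \<one> (ihom V Y X)) \<cdot> symm V (ihom V Y X) (ihom V X A)"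
    using t by (intro symm_nat) (simp_all add: hom_def)
  also have "VComp (self V) Y X B \<cdot> ((ipost X f \<otimes> \<one> (ihom V Y X)) \<cdot> symm V (ihom V Y X) (ihom V X A)) =
    ipost Y f \<cdot> (VComp (self V) Y X A \<cdot> symm V (ihom V Y X) (ihom V X A))"
    using t by (intro comp_permute self_comp_ipost O f) auto
  finally show ?thesis by (simp add: jact_def)
qed

text \<open>\<open>vfunctor_of_act\<close> combined with the requirement of
  \<open>Alg_Obj_iff\<close> that the action restrict along \<open>J\<close> to
  precomposition.\<close>

lemma algebra_of_action:
  assumes A: "A \<in> Obj V"
    and h: "\<And>X Y. X \<in> P \<Longrightarrow> Y \<in> P \<Longrightarrow> \<alpha> X Y \<in> hom V (VHom To X Y \<odot> ihom V X A) (ihom V Y A)"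
    and u: "\<And>X. X \<in> P \<Longrightarrow> \<alpha> X X \<cdot> (VIde To X \<otimes> \<one> (ihom V X A)) = lunit V (ihom V X A)"
    and c: "\<And>X Y Z. X \<in> P \<Longrightarrow> Y \<in> P \<Longrightarrow> Z \<in> P \<Longrightarrow>
      \<alpha> X Z \<cdot> (VComp To X Y Z \<otimes> \<one> (ihom V X A)) =
     \<alpha> Y Z \<cdot> ((\<one> (VHom To Y Z) \<otimes> \<alpha> X Y) \<cdot> assoc V (VHom To Y Z) (VHom To X Y) (ihom V X A))"
    and j: "\<And>X Y. X \<in> P \<Longrightarrow> Y \<in> P \<Longrightarrow> \<alpha> X Y \<cdot> (FHom J Y X \<otimes> \<one> (ihom V X A)) = jact A X Y"
  shows "\<exists>B \<in> VObj AT. snd B = A \<and> (\<forall>X \<in> P. \<forall>Y \<in> P. vact (fst B) X Y = \<alpha> X Y)"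
proof -
  define H where "H = mk_vfun To (\<lambda>X. ihom V X A) (\<lambda>X Y. vcurry V (VHom To X Y) (ihom V X A) (ihom V Y A) (\<alpha> X Y))"
  note v = vfunctor_of_act[OF opT slf, where G = "\<lambda>X. ihom V X A" and \<alpha> = \<alpha>, folded H_def]
  have "vfunctor V To (self V) H" by (rule v(1)) (use A h u c PO in simp_all)
  moreover have "FOb H X = ihom V X A" if "X \<in> P" for X
    by (rule v(2)) (use A h u c PO that in simp_all)
  moreover have act: "vact H X Y = \<alpha> X Y" if "X \<in> P" "Y \<in> P" for X Y
    by (rule v(3)) (use A h u c PO that in simp_all)
  ultimately have "(H, A) \<in> VObj AT" using A j by (simp add: Alg_Obj_iff)
  then show ?thesis using act by (intro bexI[of _ "(H, A)"]) simp_all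
qed

end

context alg_adj
begin

text \<open>The arrow \<open>d\<close> expresses that \<open>S\<close>, mapped into the algebras
  \<open>B i\<close>, is closed under the operations. It defines an action on \<open>S\<close>,
  whose laws hold because they hold in every \<open>B i\<close> and the \<open>m i\<close> are
  jointly monic. Products and images of algebras are both obtained from this lemma.\<close>

lemma creation:
  assumes S: "S \<in> Obj V" and B: "\<And>i. i \<in> K \<Longrightarrow> B i \<in> VObj AT" and m: "\<And>i. i \<in> K \<Longrightarrow> m i \<in> hom V S (snd (B i))"
    and jm: "\<And>W f g. f \<in> hom V W S \<Longrightarrow> g \<in> hom V W S \<Longrightarrow> (\<And>i. i \<in> K \<Longrightarrow> m i \<cdot> f = m i \<cdot> g) \<Longrightarrow> f = g"
    and d: "d \<in> hom V (TO S) S" "\<And>i. i \<in> K \<Longrightarrow> m i \<cdot> d = ex (B i) (m i)"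
  obtains A where "A \<in> VObj AT" "snd A = S" "\<And>i. i \<in> K \<Longrightarrow> Hm A (B i) (m i)"
proof -
  let ?T = "VHom To" and ?FS = "FOb F S"
  have FS: "?FS \<in> VObj AT" using S by simp
  \<comment> \<open>Enter the free algebra by the unit, act there, and return along
    \<open>d\<close>. Since \<open>m i \<cdot> d\<close> is a homomorphism, \<open>m i\<close>
    intertwines this action with that of \<open>B i\<close>.\<close>
  define \<alpha> where "\<alpha> X Y = ipost Y d \<cdot> (vact (fst ?FS) X Y \<cdot> (\<one> (?T X Y) \<otimes> ipost X (e S)))" for X Y
  note eh = e_hom[OF S]
  have \<alpha>h: "\<alpha> X Y \<in> hom V (?T X Y \<odot> ihom V X S) (ihom V Y S)" if "X \<in> P" "Y \<in> P" for X Y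
    unfolding \<alpha>_def using homD[OF eh] homD[OF d(1)] alg_act[OF FS that] To_hom[OF that] PO that by (simp add: hom_def)
  have \<alpha>s: "\<alpha> X Y \<in> Arr V" "Dom V (\<alpha> X Y) = ?T X Y \<odot> ihom V X S" "Cod V (\<alpha> X Y) = ihom V Y S" if "X \<in> P" "Y \<in> P" for X Y
    using homD[OF \<alpha>h[OF that]] by auto
  have key: "ipost Y (m i) \<cdot> \<alpha> X Y = vact (fst (B i)) X Y \<cdot> (\<one> (?T X Y) \<otimes> ipost X (m i))"
    if i: "i \<in> K" and XY: "X \<in> P" "Y \<in> P" for i X Y
  proof -
    let ?x = "ex (B i) (m i)"
    note xh = ex_Hm[OF B[OF i] m[OF i]] ex_hom[OF B[OF i] m[OF i]]
    note t = homD[OF eh] homD[OF d(1)] alg_act[OF FS XY] alg_act[OF B[OF i] XY] To_hom[OF XY] PO[OF XY(1)] PO[OF XY(2)] homD[OF m[OF i]] homD[OF xh(3)]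
    have "ipost Y (m i) \<cdot> \<alpha> X Y = ipost Y ?x \<cdot> (vact (fst ?FS) X Y \<cdot> (\<one> (?T X Y) \<otimes> ipost X (e S)))"
      unfolding \<alpha>_def by (rule comp_reduce) (use t ipost_comp[OF _ d(1) m[OF i]] d(2)[OF i] in simp_all)
    also have "\<dots> = vact (fst (B i)) X Y \<cdot> ((\<one> (?T X Y) \<otimes> ipost X ?x) \<cdot> (\<one> (?T X Y) \<otimes> ipost X (e S)))"
      by (rule comp_permute) (use t xh(1) XY in \<open>simp_all add: Hm_def\<close>)
    also have "\<dots> = vact (fst (B i)) X Y \<cdot> (\<one> (?T X Y) \<otimes> ipost X (m i))"
      using t ipost_comp[OF _ eh xh(3)] xh(2) by simp
    finally show ?thesis .
  qed
  note jm' = ipost_jointly_monic[OF S _ m jm]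
  have "\<exists>A \<in> VObj AT. snd A = S \<and> (\<forall>X \<in> P. \<forall>Y \<in> P. vact (fst A) X Y = \<alpha> X Y)"
  proof (rule algebra_of_action[OF S \<alpha>h])
    fix X assume X: "X \<in> P"
    show "\<alpha> X X \<cdot> (VIde To X \<otimes> \<one> (ihom V X S)) = lunit V (ihom V X S)"
    proof (rule jm'[of X])
      note t = PO[OF X] S vcat_Arr[OF opT, of X X] X \<alpha>s[OF X X]
      show "\<alpha> X X \<cdot> (VIde To X \<otimes> \<one> (ihom V X S)) \<in> hom V (\<I> \<odot> ihom V X S) (ihom V X S)"
        "lunit V (ihom V X S) \<in> hom V (\<I> \<odot> ihom V X S) (ihom V X S)"
        using t by (simp_all add: hom_def)
      fix i assume i: "i \<in> K"
      note t' = t homD[OF m[OF i]] alg_act[OF B[OF i] X X] alg_Obj[OF B[OF i]]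
      have "ipost X (m i) \<cdot> (\<alpha> X X \<cdot> (VIde To X \<otimes> \<one> (ihom V X S))) =
         vact (fst (B i)) X X \<cdot> ((\<one> (?T X X) \<otimes> ipost X (m i)) \<cdot> (VIde To X \<otimes> \<one> (ihom V X S)))"
        by (rule comp_permute[OF key[OF i X X]]) (use t' in simp_all)
      also have "\<dots> = vact (fst (B i)) X X \<cdot> ((VIde To X \<otimes> \<one> (ihom V X (snd (B i)))) \<cdot> (\<one> \<I> \<otimes> ipost X (m i)))"
        using t' by simp
      also have "\<dots> = lunit V (ihom V X (snd (B i))) \<cdot> (\<one> \<I> \<otimes> ipost X (m i))"
        by (rule comp_reduce) (use t' vact_unit[OF AlgD(2)[OF B[OF i]], of X] AlgD(3)[OF B[OF i] X] in simp_all)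
      also have "\<dots> = ipost X (m i) \<cdot> lunit V (ihom V X S)"
        by (rule lunit_nat) (use t' in \<open>simp add: hom_def\<close>)
      finally show "ipost X (m i) \<cdot> (\<alpha> X X \<cdot> (VIde To X \<otimes> \<one> (ihom V X S))) = ipost X (m i) \<cdot> lunit V (ihom V X S)" .
    qed (rule PO[OF X])
  next
    fix X Y Z assume XYZ: "X \<in> P" "Y \<in> P" "Z \<in> P"
    let ?a = "assoc V (?T Y Z) (?T X Y)"
    note t = PO[OF XYZ(1)] PO[OF XYZ(2)] PO[OF XYZ(3)] S vcat_Arr[OF opT, of X Y] vcat_Arr[OF opT, of Y Z] vcat_Arr[OF opT, of X Z] XYZ
      \<alpha>s[OF XYZ(1,2)] \<alpha>s[OF XYZ(2,3)] \<alpha>s[OF XYZ(1,3)]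
    show "\<alpha> X Z \<cdot> (VComp To X Y Z \<otimes> \<one> (ihom V X S)) = \<alpha> Y Z \<cdot> ((\<one> (?T Y Z) \<otimes> \<alpha> X Y) \<cdot> ?a (ihom V X S))"
    proof (rule jm'[of Z])
      show "\<alpha> X Z \<cdot> (VComp To X Y Z \<otimes> \<one> (ihom V X S)) \<in> hom V ((?T Y Z \<odot> ?T X Y) \<odot> ihom V X S) (ihom V Z S)"
        "\<alpha> Y Z \<cdot> ((\<one> (?T Y Z) \<otimes> \<alpha> X Y) \<cdot> ?a (ihom V X S)) \<in> hom V ((?T Y Z \<odot> ?T X Y) \<odot> ihom V X S) (ihom V Z S)"
        using t by (simp_all add: hom_def)
      fix i assume i: "i \<in> K"
      let ?B = "vact (fst (B i))"
      note t' = t homD[OF m[OF i]] alg_act[OF B[OF i] XYZ(1,2)] alg_act[OF B[OF i] XYZ(2,3)] alg_act[OF B[OF i] XYZ(1,3)] alg_Obj[OF B[OF i]]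
      have "ipost Z (m i) \<cdot> (\<alpha> X Z \<cdot> (VComp To X Y Z \<otimes> \<one> (ihom V X S))) =
         ?B X Z \<cdot> ((\<one> (?T X Z) \<otimes> ipost X (m i)) \<cdot> (VComp To X Y Z \<otimes> \<one> (ihom V X S)))"
        by (rule comp_permute[OF key[OF i XYZ(1,3)]]) (use t' in simp_all)
      also have "\<dots> = ?B X Z \<cdot> ((VComp To X Y Z \<otimes> \<one> (ihom V X (snd (B i)))) \<cdot> ((\<one> (?T Y Z) \<otimes> \<one> (?T X Y)) \<otimes> ipost X (m i)))"
        using t' by simp
      also have "\<dots> = (?B Y Z \<cdot> ((\<one> (?T Y Z) \<otimes> ?B X Y) \<cdot> ?a (ihom V X (snd (B i))))) \<cdot> ((\<one> (?T Y Z) \<otimes> \<one> (?T X Y)) \<otimes> ipost X (m i))"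
        by (rule comp_reduce) (use t' vact_comp[OF AlgD(2)[OF B[OF i]], of X Y Z] AlgD(3)[OF B[OF i] XYZ(1)] in simp_all)
      also have "\<dots> = ?B Y Z \<cdot> ((\<one> (?T Y Z) \<otimes> ?B X Y) \<cdot> (?a (ihom V X (snd (B i))) \<cdot> ((\<one> (?T Y Z) \<otimes> \<one> (?T X Y)) \<otimes> ipost X (m i))))"
        using t' by (simp del: tens_Ide)
      also have "?a (ihom V X (snd (B i))) \<cdot> ((\<one> (?T Y Z) \<otimes> \<one> (?T X Y)) \<otimes> ipost X (m i)) =
          (\<one> (?T Y Z) \<otimes> (\<one> (?T X Y) \<otimes> ipost X (m i))) \<cdot> ?a (ihom V X S)"
        by (rule assoc_nat) (use t' in \<open>simp_all add: hom_def\<close>)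
      also have "?B Y Z \<cdot> ((\<one> (?T Y Z) \<otimes> ?B X Y) \<cdot> ((\<one> (?T Y Z) \<otimes> (\<one> (?T X Y) \<otimes> ipost X (m i))) \<cdot> ?a (ihom V X S))) =
        ?B Y Z \<cdot> ((\<one> (?T Y Z) \<otimes> (?B X Y \<cdot> (\<one> (?T X Y) \<otimes> ipost X (m i)))) \<cdot> ?a (ihom V X S))"
        using t' by simp
      also have "\<dots> = ?B Y Z \<cdot> ((\<one> (?T Y Z) \<otimes> (ipost Y (m i) \<cdot> \<alpha> X Y)) \<cdot> ?a (ihom V X S))"
        by (simp only: key[OF i XYZ(1,2)])
      also have "\<dots> = ?B Y Z \<cdot> ((\<one> (?T Y Z) \<otimes> ipost Y (m i)) \<cdot> ((\<one> (?T Y Z) \<otimes> \<alpha> X Y) \<cdot> ?a (ihom V X S)))"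
        using t' by simp
      also have "\<dots> = ipost Z (m i) \<cdot> (\<alpha> Y Z \<cdot> ((\<one> (?T Y Z) \<otimes> \<alpha> X Y) \<cdot> ?a (ihom V X S)))"
        by (rule comp_permute[OF key[OF i XYZ(2,3), symmetric]]) (use t' in simp_all)
      finally show "ipost Z (m i) \<cdot> (\<alpha> X Z \<cdot> (VComp To X Y Z \<otimes> \<one> (ihom V X S))) =
         ipost Z (m i) \<cdot> (\<alpha> Y Z \<cdot> ((\<one> (?T Y Z) \<otimes> \<alpha> X Y) \<cdot> ?a (ihom V X S)))" .
    qed (rule PO[OF XYZ(3)])
  next
    fix X Y assume XY: "X \<in> P" "Y \<in> P"
    note t = PO[OF XY(1)] PO[OF XY(2)] S XY \<alpha>s[OF XY] J_Arr[OF XY] To_hom[OF XY]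
    show "\<alpha> X Y \<cdot> (FHom J Y X \<otimes> \<one> (ihom V X S)) = jact S X Y"
    proof (rule jm'[of Y])
      show "\<alpha> X Y \<cdot> (FHom J Y X \<otimes> \<one> (ihom V X S)) \<in> hom V (ihom V Y X \<odot> ihom V X S) (ihom V Y S)"
        "jact S X Y \<in> hom V (ihom V Y X \<odot> ihom V X S) (ihom V Y S)"
        using t by (simp_all add: hom_def)
      fix i assume i: "i \<in> K"
      note t' = t homD[OF m[OF i]] alg_act[OF B[OF i] XY] alg_Obj[OF B[OF i]]
      have "ipost Y (m i) \<cdot> (\<alpha> X Y \<cdot> (FHom J Y X \<otimes> \<one> (ihom V X S))) =
         vact (fst (B i)) X Y \<cdot> ((\<one> (?T X Y) \<otimes> ipost X (m i)) \<cdot> (FHom J Y X \<otimes> \<one> (ihom V X S)))"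
        by (rule comp_permute[OF key[OF i XY]]) (use t' in simp_all)
      also have "\<dots> = vact (fst (B i)) X Y \<cdot> ((FHom J Y X \<otimes> \<one> (ihom V X (snd (B i)))) \<cdot> (\<one> (ihom V Y X) \<otimes> ipost X (m i)))"
        using t' by simp
      also have "\<dots> = jact (snd (B i)) X Y \<cdot> (\<one> (ihom V Y X) \<otimes> ipost X (m i))"
        by (rule comp_reduce) (use t' AlgD(4)[OF B[OF i] XY] in simp_all)
      also have "\<dots> = ipost Y (m i) \<cdot> jact S X Y" by (rule jact_ipost) (use t m[OF i] in simp_all)
      finally show "ipost Y (m i) \<cdot> (\<alpha> X Y \<cdot> (FHom J Y X \<otimes> \<one> (ihom V X S))) = ipost Y (m i) \<cdot> jact S X Y" .
    qed (rule PO[OF XY(2)])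
  qed
  then obtain A where A: "A \<in> VObj AT" "snd A = S" "\<And>X Y. X \<in> P \<Longrightarrow> Y \<in> P \<Longrightarrow> vact (fst A) X Y = \<alpha> X Y"
    by blast
  show thesis
  proof (rule that[OF A(1,2)])
    show "Hm A (B i) (m i)" if "i \<in> K" for i
      unfolding Hm_def using m[OF that] key[OF that] A(2,3) by simp
  qed
qed

end

section \<open>Internal homs out of presentable objects\<close>

context lps
begin

lemma presentable_colimit:
  assumes "Q \<in> Obj V"
  obtains S r D d c where "directed_diagram lam V (Arr V) S r D d" "\<And>i. i \<in> S \<Longrightarrow> presentable lam V (D i)"
    "is_colimit (poset_cat S r) V D d Q c"
proof -
  obtain G where "\<forall>X \<in> G. presentable lam V X" "\<forall>Q \<in> Obj V. directed_colimit_of lam V (Arr V) G Q"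
    using lp unfolding locally_presentable_def by blast
  moreover from this obtain S r D d c where "directed_diagram lam V (Arr V) S r D d" "D ` S \<subseteq> G"
    "is_colimit (poset_cat S r) V D d Q c"
    using assms unfolding directed_colimit_of_def by blast
  ultimately show thesis using that[of S r D d c] by blast
qed

lemma presentable_Obj: "presentable lam V X \<Longrightarrow> X \<in> Obj V"
  by (simp add: presentable_def)

lemma poset_colimit_eq:
  fixes m :: "'u rel"
  assumes "is_colimit (poset_cat S r) V D d Q c" "directed_diagram m V M S r D d"
    "f \<in> hom V Q R" "g \<in> hom V Q R" "\<And>i. i \<in> S \<Longrightarrow> f \<cdot> c i = g \<cdot> c i"
  shows "f = g"
  by (rule colimit_arrows_eq[OF assms(1,3,4)])
    (use assms(2,5) directed_diagramD(2)[OF assms(2)] in \<open>auto simp: is_functor_def\<close>)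

text \<open>The internal hom out of a presentable object preserves directed colimits: presentable objects
  are closed under tensor products and generate.\<close>

lemma ihom_colimit:
  assumes X: "presentable lam V X" and dd: "directed_diagram lam V M S r D d" and cl: "is_colimit (poset_cat S r) V D d Q c"
  shows "\<And>R b. R \<in> Obj V \<Longrightarrow> (\<And>i. i \<in> S \<Longrightarrow> b i \<in> hom V (ihom V X (D i)) R) \<Longrightarrow>
      (\<And>i j. (i, j) \<in> r \<Longrightarrow> b j \<cdot> ipost X (d (i, j)) = b i) \<Longrightarrow>
      \<exists>u \<in> hom V (ihom V X Q) R. \<forall>i \<in> S. u \<cdot> ipost X (c i) = b i"
    "\<And>R f g. f \<in> hom V (ihom V X Q) R \<Longrightarrow> g \<in> hom V (ihom V X Q) R \<Longrightarrow>
       (\<And>i. i \<in> S \<Longrightarrow> f \<cdot> ipost X (c i) = g \<cdot> ipost X (c i)) \<Longrightarrow> f = g"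
proof -
  note dD = directed_diagramD[OF dd] and cD = poset_colimitD[OF cl]
  note XO = presentable_Obj[OF X]
  have Q: "Q \<in> Obj V" by (rule cD(1))
  \<comment> \<open>By adjunction \<open>f\<close> is an arrow out of \<open>W \<odot> X\<close>,
    which is presentable and hence factors through a stage.\<close>
  have factor: "\<exists>i \<in> S. \<exists>h \<in> hom V W (ihom V X (D i)). ipost X (c i) \<cdot> h = f"
    if W: "presentable lam V W" and f: "f \<in> hom V W (ihom V X Q)" for W f
  proof -
    have WO: "W \<in> Obj V" using W by (rule presentable_Obj)
    have "evl V X Q \<cdot> (f \<otimes> \<one> X) \<in> hom V (W \<odot> X) Q" using homD[OF f] XO Q by (simp add: hom_def)
    then obtain i g where i: "i \<in> S" and g: "g \<in> hom V (W \<odot> X) (D i)" "c i \<cdot> g = evl V X Q \<cdot> (f \<otimes> \<one> X)"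
      using presentable_factor[OF presentable_tens[OF W X] dd cl] by blast
    note cg = vcurry_hom[OF XO dD(6)[OF i] WO g(1)] and ci = cD(2)[OF i]
    have "ipost X (c i) \<cdot> vcurry V W X (D i) g = f"
    proof (rule curry_inj[OF _ _ f XO Q])
      show "evl V X Q \<cdot> ((ipost X (c i) \<cdot> vcurry V W X (D i) g) \<otimes> \<one> X) = evl V X Q \<cdot> (f \<otimes> \<one> X)"
        using evl_tens[OF XO cg(1) ci] cg(2) g(2) by simp
      show "ipost X (c i) \<cdot> vcurry V W X (D i) g \<in> hom V W (ihom V X Q)"
        using homD[OF ci] homD[OF cg(1)] XO by (simp add: hom_def)
    qed
    then show ?thesis using i cg(1) by blast
  qed
  have ic: "ipost X (c i) \<in> hom V (ihom V X (D i)) (ihom V X Q)" if "i \<in> S" for i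
    using homD[OF cD(2)[OF that]] XO by (simp add: hom_def)
  have id: "ipost X (d (i, j)) \<in> hom V (ihom V X (D i)) (ihom V X (D j))" if "(i, j) \<in> r" for i j
    using homD[OF dD(3)[OF that]] XO by (simp add: hom_def)
  have icd: "ipost X (c j) \<cdot> ipost X (d (i, j)) = ipost X (c i)" if ij: "(i, j) \<in> r" for i j
    using ipost_comp[OF XO dD(3)[OF ij] cD(2)] directed_posetD(4)[OF dD(1) ij] cD(3)[OF ij] by simp
  have same: "\<exists>k. (i, k) \<in> r \<and> ipost X (d (i, k)) \<cdot> h = ipost X (d (i, k)) \<cdot> h'"
    if W: "presentable lam V W" and i: "i \<in> S" and h: "h \<in> hom V W (ihom V X (D i))" "h' \<in> hom V W (ihom V X (D i))"
      and eq: "ipost X (c i) \<cdot> h = ipost X (c i) \<cdot> h'" for W i h h'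
  proof -
    have u: "evl V X (D i) \<cdot> (h \<otimes> \<one> X) \<in> hom V (W \<odot> X) (D i)" "evl V X (D i) \<cdot> (h' \<otimes> \<one> X) \<in> hom V (W \<odot> X) (D i)"
      using homD[OF h(1)] homD[OF h(2)] XO dD(6)[OF i] by (simp_all add: hom_def)
    have "c i \<cdot> (evl V X (D i) \<cdot> (h \<otimes> \<one> X)) = c i \<cdot> (evl V X (D i) \<cdot> (h' \<otimes> \<one> X))"
      using evl_tens[OF XO h(1) cD(2)[OF i]] evl_tens[OF XO h(2) cD(2)[OF i]] eq by simp
    from presentable_eq[OF presentable_tens[OF W X] dd cl i u this] obtain k where k: "(i, k) \<in> r"
      "d (i, k) \<cdot> (evl V X (D i) \<cdot> (h \<otimes> \<one> X)) = d (i, k) \<cdot> (evl V X (D i) \<cdot> (h' \<otimes> \<one> X))" by blast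
    have kS: "k \<in> S" using directed_posetD(4)[OF dD(1) k(1)] .
    have "ipost X (d (i, k)) \<cdot> h = ipost X (d (i, k)) \<cdot> h'"
    proof (rule curry_inj[OF _ comp_hom[OF h(1) id[OF k(1)]] comp_hom[OF h(2) id[OF k(1)]] XO dD(6)[OF kS]])
      show "evl V X (D k) \<cdot> ((ipost X (d (i, k)) \<cdot> h) \<otimes> \<one> X) = evl V X (D k) \<cdot> ((ipost X (d (i, k)) \<cdot> h') \<otimes> \<one> X)"
        using evl_tens[OF XO h(1) dD(3)[OF k(1)]] evl_tens[OF XO h(2) dD(3)[OF k(1)]] k(2) by simp
    qed
    then show ?thesis using k(1) by blast
  qed
  have IQ: "ihom V X Q \<in> Obj V" using XO Q by simp
  \<comment> \<open>\<open>factor\<close> and \<open>same\<close> concern presentable domains only,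
    so [X, Q] is itself resolved as a directed colimit of presentable objects.\<close>
  obtain S' r' D' d' c' where dd': "directed_diagram lam V (Arr V) S' r' D' d'" and D': "\<And>i. i \<in> S' \<Longrightarrow> presentable lam V (D' i)"
    and cl': "is_colimit (poset_cat S' r') V D' d' (ihom V X Q) c'"
    using presentable_colimit[OF IQ] by blast
  note dD' = directed_diagramD[OF dd'] and cD' = poset_colimitD[OF cl']
  show "f = g" if fg: "f \<in> hom V (ihom V X Q) R" "g \<in> hom V (ihom V X Q) R"
    and eq: "\<And>i. i \<in> S \<Longrightarrow> f \<cdot> ipost X (c i) = g \<cdot> ipost X (c i)" for R f g
  proof (rule poset_colimit_eq[OF cl' dd' fg])
    fix k assume k: "k \<in> S'"
    obtain i h where i: "i \<in> S" and h: "h \<in> hom V (D' k) (ihom V X (D i))" "ipost X (c i) \<cdot> h = c' k"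
      using factor[OF D'[OF k] cD'(2)[OF k]] by blast
    have "f \<cdot> (ipost X (c i) \<cdot> h) = g \<cdot> (ipost X (c i) \<cdot> h)"
      using homD[OF ic[OF i]] homD[OF fg(1)] homD[OF fg(2)] homD[OF h(1)]
      by (intro comp_permute[OF eq[OF i]]) auto
    then show "f \<cdot> c' k = g \<cdot> c' k" by (simp only: h(2))
  qed
  show "\<exists>u \<in> hom V (ihom V X Q) R. \<forall>i \<in> S. u \<cdot> ipost X (c i) = b i"
    if R: "R \<in> Obj V" and b: "\<And>i. i \<in> S \<Longrightarrow> b i \<in> hom V (ihom V X (D i)) R"
      and bd: "\<And>i j. (i, j) \<in> r \<Longrightarrow> b j \<cdot> ipost X (d (i, j)) = b i" for R b
  proof -
    have bdh: "b j \<cdot> (ipost X (d (i, j)) \<cdot> h) = b i \<cdot> h" if ij: "(i, j) \<in> r" and h: "h \<in> hom V W (ihom V X (D i))" for i j W h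
      using comp_reduce[OF bd[OF ij], of h] homD[OF id[OF ij]] homD[OF b] homD[OF h] directed_posetD(4)[OF dD(1) ij] by simp
    \<comment> \<open>The value \<open>b i \<cdot> h\<close> depends only on the composite with
      \<open>ipost X (c i)\<close>: two lifts of the same arrow become equal at a later stage, and
      \<open>b\<close> is compatible with the diagram.\<close>
    have indep: "b i \<cdot> h = b j \<cdot> h'" if W: "presentable lam V W" and ij: "i \<in> S" "j \<in> S"
      and h: "h \<in> hom V W (ihom V X (D i))" "h' \<in> hom V W (ihom V X (D j))" and eq: "ipost X (c i) \<cdot> h = ipost X (c j) \<cdot> h'" for W i j h h'
    proof -
      obtain k where k: "(i, k) \<in> r" "(j, k) \<in> r" using directed_poset_ub[OF dD(1) lam ij] by blast
      have kS: "k \<in> S" using directed_posetD(4)[OF dD(1) k(1)] .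
      let ?h = "ipost X (d (i, k)) \<cdot> h" and ?h' = "ipost X (d (j, k)) \<cdot> h'"
      have hh: "?h \<in> hom V W (ihom V X (D k))" "?h' \<in> hom V W (ihom V X (D k))"
        using comp_hom[OF h(1) id[OF k(1)]] comp_hom[OF h(2) id[OF k(2)]] .
      have "ipost X (c k) \<cdot> ?h = ipost X (c i) \<cdot> h" "ipost X (c k) \<cdot> ?h' = ipost X (c j) \<cdot> h'"
        using comp_reduce[OF icd[OF k(1)], of h] comp_reduce[OF icd[OF k(2)], of h'] homD[OF id[OF k(1)]] homD[OF id[OF k(2)]]
          homD[OF ic[OF kS]] homD[OF h(1)] homD[OF h(2)] by simp_all
      then have "ipost X (c k) \<cdot> ?h = ipost X (c k) \<cdot> ?h'" using eq by simp
      from same[OF W kS hh this] obtain l where l: "(k, l) \<in> r" "ipost X (d (k, l)) \<cdot> ?h = ipost X (d (k, l)) \<cdot> ?h'" by blast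
      have "b i \<cdot> h = b l \<cdot> (ipost X (d (k, l)) \<cdot> ?h)" using bdh[OF k(1) h(1)] bdh[OF l(1) hh(1)] by simp
      also have "\<dots> = b j \<cdot> h'" using bdh[OF k(2) h(2)] bdh[OF l(1) hh(2)] l(2) by simp
      finally show ?thesis .
    qed
    have "\<forall>k \<in> S'. \<exists>y. \<exists>i \<in> S. \<exists>h \<in> hom V (D' k) (ihom V X (D i)). ipost X (c i) \<cdot> h = c' k \<and> y = b i \<cdot> h"
    proof
      fix k assume k: "k \<in> S'"
      show "\<exists>y. \<exists>i \<in> S. \<exists>h \<in> hom V (D' k) (ihom V X (D i)). ipost X (c i) \<cdot> h = c' k \<and> y = b i \<cdot> h"
        using factor[OF D'[OF k] cD'(2)[OF k]] by blast
    qed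
    note bchoice[OF this]
    then obtain s where s: "\<And>k. k \<in> S' \<Longrightarrow> \<exists>i \<in> S. \<exists>h \<in> hom V (D' k) (ihom V X (D i)). ipost X (c i) \<cdot> h = c' k \<and> s k = b i \<cdot> h"
      by blast
    have s_eq: "s k \<cdot> f = b i \<cdot> h" if k: "k \<in> S'" and W: "presentable lam V W" and f: "f \<in> hom V W (D' k)" and i: "i \<in> S"
      and h: "h \<in> hom V W (ihom V X (D i))" "ipost X (c i) \<cdot> h = c' k \<cdot> f" for k W f i h
    proof -
      obtain j h' where j: "j \<in> S" and h': "h' \<in> hom V (D' k) (ihom V X (D j))" "ipost X (c j) \<cdot> h' = c' k" "s k = b j \<cdot> h'"
        using s[OF k] by blast
      note t = homD[OF ic[OF j]] homD[OF h'(1)] homD[OF f] homD[OF b[OF j]]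
      have "ipost X (c j) \<cdot> (h' \<cdot> f) = c' k \<cdot> f" using t by (intro comp_reduce h') auto
      then have "b j \<cdot> (h' \<cdot> f) = b i \<cdot> h" using h(2) indep[OF W j i comp_hom[OF f h'(1)] h(1)] by simp
      then show ?thesis using t h'(3) by simp
    qed
    have sh: "s k \<in> hom V (D' k) R" if "k \<in> S'" for k
      using s[OF that] comp_hom[OF _ b] by (elim bexE conjE) simp
    obtain u where u: "u \<in> hom V (ihom V X Q) R" "\<And>k. k \<in> S' \<Longrightarrow> u \<cdot> c' k = s k"
    proof (rule poset_colimit_factor[OF cl' R sh])
      fix k l assume kl: "(k, l) \<in> r'"
      have S': "k \<in> S'" "l \<in> S'" using directed_posetD(3,4)[OF dD'(1) kl] .
      obtain j h' where j: "j \<in> S" and h': "h' \<in> hom V (D' k) (ihom V X (D j))" "ipost X (c j) \<cdot> h' = c' k" "s k = b j \<cdot> h'"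
        using s[OF S'(1)] by blast
      show "s l \<cdot> d' (k, l) = s k"
        unfolding h'(3) by (rule s_eq[OF S'(2) D'[OF S'(1)] dD'(3)[OF kl] j h'(1)]) (simp add: h'(2) cD'(3)[OF kl])
    qed blast+
    have "u \<cdot> ipost X (c i) = b i" if i: "i \<in> S" for i
    proof -
      \<comment> \<open>The identity is tested on presentable objects over [X, D i], where
        \<open>s_eq\<close> applies to any lift.\<close>
      have "ihom V X (D i) \<in> Obj V" using XO dD(6)[OF i] by simp
      then obtain S'' r'' D'' d'' c'' where dd'': "directed_diagram lam V (Arr V) S'' r'' D'' d''" and D'': "\<And>i. i \<in> S'' \<Longrightarrow> presentable lam V (D'' i)"
        and cl'': "is_colimit (poset_cat S'' r'') V D'' d'' (ihom V X (D i)) c''"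
        using presentable_colimit by blast
      note cD'' = poset_colimitD[OF cl'']
      show ?thesis
      proof (rule poset_colimit_eq[OF cl'' dd'' comp_hom[OF ic[OF i] u(1)] b[OF i]])
        fix l assume l: "l \<in> S''"
        note cl = cD''(2)[OF l]
        have "ipost X (c i) \<cdot> c'' l \<in> hom V (D'' l) (ihom V X Q)" by (rule comp_hom[OF cl ic[OF i]])
        then obtain k f where k: "k \<in> S'" and f: "f \<in> hom V (D'' l) (D' k)" "c' k \<cdot> f = ipost X (c i) \<cdot> c'' l"
          using presentable_factor[OF D''[OF l] dd' cl'] by blast
        note t = homD[OF ic[OF i]] homD[OF cl] homD[OF u(1)] homD[OF f(1)] homD[OF cD'(2)[OF k]]
        have "(u \<cdot> ipost X (c i)) \<cdot> c'' l = u \<cdot> (c' k \<cdot> f)" using t f(2) by simp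
        also have "\<dots> = s k \<cdot> f" using t by (intro comp_reduce u(2) k) auto
        also have "\<dots> = b i \<cdot> c'' l" by (rule s_eq[OF k D''[OF l] f(1) i cl f(2)[symmetric]])
        finally show "(u \<cdot> ipost X (c i)) \<cdot> c'' l = b i \<cdot> c'' l" .
      qed
    qed
    then show ?thesis using u(1) by blast
  qed
qed

end

section \<open>The rank of the free algebra monad\<close>

context lps
begin

text \<open>Tensoring with \<open>W\<close> is a left adjoint and preserves the colimit of
  \<open>ihom_colimit\<close>. The symmetry enters because closedness is formulated for tensoring
  with \<open>W\<close> on the right.\<close>

lemma tens_ihom_colimit:
  assumes X: "presentable lam V X" and dd: "directed_diagram lam V M S r D d" and cl: "is_colimit (poset_cat S r) V D d Q c"
    and W: "W \<in> Obj V"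
  shows "\<And>R b. R \<in> Obj V \<Longrightarrow> (\<And>i. i \<in> S \<Longrightarrow> b i \<in> hom V (W \<odot> ihom V X (D i)) R) \<Longrightarrow>
      (\<And>i j. (i, j) \<in> r \<Longrightarrow> b j \<cdot> (\<one> W \<otimes> ipost X (d (i, j))) = b i) \<Longrightarrow>
      \<exists>u \<in> hom V (W \<odot> ihom V X Q) R. \<forall>i \<in> S. u \<cdot> (\<one> W \<otimes> ipost X (c i)) = b i"
    "\<And>R f g. f \<in> hom V (W \<odot> ihom V X Q) R \<Longrightarrow> g \<in> hom V (W \<odot> ihom V X Q) R \<Longrightarrow>
       (\<And>i. i \<in> S \<Longrightarrow> f \<cdot> (\<one> W \<otimes> ipost X (c i)) = g \<cdot> (\<one> W \<otimes> ipost X (c i))) \<Longrightarrow> f = g"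
proof -
  note dD = directed_diagramD[OF dd] and cD = poset_colimitD[OF cl]
  note XO = presentable_Obj[OF X]
  let ?XQ = "ihom V X Q" and ?D = "\<lambda>i. ihom V X (D i)"
  have ic: "ipost X (c i) \<in> hom V (?D i) ?XQ" if "i \<in> S" for i
    using homD[OF cD(2)[OF that]] XO by (simp add: hom_def)
  have id: "ipost X (d (i, j)) \<in> hom V (?D i) (?D j)" if "(i, j) \<in> r" for i j
    using homD[OF dD(3)[OF that]] XO by (simp add: hom_def)
  have sc: "symm V W ?XQ \<cdot> (\<one> W \<otimes> ipost X (c i)) = (ipost X (c i) \<otimes> \<one> W) \<cdot> symm V W (?D i)"
    "symm V ?XQ W \<cdot> (ipost X (c i) \<otimes> \<one> W) = (\<one> W \<otimes> ipost X (c i)) \<cdot> symm V (?D i) W" if "i \<in> S" for i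
    using symm_nat[OF Ide_hom[OF W] ic[OF that]] symm_nat[OF ic[OF that] Ide_hom[OF W]] .
  show "f = g" if fg: "f \<in> hom V (W \<odot> ihom V X Q) R" "g \<in> hom V (W \<odot> ihom V X Q) R"
     "\<And>i. i \<in> S \<Longrightarrow> f \<cdot> (\<one> W \<otimes> ipost X (c i)) = g \<cdot> (\<one> W \<otimes> ipost X (c i))" for R f g
  proof -
    note t = homD[OF fg(1)] homD[OF fg(2)] W XO cD(1)
    have "f \<cdot> symm V ?XQ W = g \<cdot> symm V ?XQ W"
    proof (rule tens_epi[where I = "(\<lambda>i. ipost X (c i)) ` S"])
      show "f \<cdot> symm V ?XQ W \<in> hom V (?XQ \<odot> W) R" "g \<cdot> symm V ?XQ W \<in> hom V (?XQ \<odot> W) R" using t by (simp_all add: hom_def)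
      show "?XQ \<in> Obj V" "W \<in> Obj V" using t by simp_all
      show "x \<in> hom V (Dom V x) ?XQ" if "x \<in> (\<lambda>i. ipost X (c i)) ` S" for x using that homD[OF ic] by (auto simp: hom_def)
      show "(f \<cdot> symm V ?XQ W) \<cdot> (x \<otimes> \<one> W) = (g \<cdot> symm V ?XQ W) \<cdot> (x \<otimes> \<one> W)" if "x \<in> (\<lambda>i. ipost X (c i)) ` S" for x
      proof -
        obtain i where i: "i \<in> S" "x = ipost X (c i)" using \<open>x \<in> (\<lambda>i. ipost X (c i)) ` S\<close> by blast
        note t' = t homD[OF ic[OF i(1)]] dD(6)[OF i(1)] homD[OF cD(2)[OF i(1)]]
        have "(f \<cdot> symm V ?XQ W) \<cdot> (x \<otimes> \<one> W) = (f \<cdot> (\<one> W \<otimes> ipost X (c i))) \<cdot> symm V (?D i) W"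
          using t' sc(2)[OF i(1)] i(2) by simp
        also have "\<dots> = (g \<cdot> symm V ?XQ W) \<cdot> (x \<otimes> \<one> W)"
          unfolding fg(3)[OF i(1)] using t' sc(2)[OF i(1)] i(2) by simp
        finally show ?thesis .
      qed
      show "h = k" if "h \<in> hom V ?XQ R'" "k \<in> hom V ?XQ R'" "\<And>x. x \<in> (\<lambda>i. ipost X (c i)) ` S \<Longrightarrow> h \<cdot> x = k \<cdot> x" for R' h k
        by (rule ihom_colimit(2)[OF X dd cl that(1,2)]) (use that(3) in blast)
    qed
    then show "f = g" by (rule iso_cancel_right) (use t in simp_all)
  qed
  show "\<exists>u \<in> hom V (W \<odot> ?XQ) R. \<forall>i \<in> S. u \<cdot> (\<one> W \<otimes> ipost X (c i)) = b i"
    if R: "R \<in> Obj V" and b: "\<And>i. i \<in> S \<Longrightarrow> b i \<in> hom V (W \<odot> ?D i) R"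
      and bd: "\<And>i j. (i, j) \<in> r \<Longrightarrow> b j \<cdot> (\<one> W \<otimes> ipost X (d (i, j))) = b i" for R b
  proof -
    let ?b = "\<lambda>i. vcurry V (?D i) W R (b i \<cdot> symm V (?D i) W)"
    have bt: "?b i \<in> hom V (?D i) (ihom V W R)" "evl V W R \<cdot> (?b i \<otimes> \<one> W) = b i \<cdot> symm V (?D i) W" if i: "i \<in> S" for i
    proof -
      have "b i \<cdot> symm V (?D i) W \<in> hom V (?D i \<odot> W) R" using homD[OF b[OF i]] W XO dD(6)[OF i] by (simp add: hom_def)
      from vcurry_hom[OF W R _ this] show "?b i \<in> hom V (?D i) (ihom V W R)" "evl V W R \<cdot> (?b i \<otimes> \<one> W) = b i \<cdot> symm V (?D i) W"
        using XO dD(6)[OF i] by simp_all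
    qed
    have bd': "?b j \<cdot> ipost X (d (i, j)) = ?b i" if ij: "(i, j) \<in> r" for i j
    proof (rule curry_inj[OF _ _ _ W R])
      have S: "i \<in> S" "j \<in> S" using directed_posetD(3,4)[OF dD(1) ij] .
      note t = homD[OF id[OF ij]] homD[OF b[OF S(1)]] homD[OF b[OF S(2)]] homD[OF bt(1)[OF S(1)]] homD[OF bt(1)[OF S(2)]]
        W XO R dD(6)[OF S(1)] dD(6)[OF S(2)] homD[OF dD(3)[OF ij]]
      show "?b j \<cdot> ipost X (d (i, j)) \<in> hom V (?D i) (ihom V W R)" "?b i \<in> hom V (?D i) (ihom V W R)"
        using t by (simp_all add: hom_def)
      have "evl V W R \<cdot> ((?b j \<cdot> ipost X (d (i, j))) \<otimes> \<one> W) = evl V W R \<cdot> ((?b j \<otimes> \<one> W) \<cdot> (ipost X (d (i, j)) \<otimes> \<one> W))"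
        using t by simp
      also have "\<dots> = (b j \<cdot> symm V (?D j) W) \<cdot> (ipost X (d (i, j)) \<otimes> \<one> W)"
        by (rule comp_reduce[OF bt(2)[OF S(2)]]) (use t in simp_all)
      also have "\<dots> = b j \<cdot> (symm V (?D j) W \<cdot> (ipost X (d (i, j)) \<otimes> \<one> W))" using t by simp
      also have "\<dots> = b j \<cdot> ((\<one> W \<otimes> ipost X (d (i, j))) \<cdot> symm V (?D i) W)"
        by (simp only: symm_nat[OF id[OF ij] Ide_hom[OF W]])
      also have "\<dots> = b i \<cdot> symm V (?D i) W" by (rule comp_reduce[OF bd[OF ij]]) (use t in simp_all)
      finally show "evl V W R \<cdot> ((?b j \<cdot> ipost X (d (i, j))) \<otimes> \<one> W) = evl V W R \<cdot> (?b i \<otimes> \<one> W)"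
        by (simp only: bt(2)[OF S(1)])
    qed
    have "ihom V W R \<in> Obj V" using W R by simp
    from ihom_colimit(1)[OF X dd cl this bt(1) bd'] obtain u where
      u: "u \<in> hom V ?XQ (ihom V W R)" "\<And>i. i \<in> S \<Longrightarrow> u \<cdot> ipost X (c i) = ?b i" by blast
    let ?u = "evl V W R \<cdot> ((u \<otimes> \<one> W) \<cdot> symm V W ?XQ)"
    have "?u \<in> hom V (W \<odot> ?XQ) R" using homD[OF u(1)] W R XO cD(1) by (simp add: hom_def)
    moreover have "?u \<cdot> (\<one> W \<otimes> ipost X (c i)) = b i" if i: "i \<in> S" for i
    proof -
      note t = homD[OF ic[OF i]] homD[OF u(1)] W R XO cD(1) homD[OF bt(1)[OF i]] homD[OF b[OF i]] dD(6)[OF i] homD[OF cD(2)[OF i]]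
      have "?u \<cdot> (\<one> W \<otimes> ipost X (c i)) = evl V W R \<cdot> ((u \<otimes> \<one> W) \<cdot> (symm V W ?XQ \<cdot> (\<one> W \<otimes> ipost X (c i))))"
        using t by simp
      also have "\<dots> = evl V W R \<cdot> ((u \<otimes> \<one> W) \<cdot> ((ipost X (c i) \<otimes> \<one> W) \<cdot> symm V W (?D i)))"
        by (simp only: sc(1)[OF i])
      also have "\<dots> = evl V W R \<cdot> (((u \<cdot> ipost X (c i)) \<otimes> \<one> W) \<cdot> symm V W (?D i))"
        using t by simp
      also have "\<dots> = evl V W R \<cdot> ((?b i \<otimes> \<one> W) \<cdot> symm V W (?D i))" by (simp only: u(2)[OF i])
      also have "\<dots> = (b i \<cdot> symm V (?D i) W) \<cdot> symm V W (?D i)"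
        by (rule comp_reduce[OF bt(2)[OF i]]) (use t in simp_all)
      also have "\<dots> = b i" using t by simp
      finally show ?thesis .
    qed
    ultimately show ?thesis by blast
  qed
qed

end

context thy_alg
begin

text \<open>The forgetful functor creates these colimits: for \<open>X\<close> in \<open>P\<close>
  the functor [X, -] tensored with \<open>VHom To X Y\<close> preserves them, so the actions of the
  stages induce one on \<open>Q\<close>, and the laws are checked on the jointly epic stages. The
  last clause is the universal property with respect to homomorphisms.\<close>

lemma colimit_algebra:
  assumes dd: "directed_diagram lam V M S r D d" and cl: "is_colimit (poset_cat S r) V D d Q c"
    and A: "\<And>i. i \<in> S \<Longrightarrow> A i \<in> VObj AT" "\<And>i. i \<in> S \<Longrightarrow> snd (A i) = D i"
    and Ad: "\<And>i j. (i, j) \<in> r \<Longrightarrow> Hm (A i) (A j) (d (i, j))"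
  obtains B where "B \<in> VObj AT" "snd B = Q" "\<And>i. i \<in> S \<Longrightarrow> Hm (A i) B (c i)"
    "\<And>C v. C \<in> VObj AT \<Longrightarrow> v \<in> hom V Q (snd C) \<Longrightarrow> (\<And>i. i \<in> S \<Longrightarrow> Hm (A i) C (v \<cdot> c i)) \<Longrightarrow> Hm B C v"
proof -
  note dD = directed_diagramD[OF dd] and cD = poset_colimitD[OF cl]
  note epi = tens_ihom_colimit(2)[OF PP dd cl]
  let ?T = "VHom To"
  have Q: "Q \<in> Obj V" by (rule cD(1))
  have act: "vact (fst (A i)) X Y \<in> Arr V" "Dom V (vact (fst (A i)) X Y) = ?T X Y \<odot> ihom V X (D i)"
    "Cod V (vact (fst (A i)) X Y) = ihom V Y (D i)" if "i \<in> S" "X \<in> P" "Y \<in> P" for i X Y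
    using alg_act[OF A(1)[OF that(1)] that(2,3)] A(2)[OF that(1)] by simp_all
  have ic: "ipost X (c i) \<in> hom V (ihom V X (D i)) (ihom V X Q)" if "i \<in> S" "X \<in> P" for i X
    using homD[OF cD(2)[OF that(1)]] PO[OF that(2)] by (simp add: hom_def)
  have "\<exists>u \<in> hom V (?T X Y \<odot> ihom V X Q) (ihom V Y Q). \<forall>i \<in> S. u \<cdot> (\<one> (?T X Y) \<otimes> ipost X (c i)) = ipost Y (c i) \<cdot> vact (fst (A i)) X Y"
    if XY: "X \<in> P" "Y \<in> P" for X Y
  proof (rule tens_ihom_colimit(1)[OF PP[OF XY(1)] dd cl To_hom[OF XY]])
    show "ihom V Y Q \<in> Obj V" using PO[OF XY(2)] Q by simp
    show "ipost Y (c i) \<cdot> vact (fst (A i)) X Y \<in> hom V (?T X Y \<odot> ihom V X (D i)) (ihom V Y Q)" if "i \<in> S" for i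
      using act[OF that XY] homD[OF ic[OF that XY(2)]] by (simp add: hom_def)
    fix i j assume ij: "(i, j) \<in> r"
    have S: "i \<in> S" "j \<in> S" using directed_posetD(3,4)[OF dD(1) ij] .
    note t = act[OF S(1) XY] act[OF S(2) XY] homD[OF ic[OF S(1) XY(2)]] homD[OF ic[OF S(2) XY(2)]] homD[OF dD(3)[OF ij]]
      PO[OF XY(1)] PO[OF XY(2)] To_hom[OF XY]
    have "(ipost Y (c j) \<cdot> vact (fst (A j)) X Y) \<cdot> (\<one> (?T X Y) \<otimes> ipost X (d (i, j))) =
      ipost Y (c j) \<cdot> (vact (fst (A j)) X Y \<cdot> (\<one> (?T X Y) \<otimes> ipost X (d (i, j))))" using t by simp
    also have "\<dots> = ipost Y (c j) \<cdot> (ipost Y (d (i, j)) \<cdot> vact (fst (A i)) X Y)"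
      using Ad[OF ij] XY by (simp add: Hm_def)
    also have "\<dots> = ipost Y (c i) \<cdot> vact (fst (A i)) X Y"
      by (rule comp_reduce) (use t ipost_comp[OF PO[OF XY(2)] dD(3)[OF ij] cD(2)[OF S(2)]] cD(3)[OF ij] in simp_all)
    finally show "(ipost Y (c j) \<cdot> vact (fst (A j)) X Y) \<cdot> (\<one> (?T X Y) \<otimes> ipost X (d (i, j))) = ipost Y (c i) \<cdot> vact (fst (A i)) X Y" .
  qed
  then obtain \<alpha> where \<alpha>h: "\<And>X Y. X \<in> P \<Longrightarrow> Y \<in> P \<Longrightarrow> \<alpha> X Y \<in> hom V (?T X Y \<odot> ihom V X Q) (ihom V Y Q)"
    and key: "\<And>X Y i. X \<in> P \<Longrightarrow> Y \<in> P \<Longrightarrow> i \<in> S \<Longrightarrow> \<alpha> X Y \<cdot> (\<one> (?T X Y) \<otimes> ipost X (c i)) = ipost Y (c i) \<cdot> vact (fst (A i)) X Y"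
    by metis
  have \<alpha>s: "\<alpha> X Y \<in> Arr V" "Dom V (\<alpha> X Y) = ?T X Y \<odot> ihom V X Q" "Cod V (\<alpha> X Y) = ihom V Y Q" if "X \<in> P" "Y \<in> P" for X Y
    using homD[OF \<alpha>h[OF that]] by auto
  have "\<exists>B \<in> VObj AT. snd B = Q \<and> (\<forall>X \<in> P. \<forall>Y \<in> P. vact (fst B) X Y = \<alpha> X Y)"
  proof (rule algebra_of_action[OF Q \<alpha>h])
    fix X assume X: "X \<in> P"
    note t = PO[OF X] Q vcat_Arr[OF opT, of X X] X \<alpha>s[OF X X]
    show "\<alpha> X X \<cdot> (VIde To X \<otimes> \<one> (ihom V X Q)) = lunit V (ihom V X Q)"
    proof (rule epi[OF X unit_Obj])
      show "\<alpha> X X \<cdot> (VIde To X \<otimes> \<one> (ihom V X Q)) \<in> hom V (\<I> \<odot> ihom V X Q) (ihom V X Q)"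
        "lunit V (ihom V X Q) \<in> hom V (\<I> \<odot> ihom V X Q) (ihom V X Q)"
        using t by (simp_all add: hom_def)
      fix i assume i: "i \<in> S"
      note t' = t homD[OF cD(2)[OF i]] act[OF i X X] dD(6)[OF i]
      have "(\<alpha> X X \<cdot> (VIde To X \<otimes> \<one> (ihom V X Q))) \<cdot> (\<one> \<I> \<otimes> ipost X (c i)) =
        (\<alpha> X X \<cdot> (\<one> (?T X X) \<otimes> ipost X (c i))) \<cdot> (VIde To X \<otimes> \<one> (ihom V X (D i)))"
        using t' by simp
      also have "\<dots> = ipost X (c i) \<cdot> (vact (fst (A i)) X X \<cdot> (VIde To X \<otimes> \<one> (ihom V X (D i))))"
        unfolding key[OF X X i] using t' by simp
      also have "\<dots> = ipost X (c i) \<cdot> lunit V (ihom V X (D i))"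
        using vact_unit[OF AlgD(2)[OF A(1)[OF i]], of X] AlgD(3)[OF A(1)[OF i] X] A(2)[OF i] X by simp
      also have "\<dots> = lunit V (ihom V X Q) \<cdot> (\<one> \<I> \<otimes> ipost X (c i))"
        by (rule lunit_nat[OF ic[OF i X], symmetric])
      finally show "(\<alpha> X X \<cdot> (VIde To X \<otimes> \<one> (ihom V X Q))) \<cdot> (\<one> \<I> \<otimes> ipost X (c i)) = lunit V (ihom V X Q) \<cdot> (\<one> \<I> \<otimes> ipost X (c i))" .
    qed
  next
    fix X Y Z assume XYZ: "X \<in> P" "Y \<in> P" "Z \<in> P"
    let ?a = "assoc V (?T Y Z) (?T X Y)"
    note t = PO[OF XYZ(1)] PO[OF XYZ(2)] PO[OF XYZ(3)] Q vcat_Arr[OF opT, of X Y] vcat_Arr[OF opT, of Y Z] vcat_Arr[OF opT, of X Z] XYZ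
      \<alpha>s[OF XYZ(1,2)] \<alpha>s[OF XYZ(2,3)] \<alpha>s[OF XYZ(1,3)]
    show "\<alpha> X Z \<cdot> (VComp To X Y Z \<otimes> \<one> (ihom V X Q)) = \<alpha> Y Z \<cdot> ((\<one> (?T Y Z) \<otimes> \<alpha> X Y) \<cdot> ?a (ihom V X Q))"
    proof (rule epi[OF XYZ(1), where W = "?T Y Z \<odot> ?T X Y"])
      show "\<alpha> X Z \<cdot> (VComp To X Y Z \<otimes> \<one> (ihom V X Q)) \<in> hom V ((?T Y Z \<odot> ?T X Y) \<odot> ihom V X Q) (ihom V Z Q)"
        "\<alpha> Y Z \<cdot> ((\<one> (?T Y Z) \<otimes> \<alpha> X Y) \<cdot> ?a (ihom V X Q)) \<in> hom V ((?T Y Z \<odot> ?T X Y) \<odot> ihom V X Q) (ihom V Z Q)"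
        "?T Y Z \<odot> ?T X Y \<in> Obj V"
        using t by (simp_all add: hom_def)
      fix i assume i: "i \<in> S"
      let ?B = "vact (fst (A i))" and ?D = "ihom V X (D i)"
      note t' = t homD[OF cD(2)[OF i]] act[OF i XYZ(1,2)] act[OF i XYZ(2,3)] act[OF i XYZ(1,3)] dD(6)[OF i]
      have "(\<alpha> X Z \<cdot> (VComp To X Y Z \<otimes> \<one> (ihom V X Q))) \<cdot> (\<one> (?T Y Z \<odot> ?T X Y) \<otimes> ipost X (c i)) =
        (\<alpha> X Z \<cdot> (\<one> (?T X Z) \<otimes> ipost X (c i))) \<cdot> (VComp To X Y Z \<otimes> \<one> ?D)"
        using t' by simp
      also have "\<dots> = ipost Z (c i) \<cdot> (?B X Z \<cdot> (VComp To X Y Z \<otimes> \<one> ?D))"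
        unfolding key[OF XYZ(1,3) i] using t' by simp
      also have "\<dots> = ipost Z (c i) \<cdot> (?B Y Z \<cdot> ((\<one> (?T Y Z) \<otimes> ?B X Y) \<cdot> ?a ?D))"
        using vact_comp[OF AlgD(2)[OF A(1)[OF i]], of X Y Z] AlgD(3)[OF A(1)[OF i] XYZ(1)] A(2)[OF i] XYZ by simp
      also have "\<dots> = (\<alpha> Y Z \<cdot> (\<one> (?T Y Z) \<otimes> ipost Y (c i))) \<cdot> ((\<one> (?T Y Z) \<otimes> ?B X Y) \<cdot> ?a ?D)"
        unfolding key[OF XYZ(2,3) i] using t' by simp
      also have "\<dots> = \<alpha> Y Z \<cdot> ((\<one> (?T Y Z) \<otimes> (ipost Y (c i) \<cdot> ?B X Y)) \<cdot> ?a ?D)"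
        using t' by simp
      also have "\<dots> = \<alpha> Y Z \<cdot> ((\<one> (?T Y Z) \<otimes> (\<alpha> X Y \<cdot> (\<one> (?T X Y) \<otimes> ipost X (c i)))) \<cdot> ?a ?D)"
        by (simp only: key[OF XYZ(1,2) i])
      also have "\<dots> = \<alpha> Y Z \<cdot> ((\<one> (?T Y Z) \<otimes> \<alpha> X Y) \<cdot> ((\<one> (?T Y Z) \<otimes> (\<one> (?T X Y) \<otimes> ipost X (c i))) \<cdot> ?a ?D))"
        using t' by simp
      also have "(\<one> (?T Y Z) \<otimes> (\<one> (?T X Y) \<otimes> ipost X (c i))) \<cdot> ?a ?D = ?a (ihom V X Q) \<cdot> ((\<one> (?T Y Z) \<otimes> \<one> (?T X Y)) \<otimes> ipost X (c i))"
        by (rule assoc_nat[symmetric]) (use t' in \<open>simp_all add: hom_def\<close>)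
      also have "\<alpha> Y Z \<cdot> ((\<one> (?T Y Z) \<otimes> \<alpha> X Y) \<cdot> (?a (ihom V X Q) \<cdot> ((\<one> (?T Y Z) \<otimes> \<one> (?T X Y)) \<otimes> ipost X (c i)))) =
        (\<alpha> Y Z \<cdot> ((\<one> (?T Y Z) \<otimes> \<alpha> X Y) \<cdot> ?a (ihom V X Q))) \<cdot> (\<one> (?T Y Z \<odot> ?T X Y) \<otimes> ipost X (c i))"
        using t' by simp
      finally show "(\<alpha> X Z \<cdot> (VComp To X Y Z \<otimes> \<one> (ihom V X Q))) \<cdot> (\<one> (?T Y Z \<odot> ?T X Y) \<otimes> ipost X (c i)) =
        (\<alpha> Y Z \<cdot> ((\<one> (?T Y Z) \<otimes> \<alpha> X Y) \<cdot> ?a (ihom V X Q))) \<cdot> (\<one> (?T Y Z \<odot> ?T X Y) \<otimes> ipost X (c i))" .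
    qed
  next
    fix X Y assume XY: "X \<in> P" "Y \<in> P"
    note t = PO[OF XY(1)] PO[OF XY(2)] Q XY \<alpha>s[OF XY] J_Arr[OF XY] To_hom[OF XY]
    show "\<alpha> X Y \<cdot> (FHom J Y X \<otimes> \<one> (ihom V X Q)) = jact Q X Y"
    proof (rule epi[OF XY(1), where W = "ihom V Y X"])
      show "\<alpha> X Y \<cdot> (FHom J Y X \<otimes> \<one> (ihom V X Q)) \<in> hom V (ihom V Y X \<odot> ihom V X Q) (ihom V Y Q)"
        "jact Q X Y \<in> hom V (ihom V Y X \<odot> ihom V X Q) (ihom V Y Q)" "ihom V Y X \<in> Obj V"
        using t by (simp_all add: hom_def)
      fix i assume i: "i \<in> S"
      note t' = t homD[OF cD(2)[OF i]] act[OF i XY] dD(6)[OF i]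
      have "(\<alpha> X Y \<cdot> (FHom J Y X \<otimes> \<one> (ihom V X Q))) \<cdot> (\<one> (ihom V Y X) \<otimes> ipost X (c i)) =
        (\<alpha> X Y \<cdot> (\<one> (?T X Y) \<otimes> ipost X (c i))) \<cdot> (FHom J Y X \<otimes> \<one> (ihom V X (D i)))"
        using t' by simp
      also have "\<dots> = ipost Y (c i) \<cdot> (vact (fst (A i)) X Y \<cdot> (FHom J Y X \<otimes> \<one> (ihom V X (D i))))"
        unfolding key[OF XY i] using t' by simp
      also have "\<dots> = ipost Y (c i) \<cdot> jact (D i) X Y"
        using AlgD(4)[OF A(1)[OF i] XY] A(2)[OF i] by simp
      also have "\<dots> = jact Q X Y \<cdot> (\<one> (ihom V Y X) \<otimes> ipost X (c i))"
        by (rule jact_ipost[symmetric]) (use t cD(2)[OF i] in simp_all)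
      finally show "(\<alpha> X Y \<cdot> (FHom J Y X \<otimes> \<one> (ihom V X Q))) \<cdot> (\<one> (ihom V Y X) \<otimes> ipost X (c i)) = jact Q X Y \<cdot> (\<one> (ihom V Y X) \<otimes> ipost X (c i))" .
    qed
  qed
  then obtain B where B: "B \<in> VObj AT" "snd B = Q" "\<And>X Y. X \<in> P \<Longrightarrow> Y \<in> P \<Longrightarrow> vact (fst B) X Y = \<alpha> X Y"
    by blast
  show thesis
  proof (rule that[OF B(1,2)])
    show "Hm (A i) B (c i)" if "i \<in> S" for i
      unfolding Hm_def using cD(2)[OF that] A(2)[OF that] B(2,3) key[OF _ _ that] by simp
    fix C v assume C: "C \<in> VObj AT" and v: "v \<in> hom V Q (snd C)" and vc: "\<And>i. i \<in> S \<Longrightarrow> Hm (A i) C (v \<cdot> c i)"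
    show "Hm B C v"
      unfolding Hm_def
    proof (intro conjI ballI)
      show "v \<in> hom V (snd B) (snd C)" using v B(2) by simp
      fix X Y assume XY: "X \<in> P" "Y \<in> P"
      note t = PO[OF XY(1)] PO[OF XY(2)] Q XY \<alpha>s[OF XY] To_hom[OF XY] homD[OF v] alg_act[OF C XY]
      have "ipost Y v \<cdot> \<alpha> X Y = vact (fst C) X Y \<cdot> (\<one> (?T X Y) \<otimes> ipost X v)"
      proof (rule epi[OF XY(1) To_hom[OF XY]])
        show "ipost Y v \<cdot> \<alpha> X Y \<in> hom V (?T X Y \<odot> ihom V X Q) (ihom V Y (snd C))"
          "vact (fst C) X Y \<cdot> (\<one> (?T X Y) \<otimes> ipost X v) \<in> hom V (?T X Y \<odot> ihom V X Q) (ihom V Y (snd C))"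
          using t by (simp_all add: hom_def)
        fix i assume i: "i \<in> S"
        note t' = t homD[OF cD(2)[OF i]] act[OF i XY] dD(6)[OF i]
        have ip: "ipost W v \<cdot> ipost W (c i) = ipost W (v \<cdot> c i)" if "W \<in> P" for W
          using ipost_comp[OF PO[OF that] cD(2)[OF i] v] by simp
        have "(ipost Y v \<cdot> \<alpha> X Y) \<cdot> (\<one> (?T X Y) \<otimes> ipost X (c i)) = ipost Y v \<cdot> (ipost Y (c i) \<cdot> vact (fst (A i)) X Y)"
          using t' key[OF XY i] by simp
        also have "\<dots> = ipost Y (v \<cdot> c i) \<cdot> vact (fst (A i)) X Y"
          by (rule comp_reduce[OF ip[OF XY(2)]]) (use t' in simp_all)
        also have "\<dots> = vact (fst C) X Y \<cdot> (\<one> (?T X Y) \<otimes> ipost X (v \<cdot> c i))" using vc[OF i] XY by (simp add: Hm_def)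
        also have "\<dots> = (vact (fst C) X Y \<cdot> (\<one> (?T X Y) \<otimes> ipost X v)) \<cdot> (\<one> (?T X Y) \<otimes> ipost X (c i))"
          using t' ip[OF XY(1)] by simp
        finally show "(ipost Y v \<cdot> \<alpha> X Y) \<cdot> (\<one> (?T X Y) \<otimes> ipost X (c i)) = (vact (fst C) X Y \<cdot> (\<one> (?T X Y) \<otimes> ipost X v)) \<cdot> (\<one> (?T X Y) \<otimes> ipost X (c i))" .
      qed
      then show "ipost Y v \<cdot> vact (fst B) X Y = vact (fst C) X Y \<cdot> (\<one> (?T X Y) \<otimes> ipost X v)"
        using B(3)[OF XY] by simp
    qed
  qed
qed

end

section \<open>Points of free algebras on directed colimits\<close>

context alg_adj
begin

text \<open>The colimit of the free algebras on a directed diagram has the free algebra on its colimit as a retract.\<close>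

lemma free_point_factor:
  assumes dd: "directed_diagram lam V M S r D d" and cl: "is_colimit (poset_cat S r) V D d Q c"
    and t: "t \<in> hom V \<I> (TO Q)"
  shows "\<exists>i \<in> S. \<exists>t' \<in> hom V \<I> (TO (D i)). Tm (c i) \<cdot> t' = t"
proof -
  note dD = directed_diagramD[OF dd] and cD = poset_colimitD[OF cl]
  have Q: "Q \<in> Obj V" by (rule cD(1))
  have S: "i \<in> S" "j \<in> S" if "(i, j) \<in> r" for i j using directed_posetD(3,4)[OF dD(1) that] .
  have dd': "directed_diagram lam V (Arr V) S r (\<lambda>i. TO (D i)) (\<lambda>a. Tm (d a))"
    unfolding directed_diagram_def is_functor_def
  proof (intro conjI ballI allI)
    show "directed_poset lam S r" "category (poset_cat S r)" "category V"
      using dD(1) poset_category[OF dD(1)] category by simp_all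
    fix i assume "i \<in> Obj (poset_cat S r)"
    then show "TO (D i) \<in> Obj V" "Tm (d (Ide (poset_cat S r) i)) = \<one> (TO (D i))"
      using dD(5,6) Tm_Ide by simp_all
  next
    fix i j a assume "a \<in> hom (poset_cat S r) i j"
    then show "Tm (d a) \<in> hom V (TO (D i)) (TO (D j))" using Tm_hom[OF dD(3)] by (auto simp: poset_hom split: if_splits)
  next
    fix i j k a b assume "a \<in> hom (poset_cat S r) i j" "b \<in> hom (poset_cat S r) j k"
    then have "a = (i, j)" "b = (j, k)" "(i, j) \<in> r" "(j, k) \<in> r" by (auto simp: poset_hom split: if_splits)
    then show "Tm (d (b \<cdot>\<^bsub>poset_cat S r\<^esub> a)) = Tm (d b) \<cdot> Tm (d a)"
      using Tm_comp[OF dD(3) dD(3)] dD(7) by simp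
  next
    show "(\<lambda>a. Tm (d a)) ` r \<subseteq> Arr V" using homD[OF Tm_hom[OF dD(3)]] by auto
  qed
  obtain Q' c' where cl': "is_colimit (poset_cat S r) V (\<lambda>i. TO (D i)) (\<lambda>a. Tm (d a)) Q' c'"
    using directed_colimit_exists[OF dd'] by blast
  note cD' = poset_colimitD[OF cl']
  obtain B where B: "B \<in> VObj AT" "snd B = Q'" "\<And>i. i \<in> S \<Longrightarrow> Hm (FOb F (D i)) B (c' i)"
    "\<And>C v. C \<in> VObj AT \<Longrightarrow> v \<in> hom V Q' (snd C) \<Longrightarrow> (\<And>i. i \<in> S \<Longrightarrow> Hm (FOb F (D i)) C (v \<cdot> c' i)) \<Longrightarrow> Hm B C v"
    by (rule colimit_algebra[OF dd' cl', where A = "\<lambda>i. FOb F (D i)"]) (use dD(6) Tm_Hm[OF dD(3)] in \<open>simp_all\<close>)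
  have eD: "e (D i) \<in> hom V (D i) (TO (D i))" if "i \<in> S" for i using e_hom[OF dD(6)[OF that]] .
  \<comment> \<open>The units of the stages induce \<open>s\<close>; its extension
    \<open>ex B s\<close> will split the canonical arrow \<open>v\<close> from the colimit of the
    free algebras.\<close>
  obtain s where s: "s \<in> hom V Q Q'" "\<And>i. i \<in> S \<Longrightarrow> s \<cdot> c i = c' i \<cdot> e (D i)"
  proof (rule poset_colimit_factor[OF cl cD'(1), where b = "\<lambda>i. c' i \<cdot> e (D i)"])
    show "c' i \<cdot> e (D i) \<in> hom V (D i) Q'" if "i \<in> S" for i using comp_hom[OF eD cD'(2)] that by simp
    fix i j assume ij: "(i, j) \<in> r"
    note t = homD[OF cD'(2)[OF S(2)[OF ij]]] homD[OF eD[OF S(1)[OF ij]]] homD[OF eD[OF S(2)[OF ij]]] homD[OF dD(3)[OF ij]]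
      homD[OF Tm_hom[OF dD(3)[OF ij]]]
    have "(c' j \<cdot> e (D j)) \<cdot> d (i, j) = c' j \<cdot> (Tm (d (i, j)) \<cdot> e (D i))"
      using t e_nat[OF dD(3)[OF ij]] by simp
    also have "\<dots> = c' i \<cdot> e (D i)" by (rule comp_reduce[OF cD'(3)[OF ij]]) (use t in simp_all)
    finally show "(c' j \<cdot> e (D j)) \<cdot> d (i, j) = c' i \<cdot> e (D i)" .
  qed (blast intro: that)
  have TQ: "TO Q \<in> Obj V" using Q by simp
  have Tc: "Tm (c i) \<in> hom V (TO (D i)) (TO Q)" if "i \<in> S" for i using Tm_hom[OF cD(2)[OF that]] .
  obtain v where v: "v \<in> hom V Q' (TO Q)" "\<And>i. i \<in> S \<Longrightarrow> v \<cdot> c' i = Tm (c i)"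
  proof (rule poset_colimit_factor[OF cl' TQ Tc])
    fix i j assume ij: "(i, j) \<in> r"
    show "Tm (c j) \<cdot> Tm (d (i, j)) = Tm (c i)"
      using Tm_comp[OF dD(3)[OF ij] cD(2)[OF S(2)[OF ij]]] cD(3)[OF ij] by simp
  qed (blast intro: that)+
  have FQ: "FOb F Q \<in> VObj AT" using Q by simp
  have vH: "Hm B (FOb F Q) v"
    by (rule B(4)[OF FQ v(1)]) (use v(2) Tm_Hm[OF cD(2)] in simp)
  have sB: "s \<in> hom V Q (snd B)" using s(1) B(2) by simp
  note xs = ex_Hm[OF B(1) sB] ex_hom[OF B(1) sB]
  \<comment> \<open>This half of an isomorphism is enough: \<open>t\<close> equals
    \<open>v \<cdot> (ex B s \<cdot> t)\<close>, and the inner point of \<open>Q'\<close> comes from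
    a stage because \<I> is presentable.\<close>
  have "v \<cdot> ex B s = \<one> (TO Q)"
  proof (rule ex_eq[OF FQ Q Hm_comp[OF FQ B(1) FQ xs(1) vH] Hm_Ide[OF FQ]])
    note eQ = e_hom[OF Q]
    note t = homD[OF v(1)] homD[OF xs(3)] homD[OF eQ] homD[OF s(1)] B(2)
    have "(v \<cdot> ex B s) \<cdot> e Q = v \<cdot> s" using t xs(2) by simp
    also have "v \<cdot> s = e Q"
    proof (rule poset_colimit_eq[OF cl dd comp_hom[OF s(1) v(1)] eQ])
      fix i assume i: "i \<in> S"
      note t' = t homD[OF cD(2)[OF i]] homD[OF cD'(2)[OF i]] homD[OF eD[OF i]]
      have "(v \<cdot> s) \<cdot> c i = v \<cdot> (c' i \<cdot> e (D i))" using t' s(2)[OF i] by simp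
      also have "\<dots> = Tm (c i) \<cdot> e (D i)" by (rule comp_reduce[OF v(2)[OF i]]) (use t' in simp_all)
      also have "\<dots> = e Q \<cdot> c i" using e_nat[OF cD(2)[OF i]] by simp
      finally show "(v \<cdot> s) \<cdot> c i = e Q \<cdot> c i" .
    qed
    finally show "(v \<cdot> ex B s) \<cdot> e Q = \<one> (TO Q) \<cdot> e Q" using t by simp
  qed
  moreover have "ex B s \<cdot> t \<in> hom V \<I> Q'" using comp_hom[OF t xs(3)] B(2) by simp
  then obtain i t' where i: "i \<in> S" and t': "t' \<in> hom V \<I> (TO (D i))" "c' i \<cdot> t' = ex B s \<cdot> t"
    using presentable_factor[OF presentable_unit dd' cl'] by blast
  moreover have "Tm (c i) \<cdot> t' = v \<cdot> (c' i \<cdot> t')"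
    by (rule comp_reduce[OF v(2)[OF i], symmetric]) (use homD[OF v(1)] homD[OF cD'(2)[OF i]] homD[OF t'(1)] in simp_all)
  moreover have "v \<cdot> (ex B s \<cdot> t) = (v \<cdot> ex B s) \<cdot> t"
    using homD[OF v(1)] homD[OF xs(3)] homD[OF t] B(2) by simp
  ultimately have "Tm (c i) \<cdot> t' = t" using homD[OF t] by simp
  then show ?thesis using i t'(1) by blast
qed

end

section \<open>Theories and their induced monads\<close>

context smc
begin

text \<open>Mirror image of \<open>lunit_tens\<close>, again from pentagon and triangle after
  tensoring with \<I>.\<close>

lemma runit_tens:
  assumes X: "X \<in> Obj V" and Y: "Y \<in> Obj V"
  shows "(\<one> X \<otimes> runit V Y) \<cdot> assoc V X Y \<I> = runit V (X \<odot> Y)"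
proof (rule unit_tens_cancel)
  let ?a = "assoc V" and ?l = "\<one> X \<otimes> (\<one> Y \<otimes> lunit V \<I>)"
  have "?a X Y \<I> \<cdot> (((\<one> X \<otimes> runit V Y) \<cdot> ?a X Y \<I>) \<otimes> \<one> \<I>) =
    ?a X Y \<I> \<cdot> (((\<one> X \<otimes> runit V Y) \<otimes> \<one> \<I>) \<cdot> (?a X Y \<I> \<otimes> \<one> \<I>))"
    using X Y by simp
  also have "\<dots> = (\<one> X \<otimes> (runit V Y \<otimes> \<one> \<I>)) \<cdot> (?a X (Y \<odot> \<I>) \<I> \<cdot> (?a X Y \<I> \<otimes> \<one> \<I>))"
    using X Y by (intro comp_permute assoc_nat) (simp_all add: hom_def)
  also have "\<dots> = ?l \<cdot> ((\<one> X \<otimes> ?a Y \<I> \<I>) \<cdot> (?a X (Y \<odot> \<I>) \<I> \<cdot> (?a X Y \<I> \<otimes> \<one> \<I>)))"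
    using X Y triangle[of Y \<I>] by simp
  also have "\<dots> = ?l \<cdot> (?a X Y (\<I> \<odot> \<I>) \<cdot> ?a (X \<odot> Y) \<I> \<I>)"
    using X Y by (simp only: pentagon unit_Obj)
  also have "\<dots> = ?a X Y \<I> \<cdot> (((\<one> X \<otimes> \<one> Y) \<otimes> lunit V \<I>) \<cdot> ?a (X \<odot> Y) \<I> \<I>)"
    using X Y by (intro comp_permute assoc_nat[symmetric]) (simp_all add: hom_def)
  also have "\<dots> = ?a X Y \<I> \<cdot> (runit V (X \<odot> Y) \<otimes> \<one> \<I>)"
    using X Y triangle[of "X \<odot> Y" \<I>] by simp
  finally show "((\<one> X \<otimes> runit V Y) \<cdot> ?a X Y \<I>) \<otimes> \<one> \<I> = runit V (X \<odot> Y) \<otimes> \<one> \<I>"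
    by (rule iso_cancel_left) (use X Y in simp_all)
qed (use X Y in \<open>simp_all add: hom_def\<close>)

lemma assoc_inv_runit:
  assumes "X \<in> Obj V" "Y \<in> Obj V"
  shows "assoc V X Y \<I> \<cdot> inv_arr V (runit V (X \<odot> Y)) = \<one> X \<otimes> inv_arr V (runit V Y)"
proof (rule iso_cancel_left)
  show "iso V (\<one> X \<otimes> runit V Y)" using assms by (intro iso_tens) auto
  show "(\<one> X \<otimes> runit V Y) \<cdot> (assoc V X Y \<I> \<cdot> inv_arr V (runit V (X \<odot> Y))) = (\<one> X \<otimes> runit V Y) \<cdot> (\<one> X \<otimes> inv_arr V (runit V Y))"
    using assms comp_reduce[OF runit_tens[OF assms], of "inv_arr V (runit V (X \<odot> Y))"] by simp
qed (use assms in simp_all)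

lemma assoc_inv_lunit_tens:
  assumes "X \<in> Obj V" "Y \<in> Obj V"
  shows "assoc V \<I> X Y \<cdot> (inv_arr V (lunit V X) \<otimes> \<one> Y) = inv_arr V (lunit V (X \<odot> Y))"
proof (rule iso_cancel_left)
  show "iso V (lunit V (X \<odot> Y))" using assms by simp
  show "lunit V (X \<odot> Y) \<cdot> (assoc V \<I> X Y \<cdot> (inv_arr V (lunit V X) \<otimes> \<one> Y)) = lunit V (X \<odot> Y) \<cdot> inv_arr V (lunit V (X \<odot> Y))"
    using assms comp_reduce[OF lunit_tens[OF assms], of "inv_arr V (lunit V X) \<otimes> \<one> Y"] by simp
qed (use assms in simp_all)

lemma assoc_inv_middle:
  assumes "X \<in> Obj V" "Y \<in> Obj V"
  shows "assoc V X \<I> Y \<cdot> (inv_arr V (runit V X) \<otimes> \<one> Y) = \<one> X \<otimes> inv_arr V (lunit V Y)"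
proof (rule iso_cancel_left)
  show "iso V (\<one> X \<otimes> lunit V Y)" using assms by (intro iso_tens) auto
  show "(\<one> X \<otimes> lunit V Y) \<cdot> (assoc V X \<I> Y \<cdot> (inv_arr V (runit V X) \<otimes> \<one> Y)) = (\<one> X \<otimes> lunit V Y) \<cdot> (\<one> X \<otimes> inv_arr V (lunit V Y))"
    using assms comp_reduce[OF triangle[OF assms], of "inv_arr V (runit V X) \<otimes> \<one> Y"] by simp
qed (use assms in simp_all)

lemma vpre_hom:
  assumes "vcategory V C" "X \<in> VObj C" "Y \<in> VObj C" "Z \<in> VObj C" "f \<in> hom V \<I> (VHom C X Y)"
  shows "vpre V C X Y Z f \<in> hom V (VHom C Y Z) (VHom C X Z)"
  using assms homD[OF assms(5)] by (simp add: vpre_def hom_def)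

lemma vpost_hom:
  assumes "vcategory V C" "W \<in> VObj C" "X \<in> VObj C" "Y \<in> VObj C" "g \<in> hom V \<I> (VHom C X Y)"
  shows "vpost V C W X Y g \<in> hom V (VHom C W X) (VHom C W Y)"
  using assms homD[OF assms(5)] by (simp add: vpost_def hom_def)

text \<open>When one of three composable arrows is a point, associativity takes three forms,
  according to its position: this lemma, \<open>vcomp_middle\<close> and \<open>vpost_comp\<close>.
  All three are combined in \<open>em_comp_incl\<close>.\<close>

lemma vpre_comp:
  assumes C: "vcategory V C" and O: "A' \<in> VObj C" "A \<in> VObj C" "B \<in> VObj C" "D \<in> VObj C" and a: "a \<in> hom V \<I> (VHom C A' A)"
  shows "vpre V C A' A D a \<cdot> VComp C A B D = VComp C A' B D \<cdot> (\<one> (VHom C B D) \<otimes> vpre V C A' A B a)"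
proof -
  let ?BD = "VHom C B D" and ?AB = "VHom C A B"
  have M: "VComp C A B D \<in> hom V (?BD \<odot> ?AB) (VHom C A D)" using C O by (simp add: hom_def)
  note t = C O homD[OF a]
  have "vpre V C A' A D a \<cdot> VComp C A B D =
    VComp C A' A D \<cdot> ((\<one> (VHom C A D) \<otimes> a) \<cdot> (inv_arr V (runit V (VHom C A D)) \<cdot> VComp C A B D))"
    using t by (simp add: vpre_def)
  also have "\<dots> = VComp C A' A D \<cdot> ((\<one> (VHom C A D) \<otimes> a) \<cdot> ((VComp C A B D \<otimes> \<one> \<I>) \<cdot> inv_arr V (runit V (?BD \<odot> ?AB))))"
    by (simp only: runit_inv_nat[OF M])
  also have "\<dots> = (VComp C A' A D \<cdot> (VComp C A B D \<otimes> \<one> (VHom C A' A))) \<cdot> (((\<one> ?BD \<otimes> \<one> ?AB) \<otimes> a) \<cdot> inv_arr V (runit V (?BD \<odot> ?AB)))"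
    using t by simp
  also have "\<dots> = VComp C A' B D \<cdot> ((\<one> ?BD \<otimes> VComp C A' A B) \<cdot> ((assoc V ?BD ?AB (VHom C A' A) \<cdot> ((\<one> ?BD \<otimes> \<one> ?AB) \<otimes> a)) \<cdot> inv_arr V (runit V (?BD \<odot> ?AB))))"
    unfolding vcat_assoc[OF C, OF O, symmetric] using t by simp
  also have "assoc V ?BD ?AB (VHom C A' A) \<cdot> ((\<one> ?BD \<otimes> \<one> ?AB) \<otimes> a) = (\<one> ?BD \<otimes> (\<one> ?AB \<otimes> a)) \<cdot> assoc V ?BD ?AB \<I>"
    using t by (intro assoc_nat) (simp_all add: hom_def)
  also have "VComp C A' B D \<cdot> ((\<one> ?BD \<otimes> VComp C A' A B) \<cdot> (((\<one> ?BD \<otimes> (\<one> ?AB \<otimes> a)) \<cdot> assoc V ?BD ?AB \<I>) \<cdot> inv_arr V (runit V (?BD \<odot> ?AB)))) =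
    VComp C A' B D \<cdot> ((\<one> ?BD \<otimes> VComp C A' A B) \<cdot> ((\<one> ?BD \<otimes> (\<one> ?AB \<otimes> a)) \<cdot> (assoc V ?BD ?AB \<I> \<cdot> inv_arr V (runit V (?BD \<odot> ?AB)))))"
    using t by simp
  also have "\<dots> = VComp C A' B D \<cdot> (\<one> ?BD \<otimes> vpre V C A' A B a)"
    using t by (simp add: assoc_inv_runit vpre_def)
  finally show ?thesis .
qed

lemma vcomp_middle:
  assumes C: "vcategory V C" and O: "A \<in> VObj C" "B' \<in> VObj C" "B \<in> VObj C" "D \<in> VObj C" and b: "b \<in> hom V \<I> (VHom C B' B)"
  shows "VComp C A B D \<cdot> (\<one> (VHom C B D) \<otimes> vpost V C A B' B b) = VComp C A B' D \<cdot> (vpre V C B' B D b \<otimes> \<one> (VHom C A B'))"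
proof -
  let ?BD = "VHom C B D" and ?AB = "VHom C A B'"
  note t = C O homD[OF b]
  have "VComp C A B' D \<cdot> (vpre V C B' B D b \<otimes> \<one> ?AB) =
    (VComp C A B' D \<cdot> (VComp C B' B D \<otimes> \<one> ?AB)) \<cdot> (((\<one> ?BD \<otimes> b) \<otimes> \<one> ?AB) \<cdot> (inv_arr V (runit V ?BD) \<otimes> \<one> ?AB))"
    using t by (simp add: vpre_def)
  also have "\<dots> = VComp C A B D \<cdot> ((\<one> ?BD \<otimes> VComp C A B' B) \<cdot> ((assoc V ?BD (VHom C B' B) ?AB \<cdot> ((\<one> ?BD \<otimes> b) \<otimes> \<one> ?AB)) \<cdot> (inv_arr V (runit V ?BD) \<otimes> \<one> ?AB)))"
    unfolding vcat_assoc[OF C, OF O, symmetric] using t by simp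
  also have "assoc V ?BD (VHom C B' B) ?AB \<cdot> ((\<one> ?BD \<otimes> b) \<otimes> \<one> ?AB) = (\<one> ?BD \<otimes> (b \<otimes> \<one> ?AB)) \<cdot> assoc V ?BD \<I> ?AB"
    using t by (intro assoc_nat) (simp_all add: hom_def)
  also have "VComp C A B D \<cdot> ((\<one> ?BD \<otimes> VComp C A B' B) \<cdot> (((\<one> ?BD \<otimes> (b \<otimes> \<one> ?AB)) \<cdot> assoc V ?BD \<I> ?AB) \<cdot> (inv_arr V (runit V ?BD) \<otimes> \<one> ?AB))) =
    VComp C A B D \<cdot> ((\<one> ?BD \<otimes> VComp C A B' B) \<cdot> ((\<one> ?BD \<otimes> (b \<otimes> \<one> ?AB)) \<cdot> (assoc V ?BD \<I> ?AB \<cdot> (inv_arr V (runit V ?BD) \<otimes> \<one> ?AB))))"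
    using t by simp
  also have "\<dots> = VComp C A B D \<cdot> (\<one> ?BD \<otimes> vpost V C A B' B b)"
    using t by (simp add: assoc_inv_middle vpost_def)
  finally show ?thesis ..
qed

lemma vpost_comp:
  assumes C: "vcategory V C" and O: "A \<in> VObj C" "B \<in> VObj C" "D \<in> VObj C" "D' \<in> VObj C" and c: "c \<in> hom V \<I> (VHom C D D')"
  shows "VComp C A B D' \<cdot> (vpost V C B D D' c \<otimes> \<one> (VHom C A B)) = vpost V C A D D' c \<cdot> VComp C A B D"
proof -
  let ?BD = "VHom C B D" and ?AB = "VHom C A B"
  have M: "VComp C A B D \<in> hom V (?BD \<odot> ?AB) (VHom C A D)" using C O by (simp add: hom_def)
  note t = C O homD[OF c]
  have "VComp C A B D' \<cdot> (vpost V C B D D' c \<otimes> \<one> ?AB) =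
    (VComp C A B D' \<cdot> (VComp C B D D' \<otimes> \<one> ?AB)) \<cdot> (((c \<otimes> \<one> ?BD) \<otimes> \<one> ?AB) \<cdot> (inv_arr V (lunit V ?BD) \<otimes> \<one> ?AB))"
    using t by (simp add: vpost_def)
  also have "\<dots> = VComp C A D D' \<cdot> ((\<one> (VHom C D D') \<otimes> VComp C A B D) \<cdot> ((assoc V (VHom C D D') ?BD ?AB \<cdot> ((c \<otimes> \<one> ?BD) \<otimes> \<one> ?AB)) \<cdot> (inv_arr V (lunit V ?BD) \<otimes> \<one> ?AB)))"
    unfolding vcat_assoc[OF C, OF O, symmetric] using t by simp
  also have "assoc V (VHom C D D') ?BD ?AB \<cdot> ((c \<otimes> \<one> ?BD) \<otimes> \<one> ?AB) = (c \<otimes> (\<one> ?BD \<otimes> \<one> ?AB)) \<cdot> assoc V \<I> ?BD ?AB"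
    using t by (intro assoc_nat) (simp_all add: hom_def)
  also have "VComp C A D D' \<cdot> ((\<one> (VHom C D D') \<otimes> VComp C A B D) \<cdot> (((c \<otimes> (\<one> ?BD \<otimes> \<one> ?AB)) \<cdot> assoc V \<I> ?BD ?AB) \<cdot> (inv_arr V (lunit V ?BD) \<otimes> \<one> ?AB))) =
    VComp C A D D' \<cdot> ((c \<otimes> \<one> (VHom C A D)) \<cdot> ((\<one> \<I> \<otimes> VComp C A B D) \<cdot> (assoc V \<I> ?BD ?AB \<cdot> (inv_arr V (lunit V ?BD) \<otimes> \<one> ?AB))))"
    using t by simp
  also have "\<dots> = VComp C A D D' \<cdot> ((c \<otimes> \<one> (VHom C A D)) \<cdot> ((\<one> \<I> \<otimes> VComp C A B D) \<cdot> inv_arr V (lunit V (?BD \<odot> ?AB))))"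
    using t by (simp add: assoc_inv_lunit_tens)
  also have "\<dots> = VComp C A D D' \<cdot> ((c \<otimes> \<one> (VHom C A D)) \<cdot> (inv_arr V (lunit V (VHom C A D)) \<cdot> VComp C A B D))"
    by (simp only: lunit_inv_nat[OF M])
  also have "\<dots> = vpost V C A D D' c \<cdot> VComp C A B D" using t by (simp add: vpost_def)
  finally show ?thesis .
qed

lemma vfunctor_vpost:
  assumes G: "vfunctor V C D G" and O: "W \<in> VObj C" "X \<in> VObj C" "Y \<in> VObj C" and g: "g \<in> hom V \<I> (VHom C X Y)"
  shows "FHom G W Y \<cdot> vpost V C W X Y g = vpost V D (FOb G W) (FOb G X) (FOb G Y) (FHom G X Y \<cdot> g) \<cdot> FHom G W X"
proof -
  have GX: "FHom G W X \<in> hom V (VHom C W X) (VHom D (FOb G W) (FOb G X))" by (rule vfunctorD(5)[OF G O(1,2)])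
  note t = vfunctorD(1,2)[OF G] O homD[OF g] vfunctor_Arr[OF G]
  have "FHom G W Y \<cdot> vpost V C W X Y g = (FHom G W Y \<cdot> VComp C W X Y) \<cdot> ((g \<otimes> \<one> (VHom C W X)) \<cdot> inv_arr V (lunit V (VHom C W X)))"
    using t G by (simp add: vpost_def)
  also have "\<dots> = VComp D (FOb G W) (FOb G X) (FOb G Y) \<cdot> (((FHom G X Y \<cdot> g) \<otimes> \<one> (VHom D (FOb G W) (FOb G X))) \<cdot> ((\<one> \<I> \<otimes> FHom G W X) \<cdot> inv_arr V (lunit V (VHom C W X))))"
    unfolding vfunctorD(7)[OF G O] using t G by simp
  also have "\<dots> = VComp D (FOb G W) (FOb G X) (FOb G Y) \<cdot> (((FHom G X Y \<cdot> g) \<otimes> \<one> (VHom D (FOb G W) (FOb G X))) \<cdot> (inv_arr V (lunit V (VHom D (FOb G W) (FOb G X))) \<cdot> FHom G W X))"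
    by (simp only: lunit_inv_nat[OF GX])
  also have "\<dots> = vpost V D (FOb G W) (FOb G X) (FOb G Y) (FHom G X Y \<cdot> g) \<cdot> FHom G W X"
    using t G by (simp add: vpost_def)
  finally show ?thesis .
qed

lemma vfunctor_vpre:
  assumes G: "vfunctor V C D G" and O: "X \<in> VObj C" "Y \<in> VObj C" "Z \<in> VObj C" and f: "f \<in> hom V \<I> (VHom C X Y)"
  shows "FHom G X Z \<cdot> vpre V C X Y Z f = vpre V D (FOb G X) (FOb G Y) (FOb G Z) (FHom G X Y \<cdot> f) \<cdot> FHom G Y Z"
proof -
  have GX: "FHom G Y Z \<in> hom V (VHom C Y Z) (VHom D (FOb G Y) (FOb G Z))" by (rule vfunctorD(5)[OF G O(2,3)])
  note t = vfunctorD(1,2)[OF G] O homD[OF f] vfunctor_Arr[OF G]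
  have "FHom G X Z \<cdot> vpre V C X Y Z f = (FHom G X Z \<cdot> VComp C X Y Z) \<cdot> ((\<one> (VHom C Y Z) \<otimes> f) \<cdot> inv_arr V (runit V (VHom C Y Z)))"
    using t G by (simp add: vpre_def)
  also have "\<dots> = VComp D (FOb G X) (FOb G Y) (FOb G Z) \<cdot> ((\<one> (VHom D (FOb G Y) (FOb G Z)) \<otimes> (FHom G X Y \<cdot> f)) \<cdot> ((FHom G Y Z \<otimes> \<one> \<I>) \<cdot> inv_arr V (runit V (VHom C Y Z))))"
    unfolding vfunctorD(7)[OF G O] using t G by simp
  also have "\<dots> = VComp D (FOb G X) (FOb G Y) (FOb G Z) \<cdot> ((\<one> (VHom D (FOb G Y) (FOb G Z)) \<otimes> (FHom G X Y \<cdot> f)) \<cdot> (inv_arr V (runit V (VHom D (FOb G Y) (FOb G Z))) \<cdot> FHom G Y Z))"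
    by (simp only: runit_inv_nat[OF GX])
  also have "\<dots> = vpre V D (FOb G X) (FOb G Y) (FOb G Z) (FHom G X Y \<cdot> f) \<cdot> FHom G Y Z"
    using t G by (simp add: vpre_def)
  finally show ?thesis .
qed

end

section \<open>Free Eilenberg-Moore algebras of the induced monad\<close>

context alg_adj
begin

abbreviation "MM \<equiv> induced_monad_fun V P T J F"
abbreviation "mm \<equiv> induced_monad_mult V P T J F \<epsilon>"

lemma MM_vfunctor: "vfunctor V (self V) (self V) MM"
  using adjD(3) by (simp add: vnat_trans_def induced_monad_fun_def)

lemma MM_simps:
  "X \<in> Obj V \<Longrightarrow> FOb MM X = TO X"
  "X \<in> Obj V \<Longrightarrow> Y \<in> Obj V \<Longrightarrow> FHom MM X Y = qsnd (FOb F X) (FOb F Y) \<cdot> FHom F X Y"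
  by (simp_all add: induced_monad_fun_def vfun_comp_def mk_vfun_def forget_simps)

lemma mm_simps: "X \<in> Obj V \<Longrightarrow> mm X = qsnd (FOb F (TO X)) (FOb F X) \<cdot> \<epsilon> (FOb F X)"
  by (simp add: induced_monad_mult_def forget_simps)

lemma MM_hom: "X \<in> Obj V \<Longrightarrow> Y \<in> Obj V \<Longrightarrow> FHom MM X Y \<in> hom V (ihom V X Y) (ihom V (TO X) (TO Y))"
  using vfunctorD(5)[OF MM_vfunctor, of X Y] by (simp add: MM_simps(1))

lemma mm_hom: "X \<in> Obj V \<Longrightarrow> mm X \<in> hom V \<I> (ihom V (TO (TO X)) (TO X))"
  using comp_hom[OF eps_hom hom_point_bij(1)] by (simp add: mm_simps)

lemma mm_arrow: "X \<in> Obj V \<Longrightarrow> arrow_of V (TO (TO X)) (TO X) (mm X) = eps (FOb F X)"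
  by (simp add: mm_simps eps_def uo_def)

lemma MM_name: "f \<in> hom V X Y \<Longrightarrow> arrow_of V (TO X) (TO Y) (FHom MM X Y \<cdot> name_of V f) = Tm f"
proof -
  assume f: "f \<in> hom V X Y"
  have O: "X \<in> Obj V" "Y \<in> Obj V" using f hom_Obj by blast+
  have "FHom F X Y \<in> hom V (ihom V X Y) (VHom AT (FOb F X) (FOb F Y))"
    using vfunctorD(5)[OF adjD(1), of X Y] O by simp
  then show ?thesis
    using f O homD[OF f] homD[OF hom_point_bij(1)[of "FOb F X" "FOb F Y"]] homD[OF name_of_hom(1)[OF f]]
      by (simp add: MM_simps Tm_def uo_def F0_def hom_def)
qed

text \<open>Enriched naturality of the counit, carried along the forgetful functor. It says that
  \<open>MM\<close> sends arrows to homomorphisms of free Eilenberg-Moore algebras, which makes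
  \<open>em_free\<close> well defined on hom-objects.\<close>

lemma mult_nat:
  assumes O: "X \<in> Obj V" "Y \<in> Obj V"
  shows "vpre V (self V) (TO (TO X)) (TO X) (TO Y) (mm X) \<cdot> FHom MM X Y =
    (vpost V (self V) (TO (TO X)) (TO (TO Y)) (TO Y) (mm Y) \<cdot> FHom MM (TO X) (TO Y)) \<cdot> FHom MM X Y"
proof -
  let ?A = "FOb F X" and ?B = "FOb F Y" and ?FA = "FOb F (TO X)" and ?FB = "FOb F (TO Y)"
  have A: "?A \<in> VObj AT" "?B \<in> VObj AT" "?FA \<in> VObj AT" "?FB \<in> VObj AT" using O by simp_all
  have n: "vpost V AT ?FA ?FB ?B (\<epsilon> ?B) \<cdot> (FHom F (TO X) (TO Y) \<cdot> qsnd ?A ?B) =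
        vpre V AT ?FA ?A ?B (\<epsilon> ?A) \<cdot> \<one> (VHom AT ?A ?B)"
    using adjD(4) A(1,2) by (simp add: vnat_trans_def vid_def vfun_comp_def mk_vfun_def forget_simps)
  have eA: "\<epsilon> ?A \<in> hom V \<I> (VHom AT ?FA ?A)" "\<epsilon> ?B \<in> hom V \<I> (VHom AT ?FB ?B)" using eps_hom A(1,2) by simp_all
  have F1: "FHom F X Y \<in> hom V (ihom V X Y) (VHom AT ?A ?B)"
    using vfunctorD(5)[OF adjD(1), of X Y] O by simp
  have F2: "FHom F (TO X) (TO Y) \<in> hom V (ihom V (TO X) (TO Y)) (VHom AT ?FA ?FB)"
    using vfunctorD(5)[OF adjD(1), of "TO X" "TO Y"] O by simp
  have q: "qsnd ?A ?B \<in> hom V (VHom AT ?A ?B) (ihom V (TO X) (TO Y))" "qsnd ?FA ?FB \<in> hom V (VHom AT ?FA ?FB) (ihom V (TO (TO X)) (TO (TO Y)))"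
    "qsnd ?FA ?B \<in> hom V (VHom AT ?FA ?B) (ihom V (TO (TO X)) (TO Y))"
    using hom_point_bij(1)[OF A(1,2)] hom_point_bij(1)[OF A(3,4)] hom_point_bij(1)[OF A(3,2)] .
  have pre: "vpre V AT ?FA ?A ?B (\<epsilon> ?A) \<in> hom V (VHom AT ?A ?B) (VHom AT ?FA ?B)"
    by (rule vpre_hom[OF AT_cat A(3,1,2) eA(1)])
  have post: "vpost V AT ?FA ?FB ?B (\<epsilon> ?B) \<in> hom V (VHom AT ?FA ?FB) (VHom AT ?FA ?B)"
    by (rule vpost_hom[OF AT_cat A(3,4,2) eA(2)])
  have pre': "vpre V (self V) (TO (TO X)) (TO X) (TO Y) (mm X) \<in> hom V (ihom V (TO X) (TO Y)) (ihom V (TO (TO X)) (TO Y))"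
    using vpre_hom[OF slf, of "TO (TO X)" "TO X" "TO Y" "mm X"] O mm_hom[OF O(1)] by simp
  have post': "vpost V (self V) (TO (TO X)) (TO (TO Y)) (TO Y) (mm Y) \<in> hom V (ihom V (TO (TO X)) (TO (TO Y))) (ihom V (TO (TO X)) (TO Y))"
    using vpost_hom[OF slf, of "TO (TO X)" "TO (TO Y)" "TO Y" "mm Y"] O mm_hom[OF O(2)] by simp
  have u1: "qsnd ?FA ?B \<cdot> vpre V AT ?FA ?A ?B (\<epsilon> ?A) = vpre V (self V) (TO (TO X)) (TO X) (TO Y) (mm X) \<cdot> qsnd ?A ?B"
    using vfunctor_vpre[OF adjD(2) A(3,1,2) eA(1)] A O by (simp add: forget_simps mm_simps)
  have u2: "qsnd ?FA ?B \<cdot> vpost V AT ?FA ?FB ?B (\<epsilon> ?B) = vpost V (self V) (TO (TO X)) (TO (TO Y)) (TO Y) (mm Y) \<cdot> qsnd ?FA ?FB"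
    using vfunctor_vpost[OF adjD(2) A(3,4,2) eA(2)] A O by (simp add: forget_simps mm_simps)
  note t = homD[OF F1] homD[OF F2] homD[OF q(1)] homD[OF q(2)] homD[OF q(3)] homD[OF pre] homD[OF post] homD[OF pre'] homD[OF post']
  have "vpre V (self V) (TO (TO X)) (TO X) (TO Y) (mm X) \<cdot> FHom MM X Y =
     (vpre V (self V) (TO (TO X)) (TO X) (TO Y) (mm X) \<cdot> qsnd ?A ?B) \<cdot> FHom F X Y"
    using O t by (simp add: MM_simps)
  also have "\<dots> = qsnd ?FA ?B \<cdot> ((vpre V AT ?FA ?A ?B (\<epsilon> ?A) \<cdot> \<one> (VHom AT ?A ?B)) \<cdot> FHom F X Y)"
    unfolding u1[symmetric] using t A AT_cat by simp
  also have "\<dots> = (qsnd ?FA ?B \<cdot> vpost V AT ?FA ?FB ?B (\<epsilon> ?B)) \<cdot> (FHom F (TO X) (TO Y) \<cdot> (qsnd ?A ?B \<cdot> FHom F X Y))"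
    unfolding n[symmetric] using t by simp
  also have "\<dots> = (vpost V (self V) (TO (TO X)) (TO (TO Y)) (TO Y) (mm Y) \<cdot> FHom MM (TO X) (TO Y)) \<cdot> FHom MM X Y"
    unfolding u2 using t O by (simp add: MM_simps)
  finally show ?thesis .
qed

text \<open>\<open>emo X\<close> is the free Eilenberg-Moore algebra on \<open>X\<close>. The chosen
  hom-object \<open>emH\<close> with its inclusion \<open>emi\<close> is the equalizer of
  \<open>empr\<close> and \<open>empo\<close>.\<close>

abbreviation emo where "emo X \<equiv> (FOb MM X, mm X)"
abbreviation emH where "emH X Y \<equiv> em_ob V (self V) MM (emo X) (emo Y)"
abbreviation emi where "emi X Y \<equiv> em_incl V (self V) MM (emo X) (emo Y)"
abbreviation empr where "empr X Y \<equiv> vpre V (self V) (TO (TO X)) (TO X) (TO Y) (mm X)"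
abbreviation empo where "empo X Y \<equiv> vpost V (self V) (TO (TO X)) (TO (TO Y)) (TO Y) (mm Y) \<cdot> FHom MM (TO X) (TO Y)"

lemma em_homs:
  assumes O: "X \<in> Obj V" "Y \<in> Obj V"
  shows "empr X Y \<in> hom V (ihom V (TO X) (TO Y)) (ihom V (TO (TO X)) (TO Y))"
    "empo X Y \<in> hom V (ihom V (TO X) (TO Y)) (ihom V (TO (TO X)) (TO Y))"
proof -
  show "empr X Y \<in> hom V (ihom V (TO X) (TO Y)) (ihom V (TO (TO X)) (TO Y))"
    using vpre_hom[OF slf, of "TO (TO X)" "TO X" "TO Y" "mm X"] O mm_hom[OF O(1)] by simp
  have "vpost V (self V) (TO (TO X)) (TO (TO Y)) (TO Y) (mm Y) \<in> hom V (ihom V (TO (TO X)) (TO (TO Y))) (ihom V (TO (TO X)) (TO Y))"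
    using vpost_hom[OF slf, of "TO (TO X)" "TO (TO Y)" "TO Y" "mm Y"] O mm_hom[OF O(2)] by simp
  then show "empo X Y \<in> hom V (ihom V (TO X) (TO Y)) (ihom V (TO (TO X)) (TO Y))"
    using comp_hom[OF MM_hom[of "TO X" "TO Y"]] O by simp
qed

lemma em_equalizer:
  assumes O: "X \<in> Obj V" "Y \<in> Obj V"
  shows "emi X Y \<in> hom V (emH X Y) (ihom V (TO X) (TO Y))" "empr X Y \<cdot> emi X Y = empo X Y \<cdot> emi X Y"
    "w \<in> hom V W (ihom V (TO X) (TO Y)) \<Longrightarrow> empr X Y \<cdot> w = empo X Y \<cdot> w \<Longrightarrow> \<exists>!u. u \<in> hom V W (emH X Y) \<and> emi X Y \<cdot> u = w"
proof -
  note h = em_homs[OF O]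
  obtain H' e' where "is_equalizer V (empr X Y) (empo X Y) H' e'" using equalizer_exists[OF h] by blast
  then have "\<exists>x. case x of (E, q) \<Rightarrow> is_equalizer V (empr X Y) (empo X Y) E q" by auto
  from someI_ex[OF this] have "case em_object V (self V) MM (emo X) (emo Y) of (E, q) \<Rightarrow> is_equalizer V (empr X Y) (empo X Y) E q"
    using O by (simp add: em_object_def MM_simps(1))
  then have eq: "is_equalizer V (empr X Y) (empo X Y) (emH X Y) (emi X Y)" by (simp add: case_prod_beta)
  have D: "Dom V (empr X Y) = ihom V (TO X) (TO Y)" using homD[OF h(1)] by simp
  show "emi X Y \<in> hom V (emH X Y) (ihom V (TO X) (TO Y))" "empr X Y \<cdot> emi X Y = empo X Y \<cdot> emi X Y"
    "w \<in> hom V W (ihom V (TO X) (TO Y)) \<Longrightarrow> empr X Y \<cdot> w = empo X Y \<cdot> w \<Longrightarrow> \<exists>!u. u \<in> hom V W (emH X Y) \<and> emi X Y \<cdot> u = w"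
    using eq unfolding is_equalizer_def D by blast+
qed

lemma em_free_incl:
  assumes O: "X \<in> Obj V" "Y \<in> Obj V"
  shows "FHom (em_free V (self V) MM mm) X Y \<in> hom V (ihom V X Y) (emH X Y)"
    "emi X Y \<cdot> FHom (em_free V (self V) MM mm) X Y = FHom MM X Y"
proof -
  have "FHom (em_free V (self V) MM mm) X Y = (THE h. h \<in> hom V (ihom V X Y) (emH X Y) \<and> emi X Y \<cdot> h = FHom MM X Y)"
    using O by (simp add: em_free_def mk_vfun_def)
  moreover have "\<exists>!h. h \<in> hom V (ihom V X Y) (emH X Y) \<and> emi X Y \<cdot> h = FHom MM X Y"
    by (rule em_equalizer(3)[OF O MM_hom[OF O]]) (rule mult_nat[OF O])
  ultimately show "FHom (em_free V (self V) MM mm) X Y \<in> hom V (ihom V X Y) (emH X Y)"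
    "emi X Y \<cdot> FHom (em_free V (self V) MM mm) X Y = FHom MM X Y"
    using theI'[of "\<lambda>h. h \<in> hom V (ihom V X Y) (emH X Y) \<and> emi X Y \<cdot> h = FHom MM X Y"] by simp_all
qed

text \<open>The multiplication is passed along the composite from \<open>mm X\<close> over
  \<open>mm Y\<close> to \<open>mm Z\<close> by the three associativity lemmas. Hence the composite
  equalizes \<open>empr\<close> and \<open>empo\<close>, and the \<open>THE\<close> that defines
  composition has a value.\<close>

lemma em_comp_incl:
  assumes O: "X \<in> Obj V" "Y \<in> Obj V" "Z \<in> Obj V"
  shows "VComp (em_cat V (self V) MM \<eta> mm) (emo X) (emo Y) (emo Z) \<in> hom V (emH Y Z \<odot> emH X Y) (emH X Z)"
    "emi X Z \<cdot> VComp (em_cat V (self V) MM \<eta> mm) (emo X) (emo Y) (emo Z) =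
      VComp (self V) (TO X) (TO Y) (TO Z) \<cdot> (emi Y Z \<otimes> emi X Y)"
proof -
  let ?A = "TO X" and ?B = "TO Y" and ?C = "TO Z" and ?M = "FHom MM" and ?c = "VComp (self V)"
  let ?poX = "vpost V (self V) (TO ?A) (TO ?B) ?B (mm Y)" and ?poZ = "vpost V (self V) (TO ?B) (TO ?C) ?C (mm Z)"
    and ?poZ' = "vpost V (self V) (TO ?A) (TO ?C) ?C (mm Z)"
  have TT: "?A \<in> Obj V" "?B \<in> Obj V" "?C \<in> Obj V" "TO ?A \<in> Obj V" "TO ?B \<in> Obj V" "TO ?C \<in> Obj V" using O by simp_all
  note iXY = em_equalizer(1,2)[OF O(1,2)] and iYZ = em_equalizer(1,2)[OF O(2,3)]
  note pXY = em_homs(1)[OF O(1,2)] and pYZ = em_homs(1)[OF O(2,3)] and pXZ = em_homs(1)[OF O(1,3)]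
  have post: "?poX \<in> hom V (ihom V (TO ?A) (TO ?B)) (ihom V (TO ?A) ?B)" "?poZ \<in> hom V (ihom V (TO ?B) (TO ?C)) (ihom V (TO ?B) ?C)"
    "?poZ' \<in> hom V (ihom V (TO ?A) (TO ?C)) (ihom V (TO ?A) ?C)"
    using vpost_hom[OF slf, of "TO ?A" "TO ?B" "?B" "mm Y"] vpost_hom[OF slf, of "TO ?B" "TO ?C" ?C "mm Z"]
      vpost_hom[OF slf, of "TO ?A" "TO ?C" ?C "mm Z"] TT mm_hom O by simp_all
  note M1 = MM_hom[OF TT(1,2)] and M2 = MM_hom[OF TT(2,3)] and M3 = MM_hom[OF TT(1,3)]
  have HO: "emH X Y \<in> Obj V" "emH Y Z \<in> Obj V" using hom_Obj iXY(1) iYZ(1) by blast+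
  note t = TT homD[OF iXY(1)] homD[OF iYZ(1)] homD[OF pXY] homD[OF pYZ] homD[OF pXZ] homD[OF post(1)] homD[OF post(2)] homD[OF post(3)]
    homD[OF M1] homD[OF M2] homD[OF M3] HO
  have ii: "?c ?A ?B ?C \<cdot> (emi Y Z \<otimes> emi X Y) \<in> hom V (emH Y Z \<odot> emH X Y) (ihom V ?A ?C)" using t by (simp add: hom_def)
  have c1: "empr X Z \<cdot> ?c ?A ?B ?C = ?c (TO ?A) ?B ?C \<cdot> (\<one> (ihom V ?B ?C) \<otimes> empr X Y)"
    using vpre_comp[OF slf, of "TO ?A" ?A ?B ?C "mm X"] TT mm_hom[OF O(1)] by simp
  have c2: "?c (TO ?A) ?B ?C \<cdot> (\<one> (ihom V ?B ?C) \<otimes> ?poX) = ?c (TO ?A) (TO ?B) ?C \<cdot> (empr Y Z \<otimes> \<one> (ihom V (TO ?A) (TO ?B)))"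
    using vcomp_middle[OF slf, of "TO ?A" "TO ?B" ?B ?C "mm Y"] TT mm_hom[OF O(2)] by simp
  have c3: "?c (TO ?A) (TO ?B) ?C \<cdot> (?poZ \<otimes> \<one> (ihom V (TO ?A) (TO ?B))) = ?poZ' \<cdot> ?c (TO ?A) (TO ?B) (TO ?C)"
    using vpost_comp[OF slf, of "TO ?A" "TO ?B" "TO ?C" ?C "mm Z"] TT mm_hom[OF O(3)] by simp
  have c4: "?M ?A ?C \<cdot> ?c ?A ?B ?C = ?c (TO ?A) (TO ?B) (TO ?C) \<cdot> (?M ?B ?C \<otimes> ?M ?A ?B)"
    using vfunctorD(7)[OF MM_vfunctor, of ?A ?B ?C] TT by (simp add: MM_simps(1))
  have "empr X Z \<cdot> (?c ?A ?B ?C \<cdot> (emi Y Z \<otimes> emi X Y)) = ?c (TO ?A) ?B ?C \<cdot> ((\<one> (ihom V ?B ?C) \<otimes> empr X Y) \<cdot> (emi Y Z \<otimes> emi X Y))"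
    by (rule comp_permute[OF c1]) (use t in simp_all)
  also have "\<dots> = ?c (TO ?A) ?B ?C \<cdot> (emi Y Z \<otimes> (empo X Y \<cdot> emi X Y))"
    using t by (simp add: iXY(2))
  also have "\<dots> = (?c (TO ?A) ?B ?C \<cdot> (\<one> (ihom V ?B ?C) \<otimes> ?poX)) \<cdot> (emi Y Z \<otimes> (?M ?A ?B \<cdot> emi X Y))"
    using t by simp
  also have "\<dots> = ?c (TO ?A) (TO ?B) ?C \<cdot> ((empr Y Z \<cdot> emi Y Z) \<otimes> (?M ?A ?B \<cdot> emi X Y))"
    unfolding c2 using t by simp
  also have "\<dots> = (?c (TO ?A) (TO ?B) ?C \<cdot> (?poZ \<otimes> \<one> (ihom V (TO ?A) (TO ?B)))) \<cdot> ((?M ?B ?C \<cdot> emi Y Z) \<otimes> (?M ?A ?B \<cdot> emi X Y))"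
    unfolding iYZ(2) using t by simp
  also have "\<dots> = ?poZ' \<cdot> ((?c (TO ?A) (TO ?B) (TO ?C) \<cdot> (?M ?B ?C \<otimes> ?M ?A ?B)) \<cdot> (emi Y Z \<otimes> emi X Y))"
    unfolding c3 using t by simp
  also have "\<dots> = empo X Z \<cdot> (?c ?A ?B ?C \<cdot> (emi Y Z \<otimes> emi X Y))"
    unfolding c4[symmetric] using t by simp
  finally have "\<exists>!k. k \<in> hom V (emH Y Z \<odot> emH X Y) (emH X Z) \<and> emi X Z \<cdot> k = ?c ?A ?B ?C \<cdot> (emi Y Z \<otimes> emi X Y)"
    by (rule em_equalizer(3)[OF O(1,3) ii])
  moreover have "VComp (em_cat V (self V) MM \<eta> mm) (emo X) (emo Y) (emo Z) =
     (THE k. k \<in> hom V (emH Y Z \<odot> emH X Y) (emH X Z) \<and> emi X Z \<cdot> k = ?c ?A ?B ?C \<cdot> (emi Y Z \<otimes> emi X Y))"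
    using O by (simp add: em_cat_def MM_simps(1))
  ultimately show "VComp (em_cat V (self V) MM \<eta> mm) (emo X) (emo Y) (emo Z) \<in> hom V (emH Y Z \<odot> emH X Y) (emH X Z)"
    "emi X Z \<cdot> VComp (em_cat V (self V) MM \<eta> mm) (emo X) (emo Y) (emo Z) = ?c ?A ?B ?C \<cdot> (emi Y Z \<otimes> emi X Y)"
    using theI'[of "\<lambda>k. k \<in> hom V (emH Y Z \<odot> emH X Y) (emH X Z) \<and> emi X Z \<cdot> k = ?c ?A ?B ?C \<cdot> (emi Y Z \<otimes> emi X Y)"] by simp_all
qed

text \<open>Discreteness speaks of points of hom-objects of \<T>, while \<open>x\<close> is a point
  of \<open>TO X\<close>. The extension of \<open>x\<close> is a homomorphism of free algebras,
  hence a point of \<open>emH \<I> X\<close>, and the isomorphism of pretheories moves it into \<T>.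
  The factorization found there is moved back, and \<open>J\<close> applied to
  \<open>\<delta>\<close> becomes \<open>Tm \<delta>\<close>.\<close>

lemma discrete_point:
  assumes iso: "pretheory_iso V P T J (monad_pretheory_cat V P MM \<eta> mm) (monad_pretheory_fun V P MM mm)"
    and IP: "\<I> \<in> P" and X: "X \<in> P" "X\<^sub>0 \<in> P" and \<delta>: "\<delta> \<in> hom V X\<^sub>0 X"
    and disc: "\<forall>g \<in> hom V \<I> (VHom T \<I> X). \<exists>f \<in> hom V \<I> (VHom T \<I> X\<^sub>0).
           g = el_comp V T \<I> X\<^sub>0 X (FHom J X\<^sub>0 X \<cdot> name_of V \<delta>) f"
    and x: "x \<in> hom V \<I> (TO X)"
  shows "\<exists>x\<^sub>0 \<in> hom V \<I> (TO X\<^sub>0). Tm \<delta> \<cdot> x\<^sub>0 = x"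
proof -
  let ?Mc = "monad_pretheory_cat V P MM \<eta> mm"
  have O: "X \<in> Obj V" "X\<^sub>0 \<in> Obj V" using PO X by simp_all
  have AX: "FOb F X \<in> VObj AT" "FOb F X\<^sub>0 \<in> VObj AT" "FOb F \<I> \<in> VObj AT" using O by simp_all
  obtain \<Phi> where \<Phi>: "vfunctor V T ?Mc \<Phi>" "\<And>X. X \<in> P \<Longrightarrow> FOb \<Phi> X = X"
     "\<And>X Y. X \<in> P \<Longrightarrow> Y \<in> P \<Longrightarrow> iso V (FHom \<Phi> X Y)"
     "vfun_comp V (vfull (self V) P) \<Phi> J = monad_pretheory_fun V P MM mm"
    using iso unfolding pretheory_iso_def by blast
  have TO_P: "VObj T = P" using pre by (simp add: pretheory_def)
  have Mc: "VHom ?Mc A B = emH A B" "VComp ?Mc A B C = VComp (em_cat V (self V) MM \<eta> mm) (emo A) (emo B) (emo C)"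
    if "A \<in> P" "B \<in> P" "C \<in> P" for A B C
    using that PO by (simp_all add: monad_pretheory_cat_def Let_def em_free_def mk_vfun_def em_cat_def)
  have \<Phi>h: "FHom \<Phi> A B \<in> hom V (VHom T A B) (emH A B)" if "A \<in> P" "B \<in> P" for A B
    using vfunctorD(5)[OF \<Phi>(1), of A B] that \<Phi>(2) Mc(1)[OF that that(1)] TO_P by simp
  note xh = ex_Hm[OF AX(1) x] and xa = ex_hom[OF AX(1) x]
  let ?x = "ex (FOb F X) x"
  note nx = name_of_hom(1)[OF xa]
  \<comment> \<open>Naturality of the counit at the extension of \<open>x\<close>; expressed with
    names, it says that the point lies in the equalizer.\<close>
  have "empr \<I> X \<cdot> name_of V ?x = empo \<I> X \<cdot> name_of V ?x"
  proof (rule arrow_of_inj)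
    have TT: "TO (TO \<I>) \<in> Obj V" "TO \<I> \<in> Obj V" "TO X \<in> Obj V" "TO (TO X) \<in> Obj V" using O by simp_all
    have Mx: "FHom MM (TO \<I>) (TO X) \<cdot> name_of V ?x \<in> hom V \<I> (ihom V (TO (TO \<I>)) (TO (TO X)))"
      by (rule comp_hom[OF nx MM_hom[OF TT(2,3)]])
    have mI: "mm \<I> \<in> hom V \<I> (ihom V (TO (TO \<I>)) (TO \<I>))" and mX: "mm X \<in> hom V \<I> (ihom V (TO (TO X)) (TO X))"
      using mm_hom O by simp_all
    have 1: "empr \<I> X \<cdot> name_of V ?x = el_comp V (self V) (TO (TO \<I>)) (TO \<I>) (TO X) (name_of V ?x) (mm \<I>)"
      using vpre_point[OF slf, of "TO (TO \<I>)" "TO \<I>" "TO X" "name_of V ?x" "mm \<I>"] TT nx mI by simp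
    have po: "vpost V (self V) (TO (TO \<I>)) (TO (TO X)) (TO X) (mm X) \<in> hom V (ihom V (TO (TO \<I>)) (TO (TO X))) (ihom V (TO (TO \<I>)) (TO X))"
      using vpost_hom[OF slf, of "TO (TO \<I>)" "TO (TO X)" "TO X" "mm X"] TT mX by simp
    have "empo \<I> X \<cdot> name_of V ?x = vpost V (self V) (TO (TO \<I>)) (TO (TO X)) (TO X) (mm X) \<cdot> (FHom MM (TO \<I>) (TO X) \<cdot> name_of V ?x)"
      using homD[OF po] homD[OF MM_hom[OF TT(2,3)]] homD[OF nx] by simp
    then have 2: "empo \<I> X \<cdot> name_of V ?x = el_comp V (self V) (TO (TO \<I>)) (TO (TO X)) (TO X) (mm X) (FHom MM (TO \<I>) (TO X) \<cdot> name_of V ?x)"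
      using vpost_point[OF slf, of "TO (TO \<I>)" "TO (TO X)" "TO X" "mm X"] TT Mx mX by simp
    show "arrow_of V (TO (TO \<I>)) (TO X) (empr \<I> X \<cdot> name_of V ?x) = arrow_of V (TO (TO \<I>)) (TO X) (empo \<I> X \<cdot> name_of V ?x)"
      unfolding 1 2 arrow_of_el_comp[OF TT(1,2,3) nx mI] arrow_of_el_comp[OF TT(1,4,3) mX Mx]
      using eps_nat[OF AX(3,1) xh(1)] O by (simp add: mm_arrow MM_name[OF xa] arrow_of_name[OF xa])
    show "empr \<I> X \<cdot> name_of V ?x \<in> hom V \<I> (ihom V (TO (TO \<I>)) (TO X))" "empo \<I> X \<cdot> name_of V ?x \<in> hom V \<I> (ihom V (TO (TO \<I>)) (TO X))"
      using comp_hom[OF nx em_homs(1)[OF unit_Obj O(1)]] comp_hom[OF nx em_homs(2)[OF unit_Obj O(1)]] .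
  qed (use O in simp_all)
  then obtain g\<^sub>0 where g\<^sub>0: "g\<^sub>0 \<in> hom V \<I> (emH \<I> X)" "emi \<I> X \<cdot> g\<^sub>0 = name_of V ?x"
    using em_equalizer(3)[OF unit_Obj O(1) nx] by blast
  let ?g = "inv_arr V (FHom \<Phi> \<I> X) \<cdot> g\<^sub>0"
  note tI = \<Phi>(3)[OF IP X(1)] homD[OF \<Phi>h[OF IP X(1)]] homD[OF g\<^sub>0(1)]
  have "?g \<in> hom V \<I> (VHom T \<I> X)" using tI by (simp add: hom_def)
  then obtain f where f: "f \<in> hom V \<I> (VHom T \<I> X\<^sub>0)" "?g = el_comp V T \<I> X\<^sub>0 X (FHom J X\<^sub>0 X \<cdot> name_of V \<delta>) f"
    using disc by blast
  have Jd: "FHom J X\<^sub>0 X \<cdot> name_of V \<delta> \<in> hom V \<I> (VHom T X\<^sub>0 X)"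
    using comp_hom[OF name_of_hom(1)[OF \<delta>] J_hom[OF X(1,2)]] by (simp add: vop_def)
  have "FHom \<Phi> X\<^sub>0 X \<cdot> FHom J X\<^sub>0 X = FHom (em_free V (self V) MM mm) X\<^sub>0 X"
  proof -
    have "FHom (vfun_comp V (vfull (self V) P) \<Phi> J) X\<^sub>0 X = FHom (monad_pretheory_fun V P MM mm) X\<^sub>0 X"
      using \<Phi>(4) by simp
    then show ?thesis using X by (simp add: vfun_comp_def monad_pretheory_fun_def mk_vfun_def vfull_def J_obj)
  qed
  then have \<Phi>J: "FHom \<Phi> X\<^sub>0 X \<cdot> (FHom J X\<^sub>0 X \<cdot> name_of V \<delta>) = FHom (em_free V (self V) MM mm) X\<^sub>0 X \<cdot> name_of V \<delta>"
    using comp_reduce[of "FHom \<Phi> X\<^sub>0 X" "FHom J X\<^sub>0 X" _ "name_of V \<delta>"] homD[OF \<Phi>h[OF X(2,1)]] J_Arr[OF X(1,2)]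
      homD[OF name_of_hom(1)[OF \<delta>]] by (simp add: vop_def)
  let ?a = "FHom \<Phi> \<I> X\<^sub>0 \<cdot> f" and ?b = "FHom (em_free V (self V) MM mm) X\<^sub>0 X \<cdot> name_of V \<delta>"
  have a: "?a \<in> hom V \<I> (emH \<I> X\<^sub>0)" by (rule comp_hom[OF f(1) \<Phi>h[OF IP X(2)]])
  have b: "?b \<in> hom V \<I> (emH X\<^sub>0 X)" by (rule comp_hom[OF name_of_hom(1)[OF \<delta>] em_free_incl(1)[OF O(2,1)]])
  have "g\<^sub>0 = FHom \<Phi> \<I> X \<cdot> ?g" using tI by simp
  also have "\<dots> = el_comp V ?Mc \<I> X\<^sub>0 X ?b ?a"
    unfolding f(2) using vfunctor_el_comp[OF \<Phi>(1), of \<I> X\<^sub>0 X, OF _ _ _ Jd f(1)] TO_P IP X \<Phi>(2) \<Phi>J by simp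
  finally have g0: "g\<^sub>0 = VComp (em_cat V (self V) MM \<eta> mm) (emo \<I>) (emo X\<^sub>0) (emo X) \<cdot> (?b \<otimes> ?a) \<cdot> inv_arr V (lunit V \<I>)"
    by (simp only: el_comp_def Mc(2)[OF IP X(2,1)])
  note ia = comp_hom[OF a em_equalizer(1)[OF unit_Obj O(2)]] and ib = comp_hom[OF b em_equalizer(1)[OF O(2,1)]]
  note c = em_comp_incl[OF unit_Obj O(2,1)]
  have "name_of V ?x = emi \<I> X \<cdot> (VComp (em_cat V (self V) MM \<eta> mm) (emo \<I>) (emo X\<^sub>0) (emo X) \<cdot> ((?b \<otimes> ?a) \<cdot> inv_arr V (lunit V \<I>)))"
    using g\<^sub>0(2) homD[OF a] homD[OF b] homD[OF c(1)] unfolding g0 by simp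
  also have "\<dots> = (VComp (self V) (TO \<I>) (TO X\<^sub>0) (TO X) \<cdot> (emi X\<^sub>0 X \<otimes> emi \<I> X\<^sub>0)) \<cdot> ((?b \<otimes> ?a) \<cdot> inv_arr V (lunit V \<I>))"
    by (rule comp_reduce[OF c(2)]) (use homD[OF a] homD[OF b] homD[OF c(1)] homD[OF em_equalizer(1)[OF unit_Obj O(1)]] in simp_all)
  also have "\<dots> = el_comp V (self V) (TO \<I>) (TO X\<^sub>0) (TO X) (emi X\<^sub>0 X \<cdot> ?b) (emi \<I> X\<^sub>0 \<cdot> ?a)"
    using homD[OF a] homD[OF b] homD[OF em_equalizer(1)[OF unit_Obj O(2)]] homD[OF em_equalizer(1)[OF O(2,1)]] O
    by (simp add: el_comp_def)
  finally have n: "name_of V ?x = el_comp V (self V) (TO \<I>) (TO X\<^sub>0) (TO X) (emi X\<^sub>0 X \<cdot> ?b) (emi \<I> X\<^sub>0 \<cdot> ?a)" .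
  have ibd: "emi X\<^sub>0 X \<cdot> ?b = FHom MM X\<^sub>0 X \<cdot> name_of V \<delta>"
    by (rule comp_reduce[OF em_free_incl(2)[OF O(2,1)]])
      (use homD[OF em_free_incl(1)[OF O(2,1)]] homD[OF em_equalizer(1)[OF O(2,1)]] homD[OF name_of_hom(1)[OF \<delta>]] in simp_all)
  let ?f = "arrow_of V (TO \<I>) (TO X\<^sub>0) (emi \<I> X\<^sub>0 \<cdot> ?a)"
  have fh: "?f \<in> hom V (TO \<I>) (TO X\<^sub>0)" using arrow_of_hom(1)[OF ia] O by simp
  have "?x = Tm \<delta> \<cdot> ?f"
  proof -
    have "?x = arrow_of V (TO \<I>) (TO X) (name_of V ?x)" by (simp only: arrow_of_name[OF xa])
    also have "\<dots> = arrow_of V (TO X\<^sub>0) (TO X) (emi X\<^sub>0 X \<cdot> ?b) \<cdot> ?f"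
      unfolding n by (rule arrow_of_el_comp[OF _ _ _ ib ia]) (use O in simp_all)
    also have "\<dots> = Tm \<delta> \<cdot> ?f" unfolding ibd MM_name[OF \<delta>] ..
    finally show ?thesis .
  qed
  then have "Tm \<delta> \<cdot> (?f \<cdot> e \<I>) = x"
    using xh(2) homD[OF Tm_hom[OF \<delta>]] homD[OF fh] homD[OF e_hom[OF unit_Obj]] by simp
  then show ?thesis using comp_hom[OF e_hom[OF unit_Obj] fh] by blast
qed

end

section \<open>Surjections, images and products of algebras\<close>

context alg_adj
begin

text \<open>The definition of a theory provides some left adjoint, the theorem fixes a possibly
  different one. Extending each unit along the other compares the two free algebras; the argument
  uses that \<open>?\<psi>\<close> is a left inverse of \<open>?\<phi>\<close> and that the
  comparison is natural in \<open>\<delta>\<close>.\<close>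

lemma discrete_point_transfer:
  assumes B: "alg_adj V lam P T J F' \<eta>' \<epsilon>'" and \<delta>: "\<delta> \<in> hom V X\<^sub>0 X"
    and F': "\<And>x. x \<in> hom V \<I> (snd (FOb F' X)) \<Longrightarrow> \<exists>y \<in> hom V \<I> (snd (FOb F' X\<^sub>0)). alg_adj.Tm V P T J F' \<delta> \<cdot> y = x"
    and x: "x \<in> hom V \<I> (TO X)"
  shows "\<exists>y \<in> hom V \<I> (TO X\<^sub>0). Tm \<delta> \<cdot> y = x"
proof -
  interpret B: alg_adj V lam P T J F' \<eta>' \<epsilon>' by (rule B)
  have O: "X\<^sub>0 \<in> Obj V" "X \<in> Obj V" using \<delta> hom_Obj by blast+
  note eX = e_hom[OF O(2)] and eX0 = e_hom[OF O(1)] and bX = B.e_hom[OF O(2)] and bX0 = B.e_hom[OF O(1)]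
  have AX: "FOb F X \<in> VObj AT" "FOb F X\<^sub>0 \<in> VObj AT" "FOb F' X \<in> VObj AT" "FOb F' X\<^sub>0 \<in> VObj AT" using O by simp_all
  note \<phi> = ex_Hm[OF AX(3) bX] ex_hom[OF AX(3) bX]
  note \<psi> = B.ex_Hm[OF AX(1) eX] B.ex_hom[OF AX(1) eX]
  note \<psi>\<^sub>0 = B.ex_Hm[OF AX(2) eX0] B.ex_hom[OF AX(2) eX0]
  let ?\<phi> = "ex (FOb F' X) (B.e X)" and ?\<psi> = "B.ex (FOb F X) (e X)" and ?\<psi>\<^sub>0 = "B.ex (FOb F X\<^sub>0) (e X\<^sub>0)"
  note t = homD[OF \<phi>(3)] homD[OF \<psi>(3)] homD[OF \<psi>\<^sub>0(3)] homD[OF eX] homD[OF eX0] homD[OF bX] homD[OF bX0] homD[OF \<delta>]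
    homD[OF Tm_hom[OF \<delta>]] homD[OF B.Tm_hom[OF \<delta>]]
  have inv: "?\<psi> \<cdot> ?\<phi> = \<one> (TO X)"
  proof (rule ex_eq[OF AX(1) O(2) Hm_comp[OF AX(1,3,1) \<phi>(1) \<psi>(1)] Hm_Ide[OF AX(1)]])
    show "(?\<psi> \<cdot> ?\<phi>) \<cdot> e X = \<one> (TO X) \<cdot> e X" using t \<phi>(2) \<psi>(2) by simp
  qed
  have nat: "?\<psi> \<cdot> B.Tm \<delta> = Tm \<delta> \<cdot> ?\<psi>\<^sub>0"
  proof (rule B.ex_eq[OF AX(1) O(1)])
    show "Hm (FOb F' X\<^sub>0) (FOb F X) (?\<psi> \<cdot> B.Tm \<delta>)" by (rule Hm_comp[OF AX(4,3,1) B.Tm_Hm[OF \<delta>] \<psi>(1)])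
    show "Hm (FOb F' X\<^sub>0) (FOb F X) (Tm \<delta> \<cdot> ?\<psi>\<^sub>0)" by (rule Hm_comp[OF AX(4,2,1) \<psi>\<^sub>0(1) Tm_Hm[OF \<delta>]])
    have "(?\<psi> \<cdot> B.Tm \<delta>) \<cdot> B.e X\<^sub>0 = ?\<psi> \<cdot> (B.e X \<cdot> \<delta>)" using t by (simp add: B.e_nat[OF \<delta>])
    also have "\<dots> = e X \<cdot> \<delta>" by (rule comp_reduce[OF \<psi>(2)]) (use t in simp_all)
    also have "\<dots> = (Tm \<delta> \<cdot> ?\<psi>\<^sub>0) \<cdot> B.e X\<^sub>0" using t by (simp add: e_nat[OF \<delta>] \<psi>\<^sub>0(2))
    finally show "(?\<psi> \<cdot> B.Tm \<delta>) \<cdot> B.e X\<^sub>0 = (Tm \<delta> \<cdot> ?\<psi>\<^sub>0) \<cdot> B.e X\<^sub>0" .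
  qed
  obtain y where y: "y \<in> hom V \<I> (snd (FOb F' X\<^sub>0))" "B.Tm \<delta> \<cdot> y = ?\<phi> \<cdot> x"
    using F'[OF comp_hom[OF x \<phi>(3)]] by blast
  have "Tm \<delta> \<cdot> (?\<psi>\<^sub>0 \<cdot> y) = (Tm \<delta> \<cdot> ?\<psi>\<^sub>0) \<cdot> y" using t homD[OF y(1)] by simp
  also have "\<dots> = ?\<psi> \<cdot> (?\<phi> \<cdot> x)" unfolding nat[symmetric] using t homD[OF y(1)] y(2) by simp
  also have "\<dots> = (?\<psi> \<cdot> ?\<phi>) \<cdot> x" using t homD[OF x] by simp
  also have "\<dots> = x" unfolding inv using homD[OF x] by simp
  finally show ?thesis using comp_hom[OF y(1) \<psi>\<^sub>0(3)] by blast
qed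

text \<open>[Y, -] keeps the family jointly monic, so compatibility of \<open>s\<close> with the
  actions can be tested after composing with each \<open>m i\<close>.\<close>

lemma Hm_reflect:
  assumes C: "C \<in> VObj AT" and A: "A \<in> VObj AT" and B: "\<And>i. i \<in> K \<Longrightarrow> B i \<in> VObj AT"
    and m: "\<And>i. i \<in> K \<Longrightarrow> Hm A (B i) (m i)"
    and jm: "\<And>W f g. f \<in> hom V W (snd A) \<Longrightarrow> g \<in> hom V W (snd A) \<Longrightarrow> (\<And>i. i \<in> K \<Longrightarrow> m i \<cdot> f = m i \<cdot> g) \<Longrightarrow> f = g"
    and s: "s \<in> hom V (snd C) (snd A)" "\<And>i. i \<in> K \<Longrightarrow> Hm C (B i) (m i \<cdot> s)"
  shows "Hm C A s"
  unfolding Hm_def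
proof (intro conjI ballI)
  show "s \<in> hom V (snd C) (snd A)" by (rule s(1))
  fix X Y assume XY: "X \<in> P" "Y \<in> P"
  note t = homD[OF s(1)] alg_act[OF C XY] alg_act[OF A XY] PO[OF XY(1)] PO[OF XY(2)] To_hom[OF XY]
  show "ipost Y s \<cdot> vact (fst C) X Y = vact (fst A) X Y \<cdot> (\<one> (VHom To X Y) \<otimes> ipost X s)"
  proof (rule ipost_jointly_monic[OF alg_Obj[OF A] PO[OF XY(2)] Hm_hom[OF m] jm])
    show "ipost Y s \<cdot> vact (fst C) X Y \<in> hom V (VHom To X Y \<odot> ihom V X (snd C)) (ihom V Y (snd A))"
      "vact (fst A) X Y \<cdot> (\<one> (VHom To X Y) \<otimes> ipost X s) \<in> hom V (VHom To X Y \<odot> ihom V X (snd C)) (ihom V Y (snd A))"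
      using t by (simp_all add: hom_def)
    fix i assume i: "i \<in> K"
    note mh = Hm_hom[OF m[OF i]]
    note t' = t homD[OF mh] alg_act[OF B[OF i] XY]
    have ip: "ipost W (m i) \<cdot> ipost W s = ipost W (m i \<cdot> s)" if "W \<in> P" for W
      using ipost_comp[OF PO[OF that] s(1) mh] by simp
    have "ipost Y (m i) \<cdot> (ipost Y s \<cdot> vact (fst C) X Y) = ipost Y (m i \<cdot> s) \<cdot> vact (fst C) X Y"
      by (rule comp_reduce[OF ip[OF XY(2)]]) (use t' in simp_all)
    also have "\<dots> = vact (fst (B i)) X Y \<cdot> (\<one> (VHom To X Y) \<otimes> ipost X (m i \<cdot> s))"
      using s(2)[OF i] XY by (simp add: Hm_def)
    also have "\<dots> = (vact (fst (B i)) X Y \<cdot> (\<one> (VHom To X Y) \<otimes> ipost X (m i))) \<cdot> (\<one> (VHom To X Y) \<otimes> ipost X s)"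
      using t' ip[OF XY(1)] by simp
    also have "\<dots> = ipost Y (m i) \<cdot> (vact (fst A) X Y \<cdot> (\<one> (VHom To X Y) \<otimes> ipost X s))"
    proof -
      have "ipost Y (m i) \<cdot> vact (fst A) X Y = vact (fst (B i)) X Y \<cdot> (\<one> (VHom To X Y) \<otimes> ipost X (m i))"
        using m[OF i] XY by (simp add: Hm_def)
      from this[symmetric] show ?thesis using t' by simp
    qed
    finally show "ipost Y (m i) \<cdot> (ipost Y s \<cdot> vact (fst C) X Y) =
      ipost Y (m i) \<cdot> (vact (fst A) X Y \<cdot> (\<one> (VHom To X Y) \<otimes> ipost X s))" .
  qed
qed

lemma product_pair:
  assumes "is_product V K D Q p"
  shows "\<And>i. i \<in> K \<Longrightarrow> p i \<in> hom V Q (D i)"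
    "\<And>R f. R \<in> Obj V \<Longrightarrow> (\<And>i. i \<in> K \<Longrightarrow> f i \<in> hom V R (D i)) \<Longrightarrow> \<exists>u \<in> hom V R Q. \<forall>i \<in> K. p i \<cdot> u = f i"
    "\<And>R u v. u \<in> hom V R Q \<Longrightarrow> v \<in> hom V R Q \<Longrightarrow> (\<And>i. i \<in> K \<Longrightarrow> p i \<cdot> u = p i \<cdot> v) \<Longrightarrow> u = v"
proof -
  show p: "\<And>i. i \<in> K \<Longrightarrow> p i \<in> hom V Q (D i)" using assms by (simp add: is_product_def)
  have U: "\<exists>!u. u \<in> hom V R Q \<and> (\<forall>i \<in> K. p i \<cdot> u = r i)" if "R \<in> Obj V" "\<And>i. i \<in> K \<Longrightarrow> r i \<in> hom V R (D i)" for R r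
    using assms that unfolding is_product_def by simp
  then show "\<And>R f. R \<in> Obj V \<Longrightarrow> (\<And>i. i \<in> K \<Longrightarrow> f i \<in> hom V R (D i)) \<Longrightarrow> \<exists>u \<in> hom V R Q. \<forall>i \<in> K. p i \<cdot> u = f i" by blast
  show "u = v" if uv: "u \<in> hom V R Q" "v \<in> hom V R Q" "\<And>i. i \<in> K \<Longrightarrow> p i \<cdot> u = p i \<cdot> v" for R u v
    by (rule ex1_implies_unique[OF U[of R "\<lambda>i. p i \<cdot> v"]]) (use uv p comp_hom hom_Obj in \<open>auto\<close>)
qed

text \<open>An instance of \<open>creation\<close>, with \<open>d\<close> acting componentwise
  through the transposes of the projections.\<close>

lemma product_algebra:
  fixes K :: "'k set"
  assumes K: "small TYPE('u) K" and B: "\<And>i. i \<in> K \<Longrightarrow> B i \<in> VObj AT"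
  obtains R p where "R \<in> VObj AT" "is_product V K (\<lambda>i. snd (B i)) (snd R) p" "\<And>i. i \<in> K \<Longrightarrow> Hm R (B i) (p i)"
proof -
  obtain Q p where Q: "is_product V K (\<lambda>i. snd (B i)) Q p"
    by (rule product_exists[OF K, of "\<lambda>i. snd (B i)"]) (use B in auto)
  note pr = product_pair[OF Q]
  have QO: "Q \<in> Obj V" using Q by (simp add: is_product_def)
  obtain d where d: "d \<in> hom V (TO Q) Q" "\<And>i. i \<in> K \<Longrightarrow> p i \<cdot> d = ex (B i) (p i)"
    using pr(2)[OF TO_Obj[OF QO], of "\<lambda>i. ex (B i) (p i)"] ex_hom[OF B pr(1)] by blast
  show thesis
  proof (rule creation[OF QO B pr(1) pr(3) d])
    fix A assume A: "A \<in> VObj AT" "snd A = Q" "\<And>i. i \<in> K \<Longrightarrow> Hm A (B i) (p i)"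
    show thesis by (rule that[of A p]) (use A Q in simp_all)
  qed
qed

text \<open>Closure under products refers to products in the category of algebras.
  \<open>Hm_reflect\<close> shows that the mediating arrow into the underlying product is a
  homomorphism.\<close>

lemma A0_product:
  assumes R: "R \<in> VObj AT" and B: "\<And>i. i \<in> K \<Longrightarrow> B i \<in> VObj AT" and P: "is_product V K (\<lambda>i. snd (B i)) (snd R) p"
    and p: "\<And>i. i \<in> K \<Longrightarrow> Hm R (B i) (p i)"
  obtains p' where "is_product A0 K B R p'"
proof -
  note pr = product_pair[OF P]
  have "\<exists>g. g \<in> hom A0 R (B i) \<and> fo g = p i" if "i \<in> K" for i using fo_surj[OF R B[OF that] p[OF that]] by blast
  then obtain p' where p': "\<And>i. i \<in> K \<Longrightarrow> p' i \<in> hom A0 R (B i)" "\<And>i. i \<in> K \<Longrightarrow> fo (p' i) = p i" by metis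
  have "is_product A0 K B R p'"
    unfolding is_product_def
  proof (intro conjI ballI allI impI)
    show "R \<in> Obj A0" using R by simp
    show "p' i \<in> hom A0 R (B i)" if "i \<in> K" for i using p'(1)[OF that] .
    fix W r assume "W \<in> Obj A0" and r: "\<forall>i\<in>K. r i \<in> hom A0 W (B i)"
    then have W: "W \<in> VObj AT" by simp
    show "\<exists>!u. u \<in> hom A0 W R \<and> (\<forall>i\<in>K. p' i \<cdot>\<^bsub>A0\<^esub> u = r i)"
    proof (rule ex_ex1I)
      have rh: "Hm W (B i) (fo (r i))" if "i \<in> K" for i using r fo_Hm(3) that by blast
      obtain u where u: "u \<in> hom V (snd W) (snd R)" "\<And>i. i \<in> K \<Longrightarrow> p i \<cdot> u = fo (r i)"
        using pr(2)[of "snd W" "\<lambda>i. fo (r i)"] W Hm_hom[OF rh] by auto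
      have "Hm W R u" by (rule Hm_reflect[OF W R B p pr(3) u(1)]) (use u(2) rh in auto)
      then obtain v where v: "v \<in> hom A0 W R" "fo v = u" using fo_surj[OF W R] by blast
      have "p' i \<cdot>\<^bsub>A0\<^esub> v = r i" if i: "i \<in> K" for i
        by (rule fo_inj[OF fo_comp(1)[OF v(1) p'(1)[OF i]]]) (use r i fo_comp(2)[OF v(1) p'(1)[OF i]] v(2) p'(2) u(2) in auto)
      then show "\<exists>u. u \<in> hom A0 W R \<and> (\<forall>i\<in>K. p' i \<cdot>\<^bsub>A0\<^esub> u = r i)" using v(1) by blast
      fix x y assume x: "x \<in> hom A0 W R \<and> (\<forall>i\<in>K. p' i \<cdot>\<^bsub>A0\<^esub> x = r i)" and y: "y \<in> hom A0 W R \<and> (\<forall>i\<in>K. p' i \<cdot>\<^bsub>A0\<^esub> y = r i)"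
      then have xy: "x \<in> hom A0 W R" "y \<in> hom A0 W R" by simp_all
      have "fo x = fo y"
      proof (rule pr(3)[OF Hm_hom[OF fo_Hm(3)[OF xy(1)]] Hm_hom[OF fo_Hm(3)[OF xy(2)]]])
        fix i assume i: "i \<in> K"
        have "fo (p' i \<cdot>\<^bsub>A0\<^esub> x) = fo (p' i \<cdot>\<^bsub>A0\<^esub> y)" using x y i by simp
        then show "p i \<cdot> fo x = p i \<cdot> fo y"
          using fo_comp(2)[OF xy(1) p'(1)[OF i]] fo_comp(2)[OF xy(2) p'(1)[OF i]] p'(2)[OF i] by simp
      qed
      then show "x = y" by (rule fo_inj[OF xy])
    qed
  qed
  then show thesis by (rule that)
qed

end

section \<open>Coproducts, points and images in the discrete setting\<close>

lemma coproductD: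
  assumes "is_coproduct C K D Q c"
  shows "Q \<in> Obj C" "\<And>i. i \<in> K \<Longrightarrow> c i \<in> hom C (D i) Q"
    "\<And>R r. R \<in> Obj C \<Longrightarrow> (\<And>i. i \<in> K \<Longrightarrow> r i \<in> hom C (D i) R) \<Longrightarrow> \<exists>!u. u \<in> hom C Q R \<and> (\<forall>i \<in> K. u \<cdot>\<^bsub>C\<^esub> c i = r i)"
  using assms unfolding is_coproduct_def by simp_all

lemma (in cat) coproduct_arrows_eq:
  assumes "is_coproduct C K D Q c" "u \<in> hom C Q R" "v \<in> hom C Q R" "\<And>i. i \<in> K \<Longrightarrow> u \<cdot> c i = v \<cdot> c i"
  shows "u = v"
proof -
  have "\<exists>!w. w \<in> hom C Q R \<and> (\<forall>i \<in> K. w \<cdot> c i = v \<cdot> c i)"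
    by (rule coproductD(3)[OF assms(1)]) (use assms(3) hom_Obj comp_hom coproductD(2)[OF assms(1)] in blast)+
  then show ?thesis by (rule ex1_implies_unique) (use assms in simp_all)
qed

text \<open>The assumption \<open>disc\<close> is discreteness in the form delivered by
  \<open>discrete_point\<close> and \<open>discrete_point_transfer\<close>: for the given
  adjunction, \<open>Tm\<close> of the canonical arrow is onto on points.\<close>

locale discrete_setting = alg_adj V lam P T J F \<eta> \<epsilon> for V :: "('o, 'u) smcc" (structure) and lam :: "'u rel" and P T J F \<eta> \<epsilon> +
  fixes \<mu> :: "'u rel"
  assumes rep: "\<And>X. presentable lam V X \<Longrightarrow> \<exists>X' \<in> P. isomorphic V X X'"
    and disc: "\<And>X. X \<in> P \<Longrightarrow> \<exists>X\<^sub>0 \<delta>. is_discrete_cover V X X\<^sub>0 \<delta> \<and> (\<forall>x \<in> hom V \<I> (TO X). \<exists>y \<in> hom V \<I> (TO X\<^sub>0). Tm \<delta> \<cdot> y = x)"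
    and fs: "factorization_system V (Surj V) (Inj V)"
    and proper: "proper_factorization V (Surj V) (Inj V)"
    and mu: "small_regular_cardinal \<mu>"
    and lg: "Inj_locally_generated \<mu> V"
begin

lemma SurjD:
  assumes "f \<in> Surj V" "f \<in> hom V X Y" "y \<in> hom V \<I> Y" obtains x where "x \<in> hom V \<I> X" "f \<cdot> x = y"
proof -
  have "y \<in> (\<lambda>x. f \<cdot> x) ` hom V \<I> X" using assms homD[OF assms(2)] by (simp add: Surj_def)
  then show thesis using that by blast
qed

lemma SurjI:
  assumes "f \<in> hom V X Y" "\<And>y. y \<in> hom V \<I> Y \<Longrightarrow> \<exists>x \<in> hom V \<I> X. f \<cdot> x = y" shows "f \<in> Surj V"
  using assms homD[OF assms(1)] comp_hom[OF _ assms(1)] by (fastforce simp: Surj_def)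

text \<open>The unit is a generator: the canonical arrow from the copower of \<I> over all points of
  \<open>X\<close> is onto on points by construction, hence an epimorphism by properness.\<close>

lemma points_separate:
  assumes fg: "f \<in> hom V X Y" "g \<in> hom V X Y" and eq: "\<And>x. x \<in> hom V \<I> X \<Longrightarrow> f \<cdot> x = g \<cdot> x"
  shows "f = g"
proof -
  have X: "X \<in> Obj V" using fg hom_Obj by blast
  obtain X0 c where X0: "is_coproduct V (hom V \<I> X) (\<lambda>x. \<I>) X0 c"
    by (rule coproduct_exists[OF small_hom[OF unit_Obj X], of "\<lambda>_. \<I>"]) auto
  note cD = coproductD[OF X0]
  obtain \<delta> where \<delta>: "\<delta> \<in> hom V X0 X" "\<And>x. x \<in> hom V \<I> X \<Longrightarrow> \<delta> \<cdot> c x = x"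
    using cD(3)[OF X, of "\<lambda>x. x"] by blast
  have "\<delta> \<in> Surj V" by (rule SurjI[OF \<delta>(1)]) (use \<delta>(2) cD(2) in blast)
  then have "epi_arr V \<delta>" using proper by (simp add: proper_factorization_def)
  moreover have "f \<cdot> \<delta> = g \<cdot> \<delta>"
  proof (rule coproduct_arrows_eq[OF X0 comp_hom[OF \<delta>(1) fg(1)] comp_hom[OF \<delta>(1) fg(2)]])
    fix x assume x: "x \<in> hom V \<I> X"
    show "(f \<cdot> \<delta>) \<cdot> c x = (g \<cdot> \<delta>) \<cdot> c x"
      using eq[OF x] \<delta>(2)[OF x] homD[OF \<delta>(1)] homD[OF fg(1)] homD[OF fg(2)] homD[OF cD(2)[OF x]] by simp
  qed
  ultimately show "f = g" using fg homD[OF \<delta>(1)] unfolding epi_arr_def by metis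
qed

text \<open>A consequence of \<open>points_separate\<close>; it reduces the monomorphism needed for
  a subalgebra to a statement about points.\<close>

lemma mono_points:
  assumes m: "m \<in> hom V X Y" and inj: "\<And>x y. x \<in> hom V \<I> X \<Longrightarrow> y \<in> hom V \<I> X \<Longrightarrow> m \<cdot> x = m \<cdot> y \<Longrightarrow> x = y"
  shows "mono_arr V m"
  unfolding mono_arr_def
proof (intro conjI allI ballI impI)
  show "m \<in> Arr V" using homD[OF m] by simp
  fix W f g assume "f \<in> hom V W (Dom V m)" "g \<in> hom V W (Dom V m)" and eq: "m \<cdot> f = m \<cdot> g"
  then have fg: "f \<in> hom V W X" "g \<in> hom V W X" using homD[OF m] by simp_all
  show "f = g"
  proof (rule points_separate[OF fg])
    fix x assume x: "x \<in> hom V \<I> W"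
    have "m \<cdot> (f \<cdot> x) = m \<cdot> (g \<cdot> x)"
      using comp_permute[OF eq, of x] homD[OF m] homD[OF fg(1)] homD[OF fg(2)] homD[OF x] by simp
    then show "f \<cdot> x = g \<cdot> x" by (rule inj[OF comp_hom[OF x fg(1)] comp_hom[OF x fg(2)]])
  qed
qed

text \<open>This is where discreteness enters: a point of a free algebra already comes from the free
  algebra on a copower of the unit, along which surjections can be lifted.\<close>

lemma Tm_Surj:
  assumes s: "s \<in> Surj V" "s \<in> hom V X Y" shows "Tm s \<in> Surj V"
proof (rule SurjI[OF Tm_hom[OF s(2)]])
  fix t assume t: "t \<in> hom V \<I> (TO Y)"
  have O: "X \<in> Obj V" "Y \<in> Obj V" using s(2) hom_Obj by blast+
  obtain S r D d c where dd: "directed_diagram lam V (Arr V) S r D d" and D: "\<And>i. i \<in> S \<Longrightarrow> presentable lam V (D i)"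
    and cl: "is_colimit (poset_cat S r) V D d Y c" using presentable_colimit[OF O(2)] by blast
  obtain i t' where i: "i \<in> S" and t': "t' \<in> hom V \<I> (TO (D i))" "Tm (c i) \<cdot> t' = t"
    using free_point_factor[OF dd cl t] by blast
  note ci = poset_colimitD(2)[OF cl i]
  \<comment> \<open>The presentable stage is replaced by its representative in \<open>P\<close>, for
    which \<open>disc\<close> is available.\<close>
  obtain Z \<phi> where Z: "Z \<in> P" and \<phi>: "\<phi> \<in> hom V (D i) Z" "iso V \<phi>" using rep[OF D[OF i]] unfolding isomorphic_def by blast
  let ?\<psi> = "inv_arr V \<phi>"
  have \<psi>: "?\<psi> \<in> hom V Z (D i)" "?\<psi> \<cdot> \<phi> = \<one> (D i)" using homD[OF \<phi>(1)] \<phi>(2) by (simp_all add: hom_def)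
  have c': "c i \<cdot> ?\<psi> \<in> hom V Z Y" by (rule comp_hom[OF \<psi>(1) ci])
  obtain Z0 \<delta> where \<delta>: "is_discrete_cover V Z Z0 \<delta>" "\<forall>x \<in> hom V \<I> (TO Z). \<exists>y \<in> hom V \<I> (TO Z0). Tm \<delta> \<cdot> y = x"
    using disc[OF Z] by blast
  obtain y where y: "y \<in> hom V \<I> (TO Z0)" "Tm \<delta> \<cdot> y = Tm \<phi> \<cdot> t'"
    using \<delta>(2) comp_hom[OF t'(1) Tm_hom[OF \<phi>(1)]] by blast
  obtain k where k: "is_coproduct V (hom V \<I> Z) (\<lambda>x. \<I>) Z0 k" "\<delta> \<in> hom V Z0 Z" "\<forall>x \<in> hom V \<I> Z. \<delta> \<cdot> k x = x"
    using \<delta>(1) unfolding is_discrete_cover_def by blast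
  \<comment> \<open>An arrow out of \<open>Z\<close> itself may fail to lift along \<open>s\<close>,
    but one out of the copower \<open>Z0\<close> lifts: a preimage is chosen for the image of every
    point of \<open>Z\<close>, and the choices assemble to \<open>u\<close>.\<close>
  have "\<exists>x'. x' \<in> hom V \<I> X \<and> s \<cdot> x' = (c i \<cdot> ?\<psi>) \<cdot> x" if "x \<in> hom V \<I> Z" for x
    using SurjD[OF s comp_hom[OF that c']] by blast
  then obtain l where l: "\<And>x. x \<in> hom V \<I> Z \<Longrightarrow> l x \<in> hom V \<I> X" "\<And>x. x \<in> hom V \<I> Z \<Longrightarrow> s \<cdot> l x = (c i \<cdot> ?\<psi>) \<cdot> x" by metis
  obtain u where u: "u \<in> hom V Z0 X" "\<And>x. x \<in> hom V \<I> Z \<Longrightarrow> u \<cdot> k x = l x"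
    using coproductD(3)[OF k(1) O(1), of l] l(1) by blast
  have su: "s \<cdot> u = (c i \<cdot> ?\<psi>) \<cdot> \<delta>"
  proof (rule coproduct_arrows_eq[OF k(1) comp_hom[OF u(1) s(2)] comp_hom[OF k(2) c']])
    fix x assume x: "x \<in> hom V \<I> Z"
    note kx = coproductD(2)[OF k(1) x]
    have "(s \<cdot> u) \<cdot> k x = s \<cdot> l x" using homD[OF s(2)] homD[OF u(1)] homD[OF kx] u(2)[OF x] by simp
    also have "\<dots> = (c i \<cdot> ?\<psi>) \<cdot> (\<delta> \<cdot> k x)" using l(2)[OF x] k(3) x by simp
    also have "\<dots> = ((c i \<cdot> ?\<psi>) \<cdot> \<delta>) \<cdot> k x" using homD[OF ci] homD[OF \<psi>(1)] homD[OF k(2)] homD[OF kx] by simp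
    finally show "(s \<cdot> u) \<cdot> k x = ((c i \<cdot> ?\<psi>) \<cdot> \<delta>) \<cdot> k x" .
  qed
  have "Tm s \<cdot> (Tm u \<cdot> y) = Tm (s \<cdot> u) \<cdot> y"
    using homD[OF Tm_hom[OF s(2)]] homD[OF Tm_hom[OF u(1)]] homD[OF y(1)] by (simp add: Tm_comp[OF u(1) s(2)])
  also have "\<dots> = (Tm (c i \<cdot> ?\<psi>) \<cdot> Tm \<delta>) \<cdot> y" unfolding su by (simp only: Tm_comp[OF k(2) c'])
  also have "\<dots> = Tm (c i \<cdot> ?\<psi>) \<cdot> (Tm \<phi> \<cdot> t')"
    using homD[OF Tm_hom[OF c']] homD[OF Tm_hom[OF k(2)]] homD[OF y(1)] y(2) by simp
  also have "\<dots> = Tm ((c i \<cdot> ?\<psi>) \<cdot> \<phi>) \<cdot> t'"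
    using homD[OF Tm_hom[OF c']] homD[OF Tm_hom[OF \<phi>(1)]] homD[OF t'(1)] by (simp only: Tm_comp[OF \<phi>(1) c']) simp
  also have "(c i \<cdot> ?\<psi>) \<cdot> \<phi> = c i" using homD[OF ci] homD[OF \<psi>(1)] homD[OF \<phi>(1)] \<psi>(2) by simp
  finally have "Tm s \<cdot> (Tm u \<cdot> y) = t" using t'(2) by simp
  then show "\<exists>x \<in> hom V \<I> (TO X). Tm s \<cdot> x = t" using comp_hom[OF y(1) Tm_hom[OF u(1)]] by blast
qed

text \<open>The induced arrow into the product of the \<open>B i\<close> is factored as a surjection
  followed by an injection. The algebra structure on the middle object is a diagonal fill-in, since
  \<open>Tm s\<close> is again a surjection by \<open>Tm_Surj\<close> and so orthogonal to the
  injection.\<close>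

lemma image_algebra:
  fixes K :: "'k set"
  assumes K: "small TYPE('u) K" and B: "\<And>i. i \<in> K \<Longrightarrow> B i \<in> VObj AT" and X: "X \<in> Obj V" and h: "\<And>i. i \<in> K \<Longrightarrow> Hm (FOb F X) (B i) (h i)"
  obtains A s m where "A \<in> VObj AT" "Hm (FOb F X) A s" "s \<in> Surj V"
    "\<And>i. i \<in> K \<Longrightarrow> Hm A (B i) (m i)" "\<And>i. i \<in> K \<Longrightarrow> m i \<cdot> s = h i"
    "\<And>W f g. f \<in> hom V W (snd A) \<Longrightarrow> g \<in> hom V W (snd A) \<Longrightarrow> (\<And>i. i \<in> K \<Longrightarrow> m i \<cdot> f = m i \<cdot> g) \<Longrightarrow> f = g"
proof -
  obtain Q p where Q: "is_product V K (\<lambda>i. snd (B i)) Q p"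
    by (rule product_exists[OF K, of "\<lambda>i. snd (B i)"]) (use B in auto)
  note pr = product_pair[OF Q]
  have QO: "Q \<in> Obj V" using Q by (simp add: is_product_def)
  have FX: "FOb F X \<in> VObj AT" using X by simp
  obtain g where g: "g \<in> hom V (TO X) Q" "\<And>i. i \<in> K \<Longrightarrow> p i \<cdot> g = h i"
    using pr(2)[OF TO_Obj[OF X], of h] Hm_hom[OF h] by blast
  obtain s m where s: "s \<in> Surj V" and m: "m \<in> Inj V" and sm: "Cod V s = Dom V m" "g = m \<cdot> s"
    using fs homD[OF g(1)] unfolding factorization_system_def by metis
  define S where "S = Cod V s"
  have sA: "s \<in> Arr V" "m \<in> Arr V" using s m by (auto simp: Surj_def Inj_def)
  have sh: "s \<in> hom V (TO X) S" and mh: "m \<in> hom V S Q"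
    using homD[OF g(1)] sA sm by (auto simp: hom_def S_def)
  have SO: "S \<in> Obj V" using sh hom_Obj by blast
  have mm: "mono_arr V m" using proper m by (simp add: proper_factorization_def)
  have mi: "p i \<cdot> m \<in> hom V S (snd (B i))" if "i \<in> K" for i using comp_hom[OF mh pr(1)[OF that]] .
  have jm: "f = f'" if f: "f \<in> hom V W S" "f' \<in> hom V W S" "\<And>i. i \<in> K \<Longrightarrow> (p i \<cdot> m) \<cdot> f = (p i \<cdot> m) \<cdot> f'" for W f f'
  proof -
    have "m \<cdot> f = m \<cdot> f'"
      by (rule pr(3)[OF comp_hom[OF f(1) mh] comp_hom[OF f(2) mh]])
        (use f(3) homD[OF mh] homD[OF f(1)] homD[OF f(2)] homD[OF pr(1)] in simp)
    then show ?thesis using mm f(1,2) homD[OF mh] unfolding mono_arr_def by metis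
  qed
  have hi: "(p i \<cdot> m) \<cdot> s = h i" if "i \<in> K" for i
    using g(2)[OF that] sm(2) homD[OF pr(1)[OF that]] homD[OF mh] homD[OF sh] by simp
  obtain v where v: "v \<in> hom V (TO S) Q" "\<And>i. i \<in> K \<Longrightarrow> p i \<cdot> v = ex (B i) (p i \<cdot> m)"
    using pr(2)[OF TO_Obj[OF SO], of "\<lambda>i. ex (B i) (p i \<cdot> m)"] ex_hom[OF B mi] by blast
  note Ts = Tm_hom[OF sh] and eX = Hm_hom[OF eps_Hm[OF FX]]
  \<comment> \<open>The square whose diagonal is the structure arrow: the counit of the free algebra
    followed by \<open>s\<close> on one side, the componentwise structure \<open>v\<close> on the
    other.\<close>
  have sq: "m \<cdot> (s \<cdot> eps (FOb F X)) = v \<cdot> Tm s"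
  proof (rule pr(3))
    show "m \<cdot> (s \<cdot> eps (FOb F X)) \<in> hom V (TO (TO X)) Q" "v \<cdot> Tm s \<in> hom V (TO (TO X)) Q"
      using comp_hom[OF comp_hom[OF eX sh] mh] comp_hom[OF Ts v(1)] .
    fix i assume i: "i \<in> K"
    note t = homD[OF pr(1)[OF i]] homD[OF mh] homD[OF sh] homD[OF eX] homD[OF Ts] homD[OF v(1)] homD[OF ex_hom[OF B[OF i] mi[OF i]]]
    have "p i \<cdot> (m \<cdot> (s \<cdot> eps (FOb F X))) = ((p i \<cdot> m) \<cdot> s) \<cdot> eps (FOb F X)" using t by simp
    also have "\<dots> = eps (B i) \<cdot> Tm (h i)" unfolding hi[OF i] by (rule eps_nat[OF FX B[OF i] h[OF i], symmetric])
    also have "\<dots> = ex (B i) (p i \<cdot> m) \<cdot> Tm s"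
      using ex_Tm[OF B[OF i] mi[OF i] sh] hi[OF i] by (simp add: ex_def)
    also have "\<dots> = p i \<cdot> (v \<cdot> Tm s)" using t by (simp add: v(2)[OF i, symmetric])
    finally show "p i \<cdot> (m \<cdot> (s \<cdot> eps (FOb F X))) = p i \<cdot> (v \<cdot> Tm s)" .
  qed
  have "unique_lifting V (Tm s) m" using m Tm_Surj[OF s sh] by (simp add: Inj_def)
  then obtain d where d: "d \<in> hom V (TO S) S" "m \<cdot> d = v"
    using sq comp_hom[OF eX sh] v(1) homD[OF Ts] homD[OF mh] unfolding unique_lifting_def by metis
  have md: "(p i \<cdot> m) \<cdot> d = ex (B i) (p i \<cdot> m)" if "i \<in> K" for i
    using v(2)[OF that] d homD[OF d(1)] homD[OF mh] homD[OF pr(1)[OF that]] by simp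
  show thesis
  proof (rule creation[OF SO B mi jm d(1) md])
    fix A assume A: "A \<in> VObj AT" "snd A = S" "\<And>i. i \<in> K \<Longrightarrow> Hm A (B i) (p i \<cdot> m)"
    have "Hm (FOb F X) A s"
      by (rule Hm_reflect[OF FX A(1) B A(3)]) (use jm A(2) sh hi h in auto)
    then show thesis
      by (rule that[OF A(1) _ s A(3) hi]) (use jm A(2) in auto)
  qed
qed

end

section \<open>Equational classes and Birkhoff subcategories\<close>

lemma regular_stable: "small_regular_cardinal m \<Longrightarrow> stable m"
  unfolding small_regular_cardinal_def cinfinite_def by (blast intro: regularCard_stable)

context alg_adj
begin

text \<open>A coproduct is the directed colimit of its subcoproducts with fewer than \<open>lam\<close> summands
  besides those over \<open>B\<^sub>0\<close>.\<close>

lemma subcoproduct_point: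
  fixes K :: "'u set"
  assumes K: "small TYPE('u) K" and D: "\<And>i. i \<in> K \<Longrightarrow> D i \<in> Obj V" and X: "is_coproduct V K D X c"
    and B\<^sub>0: "B\<^sub>0 \<subseteq> K" and t: "t \<in> hom V \<I> (TO X)"
  obtains K' where "B\<^sub>0 \<subseteq> K'" "K' \<subseteq> K" "|K' - B\<^sub>0| <o lam"
    "\<And>K'' X' c' j. K' \<subseteq> K'' \<Longrightarrow> K'' \<subseteq> K \<Longrightarrow> is_coproduct V K'' D X' c' \<Longrightarrow> j \<in> hom V X' X \<Longrightarrow> (\<And>i. i \<in> K'' \<Longrightarrow> j \<cdot> c' i = c i) \<Longrightarrow>
      \<exists>t' \<in> hom V \<I> (TO X'). Tm j \<cdot> t' = t"
proof -
  define \<S> where "\<S> = {K'. B\<^sub>0 \<subseteq> K' \<and> K' \<subseteq> K \<and> |K' - B\<^sub>0| <o lam}"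
  have smS: "small TYPE('u) \<S>" by (rule small_mono[OF small_Pow[OF univ K]]) (auto simp: \<S>_def)
  obtain enc :: "'u set \<Rightarrow> 'u" where enc: "inj_on enc \<S>" using small_code[OF smS] by blast
  define dec where "dec = inv_into \<S> enc"
  have dec [simp]: "dec (enc K') = K'" if "K' \<in> \<S>" for K' using that enc by (simp add: dec_def)
  define S where "S = enc ` \<S>"
  have decS: "dec x \<in> \<S>" "enc (dec x) = x" if "x \<in> S" for x using that by (auto simp: S_def)
  define r where "r = {(x, y). x \<in> S \<and> y \<in> S \<and> dec x \<subseteq> dec y}"
  have KS: "K' \<subseteq> K" if "K' \<in> \<S>" for K' using that by (simp add: \<S>_def)
  have single: "insert i B\<^sub>0 \<in> \<S>" if "i \<in> K" for i
  proof -
    have "|{i}| <o lam" using regular_two[OF lam, of i i] by simp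
    moreover have "|insert i B\<^sub>0 - B\<^sub>0| \<le>o |{i}|" by (rule card_of_mono1) auto
    ultimately have "|insert i B\<^sub>0 - B\<^sub>0| <o lam" by (rule ordLeq_ordLess_trans[rotated])
    then show ?thesis using that B\<^sub>0 by (auto simp: \<S>_def)
  qed
  have "\<exists>q. is_coproduct V K' D (fst q) (snd q)" if K': "K' \<in> \<S>" for K'
  proof -
    have "small TYPE('u) K'" by (rule small_mono[OF K KS[OF K']])
    then obtain Q c where "is_coproduct V K' D Q c" by (rule coproduct_exists[of K' D]) (use D KS[OF K'] in auto)
    then show ?thesis by (intro exI[of _ "(Q, c)"]) simp
  qed
  then obtain q where q: "\<And>K'. K' \<in> \<S> \<Longrightarrow> is_coproduct V K' D (fst (q K')) (snd (q K'))" by metis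
  define CX where "CX K' = fst (q K')" for K'
  define Cc where "Cc K' = snd (q K')" for K'
  have cp: "is_coproduct V K' D (CX K') (Cc K')" if "K' \<in> \<S>" for K' using q[OF that] by (simp add: CX_def Cc_def)
  note cpD = coproductD[OF cp] and XD = coproductD[OF X]
  have "\<exists>u. u \<in> hom V (CX K1) (CX K2) \<and> (\<forall>i \<in> K1. u \<cdot> Cc K1 i = Cc K2 i)" if "K1 \<in> \<S>" "K2 \<in> \<S>" "K1 \<subseteq> K2" for K1 K2
    using cpD(3)[OF that(1) cpD(1)[OF that(2)], of "Cc K2"] cpD(2)[OF that(2)] that(3) by blast
  then obtain inc where inc: "\<And>K1 K2. K1 \<in> \<S> \<Longrightarrow> K2 \<in> \<S> \<Longrightarrow> K1 \<subseteq> K2 \<Longrightarrow> inc K1 K2 \<in> hom V (CX K1) (CX K2)"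
    "\<And>K1 K2 i. K1 \<in> \<S> \<Longrightarrow> K2 \<in> \<S> \<Longrightarrow> K1 \<subseteq> K2 \<Longrightarrow> i \<in> K1 \<Longrightarrow> inc K1 K2 \<cdot> Cc K1 i = Cc K2 i"
    by metis
  have "\<exists>u. u \<in> hom V (CX K1) X \<and> (\<forall>i \<in> K1. u \<cdot> Cc K1 i = c i)" if "K1 \<in> \<S>" for K1
    using cpD(3)[OF that XD(1), of c] XD(2) KS[OF that] by blast
  then obtain J where J: "\<And>K1. K1 \<in> \<S> \<Longrightarrow> J K1 \<in> hom V (CX K1) X" "\<And>K1 i. K1 \<in> \<S> \<Longrightarrow> i \<in> K1 \<Longrightarrow> J K1 \<cdot> Cc K1 i = c i"
    by metis
  have comp: "(g \<cdot> f) \<cdot> Cc K1 i = g \<cdot> (f \<cdot> Cc K1 i)" if "K1 \<in> \<S>" "i \<in> K1" "f \<in> hom V (CX K1) Y" "g \<in> hom V Y Z" for K1 i f g Y Z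
    using homD[OF cpD(2)[OF that(1,2)]] homD[OF that(3)] homD[OF that(4)] by simp
  have dp: "directed_poset lam S r"
    unfolding directed_poset_def
  proof (intro conjI allI impI)
    show "small TYPE('u) S" using small_image[OF smS] by (simp add: S_def)
    show "r \<subseteq> S \<times> S" by (auto simp: r_def)
    show "partial_order_on S r"
      unfolding partial_order_on_def preorder_on_def
    proof (intro conjI)
      show "refl_on S r" by (auto simp: refl_on_def r_def)
      show "trans r" by (auto simp: trans_def r_def)
      show "antisym r" unfolding antisym_def r_def using decS(2) by (metis (mono_tags, lifting) case_prodD mem_Collect_eq subset_antisym)
    qed (auto simp: r_def)
    fix A assume A: "A \<subseteq> S" "|A| <o lam"
    \<comment> \<open>Adding \<open>B\<^sub>0\<close> explicitly makes the union of the empty family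
      a member of \<open>\<S>\<close> as well.\<close>
    let ?U = "B\<^sub>0 \<union> (\<Union>a\<in>A. dec a)"
    have "|\<Union>a\<in>A. dec a - B\<^sub>0| <o lam"
      using stable_UNION[OF regular_stable[OF lam] A(2), of "\<lambda>a. dec a - B\<^sub>0"] A(1) decS(1) by (auto simp: \<S>_def)
    moreover have "?U - B\<^sub>0 = (\<Union>a\<in>A. dec a - B\<^sub>0)" by blast
    ultimately have "?U \<in> \<S>" using A(1) decS(1) B\<^sub>0 by (auto simp: \<S>_def)
    then show "\<exists>u \<in> S. \<forall>a \<in> A. (a, u) \<in> r" using A(1) by (intro bexI[of _ "enc ?U"]) (auto simp: r_def S_def)
  qed
  have dd: "directed_diagram lam V (Arr V) S r (\<lambda>x. CX (dec x)) (\<lambda>a. inc (dec (fst a)) (dec (snd a)))"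
    unfolding directed_diagram_def is_functor_def
  proof (intro conjI ballI allI)
    show "directed_poset lam S r" "category (poset_cat S r)" "category V" using dp poset_category[OF dp] category by simp_all
    fix x assume "x \<in> Obj (poset_cat S r)"
    then have x: "dec x \<in> \<S>" using decS by simp
    show "CX (dec x) \<in> Obj V" by (rule cpD(1)[OF x])
    show "inc (dec (fst (Ide (poset_cat S r) x))) (dec (snd (Ide (poset_cat S r) x))) = \<one> (CX (dec x))"
      by (rule coproduct_arrows_eq[OF cp[OF x]])
        (use inc[OF x x] cpD(1)[OF x] Ide_hom homD[OF cpD(2)[OF x]] in auto)
  next
    fix x y a assume "a \<in> hom (poset_cat S r) x y"
    then have "a = (x, y)" "x \<in> S" "y \<in> S" "dec x \<subseteq> dec y" by (auto simp: poset_hom r_def split: if_splits)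
    then show "inc (dec (fst a)) (dec (snd a)) \<in> hom V (CX (dec x)) (CX (dec y))" using inc(1) decS(1) by simp
  next
    fix x y z a b assume "a \<in> hom (poset_cat S r) x y" "b \<in> hom (poset_cat S r) y z"
    then have ab: "a = (x, y)" "b = (y, z)" and S: "x \<in> S" "y \<in> S" "z \<in> S" and le: "dec x \<subseteq> dec y" "dec y \<subseteq> dec z"
      by (auto simp: poset_hom r_def split: if_splits)
    note d = decS(1)[OF S(1)] decS(1)[OF S(2)] decS(1)[OF S(3)]
    have le': "dec x \<subseteq> dec z" using le by blast
    have "inc (dec x) (dec z) = inc (dec y) (dec z) \<cdot> inc (dec x) (dec y)"
    proof (rule coproduct_arrows_eq[OF cp[OF d(1)] inc(1)[OF d(1,3) le'] comp_hom[OF inc(1)[OF d(1,2) le(1)] inc(1)[OF d(2,3) le(2)]]])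
      fix i assume i: "i \<in> dec x"
      then show "inc (dec x) (dec z) \<cdot> Cc (dec x) i = (inc (dec y) (dec z) \<cdot> inc (dec x) (dec y)) \<cdot> Cc (dec x) i"
        using comp[OF d(1) i inc(1)[OF d(1,2) le(1)] inc(1)[OF d(2,3) le(2)]] inc(2)[OF d(1,3) le' i] inc(2)[OF d(1,2) le(1) i]
          inc(2)[OF d(2,3) le(2)] le(1) by auto
    qed
    then show "inc (dec (fst (b \<cdot>\<^bsub>poset_cat S r\<^esub> a))) (dec (snd (b \<cdot>\<^bsub>poset_cat S r\<^esub> a))) =
      inc (dec (fst b)) (dec (snd b)) \<cdot> inc (dec (fst a)) (dec (snd a))" by (simp add: ab)
  next
    show "(\<lambda>a. inc (dec (fst a)) (dec (snd a))) ` r \<subseteq> Arr V"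
      using homD[OF inc(1)] decS(1) by (auto simp: r_def)
  qed
  have cl: "is_colimit (poset_cat S r) V (\<lambda>x. CX (dec x)) (\<lambda>a. inc (dec (fst a)) (dec (snd a))) X (\<lambda>x. J (dec x))"
    unfolding is_colimit_def
  proof (intro conjI allI impI)
    show "is_cocone (poset_cat S r) V (\<lambda>x. CX (dec x)) (\<lambda>a. inc (dec (fst a)) (dec (snd a))) X (\<lambda>x. J (dec x))"
    proof (rule poset_coconeI[OF XD(1)])
      show "J (dec x) \<in> hom V (CX (dec x)) X" if "x \<in> S" for x using J(1) decS(1)[OF that] by simp
      fix x y assume "(x, y) \<in> r"
      then have S: "x \<in> S" "y \<in> S" and le: "dec x \<subseteq> dec y" by (auto simp: r_def)
      note d = decS(1)[OF S(1)] decS(1)[OF S(2)]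
      show "J (dec y) \<cdot> inc (dec (fst (x, y))) (dec (snd (x, y))) = J (dec x)"
        unfolding fst_conv snd_conv
      proof (rule coproduct_arrows_eq[OF cp[OF d(1)] comp_hom[OF inc(1)[OF d le] J(1)[OF d(2)]] J(1)[OF d(1)]])
        fix i assume i: "i \<in> dec x"
        then show "(J (dec y) \<cdot> inc (dec x) (dec y)) \<cdot> Cc (dec x) i = J (dec x) \<cdot> Cc (dec x) i"
          using comp[OF d(1) i inc(1)[OF d le] J(1)[OF d(2)]] inc(2)[OF d le i] J(2)[OF d(1) i] J(2)[OF d(2)] le by auto
      qed
    qed
    fix R b assume cc: "is_cocone (poset_cat S r) V (\<lambda>x. CX (dec x)) (\<lambda>a. inc (dec (fst a)) (dec (snd a))) R b"
    then have R: "R \<in> Obj V" and b: "\<And>x. x \<in> S \<Longrightarrow> b x \<in> hom V (CX (dec x)) R" by (simp_all add: is_cocone_def)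
    have bn: "b y \<cdot> inc (dec x) (dec y) = b x" if "(x, y) \<in> r" for x y
    proof -
      have "(x, y) \<in> hom (poset_cat S r) x y" using that by (simp add: poset_hom)
      then have "b y \<cdot> inc (dec (fst (x, y))) (dec (snd (x, y))) = b x" using cc unfolding is_cocone_def by blast
      then show ?thesis by simp
    qed
    have bK: "b (enc K1) \<in> hom V (CX K1) R" if "K1 \<in> \<S>" for K1 using b[of "enc K1"] that by (simp add: S_def)
    have bnK: "b (enc K2) \<cdot> inc K1 K2 = b (enc K1)" if "K1 \<in> \<S>" "K2 \<in> \<S>" "K1 \<subseteq> K2" for K1 K2
      using bn[of "enc K1" "enc K2"] that by (simp add: r_def S_def)
    \<comment> \<open>The arrow on the summand \<open>i\<close> is read off at the smallest
      admissible index set containing \<open>i\<close>; by \<open>re\<close> every other admissible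
      set gives the same arrow.\<close>
    let ?r = "\<lambda>i. b (enc (insert i B\<^sub>0)) \<cdot> Cc (insert i B\<^sub>0) i"
    have rh: "?r i \<in> hom V (D i) R" if "i \<in> K" for i
      using comp_hom[OF cpD(2)[OF single[OF that]] bK[OF single[OF that]]] by simp
    have re: "?r i = b (enc K1) \<cdot> Cc K1 i" if "K1 \<in> \<S>" "i \<in> K1" for K1 i
    proof -
      have iK: "i \<in> K" using KS[OF that(1)] that(2) by blast
      have le: "insert i B\<^sub>0 \<subseteq> K1" using that by (auto simp: \<S>_def)
      have "?r i = (b (enc K1) \<cdot> inc (insert i B\<^sub>0) K1) \<cdot> Cc (insert i B\<^sub>0) i" by (simp only: bnK[OF single[OF iK] that(1) le])
      also have "\<dots> = b (enc K1) \<cdot> (inc (insert i B\<^sub>0) K1 \<cdot> Cc (insert i B\<^sub>0) i)"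
        by (rule comp[OF single[OF iK] _ inc(1)[OF single[OF iK] that(1) le] bK[OF that(1)]]) simp
      also have "\<dots> = b (enc K1) \<cdot> Cc K1 i" using inc(2)[OF single[OF iK] that(1) le, of i] by simp
      finally show ?thesis .
    qed
    have ex1: "\<exists>!u. u \<in> hom V X R \<and> (\<forall>i \<in> K. u \<cdot> c i = ?r i)" by (rule XD(3)[OF R rh])
    have iff: "(\<forall>x \<in> S. u \<cdot> J (dec x) = b x) \<longleftrightarrow> (\<forall>i \<in> K. u \<cdot> c i = ?r i)" if u: "u \<in> hom V X R" for u
    proof
      assume h: "\<forall>x \<in> S. u \<cdot> J (dec x) = b x"
      show "\<forall>i \<in> K. u \<cdot> c i = ?r i"
      proof
        fix i assume i: "i \<in> K"
        let ?K = "insert i B\<^sub>0"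
        have "u \<cdot> J ?K = b (enc ?K)" using h single[OF i] dec[OF single[OF i]] unfolding S_def by (metis imageI)
        then have "(u \<cdot> J ?K) \<cdot> Cc ?K i = ?r i" by simp
        then show "u \<cdot> c i = ?r i"
          using comp[OF single[OF i] _ J(1)[OF single[OF i]] u, of i] J(2)[OF single[OF i], of i] by simp
      qed
    next
      assume h: "\<forall>i \<in> K. u \<cdot> c i = ?r i"
      show "\<forall>x \<in> S. u \<cdot> J (dec x) = b x"
      proof
        fix x assume x: "x \<in> S"
        note d = decS(1)[OF x]
        show "u \<cdot> J (dec x) = b x"
        proof (rule coproduct_arrows_eq[OF cp[OF d] comp_hom[OF J(1)[OF d] u] b[OF x]])
          fix i assume i: "i \<in> dec x"
          have iK: "i \<in> K" using KS[OF d] i by blast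
          have "(u \<cdot> J (dec x)) \<cdot> Cc (dec x) i = u \<cdot> c i" using comp[OF d i J(1)[OF d] u] J(2)[OF d i] by simp
          also have "\<dots> = b (enc (dec x)) \<cdot> Cc (dec x) i" using h iK re[OF d i] by simp
          finally show "(u \<cdot> J (dec x)) \<cdot> Cc (dec x) i = b x \<cdot> Cc (dec x) i" by (simp add: decS(2)[OF x])
        qed
      qed
    qed
    show "\<exists>!u. u \<in> hom V X R \<and> (\<forall>x \<in> Obj (poset_cat S r). u \<cdot> J (dec x) = b x)"
      using ex1 iff by (metis (no_types, lifting) poset_cat_simps(1))
  qed
  obtain x t' where x: "x \<in> S" and t': "t' \<in> hom V \<I> (TO (CX (dec x)))" "Tm (J (dec x)) \<cdot> t' = t"
    using free_point_factor[OF dd cl t] by blast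
  note d = decS(1)[OF x]
  show thesis
  proof (rule that[of "dec x"])
    show "B\<^sub>0 \<subseteq> dec x" "dec x \<subseteq> K" "|dec x - B\<^sub>0| <o lam" using d by (auto simp: \<S>_def)
    fix K'' X' c' j assume K'': "dec x \<subseteq> K''" "K'' \<subseteq> K" and X': "is_coproduct V K'' D X' c'" and j: "j \<in> hom V X' X"
      "\<And>i. i \<in> K'' \<Longrightarrow> j \<cdot> c' i = c i"
    \<comment> \<open>Larger index sets work too, because the coproduct over \<open>dec x\<close>
      maps into the one over \<open>K''\<close> compatibly with the arrows to \<open>X\<close>. This
      is what later allows two points to be treated on a common subcoproduct.\<close>
    obtain u where u: "u \<in> hom V (CX (dec x)) X'" "\<And>i. i \<in> dec x \<Longrightarrow> u \<cdot> Cc (dec x) i = c' i"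
      using cpD(3)[OF d coproductD(1)[OF X'], of c'] coproductD(2)[OF X'] K''(1) by blast
    have "j \<cdot> u = J (dec x)"
    proof (rule coproduct_arrows_eq[OF cp[OF d] comp_hom[OF u(1) j(1)] J(1)[OF d]])
      fix i assume i: "i \<in> dec x"
      then show "(j \<cdot> u) \<cdot> Cc (dec x) i = J (dec x) \<cdot> Cc (dec x) i"
        using comp[OF d i u(1) j(1)] u(2) j(2) J(2)[OF d i] K''(1) by auto
    qed
    then have "Tm j \<cdot> (Tm u \<cdot> t') = t"
      using Tm_comp[OF u(1) j(1)] homD[OF Tm_hom[OF u(1)]] homD[OF Tm_hom[OF j(1)]] homD[OF t'(1)] t'(2)
      by (metis comp_assoc)
    then show "\<exists>t' \<in> hom V \<I> (TO X'). Tm j \<cdot> t' = t" using comp_hom[OF t'(1) Tm_hom[OF u(1)]] by blast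
  qed
qed

section \<open>Equational classes are Birkhoff subcategories\<close>

lemma A0_assoc:
  assumes "f \<in> hom A0 A B" "g \<in> hom A0 B C" "h \<in> hom A0 C D"
  shows "(h \<cdot>\<^bsub>A0\<^esub> g) \<cdot>\<^bsub>A0\<^esub> f = h \<cdot>\<^bsub>A0\<^esub> (g \<cdot>\<^bsub>A0\<^esub> f)"
proof (rule fo_inj)
  note fg = fo_comp[OF assms(1,2)] and gh = fo_comp[OF assms(2,3)]
  show "(h \<cdot>\<^bsub>A0\<^esub> g) \<cdot>\<^bsub>A0\<^esub> f \<in> hom A0 A D" "h \<cdot>\<^bsub>A0\<^esub> (g \<cdot>\<^bsub>A0\<^esub> f) \<in> hom A0 A D"
    using fo_comp(1)[OF assms(1) gh(1)] fo_comp(1)[OF fg(1) assms(3)] .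
  show "fo ((h \<cdot>\<^bsub>A0\<^esub> g) \<cdot>\<^bsub>A0\<^esub> f) = fo (h \<cdot>\<^bsub>A0\<^esub> (g \<cdot>\<^bsub>A0\<^esub> f))"
    using fo_comp(2)[OF assms(1) gh(1)] fo_comp(2)[OF fg(1) assms(3)] fg(2) gh(2)
      homD[OF Hm_hom[OF fo_Hm(3)[OF assms(1)]]] homD[OF Hm_hom[OF fo_Hm(3)[OF assms(2)]]] homD[OF Hm_hom[OF fo_Hm(3)[OF assms(3)]]]
    by simp
qed

text \<open>The shape of the equations matters for \<mu>-pure quotients. As \<open>?X\<close> is a
  coproduct of \<mu>-generated objects, an arrow from it to the quotient lifts summand by summand,
  so a homomorphism from the free algebra on \<open>?X\<close> factors through the quotient map and
  inherits the equation. Split epimorphisms are covered, being \<mu>-pure.\<close>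

lemma equational_class_mu_Birkhoff:
  assumes E: "equational_theory V P T J F E" and cl: "\<forall>q \<in> E. clustered \<mu> V q"
    and L: "L = equational_class V P T J F E" and fr: "full_replete A0 L"
  shows "mu_Birkhoff \<mu> V P T J L"
proof -
  have LD: "A \<in> L \<longleftrightarrow> A \<in> VObj AT \<and> (\<forall>q \<in> E. \<forall>h \<in> hom A0 (FOb F (eq_cod q)) A. h \<cdot>\<^bsub>A0\<^esub> eq_lhs q = h \<cdot>\<^bsub>A0\<^esub> eq_rhs q)" for A
    unfolding L equational_class_def satisfies_def by simp
  have q: "eq_lhs q \<in> hom A0 (FOb F (eq_dom q)) (FOb F (eq_cod q))" "eq_rhs q \<in> hom A0 (FOb F (eq_dom q)) (FOb F (eq_cod q))"
    "eq_cod q \<in> Obj V" if "q \<in> E" for q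
    using E that by (simp_all add: equational_theory_def is_equation_def)
  have prod: "Q \<in> L" if D: "D ` K \<subseteq> L" and Q: "is_product A0 K D Q p" for K :: "'u set" and D Q p
    unfolding LD
  proof (intro conjI ballI)
    show "Q \<in> VObj AT" using Q by (simp add: is_product_def)
    have p: "p i \<in> hom A0 Q (D i)" if "i \<in> K" for i using Q that by (simp add: is_product_def)
    fix q h assume qE: "q \<in> E" and h: "h \<in> hom A0 (FOb F (eq_cod q)) Q"
    note l = q(1)[OF qE] and r = q(2)[OF qE]
    have "\<exists>!u. u \<in> hom A0 (FOb F (eq_dom q)) Q \<and> (\<forall>i \<in> K. p i \<cdot>\<^bsub>A0\<^esub> u = p i \<cdot>\<^bsub>A0\<^esub> (h \<cdot>\<^bsub>A0\<^esub> eq_lhs q))"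
      using Q fo_comp(1)[OF fo_comp(1)[OF l h] p] fo_Hm(1)[OF l] unfolding is_product_def by simp
    then show "h \<cdot>\<^bsub>A0\<^esub> eq_lhs q = h \<cdot>\<^bsub>A0\<^esub> eq_rhs q"
    proof (rule ex1_implies_unique)
      show "h \<cdot>\<^bsub>A0\<^esub> eq_rhs q \<in> hom A0 (FOb F (eq_dom q)) Q \<and> (\<forall>i \<in> K. p i \<cdot>\<^bsub>A0\<^esub> (h \<cdot>\<^bsub>A0\<^esub> eq_rhs q) = p i \<cdot>\<^bsub>A0\<^esub> (h \<cdot>\<^bsub>A0\<^esub> eq_lhs q))"
      proof (intro conjI ballI)
        show "h \<cdot>\<^bsub>A0\<^esub> eq_rhs q \<in> hom A0 (FOb F (eq_dom q)) Q" by (rule fo_comp(1)[OF r h])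
        fix i assume i: "i \<in> K"
        have "(p i \<cdot>\<^bsub>A0\<^esub> h) \<cdot>\<^bsub>A0\<^esub> eq_rhs q = (p i \<cdot>\<^bsub>A0\<^esub> h) \<cdot>\<^bsub>A0\<^esub> eq_lhs q"
          using D i LD[of "D i"] qE fo_comp(1)[OF h p[OF i]] by auto
        then show "p i \<cdot>\<^bsub>A0\<^esub> (h \<cdot>\<^bsub>A0\<^esub> eq_rhs q) = p i \<cdot>\<^bsub>A0\<^esub> (h \<cdot>\<^bsub>A0\<^esub> eq_lhs q)"
          by (simp only: A0_assoc[OF r h p[OF i]] A0_assoc[OF l h p[OF i]])
      qed
    qed (use fo_comp(1)[OF l h] in simp)
  qed
  have sub: "A \<in> L" if f: "f \<in> hom A0 A B" "mono_arr A0 f" and B: "B \<in> L" for A B f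
    unfolding LD
  proof (intro conjI ballI)
    show "A \<in> VObj AT" by (rule fo_Hm(1)[OF f(1)])
    fix q h assume qE: "q \<in> E" and h: "h \<in> hom A0 (FOb F (eq_cod q)) A"
    note l = q(1)[OF qE] and r = q(2)[OF qE]
    have "(f \<cdot>\<^bsub>A0\<^esub> h) \<cdot>\<^bsub>A0\<^esub> eq_lhs q = (f \<cdot>\<^bsub>A0\<^esub> h) \<cdot>\<^bsub>A0\<^esub> eq_rhs q"
      using B LD[of B] qE fo_comp(1)[OF h f(1)] by blast
    then have "f \<cdot>\<^bsub>A0\<^esub> (h \<cdot>\<^bsub>A0\<^esub> eq_lhs q) = f \<cdot>\<^bsub>A0\<^esub> (h \<cdot>\<^bsub>A0\<^esub> eq_rhs q)"
      by (simp only: A0_assoc[OF r h f(1)] A0_assoc[OF l h f(1)])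
    moreover have "Dom A0 f = A" using f(1) by (simp add: hom_def)
    ultimately show "h \<cdot>\<^bsub>A0\<^esub> eq_lhs q = h \<cdot>\<^bsub>A0\<^esub> eq_rhs q"
      using f(2) fo_comp(1)[OF l h] fo_comp(1)[OF r h] unfolding mono_arr_def by metis
  qed
  have quot: "B \<in> L" if f: "f \<in> hom A0 A B" "pure_epi \<mu> V (fo f)" and A: "A \<in> L" for A B f
    unfolding LD
  proof (intro conjI ballI)
    note fH = fo_Hm[OF f(1)]
    note fh = Hm_hom[OF fH(3)]
    show "B \<in> VObj AT" by (rule fH(2))
    fix q h assume qE: "q \<in> E" and h: "h \<in> hom A0 (FOb F (eq_cod q)) B"
    note l = q(1)[OF qE] and r = q(2)[OF qE]
    let ?X = "eq_cod q"
    note hH = fo_Hm(3)[OF h]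
    note X = q(3)[OF qE]
    have x: "fo h \<cdot> e ?X \<in> hom V ?X (snd B)" by (rule comp_hom[OF e_hom[OF X] Hm_hom[OF hH]])
    have "clustered \<mu> V q" using cl qE by blast
    then obtain K :: "'u set" and D c where "\<forall>i \<in> K. generated \<mu> V (D i)" and K2: "is_coproduct V K D ?X c"
      unfolding clustered_def by (elim exE conjE)
    then have K: "\<And>i. i \<in> K \<Longrightarrow> generated \<mu> V (D i)" "is_coproduct V K D ?X c" by simp_all
    have "\<exists>a. a \<in> hom V (D i) (snd A) \<and> fo f \<cdot> a = (fo h \<cdot> e ?X) \<cdot> c i" if i: "i \<in> K" for i
      using f(2) K(1)[OF i] comp_hom[OF coproductD(2)[OF K(2) i] x] homD[OF fh] unfolding pure_epi_def by metis
    then obtain a where a: "\<And>i. i \<in> K \<Longrightarrow> a i \<in> hom V (D i) (snd A)" "\<And>i. i \<in> K \<Longrightarrow> fo f \<cdot> a i = (fo h \<cdot> e ?X) \<cdot> c i" by metis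
    obtain u where u: "u \<in> hom V ?X (snd A)" "\<And>i. i \<in> K \<Longrightarrow> u \<cdot> c i = a i"
      using coproductD(3)[OF K(2) alg_Obj[OF fH(1)], of a] a(1) by blast
    have fu: "fo f \<cdot> u = fo h \<cdot> e ?X"
    proof (rule coproduct_arrows_eq[OF K(2) comp_hom[OF u(1) fh] x])
      fix i assume i: "i \<in> K"
      show "(fo f \<cdot> u) \<cdot> c i = (fo h \<cdot> e ?X) \<cdot> c i"
        using homD[OF fh] homD[OF u(1)] homD[OF coproductD(2)[OF K(2) i]] u(2)[OF i] a(2)[OF i] by simp
    qed
    note xu = ex_Hm[OF fH(1) u(1)] ex_hom[OF fH(1) u(1)]
    have FX: "FOb F ?X \<in> VObj AT" using X by simp
    obtain h' where h': "h' \<in> hom A0 (FOb F ?X) A" "fo h' = ex A u" by (rule fo_surj[OF FX fH(1) xu(1)])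
    have "fo (f \<cdot>\<^bsub>A0\<^esub> h') = fo h"
    proof (rule ex_eq[OF fH(2) X fo_Hm(3)[OF fo_comp(1)[OF h'(1) f(1)]] hH])
      show "fo (f \<cdot>\<^bsub>A0\<^esub> h') \<cdot> e ?X = fo h \<cdot> e ?X"
        unfolding fo_comp(2)[OF h'(1) f(1)] h'(2) using homD[OF fh] homD[OF xu(3)] homD[OF e_hom[OF X]] xu(2) fu by simp
    qed
    then have hf: "f \<cdot>\<^bsub>A0\<^esub> h' = h" by (rule fo_inj[OF fo_comp(1)[OF h'(1) f(1)] h])
    have "h' \<cdot>\<^bsub>A0\<^esub> eq_lhs q = h' \<cdot>\<^bsub>A0\<^esub> eq_rhs q" using A LD[of A] qE h'(1) by blast
    then show "h \<cdot>\<^bsub>A0\<^esub> eq_lhs q = h \<cdot>\<^bsub>A0\<^esub> eq_rhs q"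
      using A0_assoc[OF l h'(1) f(1)] A0_assoc[OF r h'(1) f(1)] hf by simp
  qed
  have split: "pure_epi \<mu> V g" if "split_epi V g" for g
  proof -
    obtain s where g: "g \<in> Arr V" and s: "s \<in> hom V (Cod V g) (Dom V g)" "g \<cdot> s = \<one> (Cod V g)"
      using \<open>split_epi V g\<close> unfolding split_epi_def by blast
    have "g \<cdot> (s \<cdot> b) = b" if "b \<in> hom V X (Cod V g)" for X b
      using comp_reduce[OF s(2), of b] g homD[OF s(1)] homD[OF that] by simp
    then show ?thesis unfolding pure_epi_def using g comp_hom[OF _ s(1)] by blast
  qed
  show ?thesis
    unfolding mu_Birkhoff_def Birkhoff_def
  proof (intro conjI allI impI ballI)
    fix K :: "'u set" and D Q p
    assume "small TYPE('u) K \<and> D ` K \<subseteq> L \<and> is_product A0 K D Q p"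
    then show "Q \<in> L" using prod by blast
  next
    fix A B f assume "f \<in> hom A0 A B" "mono_arr A0 f \<and> B \<in> L"
    then show "A \<in> L" using sub by blast
  next
    fix A B g assume "g \<in> hom A0 A B" "split_epi V (fo g) \<and> A \<in> L"
    then show "B \<in> L" using quot split by blast
  next
    fix A B f assume "f \<in> hom A0 A B" "pure_epi \<mu> V (fo f) \<and> A \<in> L"
    then show "B \<in> L" using quot by blast
  qed (fact fr)
qed

end

section \<open>Birkhoff subcategories are equational classes\<close>

context discrete_setting
begin

text \<open>Lists all arrows from generators to \<open>Y\<close> by elements of \<open>'u\<close>,
  the index type of the coproduct that will be formed. A generator occurs once for each of its
  arrows, hence in general many times.\<close>

lemma code_elements:
  assumes G: "small TYPE('u) G" "G \<subseteq> Obj V" and Y: "Y \<in> Obj V"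
  obtains K :: "'u set" and D x where "small TYPE('u) K" "\<And>k. k \<in> K \<Longrightarrow> D k \<in> G" "\<And>k. k \<in> K \<Longrightarrow> x k \<in> hom V (D k) Y"
    "\<And>g y. g \<in> G \<Longrightarrow> y \<in> hom V g Y \<Longrightarrow> \<exists>k \<in> K. D k = g \<and> x k = y"
proof -
  let ?A = "SIGMA g:G. hom V g Y"
  have sA: "small TYPE('u) ?A" by (rule small_Sigma[OF univ G(1) small_hom]) (use G(2) Y in auto)
  obtain c :: "'o \<times> 'u \<Rightarrow> 'u" where c: "inj_on c ?A" using small_code[OF sA] by blast
  let ?d = "inv_into ?A c"
  have d: "?d (c z) = z" if "z \<in> ?A" for z using that c by simp
  show thesis
  proof (rule that[of "c ` ?A" "\<lambda>k. fst (?d k)" "\<lambda>k. snd (?d k)"])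
    show "small TYPE('u) (c ` ?A)" by (rule small_image[OF sA])
    show "fst (?d k) \<in> G" "snd (?d k) \<in> hom V (fst (?d k)) Y" if k: "k \<in> c ` ?A" for k
    proof -
      obtain z where z: "z \<in> ?A" "k = c z" using k by blast
      have "?d k \<in> ?A" using d[OF z(1)] z by simp
      then show "fst (?d k) \<in> G" "snd (?d k) \<in> hom V (fst (?d k)) Y" by auto
    qed
    fix g y assume gy: "g \<in> G" "y \<in> hom V g Y"
    then have "(g, y) \<in> ?A" by blast
    then show "\<exists>k \<in> c ` ?A. fst (?d k) = g \<and> snd (?d k) = y"
      using d[of "(g, y)"] by (intro bexI[of _ "c (g, y)"]) auto
  qed
qed

text \<open>The reason why a set of equations suffices: \<open>f\<close> embeds
  \<open>B\<^sub>0\<close> into the generators and fewer than \<open>lam\<close> further indices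
  remain, so each such \<open>K'\<close> embeds into a single set built from \<open>G\<close> and
  \<open>Field lam\<close>. That set depends on no algebra.\<close>

lemma index_bound:
  fixes G :: "'o set"
  assumes G: "small TYPE('u) G"
  obtains K\<^sub>0 :: "'u set" where "small TYPE('u) K\<^sub>0"
    "\<And>(B\<^sub>0 :: 'u set) K' f. inj_on f B\<^sub>0 \<Longrightarrow> f ` B\<^sub>0 \<subseteq> G \<Longrightarrow> |K' - B\<^sub>0| <o lam \<Longrightarrow> \<exists>\<iota>. inj_on \<iota> K' \<and> \<iota> ` K' \<subseteq> K\<^sub>0"
proof -
  have Fl: "|Field lam| =o lam" "lam <o |UNIV :: 'u set|"
    using lam card_of_Field_ordIso unfolding small_regular_cardinal_def by blast+
  have sF: "small TYPE('u) (Field lam)" unfolding small_def using Fl ordIso_ordLess_trans by blast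
  let ?S = "Inl ` G \<union> Inr ` Field lam :: ('o + 'u) set"
  have sS: "small TYPE('u) ?S" by (intro small_Un[OF univ] small_image G sF)
  obtain c :: "'o + 'u \<Rightarrow> 'u" where c: "inj_on c ?S" using small_code[OF sS] by blast
  show thesis
  proof (rule that[of "c ` ?S"])
    show "small TYPE('u) (c ` ?S)" by (rule small_image[OF sS])
    fix B\<^sub>0 K' :: "'u set" and f assume f: "inj_on f B\<^sub>0" "f ` B\<^sub>0 \<subseteq> G" and K': "|K' - B\<^sub>0| <o lam"
    have "|K' - B\<^sub>0| \<le>o |Field lam|"
      using K' Fl(1) ordIso_symmetric ordLess_imp_ordLeq ordLeq_ordIso_trans by blast
    then obtain g where g: "inj_on g (K' - B\<^sub>0)" "g ` (K' - B\<^sub>0) \<subseteq> Field lam" using card_of_ordLeq[of "K' - B\<^sub>0" "Field lam"] by blast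
    let ?j = "\<lambda>k. if k \<in> B\<^sub>0 then Inl (f k) else Inr (g k)"
    have j: "inj_on ?j K'" "?j ` K' \<subseteq> ?S" using f g by (auto simp: inj_on_def)
    have "inj_on (c \<circ> ?j) K'" by (rule comp_inj_on[OF j(1) inj_on_subset[OF c j(2)]])
    moreover have "(c \<circ> ?j) ` K' \<subseteq> c ` ?S" unfolding image_comp[symmetric] by (rule image_mono[OF j(2)])
    ultimately show "\<exists>\<iota>. inj_on \<iota> K' \<and> \<iota> ` K' \<subseteq> c ` ?S" by blast
  qed
qed

text \<open>The forgetful functor is faithful and \<V> is locally small.\<close>

lemma small_hom_A0:
  assumes "A \<in> VObj AT" "B \<in> VObj AT" shows "small TYPE('u) (hom A0 A B)"
proof (rule small_inj_on)
  show "small TYPE('u) (hom V (snd A) (snd B))" using small_hom assms by simp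
  show "inj_on fo (hom A0 A B)" using fo_inj by (auto simp: inj_on_def)
  show "fo ` hom A0 A B \<subseteq> hom V (snd A) (snd B)" using Hm_hom[OF fo_Hm(3)] by blast
qed

lemma mu_Birkhoff_equational:
  assumes mB: "mu_Birkhoff \<mu> V P T J L"
  shows "\<exists>E. equational_theory V P T J F E \<and> (\<forall>q \<in> E. clustered \<mu> V q) \<and> L = equational_class V P T J F E"
proof -
  have LO: "L \<subseteq> VObj AT" using mB by (simp add: mu_Birkhoff_def Birkhoff_def full_replete_def)
  have Lprod: "Q \<in> L" if "small TYPE('u) K" "D ` K \<subseteq> L" "is_product A0 K D Q p" for K :: "'u set" and D Q p
    using mB that unfolding mu_Birkhoff_def Birkhoff_def by blast
  have Lsub: "A \<in> L" if "f \<in> hom A0 A B" "mono_arr A0 f" "B \<in> L" for A B f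
    using mB that unfolding mu_Birkhoff_def Birkhoff_def by blast
  have Lquot: "B \<in> L" if "f \<in> hom A0 A B" "pure_epi \<mu> V (fo f)" "A \<in> L" for A B f
    using mB that unfolding mu_Birkhoff_def by blast
  obtain G where G: "small TYPE('u) G" "\<And>X. X \<in> G \<Longrightarrow> generated \<mu> V X" "\<And>Q. Q \<in> Obj V \<Longrightarrow> directed_colimit_of \<mu> V (Inj V) G Q"
    using lg unfolding Inj_locally_generated_def by blast
  have GO: "G \<subseteq> Obj V" using G(2) by (auto simp: generated_def)
  obtain K\<^sub>0 :: "'u set" where K0: "small TYPE('u) K\<^sub>0"
    "\<And>(B\<^sub>0 :: 'u set) K' f. inj_on f B\<^sub>0 \<Longrightarrow> f ` B\<^sub>0 \<subseteq> G \<Longrightarrow> |K' - B\<^sub>0| <o lam \<Longrightarrow> \<exists>\<iota>. inj_on \<iota> K' \<and> \<iota> ` K' \<subseteq> K\<^sub>0"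
    by (rule index_bound[OF G(1)], rule that)
  \<comment> \<open>All families of generators indexed inside \<open>K\<^sub>0\<close>, fixed before
    any algebra is considered. Their chosen coproducts are the only objects over which equations
    will be written.\<close>
  define W where "W = (SIGMA K:Pow K\<^sub>0. K \<rightarrow>\<^sub>E G)"
  have W: "small TYPE('u) (fst w)" "\<And>k. k \<in> fst w \<Longrightarrow> snd w k \<in> G" if "w \<in> W" for w
    using that small_mono[OF K0(1)] by (auto simp: W_def)
  have "\<exists>Zc. is_coproduct V (fst w) (snd w) (fst Zc) (snd Zc)" if w: "w \<in> W" for w
  proof -
    obtain Z c where "is_coproduct V (fst w) (snd w) Z c"
      by (rule coproduct_exists[OF W(1)[OF w], of "snd w"]) (use W(2)[OF w] GO in auto)
    then show ?thesis by (intro exI[of _ "(Z, c)"]) simp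
  qed
  then obtain Zc where Zc: "\<And>w. w \<in> W \<Longrightarrow> is_coproduct V (fst w) (snd w) (fst (Zc w)) (snd (Zc w))" by metis
  define C where "C = (\<lambda>w. fst (Zc w)) ` W"
  have CO: "Z \<in> Obj V" if "Z \<in> C" for Z using that coproductD(1)[OF Zc] by (auto simp: C_def)
  have smC: "small TYPE('u) C"
    unfolding C_def W_def
    by (intro small_image small_Sigma[OF univ] small_Pow[OF univ K0(1)] small_PiE[OF univ _ G(1)]) (use small_mono[OF K0(1)] in auto)
  let ?FI = "FOb F \<I>"
  \<comment> \<open>With domain \<I>, an equation compares two points of the free algebra on
    \<open>Z\<close>.\<close>
  define E where "E = {q. (\<exists>Z \<in> C. \<exists>l \<in> hom A0 ?FI (FOb F Z). \<exists>r \<in> hom A0 ?FI (FOb F Z).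
    q = \<lparr>eq_dom = \<I>, eq_cod = Z, eq_lhs = l, eq_rhs = r\<rparr>) \<and> (\<forall>A \<in> L. satisfies V P T J F A q)}"
  have "E \<subseteq> (\<lambda>(Z, l, r). \<lparr>eq_dom = \<I>, eq_cod = Z, eq_lhs = l, eq_rhs = r\<rparr>) `
    (SIGMA Z:C. hom A0 ?FI (FOb F Z) \<times> hom A0 ?FI (FOb F Z))"
    by (auto simp: E_def image_iff)
  then have smE: "small TYPE('u) E"
    by (rule small_mono[rotated]) (intro small_image small_Sigma[OF univ smC] small_Sigma[OF univ] small_hom_A0, use CO in auto)
  have Eq: "is_equation V P T J F q" "clustered \<mu> V q" if q: "q \<in> E" for q
  proof -
    obtain Z l r where q: "Z \<in> C" "l \<in> hom A0 ?FI (FOb F Z)" "r \<in> hom A0 ?FI (FOb F Z)"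
      "q = \<lparr>eq_dom = \<I>, eq_cod = Z, eq_lhs = l, eq_rhs = r\<rparr>"
      using q unfolding E_def by blast
    show "is_equation V P T J F q" using q CO by (simp add: is_equation_def)
    obtain w where w: "w \<in> W" "Z = fst (Zc w)" using q(1) by (auto simp: C_def)
    show "clustered \<mu> V q"
      unfolding clustered_def q(4) using W[OF w(1)] G(2) Zc[OF w(1)] w(2) by auto
  qed
  have "A \<in> L" if AE: "A \<in> equational_class V P T J F E" for A
  proof -
    have A: "A \<in> VObj AT" and Asat: "\<And>q. q \<in> E \<Longrightarrow> satisfies V P T J F A q"
      using AE by (auto simp: equational_class_def)
    obtain K :: "'u set" and D x where K: "small TYPE('u) K" "\<And>k. k \<in> K \<Longrightarrow> D k \<in> G" "\<And>k. k \<in> K \<Longrightarrow> x k \<in> hom V (D k) (snd A)"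
      "\<And>g y. g \<in> G \<Longrightarrow> y \<in> hom V g (snd A) \<Longrightarrow> \<exists>k \<in> K. D k = g \<and> x k = y"
      by (rule code_elements[OF G(1) GO alg_Obj[OF A]]) blast
    have DO: "D k \<in> Obj V" if "k \<in> K" for k using K(2)[OF that] GO by blast
    obtain X c where X: "is_coproduct V K D X c" by (rule coproduct_exists[OF K(1), of D]) (use DO in auto)
    note XD = coproductD[OF X]
    obtain a where a: "a \<in> hom V X (snd A)" "\<And>k. k \<in> K \<Longrightarrow> a \<cdot> c k = x k"
      using XD(3)[OF alg_Obj[OF A], of x] K(3) by blast
    have FX: "FOb F X \<in> VObj AT" using XD(1) by simp
    define ga where "ga = ex A a"
    note ga = ex_Hm[OF A a(1), folded ga_def] ex_hom[OF A a(1), folded ga_def]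
    define identified where "identified p p' \<longleftrightarrow> (\<forall>B \<in> L. \<forall>h. Hm (FOb F X) B h \<longrightarrow> h \<cdot> p = h \<cdot> p')" for p p'
    \<comment> \<open>\<open>b\<close> selects one index for every generator that occurs;
      \<open>B\<^sub>0\<close> keeps these copies, which is what the retraction
      \<open>\<rho>\<close> relies on.\<close>
    define b where "b g = (SOME k. k \<in> K \<and> D k = g)" for g
    have b: "b (D k) \<in> K" "D (b (D k)) = D k" if "k \<in> K" for k
      using someI[of "\<lambda>j. j \<in> K \<and> D j = D k" k] that by (auto simp: b_def)
    define B\<^sub>0 where "B\<^sub>0 = (\<lambda>k. b (D k)) ` K"
    have B0: "B\<^sub>0 \<subseteq> K" "inj_on D B\<^sub>0" "D ` B\<^sub>0 \<subseteq> G"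
      using b K(2) by (auto simp: B\<^sub>0_def inj_on_def)
    \<comment> \<open>The pair comes from a subcoproduct \<open>Z\<close> that is a retract of
      \<open>X\<close>. There it is an equation of \<open>E\<close>, which \<open>A\<close>
      satisfies, and composing with \<open>Tm j\<close> returns to \<open>X\<close>.\<close>
    have key: "ga \<cdot> p = ga \<cdot> p'" if p: "p \<in> hom V \<I> (TO X)" "p' \<in> hom V \<I> (TO X)" and id: "identified p p'" for p p'
    proof -
      obtain K1 where K1: "B\<^sub>0 \<subseteq> K1" "K1 \<subseteq> K" "|K1 - B\<^sub>0| <o lam"
        "\<And>K'' X' c' j. K1 \<subseteq> K'' \<Longrightarrow> K'' \<subseteq> K \<Longrightarrow> is_coproduct V K'' D X' c' \<Longrightarrow> j \<in> hom V X' X \<Longrightarrow> (\<And>i. i \<in> K'' \<Longrightarrow> j \<cdot> c' i = c i) \<Longrightarrow>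
          \<exists>t' \<in> hom V \<I> (TO X'). Tm j \<cdot> t' = p"
        by (rule subcoproduct_point[OF K(1) DO X B0(1) p(1)]) blast+
      obtain K2 where K2: "B\<^sub>0 \<subseteq> K2" "K2 \<subseteq> K" "|K2 - B\<^sub>0| <o lam"
        "\<And>K'' X' c' j. K2 \<subseteq> K'' \<Longrightarrow> K'' \<subseteq> K \<Longrightarrow> is_coproduct V K'' D X' c' \<Longrightarrow> j \<in> hom V X' X \<Longrightarrow> (\<And>i. i \<in> K'' \<Longrightarrow> j \<cdot> c' i = c i) \<Longrightarrow>
          \<exists>t' \<in> hom V \<I> (TO X'). Tm j \<cdot> t' = p'"
        by (rule subcoproduct_point[OF K(1) DO X B0(1) p(2)]) blast+
      \<comment> \<open>Both points have to live on the same subcoproduct. The union still exceeds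
        \<open>B\<^sub>0\<close> by fewer than \<open>lam\<close> indices.\<close>
      let ?K = "K1 \<union> K2"
      have KK: "?K \<subseteq> K" "B\<^sub>0 \<subseteq> ?K" using K1 K2 by auto
      have "|?K - B\<^sub>0| <o lam"
      proof -
        have "|(K1 - B\<^sub>0) \<union> (K2 - B\<^sub>0)| <o lam"
          by (rule card_of_Un_ordLess_infinite_Field[OF _ _ K1(3) K2(3)])
            (use lam in \<open>simp_all add: small_regular_cardinal_def cinfinite_def\<close>)
        then show ?thesis by (simp add: Un_Diff)
      qed
      then obtain \<iota> where \<iota>: "inj_on \<iota> ?K" "\<iota> ` ?K \<subseteq> K\<^sub>0" using K0(2)[OF B0(2,3)] by blast
      \<comment> \<open>Reindexing along \<open>\<iota>\<close> turns the family into a member of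
        \<open>W\<close>, so that its coproduct is one of the objects in \<open>C\<close>.\<close>
      define D'' where "D'' = restrict (\<lambda>k. D (inv_into ?K \<iota> k)) (\<iota> ` ?K)"
      define w where "w = (\<iota> ` ?K, D'')"
      have Di: "D'' (\<iota> k) = D k" if "k \<in> ?K" for k using that \<iota>(1) by (simp add: D''_def)
      have "D'' k \<in> G" if "k \<in> \<iota> ` ?K" for k using that Di K(2) KK(1) by auto
      then have w: "w \<in> W" using \<iota>(2) by (auto simp: w_def W_def D''_def)
      define Z where "Z = fst (Zc w)"
      define c' where "c' k = snd (Zc w) (\<iota> k)" for k
      have Zco: "is_coproduct V (\<iota> ` ?K) D'' Z (snd (Zc w))" using Zc[OF w] by (simp add: Z_def w_def)
      note ZD = coproductD[OF Zco]
      have Z: "is_coproduct V ?K D Z c'"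
        unfolding is_coproduct_def
      proof (intro conjI ballI allI impI)
        show "Z \<in> Obj V" by (rule ZD(1))
        show "c' k \<in> hom V (D k) Z" if "k \<in> ?K" for k using ZD(2)[of "\<iota> k"] Di[OF that] that by (auto simp: c'_def)
        fix R r assume R: "R \<in> Obj V" and r: "\<forall>i \<in> ?K. r i \<in> hom V (D i) R"
        have "r (inv_into ?K \<iota> k) \<in> hom V (D'' k) R" if "k \<in> \<iota> ` ?K" for k
          using that r \<iota>(1) Di by auto
        from ZD(3)[OF R this] have "\<exists>!u. u \<in> hom V Z R \<and> (\<forall>k \<in> \<iota> ` ?K. u \<cdot> snd (Zc w) k = r (inv_into ?K \<iota> k))" .
        moreover have "(\<forall>k \<in> \<iota> ` ?K. u \<cdot> snd (Zc w) k = r (inv_into ?K \<iota> k)) \<longleftrightarrow> (\<forall>i \<in> ?K. u \<cdot> c' i = r i)" for u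
          unfolding ball_simps(9) c'_def using \<iota>(1) by (intro ball_cong) simp_all
        ultimately show "\<exists>!u. u \<in> hom V Z R \<and> (\<forall>i \<in> ?K. u \<cdot> c' i = r i)" by simp
      qed
      note ZD = coproductD[OF Z]
      have ZC: "Z \<in> C" using w by (auto simp: C_def Z_def)
      have FZ: "FOb F Z \<in> VObj AT" using ZD(1) by simp
      obtain j where j: "j \<in> hom V Z X" "\<And>k. k \<in> ?K \<Longrightarrow> j \<cdot> c' k = c k"
        using ZD(3)[OF XD(1), of c] XD(2) KK(1) by blast
      obtain y where y: "y \<in> hom V \<I> (TO Z)" "Tm j \<cdot> y = p" using K1(4)[OF _ KK(1) Z j] by blast
      obtain y' where y': "y' \<in> hom V \<I> (TO Z)" "Tm j \<cdot> y' = p'" using K2(4)[OF _ KK(1) Z j] by blast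
      \<comment> \<open>A summand outside \<open>?K\<close> is folded onto the kept copy of the same
        generator; summands in \<open>?K\<close> are fixed, which gives the retraction.\<close>
      let ?r = "\<lambda>k. if k \<in> ?K then c' k else c' (b (D k))"
      have "?r k \<in> hom V (D k) Z" if "k \<in> K" for k
      proof (cases "k \<in> ?K")
        case False
        have "b (D k) \<in> ?K" using that KK(2) by (auto simp: B\<^sub>0_def)
        then show ?thesis using ZD(2)[of "b (D k)"] b(2)[OF that] False by simp
      qed (use ZD(2) in simp)
      from ex1_implies_ex[OF XD(3)[OF ZD(1) this]] obtain \<rho> where \<rho>: "\<rho> \<in> hom V X Z" "\<And>k. k \<in> K \<Longrightarrow> \<rho> \<cdot> c k = ?r k" by blast
      have \<rho>j: "\<rho> \<cdot> j = \<one> Z"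
      proof (rule coproduct_arrows_eq[OF Z comp_hom[OF j(1) \<rho>(1)] Ide_hom[OF ZD(1)]])
        fix k assume k: "k \<in> ?K"
        have "(\<rho> \<cdot> j) \<cdot> c' k = \<rho> \<cdot> c k" using homD[OF \<rho>(1)] homD[OF j(1)] homD[OF ZD(2)[OF k]] j(2)[OF k] by simp
        also have "\<dots> = \<one> Z \<cdot> c' k" using \<rho>(2)[of k] k KK(1) homD[OF ZD(2)[OF k]] by auto
        finally show "(\<rho> \<cdot> j) \<cdot> c' k = \<one> Z \<cdot> c' k" .
      qed
      have Trj: "Tm \<rho> \<cdot> (Tm j \<cdot> z) = z" if z: "z \<in> hom V \<I> (TO Z)" for z
      proof -
        have "Tm \<rho> \<cdot> Tm j = \<one> (TO Z)" using Tm_comp[OF j(1) \<rho>(1)] \<rho>j Tm_Ide[OF ZD(1)] by simp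
        from comp_reduce[OF this, of z] show ?thesis
          using homD[OF Tm_hom[OF j(1)]] homD[OF Tm_hom[OF \<rho>(1)]] homD[OF z] by simp
      qed
      note xy = ex_Hm[OF FZ y(1)] ex_hom[OF FZ y(1)] and xy' = ex_Hm[OF FZ y'(1)] ex_hom[OF FZ y'(1)]
      have FI: "?FI \<in> VObj AT" by simp
      obtain l where l: "l \<in> hom A0 ?FI (FOb F Z)" "fo l = ex (FOb F Z) y" using fo_surj[OF FI FZ xy(1)] by blast
      obtain r where r: "r \<in> hom A0 ?FI (FOb F Z)" "fo r = ex (FOb F Z) y'" using fo_surj[OF FI FZ xy'(1)] by blast
      let ?q = "\<lparr>eq_dom = \<I>, eq_cod = Z, eq_lhs = l, eq_rhs = r\<rparr>"
      \<comment> \<open>A homomorphism on the free algebra on \<I> is determined by its composite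
        with the unit, so the equation under \<open>h\<close> amounts to equality of two
        points.\<close>
      have eqI: "h \<cdot>\<^bsub>A0\<^esub> l = h \<cdot>\<^bsub>A0\<^esub> r \<longleftrightarrow> fo h \<cdot> y = fo h \<cdot> y'" if h: "h \<in> hom A0 (FOb F Z) B" for h B
      proof -
        note hH = fo_Hm[OF h]
        note t = homD[OF Hm_hom[OF hH(3)]] homD[OF xy(3)] homD[OF xy'(3)] homD[OF e_hom[OF unit_Obj]]
        have el: "fo (h \<cdot>\<^bsub>A0\<^esub> l) \<cdot> e \<I> = fo h \<cdot> y" "fo (h \<cdot>\<^bsub>A0\<^esub> r) \<cdot> e \<I> = fo h \<cdot> y'"
          unfolding fo_comp(2)[OF l(1) h] fo_comp(2)[OF r(1) h] l(2) r(2) using t xy(2) xy'(2) by simp_all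
        show ?thesis
        proof
          assume "h \<cdot>\<^bsub>A0\<^esub> l = h \<cdot>\<^bsub>A0\<^esub> r" then show "fo h \<cdot> y = fo h \<cdot> y'" using el by simp
        next
          assume eq: "fo h \<cdot> y = fo h \<cdot> y'"
          have "fo (h \<cdot>\<^bsub>A0\<^esub> l) = fo (h \<cdot>\<^bsub>A0\<^esub> r)"
            by (rule ex_eq[OF hH(2) unit_Obj fo_Hm(3)[OF fo_comp(1)[OF l(1) h]] fo_Hm(3)[OF fo_comp(1)[OF r(1) h]]])
              (simp add: el eq)
          then show "h \<cdot>\<^bsub>A0\<^esub> l = h \<cdot>\<^bsub>A0\<^esub> r" by (rule fo_inj[OF fo_comp(1)[OF l(1) h] fo_comp(1)[OF r(1) h]])
        qed
      qed
      \<comment> \<open>A homomorphism on the free algebra on \<open>Z\<close> is composed with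
        \<open>Tm \<rho>\<close>, which carries \<open>p\<close> and \<open>p'\<close> to
        \<open>y\<close> and \<open>y'\<close>; the pair is identified by hypothesis.\<close>
      have "satisfies V P T J F B ?q" if B: "B \<in> L" for B
        unfolding satisfies_def
      proof
        fix h assume "h \<in> hom A0 (FOb F (eq_cod ?q)) B"
        then have h: "h \<in> hom A0 (FOb F Z) B" by simp
        note hH = fo_Hm[OF h]
        have "Hm (FOb F X) B (fo h \<cdot> Tm \<rho>)" by (rule Hm_comp[OF FX FZ hH(2) Tm_Hm[OF \<rho>(1)] hH(3)])
        then have "(fo h \<cdot> Tm \<rho>) \<cdot> p = (fo h \<cdot> Tm \<rho>) \<cdot> p'" using id B by (simp add: identified_def)
        then have "fo h \<cdot> (Tm \<rho> \<cdot> p) = fo h \<cdot> (Tm \<rho> \<cdot> p')"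
          using homD[OF Hm_hom[OF hH(3)]] homD[OF Tm_hom[OF \<rho>(1)]] homD[OF p(1)] homD[OF p(2)] by simp
        then have "fo h \<cdot> y = fo h \<cdot> y'" using Trj[OF y(1)] Trj[OF y'(1)] y(2) y'(2) by simp
        then show "h \<cdot>\<^bsub>A0\<^esub> eq_lhs ?q = h \<cdot>\<^bsub>A0\<^esub> eq_rhs ?q" using eqI[OF h] by simp
      qed
      then have "?q \<in> E" using ZC l(1) r(1) by (auto simp: E_def)
      then have sat: "satisfies V P T J F A ?q" by (rule Asat)
      have "Hm (FOb F Z) A (ga \<cdot> Tm j)" by (rule Hm_comp[OF FZ FX A Tm_Hm[OF j(1)] ga(1)])
      then obtain h where h: "h \<in> hom A0 (FOb F Z) A" "fo h = ga \<cdot> Tm j" using fo_surj[OF FZ A] by blast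
      have "h \<cdot>\<^bsub>A0\<^esub> l = h \<cdot>\<^bsub>A0\<^esub> r" using sat h(1) by (simp add: satisfies_def)
      then have "(ga \<cdot> Tm j) \<cdot> y = (ga \<cdot> Tm j) \<cdot> y'" using eqI[OF h(1)] h(2) by simp
      then show ?thesis
        using homD[OF ga(3)] homD[OF Tm_hom[OF j(1)]] homD[OF y(1)] homD[OF y'(1)] y(2) y'(2) by simp
    qed
    \<comment> \<open>For every pair told apart by some member of \<open>L\<close>, one separating
      homomorphism is chosen. The points of \<open>TO X\<close> form a small set, so the product of
      the chosen algebras exists and belongs to \<open>L\<close>.\<close>
    define N where "N = {(p, p'). p \<in> hom V \<I> (TO X) \<and> p' \<in> hom V \<I> (TO X) \<and> \<not> identified p p'}"
    have "small TYPE('u) N"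
      by (rule small_mono[OF small_Sigma[OF univ small_hom[OF unit_Obj TO_Obj] small_hom[OF unit_Obj TO_Obj]], of X "\<lambda>_. X"])
        (use XD(1) in \<open>auto simp: N_def\<close>)
    then obtain cd :: "'u \<times> 'u \<Rightarrow> 'u" where cd: "inj_on cd N" using small_code by blast
    have smN: "small TYPE('u) (cd ` N)" by (rule small_image) fact
    have "\<exists>Bh. fst Bh \<in> L \<and> Hm (FOb F X) (fst Bh) (snd Bh) \<and> snd Bh \<cdot> fst n \<noteq> snd Bh \<cdot> snd n" if "n \<in> N" for n
      using that unfolding N_def identified_def by force
    then obtain Bh where Bh: "\<And>n. n \<in> N \<Longrightarrow> fst (Bh n) \<in> L" "\<And>n. n \<in> N \<Longrightarrow> Hm (FOb F X) (fst (Bh n)) (snd (Bh n))"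
      "\<And>n. n \<in> N \<Longrightarrow> snd (Bh n) \<cdot> fst n \<noteq> snd (Bh n) \<cdot> snd n" by metis
    define B where "B k = fst (Bh (inv_into N cd k))" for k
    define hh where "hh k = snd (Bh (inv_into N cd k))" for k
    have Bk: "B (cd n) = fst (Bh n)" "hh (cd n) = snd (Bh n)" if "n \<in> N" for n using that cd by (simp_all add: B_def hh_def)
    have BL: "B k \<in> L" "Hm (FOb F X) (B k) (hh k)" if "k \<in> cd ` N" for k using that Bh Bk by auto
    have BO: "B k \<in> VObj AT" if "k \<in> cd ` N" for k using BL(1)[OF that] LO by blast
    obtain R pr where R: "R \<in> VObj AT" "is_product V (cd ` N) (\<lambda>k. snd (B k)) (snd R) pr" "\<And>k. k \<in> cd ` N \<Longrightarrow> Hm R (B k) (pr k)"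
      by (rule product_algebra[OF smN, of B]) (use BO in auto)
    obtain pr' where "is_product A0 (cd ` N) B R pr'" by (rule A0_product[OF R(1) BO R(2,3)]) auto
    then have RL: "R \<in> L" by (rule Lprod[OF smN, rotated]) (use BL(1) in auto)
    note prp = product_pair[OF R(2)]
    obtain hR where hR: "hR \<in> hom V (TO X) (snd R)" "\<And>k. k \<in> cd ` N \<Longrightarrow> pr k \<cdot> hR = hh k"
      using prp(2)[OF TO_Obj[OF XD(1)], of hh] Hm_hom[OF BL(2)] by blast
    have hRH: "Hm (FOb F X) R hR"
      by (rule Hm_reflect[OF FX R(1) BO R(3) prp(3) hR(1)]) (use hR(2) BL(2) in auto)
    \<comment> \<open>The image in \<open>R \<times> A\<close> is taken as the image of a family of
      two homomorphisms indexed by the booleans: \<open>True\<close> for \<open>R\<close>,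
      \<open>False\<close> for \<open>A\<close>.\<close>
    let ?B = "\<lambda>i. if i then R else A" and ?h = "\<lambda>i. if i then hR else ga"
    have sm2: "small TYPE('u) (UNIV :: bool set)" by (rule small_finite[OF univ]) simp
    obtain S s m where S: "S \<in> VObj AT" "Hm (FOb F X) S s" "s \<in> Surj V"
      "\<And>i :: bool. i \<in> UNIV \<Longrightarrow> Hm S (?B i) (m i)" "\<And>i :: bool. i \<in> UNIV \<Longrightarrow> m i \<cdot> s = ?h i"
      "\<And>W f g. f \<in> hom V W (snd S) \<Longrightarrow> g \<in> hom V W (snd S) \<Longrightarrow> (\<And>i :: bool. i \<in> UNIV \<Longrightarrow> m i \<cdot> f = m i \<cdot> g) \<Longrightarrow> f = g"
      by (rule image_algebra[OF sm2 _ XD(1), of ?B ?h]) (use R(1) A hRH ga(1) in \<open>auto split: if_splits\<close>)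
    have mR: "Hm S R (m True)" "m True \<cdot> s = hR" and mA: "Hm S A (m False)" "m False \<cdot> s = ga"
      using S(4)[of True] S(4)[of False] S(5)[of True] S(5)[of False] by simp_all
    note sh = Hm_hom[OF S(2)] and mRh = Hm_hom[OF mR(1)] and mAh = Hm_hom[OF mA(1)]
    have "mono_arr V (m True)"
    proof (rule mono_points[OF mRh])
      fix z z' assume z: "z \<in> hom V \<I> (snd S)" "z' \<in> hom V \<I> (snd S)" and eq: "m True \<cdot> z = m True \<cdot> z'"
      obtain p where p: "p \<in> hom V \<I> (TO X)" "s \<cdot> p = z" by (rule SurjD[OF S(3) sh z(1)])
      obtain p' where p': "p' \<in> hom V \<I> (TO X)" "s \<cdot> p' = z'" by (rule SurjD[OF S(3) sh z(2)])
      have sp: "m i \<cdot> z = ?h i \<cdot> p" "m i \<cdot> z' = ?h i \<cdot> p'" for i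
        using comp_reduce[OF S(5)[OF UNIV_I], of i p] comp_reduce[OF S(5)[OF UNIV_I], of i p']
          homD[OF Hm_hom[OF S(4)[OF UNIV_I], of i]] homD[OF sh] homD[OF p(1)] homD[OF p'(1)] p(2) p'(2) by simp_all
      \<comment> \<open>Otherwise the factor of \<open>R\<close> indexed by this very pair would
        separate the two points.\<close>
      have "identified p p'"
      proof (rule ccontr)
        assume "\<not> identified p p'"
        then have n: "(p, p') \<in> N" using p(1) p'(1) by (simp add: N_def)
        then have k: "cd (p, p') \<in> cd ` N" by blast
        have "pr (cd (p, p')) \<cdot> (hR \<cdot> p) = pr (cd (p, p')) \<cdot> (hR \<cdot> p')" using eq sp(1)[of True] sp(2)[of True] by simp
        then have "hh (cd (p, p')) \<cdot> p = hh (cd (p, p')) \<cdot> p'"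
          using comp_reduce[OF hR(2)[OF k], of p] comp_reduce[OF hR(2)[OF k], of p'] homD[OF prp(1)[OF k]] homD[OF hR(1)] homD[OF p(1)] homD[OF p'(1)] by simp
        then show False using Bh(3)[OF n] Bk(2)[OF n] by simp
      qed
      then have "ga \<cdot> p = ga \<cdot> p'" by (rule key[OF p(1) p'(1)])
      \<comment> \<open>The points agree in \<open>R\<close> by assumption and in \<open>A\<close>
        by \<open>key\<close>; the two projections of \<open>S\<close> are jointly monic.\<close>
      then have "m i \<cdot> z = m i \<cdot> z'" for i using eq sp[of False] by (cases i) simp_all
      then show "z = z'" by (intro S(6)[OF z])
    qed
    obtain f where f: "f \<in> hom A0 S R" "fo f = m True" by (rule fo_surj[OF S(1) R(1) mR(1)])
    have "mono_arr A0 f" by (rule fo_mono[OF f(1)]) (simp add: f(2), fact)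
    then have SL: "S \<in> L" by (rule Lsub[OF f(1) _ RL])
    obtain g where g: "g \<in> hom A0 S A" "fo g = m False" by (rule fo_surj[OF S(1) A mA(1)])
    have "pure_epi \<mu> V (m False)"
      unfolding pure_epi_def
    proof (intro conjI allI impI ballI)
      show "m False \<in> Arr V" using homD[OF mAh] by simp
      fix Y y assume Y: "generated \<mu> V Y" and "y \<in> hom V Y (Cod V (m False))"
      then have y: "y \<in> hom V Y (snd A)" using homD[OF mAh] by simp
      have YO: "Y \<in> Obj V" "hom_preserves_directed_colimits \<mu> V (Inj V) Y" using Y by (simp_all add: generated_def)
      obtain S' r' D' d' c' where dd: "directed_diagram \<mu> V (Inj V) S' r' D' d'" "D' ` S' \<subseteq> G" "is_colimit (poset_cat S' r') V D' d' (snd A) c'"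
        using G(3)[OF alg_Obj[OF A]] unfolding directed_colimit_of_def by blast
      \<comment> \<open>\<open>y\<close> factors through a stage of the directed colimit of
        generators, and the arrow from that stage is one of those indexing \<open>K\<close>. The
        corresponding coprojection, followed by the unit and \<open>s\<close>, provides the
        lift.\<close>
      obtain i z where i: "i \<in> S'" and z: "z \<in> hom V Y (D' i)" "c' i \<cdot> z = y"
        using hom_preserves_factor[OF category ls univ YO(2,1) dd(1,3) y] by blast
      obtain k where k: "k \<in> K" "D k = D' i" "x k = c' i"
        using K(4)[of "D' i" "c' i"] dd(2) i poset_colimitD(2)[OF dd(3) i] by blast
      note ck = XD(2)[OF k(1)]
      have zk: "z \<in> hom V Y (D k)" using z(1) k(2) by simp
      note t = homD[OF mAh] homD[OF sh] homD[OF e_hom[OF XD(1)]] homD[OF ck] homD[OF zk] homD[OF ga(3)]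
      have "m False \<cdot> (s \<cdot> (e X \<cdot> (c k \<cdot> z))) = ga \<cdot> (e X \<cdot> (c k \<cdot> z))"
        by (rule comp_reduce[OF mA(2)]) (use t in simp_all)
      also have "\<dots> = a \<cdot> (c k \<cdot> z)" by (rule comp_reduce[OF ga(2)]) (use t in simp_all)
      also have "\<dots> = x k \<cdot> z" by (rule comp_reduce[OF a(2)[OF k(1)]]) (use t homD[OF a(1)] in simp_all)
      also have "\<dots> = y" using z(2) k(3) by simp
      finally have "m False \<cdot> (s \<cdot> (e X \<cdot> (c k \<cdot> z))) = y" .
      moreover have "s \<cdot> (e X \<cdot> (c k \<cdot> z)) \<in> hom V Y (Dom V (m False))" using t by (simp add: hom_def)
      ultimately show "\<exists>x \<in> hom V Y (Dom V (m False)). m False \<cdot> x = y" by blast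
    qed
    then show "A \<in> L" using Lquot[OF g(1) _ SL] g(2) by simp
  qed
  moreover have "L \<subseteq> equational_class V P T J F E" using LO by (auto simp: equational_class_def E_def)
  ultimately have "L = equational_class V P T J F E" by blast
  moreover have "equational_theory V P T J F E" using smE Eq(1) by (simp add: equational_theory_def)
  ultimately show ?thesis using Eq(2) by blast
qed

end

theorem theorem5p11:
  fixes V :: "('o, 'u) smcc" and \<mu> lam :: "'u rel" and P :: "'o set"
    and T :: "('o, 'o, 'u) vcat" and J :: "('o, 'o, 'u) vfun"
    and F :: "('o, ('o, 'u) alg, 'u) vfun" and \<eta> :: "'o \<Rightarrow> 'u" and \<epsilon> :: "('o, 'u) alg \<Rightarrow> 'u"
    and L :: "('o, 'u) alg set"
  assumes "universe TYPE('u)"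
    and "small_regular_cardinal \<mu>" and "small_regular_cardinal lam" and "\<mu> \<le>o lam"
    and "locally_presentable_smcc lam V"
    and "\<And>X. presentable lam V X \<Longrightarrow> presentable lam (set_cat TYPE('u)) (hom V \<I>\<^bsub>V\<^esub> X)"
    and "representative_presentables lam V P"
    and "lambda_ary_theory V P T J" and "discrete_theory V P T J"
    and "free_adjunction V P T J F \<eta> \<epsilon>"
    and "factorization_system V (Surj V) (Inj V)"
    and "proper_factorization V (Surj V) (Inj V)"
    and "convenient \<mu> V"
    and "Inj_locally_generated \<mu> V"
    and "full_replete (Alg0 V P T J) L"
  shows "mu_Birkhoff \<mu> V P T J L \<longleftrightarrow>
    (\<exists>E. equational_theory V P T J F E \<and> (\<forall>e \<in> E. clustered \<mu> V e) \<and>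
         L = equational_class V P T J F E)"
proof -
  interpret S: lps V lam by standard fact+
  have rep: "small TYPE('u) P" "\<And>X. X \<in> P \<Longrightarrow> presentable lam V X" "\<And>X. presentable lam V X \<Longrightarrow> \<exists>X' \<in> P. isomorphic V X X'"
    "\<I>\<^bsub>V\<^esub> \<in> P" using assms(7) by (auto simp: representative_presentables_def)
  have pre: "pretheory V P T J" using assms(8) by (simp add: lambda_ary_theory_def)
  have Fv: "vfunctor V (self V) (Alg V P T J) F" using assms(10) by (simp add: free_adjunction_def vadjunction_def)
  \<comment> \<open>\<open>vfunctor\<close> includes that its domain and codomain are
    \<V>-categories.\<close>
  have slf: "vcategory V (self V)" by (rule S.vfunctorD(1)[OF Fv])
  \<comment> \<open>The functor part of any algebra shows in the same way that the opposite of
    \<open>T\<close> is a \<V>-category; a free algebra provides such an algebra.\<close>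
  have "FOb F \<I>\<^bsub>V\<^esub> \<in> VObj (Alg V P T J)" using S.vfunctorD(4)[OF Fv, of "\<I>\<^bsub>V\<^esub>"] by simp
  then have "vfunctor V (vop V T) (self V) (fst (FOb F \<I>\<^bsub>V\<^esub>))"
    by (auto simp: Alg_def vpullback_def vfunctor_cat_def)
  then have opT: "vcategory V (vop V T)" by (rule S.vfunctorD(1))
  interpret T: thy_alg V lam P T J by standard (fact rep pre slf opT)+
  interpret A: alg_adj V lam P T J F \<eta> \<epsilon> by standard fact
  \<comment> \<open>The adjunction inside the definition of a theory may differ from the given one,
    so discreteness is first evaluated for \<open>F'\<close> and then transferred to
    \<open>F\<close>.\<close>
  obtain F' \<eta>' \<epsilon>' where F': "free_adjunction V P T J F' \<eta>' \<epsilon>'" "pretheory_iso V P T J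
          (monad_pretheory_cat V P (induced_monad_fun V P T J F') \<eta>' (induced_monad_mult V P T J F' \<epsilon>'))
          (monad_pretheory_fun V P (induced_monad_fun V P T J F') (induced_monad_mult V P T J F' \<epsilon>'))"
    using assms(8) unfolding lambda_ary_theory_def by blast
  interpret B: alg_adj V lam P T J F' \<eta>' \<epsilon>' by standard fact
  interpret D: discrete_setting V lam P T J F \<eta> \<epsilon> \<mu>
  proof
    fix X assume X: "X \<in> P"
    obtain X\<^sub>0 \<delta> where X0: "X\<^sub>0 \<in> P" "is_discrete_cover V X X\<^sub>0 \<delta>"
      "\<forall>g \<in> hom V \<I>\<^bsub>V\<^esub> (VHom T \<I>\<^bsub>V\<^esub> X). \<exists>f \<in> hom V \<I>\<^bsub>V\<^esub> (VHom T \<I>\<^bsub>V\<^esub> X\<^sub>0).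
           g = el_comp V T \<I>\<^bsub>V\<^esub> X\<^sub>0 X (FHom J X\<^sub>0 X \<cdot>\<^bsub>V\<^esub> name_of V \<delta>) f"
      using assms(9) X unfolding discrete_theory_def by blast
    have \<delta>: "\<delta> \<in> hom V X\<^sub>0 X" using X0(2) by (auto simp: is_discrete_cover_def)
    have "\<exists>y \<in> hom V \<I>\<^bsub>V\<^esub> (snd (FOb F X\<^sub>0)). A.Tm \<delta> \<cdot>\<^bsub>V\<^esub> y = x" if "x \<in> hom V \<I>\<^bsub>V\<^esub> (snd (FOb F X))" for x
      by (rule A.discrete_point_transfer[OF B.alg_adj_axioms \<delta> B.discrete_point[OF F'(2) rep(4) X X0(1) \<delta> X0(3)] that])
    then show "\<exists>X\<^sub>0 \<delta>. is_discrete_cover V X X\<^sub>0 \<delta> \<and> (\<forall>x\<in>hom V \<I>\<^bsub>V\<^esub> (snd (FOb F X)). \<exists>y\<in>hom V \<I>\<^bsub>V\<^esub> (snd (FOb F X\<^sub>0)). A.Tm \<delta> \<cdot>\<^bsub>V\<^esub> y = x)"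
      using X0(2) by blast
  qed (fact rep assms)+
  show ?thesis
  proof
    assume "mu_Birkhoff \<mu> V P T J L"
    then show "\<exists>E. equational_theory V P T J F E \<and> (\<forall>e \<in> E. clustered \<mu> V e) \<and> L = equational_class V P T J F E"
      by (rule D.mu_Birkhoff_equational)
  next
    assume "\<exists>E. equational_theory V P T J F E \<and> (\<forall>e \<in> E. clustered \<mu> V e) \<and> L = equational_class V P T J F E"
    then show "mu_Birkhoff \<mu> V P T J L"
      using A.equational_class_mu_Birkhoff assms(15) by blast
  qed
qed

end
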